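(* For all $t\in S^1=\mathbb{R}/\mathbb{Z}$, the tautological elamination $\Lambda_T(t)$ is an elamination. Furthermore, $\Lambda_T(t+s)=e^{i2\pi hs}\Lambda_T(t)$ for any $t,s$.
   Context: Elaminations: Let $\mathbb{D}$ be the closed unit disk and $\mathbb{E}=\mathbb{C}-\mathbb{D}$. For $z\in\mathbb{E}$ the radial segment $\ell(z)$ is the straight segment from $z/|z|$ to $z$; its height is $\log|z|$. An extended leaf of height $h>0$ is the union of a vein (either a complete geodesic in $\mathbb{D}$, in which case the leaf is simple of multiplicity $1$, or an ideal $(n+1)$-gon with $n>1$, in which case the leaf has multiplicity $n$) with radial segments of height $h$ (the tips) attached at the ideal endpoints of the vein. An elamination is a set of extended leaves such that: (1) distinct leaves have distinct veins and no two veins cross in $\mathbb{D}$; (2) for every $\epsilon>0$ only finitely many leaves have height $\ge\epsilon$; (3) saturation: for each leaf $\ell$ of height $h$ and each oriented edge $pq$ of its vein, let $L_p$ (resp. $L_q$) be the set of leaves of height $\ge h$ on the positive side of $pq$ having $p$ (resp. $q$) as an endpoint; then $L_p$ is nonempty iff $L_q$ is, and in that case the element of $L_p$ closest to $pq$ equals the element of $L_q$ closest to $pq$, and it has height strictly greater than $h$ (it saturates $\ell$). When leaves move continuously and two leaves of different heights collide, the shorter is at that moment saturated by the taller and then, as the motion continues, is pushed over it (its endpoint jumps across the taller leaf, to another endpoint of the taller leaf, and continues from there). Dynamical elaminations of degree 3: angles are arguments divided by $2\pi$, in $S^1=\mathbb{R}/\mathbb{Z}$. The map $z\mapsto z^3$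 sends a radial segment of height $r$ and angle $\theta$ to the one of height $3r$ and angle $3\theta$, and hence acts on leaves whose tips do not all have angles equal mod $1/3$; the image of a leaf $P$ is denoted $P^3$. For critical leaves $C_1,C_2$ (leaves whose tip angles agree mod $1/3$) with non-crossing veins, the dynamical elamination generated by $C_1,C_2$ is the unique elamination $L\supset\{C_1,C_2\}$ such that $z\mapsto z^3$ maps $L-\{C_1,C_2\}$ to $L$ in a $3$-to-$1$ manner. A depth $n$ preimage of $C_1$ is a leaf taken to $C_1$ by $n$ iterates. Tautological elamination: Fix a small $\epsilon>0$. For $t\in S^1$ and $s\in(t+1/3,t+2/3)$ let $L(t,s)$ be the degree $3$ dynamical elamination generated by simple critical leaves $C_1$ of height $1$ with angles $\{t,t+1/3\}$ and $C_2$ of height $1-\epsilon$ with angles $\{s,s+1/3\}$. As $s$ varies with $t$ fixed, whenever $3^ns\in\{t,t+1/3\}$ the leaf $C_2$ collides with a leaf $P$ of $L(t,s)$ that is a depth $n$ preimage of $C_1$. $\Lambda_T(t)$ is defined as the union of the leaves $P^3$ over all such $P$ and all such $s$. Rotation: $e^{i2\pi hs}\Lambda$ denotes the result of simultaneously rotating every leaf $P$ of $\Lambda$ anticlockwise through argument $2\pi hs$, where $h$ is the height of $P$, modulo leaves of greater height, i.e. pushing $P$ over leaves of greater height whenever it collides with them; leaves of equal height are all rotated through the same angle. *)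

theory Defs
  imports "HOL-Analysis.Analysis"
begin

text \<open>
  Points of the circle \<open>S\<^sup>1 = \<real>/\<int>\<close> (arguments divided by \<open>2\<pi>\<close>) are represented by
  their representatives in \<open>{0..<1}\<close>, and \<open>frac\<close> is the projection from the reals. The
  anticlockwise direction is the direction of increasing angle.

  An extended leaf is determined by its height and by the finite set of ideal endpoints of its
  vein, which are also the angles of its tips; it is encoded by these data. Two endpoints give a
  geodesic, \<open>n + 1 > 2\<close> endpoints give an ideal \<open>(n + 1)\<close>-gon, so that the multiplicity is one
  less than the number of endpoints.
\<close>

datatype leaf = Leaf (height: real) (tips: "real set")

definition extended_leaf :: "leaf \<Rightarrow> bool" where
  "extended_leaf l \<longleftrightarrow>
     height l > 0 \<and> tips l \<subseteq> {0..<1} \<and> finite (tips l) \<and> card (tips l) \<ge> 2"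

text \<open>The open and the closed arc running anticlockwise from \<open>p\<close> to \<open>q\<close>, for \<open>p \<noteq> q\<close>.\<close>

definition open_arc :: "real \<Rightarrow> real \<Rightarrow> real set" where
  "open_arc p q = {x \<in> {0..<1}. 0 < frac (x - p) \<and> frac (x - p) < frac (q - p)}"

definition closed_arc :: "real \<Rightarrow> real \<Rightarrow> real set" where
  "closed_arc p q = {p, q} \<union> open_arc p q"

text \<open>
  Oriented edges \<open>pq\<close> of the vein of \<open>l\<close>. The positive side of \<open>pq\<close> is the half-plane over the
  arc from \<open>p\<close> to \<open>q\<close>. The edges of a polygon are oriented so that the polygon lies on the
  negative side; a geodesic has both of its orientations.
\<close>

definition vein_edge :: "leaf \<Rightarrow> real \<Rightarrow> real \<Rightarrow> bool" where
  "vein_edge l p q \<longleftrightarrow> p \<in> tips l \<and> q \<in> tips l \<and> p \<noteq> q \<and> open_arc p q \<inter> tips l = {}"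

text \<open>
  The veins of distinct leaves do not cross if one of them lies on the positive side of some edge
  of the other one (this is symmetric, and common ideal endpoints and common edges are allowed).
  A diagonal of a polygon does cross the polygon.
\<close>

definition veins_cross :: "leaf \<Rightarrow> leaf \<Rightarrow> bool" where
  "veins_cross l m \<longleftrightarrow> \<not> (\<exists>p q. vein_edge l p q \<and> tips m \<subseteq> closed_arc p q)"

text \<open>
  The sets \<open>L\<^sub>p\<close> and \<open>L\<^sub>q\<close> of the saturation condition for the edge \<open>pq\<close> of \<open>l\<close> are
  \<open>leaves_at L l p q p\<close> and \<open>leaves_at L l p q q\<close>.
\<close>

definition leaves_at :: "leaf set \<Rightarrow> leaf \<Rightarrow> real \<Rightarrow> real \<Rightarrow> real \<Rightarrow> leaf set" where
  "leaves_at L l p q x =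
     {m \<in> L. m \<noteq> l \<and> height m \<ge> height l \<and> tips m \<subseteq> closed_arc p q \<and> x \<in> tips m}"

text \<open>
  For leaves \<open>m\<close>, \<open>m'\<close> on the positive side of \<open>pq\<close>: the vein of \<open>m\<close> lies between \<open>pq\<close> and the
  vein of \<open>m'\<close>, i.e. \<open>m'\<close> is beyond an edge \<open>ab\<close> of \<open>m\<close> that faces away from \<open>pq\<close>.
\<close>

definition separates :: "leaf \<Rightarrow> real \<Rightarrow> real \<Rightarrow> leaf \<Rightarrow> bool" where
  "separates m p q m' \<longleftrightarrow>
     (\<exists>a b. vein_edge m a b \<and> open_arc a b \<subseteq> open_arc p q \<and> tips m' \<subseteq> closed_arc a b)"

definition closest :: "real \<Rightarrow> real \<Rightarrow> leaf set \<Rightarrow> leaf \<Rightarrow> bool" where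
  "closest p q S m \<longleftrightarrow> m \<in> S \<and> (\<forall>m' \<in> S. m' \<noteq> m \<longrightarrow> separates m p q m')"

definition saturates :: "leaf set \<Rightarrow> leaf \<Rightarrow> leaf \<Rightarrow> real \<Rightarrow> real \<Rightarrow> bool" where
  "saturates L m l p q \<longleftrightarrow>
     closest p q (leaves_at L l p q p) m \<and> closest p q (leaves_at L l p q q) m \<and>
     height m > height l"

definition elamination :: "leaf set \<Rightarrow> bool" where
  "elamination L \<longleftrightarrow>
     (\<forall>l \<in> L. extended_leaf l) \<and>
     inj_on tips L \<and>
     (\<forall>l \<in> L. \<forall>m \<in> L. l \<noteq> m \<longrightarrow> \<not> veins_cross l m) \<and>
     (\<forall>\<epsilon> > 0. finite {l \<in> L. height l \<ge> \<epsilon>}) \<and>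
     (\<forall>l \<in> L. \<forall>p q. vein_edge l p q \<longrightarrow>
        (leaves_at L l p q p \<noteq> {} \<longleftrightarrow> leaves_at L l p q q \<noteq> {}) \<and>
        (leaves_at L l p q p \<noteq> {} \<longrightarrow> (\<exists>m. saturates L m l p q)))"

text \<open>
  The action \<open>P \<mapsto> P\<^sup>3\<close> of \<open>z \<mapsto> z\<^sup>3\<close>. For a critical leaf the result has only one tip, so that
  it is not an extended leaf.
\<close>

definition cube :: "leaf \<Rightarrow> leaf" where
  "cube l = Leaf (3 * height l) ((\<lambda>x. frac (3 * x)) ` tips l)"

definition dynamical_elamination :: "leaf \<Rightarrow> leaf \<Rightarrow> leaf set" where
  "dynamical_elamination C1 C2 =
     (THE L. elamination L \<and> {C1, C2} \<subseteq> L \<and> cube ` (L - {C1, C2}) \<subseteq> L \<and>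
        (\<forall>Q \<in> L. card {P \<in> L - {C1, C2}. cube P = Q} = 3))"

definition simple_critical_leaf :: "real \<Rightarrow> real \<Rightarrow> leaf" where
  "simple_critical_leaf h t = Leaf h {frac t, frac (t + 1/3)}"

text \<open>
  The leaves \<open>C\<^sub>2\<close> and \<open>P\<close> collide at the parameter \<open>s\<close> if \<open>P\<close> is saturated by \<open>C\<^sub>2\<close> in
  \<open>L(t,s)\<close>. Having a common endpoint is not enough: if \<open>3\<^sup>n s \<in> {t, t + 1/3}\<close> for several \<open>n\<close>,
  then other leaves that meet \<open>C\<^sub>2\<close> in an ideal point are separated from it by the taller leaves
  that collide with \<open>C\<^sub>2\<close>.
\<close>

definition tautological_elamination :: "real \<Rightarrow> real \<Rightarrow> leaf set" where
  "tautological_elamination \<epsilon> t =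
     {cube P | P s n C1 C2 L.
        t + 1/3 < s \<and> s < t + 2/3 \<and>
        C1 = simple_critical_leaf 1 t \<and> C2 = simple_critical_leaf (1 - \<epsilon>) s \<and>
        L = dynamical_elamination C1 C2 \<and>
        frac (3 ^ n * s) \<in> {frac t, frac (t + 1/3)} \<and>
        P \<in> L \<and> (cube ^^ n) P = C1 \<and>
        (\<exists>p q. vein_edge P p q \<and> saturates L C2 P p q)}"

text \<open>The pairs of tips of \<open>l\<close> that span an edge along which \<open>l\<close> is saturated.\<close>

definition saturated_edges :: "leaf set \<Rightarrow> leaf \<Rightarrow> (real \<times> real) set" where
  "saturated_edges L l =
     {(p, q). \<exists>m. vein_edge l p q \<and> saturates L m l p q \<or> vein_edge l q p \<and> saturates L m l q p}"

text \<open>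
  \<open>l'\<close> arises from the leaf \<open>l\<close> of \<open>L\<close> by rotation through a small angle \<open>d\<close> modulo taller
  leaves. Tips of \<open>l\<close> joined by saturated edges are the two ends of one and the same jump across
  a taller leaf; just before and just after the collision exactly one of them is present. Which
  one is decided by the requirement in \<open>rotation_flow\<close> that veins never cross.
\<close>

definition slides_to :: "leaf set \<Rightarrow> leaf \<Rightarrow> real \<Rightarrow> leaf \<Rightarrow> bool" where
  "slides_to L l d l' \<longleftrightarrow>
     tips l' \<subseteq> (\<lambda>x. frac (x + d)) ` tips l \<and>
     (\<forall>x \<in> tips l. \<exists>!y. y \<in> tips l \<and> (x, y) \<in> (saturated_edges L l)\<^sup>* \<and> frac (y + d) \<in> tips l')"

text \<open>
  \<open>\<phi> u l\<close> is the position of the leaf \<open>l\<close> of \<open>\<Lambda>\<close> when the leaves of height \<open>h\<close> have been rotated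
  through the angle \<open>h u\<close> (argument \<open>2\<pi>hu\<close>), for \<open>u\<close> between \<open>0\<close> and \<open>s\<close>; the rotation is
  clockwise if \<open>s < 0\<close>.
\<close>

definition rotation_flow :: "leaf set \<Rightarrow> real \<Rightarrow> (real \<Rightarrow> leaf \<Rightarrow> leaf) \<Rightarrow> bool" where
  "rotation_flow \<Lambda> s \<phi> \<longleftrightarrow>
     (\<forall>l \<in> \<Lambda>. \<phi> 0 l = l) \<and>
     (\<forall>u \<in> closed_segment 0 s.
        elamination (\<phi> u ` \<Lambda>) \<and> inj_on (\<phi> u) \<Lambda> \<and>
        (\<forall>l \<in> \<Lambda>. height (\<phi> u l) = height l \<and>
           (\<forall>\<^sub>F v in at u within closed_segment 0 s.
              slides_to (\<phi> u ` \<Lambda>) (\<phi> u l) (height l * (v - u)) (\<phi> v l))))"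

definition rotate_elamination :: "real \<Rightarrow> leaf set \<Rightarrow> leaf set" where
  "rotate_elamination s \<Lambda> = (THE \<Lambda>'. \<exists>\<phi>. rotation_flow \<Lambda> s \<phi> \<and> \<Lambda>' = \<phi> s ` \<Lambda>)"

end

theory Submission
  imports Defs
begin

text \<open>
  Let \<open>v = 3s\<close> be the critical value of \<open>C\<^sub>2\<close>. The critical leaves cut the disk into three pieces,
  each of which tripling maps to the whole disk, and \<open>L(t,s)\<close> consists of the iterated lifts of the
  critical leaves to the pieces. The leaf \<open>C\<^sub>2\<close> collides with a preimage \<open>P\<close> of depth \<open>m + 1\<close> of
  \<open>C\<^sub>1\<close> exactly if \<open>v\<close> is a tip of \<open>P\<^sup>3\<close> and \<open>m\<close> is the first time at which \<open>v\<close> reaches the ends of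
  \<open>C\<^sub>1\<close> (its level). For two critical values the leaves of \<open>L(t,s)\<close> over \<open>C\<^sub>1\<close> agree down to the level
  at which one of these leaves separates the critical values. Hence two leaves of
  \<open>\<Lambda>\<^sub>T(t)\<close> either occur in a common dynamical elamination or are separated by a taller leaf
  of \<open>\<Lambda>\<^sub>T(t)\<close>, and \<open>\<Lambda>\<^sub>T(t)\<close> inherits the axioms of an elamination.

  One end of \<open>C\<^sub>1\<close> is not hit by the forward orbit of either end. A leaf of height \<open>3\<^sup>-\<^sup>m\<close> has one tip
  above this end, all edges not ending at this tip are saturated, and when \<open>t\<close> moves by \<open>u\<close> this tip
  and the neighbouring tip in the direction of the motion move by \<open>3\<^sup>-\<^sup>m u\<close>; this is the rotation.
  The rotation is unique, by induction on the level: a leaf sliding with another second tip would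
  cross a taller, hence faster leaf, and a leaf is determined by its position shortly
  before or afterwards together with the taller leaves.
\<close>

section \<open>Elaminations in terms of the cyclic order\<close>

text \<open>The definite descriptions behind \<open>dynamical_elamination\<close> and
  \<open>rotate_elamination\<close> say nothing until existence and uniqueness are known, so both
  are proved for each. The recurring obstacle is a tip with several candidates: over the value of a
  critical leaf a lift may use either end of that leaf, and at a collision a tip may stand on either
  side of its jump. In both cases the taller leaves decide which candidates occur, so the arguments
  descend through the heights. For lifts this needs an invariant beyond the axioms,
  \<open>nondeg\<close>: no geodesic is saturated on both sides, as otherwise every candidate could
  be blocked. The bounds 0 < \<epsilon> < 2/3 say 1/3 < 1 - \<epsilon> < 1. Every proper lift is
  then lower than both critical leaves, and no lift of \<open>C1\<close> has the height of a lift of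
  \<open>C2\<close>, so the height tells which critical leaf a leaf covers. The rotation is
  constructed level by level, because a level has only finitely many leaves and hence a common short
  time interval; uniqueness compares two flows over a connected time interval.\<close>

definition btw :: "real \<Rightarrow> real \<Rightarrow> real \<Rightarrow> bool" where
  "btw p x q \<longleftrightarrow> p < x \<and> x < q \<or> x < q \<and> q < p \<or> q < p \<and> p < x"

definition carc :: "real \<Rightarrow> real \<Rightarrow> real \<Rightarrow> bool" where
  "carc p q x \<longleftrightarrow> x = p \<or> x = q \<or> btw p x q"

definition edge :: "real set \<Rightarrow> real \<Rightarrow> real \<Rightarrow> bool" where
  "edge S p q \<longleftrightarrow> p \<in> S \<and> q \<in> S \<and> p \<noteq> q \<and> (\<forall>z\<in>S. \<not> btw p z q)"

text \<open>This form is symmetric, unlike \<open>veins_cross\<close>. For equal tip sets the two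
  notions differ: a triangle does not cross itself here but does for \<open>veins_cross\<close>.
  Hence the hypothesis \<open>tips l \<noteq> tips m\<close> in the translation.\<close>

definition crossing :: "real set \<Rightarrow> real set \<Rightarrow> bool" where
  "crossing S T \<longleftrightarrow> (\<exists>a\<in>S. \<exists>b\<in>S. \<exists>x\<in>T. \<exists>y\<in>T. btw a x b \<and> btw b y a)"

text \<open>Any taller leaf spanning \<open>p\<close> and \<open>q\<close> on the positive side will
  do; the closest one is recovered by \<open>closest_sat_ex\<close>. Only taller leaves enter, so
  \<open>sat\<close> is unaffected by changes at or below the height of \<open>l\<close>.\<close>

definition sat :: "leaf set \<Rightarrow> leaf \<Rightarrow> real \<Rightarrow> real \<Rightarrow> bool" where
  "sat E l p q \<longleftrightarrow> (\<exists>m\<in>E. height m > height l \<and> p \<in> tips m \<and> q \<in> tips m \<and> (\<forall>z\<in>tips m. carc p q z))"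

text \<open>The two sets at the ends of an edge are merged into one implication: a leaf that is at
  least as high and touches either end forces a strictly taller leaf at both. The equivalence in the
  original axiom follows, since a saturator belongs to both sets.\<close>

definition elam :: "leaf set \<Rightarrow> bool" where
  "elam E \<longleftrightarrow> (\<forall>l\<in>E. extended_leaf l) \<and> inj_on tips E \<and>
     (\<forall>l\<in>E. \<forall>m\<in>E. l \<noteq> m \<longrightarrow> \<not> crossing (tips l) (tips m)) \<and>
     (\<forall>\<epsilon>>0. finite {l\<in>E. height l \<ge> \<epsilon>}) \<and>
     (\<forall>l\<in>E. \<forall>m\<in>E. \<forall>p q. l \<noteq> m \<and> height l \<le> height m \<and> edge (tips l) p q \<and>
        (\<forall>z\<in>tips m. carc p q z) \<and> (p \<in> tips m \<or> q \<in> tips m) \<longrightarrow> sat E l p q)"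

section \<open>Circle arithmetic, edges and crossings in the cyclic order\<close>

lemma frac_diff_unit:
  assumes "x \<in> {0..<1}" "p \<in> {0..<1}"
  shows "frac (x - p) = (if p \<le> x then x - p else x - p + 1)"
proof (cases "p \<le> x")
  case True
  then show ?thesis using assms by (simp add: frac_eq)
next
  case False
  have "frac (x - p) = frac (x - p + 1)" by (simp add: frac_def)
  also have "\<dots> = x - p + 1" using assms False by (subst frac_eq) auto
  finally show ?thesis using False by simp
qed

lemma btw_frac_less:
  assumes "btw p z q" "p \<in> {0..<1}" "z \<in> {0..<1}" "q \<in> {0..<1}"
  shows "frac (z - p) < frac (q - p)"
  unfolding frac_diff_unit[OF assms(3,2)] frac_diff_unit[OF assms(4,2)]
  using assms unfolding btw_def atLeastLessThan_iff by (smt (verit))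

lemma btw_frac_less':
  assumes "btw q z p" "p \<in> {0..<1}" "z \<in> {0..<1}" "q \<in> {0..<1}"
  shows "frac (p - z) < frac (p - q)"
  unfolding frac_diff_unit[OF assms(2,3)] frac_diff_unit[OF assms(2,4)]
  using assms unfolding btw_def atLeastLessThan_iff by (smt (verit))

lemma open_arc_iff:
  assumes "p \<in> {0..<1}" "q \<in> {0..<1}"
  shows "x \<in> open_arc p q \<longleftrightarrow> x \<in> {0..<1} \<and> btw p x q"
proof (cases "x \<in> {0..<1}")
  case True
  then show ?thesis
    using assms frac_diff_unit[of x p] frac_diff_unit[of q p]
    unfolding open_arc_def btw_def by (auto simp del: frac_gt_0_iff split: if_splits)
qed (auto simp: open_arc_def)

lemma closed_arc_iff:
  assumes "p \<in> {0..<1}" "q \<in> {0..<1}" "x \<in> {0..<1}"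
  shows "x \<in> closed_arc p q \<longleftrightarrow> carc p q x"
  using open_arc_iff[OF assms(1,2), of x] assms(3) unfolding closed_arc_def carc_def by blast

lemma closed_arc_subset_iff:
  assumes "p \<in> {0..<1}" "q \<in> {0..<1}" "S \<subseteq> {0..<1}"
  shows "S \<subseteq> closed_arc p q \<longleftrightarrow> (\<forall>z\<in>S. carc p q z)"
  using assms closed_arc_iff by blast

lemma extended_leafD:
  assumes "extended_leaf l"
  shows "height l > 0" "tips l \<subseteq> {0..<1}" "finite (tips l)" "card (tips l) \<ge> 2"
  using assms by (auto simp: extended_leaf_def)

lemma vein_edge_iff:
  assumes "tips l \<subseteq> {0..<1}"
  shows "vein_edge l p q \<longleftrightarrow> edge (tips l) p q"
proof -
  have "open_arc p q \<inter> tips l = {} \<longleftrightarrow> (\<forall>z\<in>tips l. \<not> btw p z q)" if "p \<in> tips l" "q \<in> tips l"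
    using that assms open_arc_iff[of p q] by blast
  then show ?thesis unfolding vein_edge_def edge_def by blast
qed

lemma ex_edge_btw:
  assumes "finite S" "p \<in> S" "a \<in> S" "p \<noteq> a" "S \<subseteq> {0..<1}"
  shows "\<exists>q. edge S p q \<and> \<not> btw p a q"
proof -
  \<comment> \<open>The distance travelled anticlockwise from \<open>p\<close>; its minimum over the
    other points is the successor of \<open>p\<close>.\<close>
  define d where "d = (\<lambda>z. frac (z - p))"
  let ?q = "arg_min_on d (S - {p})"
  have fin: "finite (S - {p})" "S - {p} \<noteq> {}" using assms by auto
  have q: "?q \<in> S - {p}" using arg_min_if_finite(1)[OF fin] .
  have "\<not> d z < d ?q" if "z \<in> S - {p}" for z using arg_min_if_finite(2)[OF fin, of d] that by blast
  moreover have "d z < d ?q" if "z \<in> S" "btw p z ?q" for z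
    using btw_frac_less[OF that(2)] that q assms(2,5) unfolding d_def by blast
  moreover have "\<not> btw p p ?q" unfolding btw_def by simp
  ultimately have "\<not> btw p z ?q" if "z \<in> S" for z using that by blast
  then have "edge S p ?q \<and> \<not> btw p a ?q" using q assms(2,3) unfolding edge_def by auto
  then show ?thesis by (rule exI)
qed

lemma ex_edge_from:
  assumes "finite S" "card S \<ge> 2" "S \<subseteq> {0..<1}" "p \<in> S"
  shows "\<exists>q. edge S p q"
proof -
  obtain a where "a \<in> S" "a \<noteq> p" using assms
    by (metis One_nat_def card_1_singleton_iff card_le_Suc0_iff_eq not_less_eq_eq numeral_2_eq_2)
  then show ?thesis using ex_edge_btw[of S p a] assms by blast
qed

lemma ex_edge_to:
  assumes "finite S" "card S \<ge> 2" "S \<subseteq> {0..<1}" "p \<in> S"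
  shows "\<exists>q. edge S q p"
proof -
  define d where "d = (\<lambda>z. frac (p - z))"
  let ?q = "arg_min_on d (S - {p})"
  obtain a where "a \<in> S" "a \<noteq> p" using assms
    by (metis One_nat_def card_1_singleton_iff card_le_Suc0_iff_eq not_less_eq_eq numeral_2_eq_2)
  then have fin: "finite (S - {p})" "S - {p} \<noteq> {}" using assms by auto
  have q: "?q \<in> S - {p}" using arg_min_if_finite(1)[OF fin] .
  have "\<not> d z < d ?q" if "z \<in> S - {p}" for z using arg_min_if_finite(2)[OF fin, of d] that by blast
  moreover have "d z < d ?q" if "z \<in> S" "btw ?q z p" for z
    using btw_frac_less'[OF that(2)] that q assms(3,4) unfolding d_def by blast
  moreover have "\<not> btw ?q p p" unfolding btw_def by simp
  ultimately have "\<not> btw ?q z p" if "z \<in> S" for z using that by blast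
  then have "edge S ?q p" using q assms(4) unfolding edge_def by auto
  then show ?thesis by (rule exI)
qed

lemma edge_unique_from:
  assumes "edge S p q" "edge S p q'"
  shows "q = q'"
proof -
  have "\<not> btw p q q'" "\<not> btw p q' q" "p \<noteq> q" "p \<noteq> q'" using assms unfolding edge_def by auto
  then show ?thesis unfolding btw_def by linarith
qed

lemma edge_unique_to:
  assumes "edge S p q" "edge S p' q"
  shows "p = p'"
proof -
  have "\<not> btw p p' q" "\<not> btw p' p q" "p \<noteq> q" "p' \<noteq> q" using assms unfolding edge_def by auto
  then show ?thesis unfolding btw_def by linarith
qed

lemma ex_edge_around:
  assumes "finite S" "card S \<ge> 2" "S \<subseteq> {0..<1}" "x \<notin> S" "x \<in> {0..<1}"
  shows "\<exists>p q. edge S p q \<and> btw p x q"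
proof -
  \<comment> \<open>The neighbours of \<open>x\<close>, once it is added to \<open>S\<close>, are
    the ends of the edge around it.\<close>
  have 1: "finite (insert x S)" "card (insert x S) \<ge> 2" "insert x S \<subseteq> {0..<1}" "x \<in> insert x S"
    using assms by auto
  obtain q where q: "edge (insert x S) x q" using ex_edge_from[OF 1] by blast
  obtain p where p: "edge (insert x S) p x" using ex_edge_to[OF 1] by blast
  have "q \<in> S" "p \<in> S" using p q assms(4) unfolding edge_def by auto
  obtain a b where ab: "a \<in> S" "b \<in> S" "a \<noteq> b" using assms(1,2)
    by (metis One_nat_def card_le_Suc0_iff_eq not_less_eq_eq numeral_2_eq_2)
  have "p \<noteq> q"
  proof
    assume "p = q"
    then have "\<not> btw x z p" "\<not> btw p z x" if "z \<in> S" for z using p q that unfolding edge_def by auto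
    then have "z = p" if "z \<in> S" for z using that assms(4) p unfolding btw_def edge_def by (smt (verit))
    then show False using ab by blast
  qed
  have "btw p x q" using p q \<open>p \<noteq> q\<close> \<open>q \<in> S\<close> \<open>p \<in> S\<close> assms(4) unfolding edge_def btw_def by (smt (verit) insert_iff)
  moreover have "\<not> btw p z q" if "z \<in> S" for z
    using p q that assms(4) \<open>btw p x q\<close> unfolding edge_def btw_def by (smt (verit) insert_iff)
  ultimately show ?thesis using \<open>q \<in> S\<close> \<open>p \<in> S\<close> \<open>p \<noteq> q\<close> unfolding edge_def by blast
qed

lemma arc_no_crossing:
  assumes "edge S p q" "\<forall>z\<in>T. carc p q z"
  shows "\<not> crossing S T"
proof
  assume "crossing S T"
  then obtain a b x y where h: "a \<in> S" "b \<in> S" "x \<in> T" "y \<in> T" "btw a x b" "btw b y a"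
    unfolding crossing_def by blast
  have "\<not> btw p a q" "\<not> btw p b q" "carc p q x" "carc p q y" "p \<noteq> q" using assms h unfolding edge_def by auto
  then show False using h(5,6) unfolding carc_def btw_def by (smt (verit))
qed

lemma crossing_sym: "crossing S T \<longleftrightarrow> crossing T S"
proof -
  have "crossing T S" if c: "crossing S T" for S T
  proof -
    obtain a b x y where h: "a \<in> S" "b \<in> S" "x \<in> T" "y \<in> T" "btw a x b" "btw b y a"
      using c unfolding crossing_def by blast
    then have "btw x b y" "btw y a x" unfolding btw_def by linarith+
    then show ?thesis using h unfolding crossing_def by blast
  qed
  then show ?thesis by blast
qed

lemma crossing_mono: "crossing S T \<Longrightarrow> S \<subseteq> S' \<Longrightarrow> T \<subseteq> T' \<Longrightarrow> crossing S' T'"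
  unfolding crossing_def by blast

text \<open>A point of \<open>T\<close> outside \<open>S\<close> lies over some edge of
  \<open>S\<close>, and a point of \<open>T\<close> elsewhere would produce a crossing. If
  \<open>T\<close> is contained in \<open>S\<close>, its points are pairwise neighbours in
  \<open>S\<close>, so they fit on one edge unless some point has both of its neighbours in
  \<open>T\<close>; in that case nothing else is left in \<open>S\<close> and
  \<open>S = T\<close>.\<close>

lemma edge_of_not_crossing:
  assumes S: "finite S" "card S \<ge> 2" "S \<subseteq> {0..<1}" and T: "T \<noteq> {}" "T \<subseteq> {0..<1}" and "S \<noteq> T"
    and nc: "\<not> crossing S T"
  shows "\<exists>p q. edge S p q \<and> (\<forall>z\<in>T. carc p q z)"
proof (cases "T \<subseteq> S")
  case False
  then obtain x where x: "x \<in> T" "x \<notin> S" by blast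
  then obtain p q where pq: "edge S p q" "btw p x q" using ex_edge_around[OF S] T by blast
  have "carc p q y" if "y \<in> T" for y
  proof (rule ccontr)
    assume "\<not> carc p q y"
    then have "btw q y p" using pq(2) unfolding carc_def btw_def by (smt (verit))
    then show False using nc pq x that unfolding crossing_def edge_def by blast
  qed
  then show ?thesis using pq by blast
next
  case True
  obtain x where x: "x \<in> T" using T by blast
  have adj: "\<not> (\<exists>s\<in>S. btw x s y) \<or> \<not> (\<exists>s\<in>S. btw y s x)" if "x \<in> T" "y \<in> T" for x y
  proof (rule ccontr)
    assume "\<not> ?thesis"
    then obtain s s' where s: "s \<in> S" "s' \<in> S" "btw x s y" "btw y s' x" by blast
    then have "btw s y s'" "btw s' x s" unfolding btw_def by (smt (verit))+
    then show False using nc s that unfolding crossing_def by blast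
  qed
  obtain q where q: "edge S x q" using ex_edge_from[OF S] x True by blast
  obtain p where p: "edge S p x" using ex_edge_to[OF S] x True by blast
  have pqx: "y = x \<or> y = p \<or> y = q" if "y \<in> T" for y
  proof -
    have yS: "y \<in> S" using that True by blast
    show ?thesis using adj[OF x that] yS p q unfolding edge_def btw_def by (smt (verit))
  qed
  show ?thesis
  proof (cases "p \<in> T \<and> q \<in> T \<and> p \<noteq> q")
    case False
    then have "(\<forall>z\<in>T. z = x \<or> z = p) \<or> (\<forall>z\<in>T. z = x \<or> z = q)" using pqx by blast
    then show ?thesis using p q unfolding carc_def by blast
  next
    case pq: True
    have "s \<in> T" if "s \<in> S" for s
    proof (rule ccontr)
      assume "s \<notin> T"
      then have "s \<noteq> x" "s \<noteq> p" "s \<noteq> q" using x pq by auto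
      then have b: "btw q s p" "btw p x q" using that p q pq unfolding edge_def btw_def by (smt (verit))+
      have "x \<in> S" using x True by blast
      then show False using adj[of p q] adj[of q p] pq b that by blast
    qed
    then show ?thesis using True assms(6) by blast
  qed
qed

section \<open>Translation of the axioms of an elamination\<close>

lemma veins_cross_iff:
  assumes "extended_leaf l" "extended_leaf m" "tips l \<noteq> tips m"
  shows "veins_cross l m \<longleftrightarrow> crossing (tips l) (tips m)"
proof -
  note l = extended_leafD[OF assms(1)] and m = extended_leafD[OF assms(2)]
  have "tips m \<noteq> {}" using m by auto
  have "(\<exists>p q. vein_edge l p q \<and> tips m \<subseteq> closed_arc p q) \<longleftrightarrow>
        (\<exists>p q. edge (tips l) p q \<and> (\<forall>z\<in>tips m. carc p q z))"
    using vein_edge_iff[OF l(2)] closed_arc_subset_iff[OF _ _ m(2)] l(2)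
    unfolding edge_def by (meson subsetD)
  then show ?thesis unfolding veins_cross_def
    using edge_of_not_crossing[of "tips l" "tips m"] arc_no_crossing l m assms(3) \<open>tips m \<noteq> {}\<close> by metis
qed

lemma leaves_at_iff:
  assumes "\<forall>l\<in>E. extended_leaf l" "l \<in> E" "edge (tips l) p q"
  shows "m \<in> leaves_at E l p q x \<longleftrightarrow>
    m \<in> E \<and> m \<noteq> l \<and> height m \<ge> height l \<and> (\<forall>z\<in>tips m. carc p q z) \<and> x \<in> tips m"
proof -
  have "p \<in> {0..<1}" "q \<in> {0..<1}" using assms extended_leafD(2) unfolding edge_def by blast+
  then show ?thesis using assms(1) extended_leafD(2) closed_arc_subset_iff[of p q "tips m"]
    unfolding leaves_at_def by blast
qed

lemma separatesI:
  assumes "extended_leaf m" "extended_leaf m'" "p \<in> {0..<1}" "q \<in> {0..<1}"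
    "edge (tips m) a b" "carc p q a" "carc p q b" "\<not> btw a p b" "\<not> btw a q b" "p \<noteq> q" "\<not> (a = q \<and> b = p)"
    "\<forall>z\<in>tips m'. carc a b z"
  shows "separates m p q m'"
proof -
  have ab: "a \<in> {0..<1}" "b \<in> {0..<1}" "a \<noteq> b"
    using assms(1,5) extended_leafD(2) unfolding edge_def by blast+
  have "btw p x q" if "btw a x b" for x
    using assms(6-11) ab(3) that unfolding carc_def btw_def by (smt (verit))
  then have "open_arc a b \<subseteq> open_arc p q"
    using open_arc_iff[OF ab(1,2)] open_arc_iff[OF assms(3,4)] by blast
  then show ?thesis unfolding separates_def
    using assms vein_edge_iff extended_leafD closed_arc_subset_iff[OF ab(1,2)] by metis
qed

lemma separatesD:
  assumes "extended_leaf m" "extended_leaf m'" "p \<in> {0..<1}" "q \<in> {0..<1}"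
    "p \<in> tips m" "q \<in> tips m" "p \<noteq> q" "tips m' = {p, q}" "separates m p q m'"
  shows "edge (tips m) p q"
proof -
  obtain a b where ab: "vein_edge m a b" "open_arc a b \<subseteq> open_arc p q" "tips m' \<subseteq> closed_arc a b"
    using assms(9) unfolding separates_def by blast
  have e: "edge (tips m) a b" using ab vein_edge_iff extended_leafD[OF assms(1)] by blast
  have ab1: "a \<in> {0..<1}" "b \<in> {0..<1}" "a \<noteq> b"
    using e assms(1) extended_leafD(2) unfolding edge_def by blast+
  have ar: "carc a b p" "carc a b q" using ab(3) closed_arc_iff ab1 assms by auto
  then have "(a = p \<and> b = q) \<or> (a = q \<and> b = p)" using e assms unfolding edge_def carc_def by metis
  moreover have "\<not> (a = q \<and> b = p)"
  proof
    assume h: "a = q \<and> b = p"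
    \<comment> \<open>A point of the open arc from \<open>q\<close> to \<open>p\<close>; the
      midpoint is taken with 1 in place of \<open>p\<close> if the arc passes through 0.\<close>
    define x where "x = (if q < p then (p+q)/2 else (1+q)/2)"
    have "x \<in> {0..<1}" "btw q x p" using assms unfolding x_def btw_def by (auto simp: field_simps)
    then have "x \<in> open_arc a b" using h open_arc_iff ab1 by blast
    then have "btw p x q" using ab(2) open_arc_iff[OF assms(3,4)] by blast
    then show False using \<open>btw q x p\<close> unfolding btw_def by linarith
  qed
  ultimately show ?thesis using e by blast
qed

lemma elamD:
  assumes "elam E"
  shows "\<And>l. l \<in> E \<Longrightarrow> extended_leaf l" "inj_on tips E"
    "\<And>l m. l \<in> E \<Longrightarrow> m \<in> E \<Longrightarrow> l \<noteq> m \<Longrightarrow> \<not> crossing (tips l) (tips m)"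
    "\<And>\<epsilon>. \<epsilon> > 0 \<Longrightarrow> finite {l\<in>E. height l \<ge> \<epsilon>}"
proof -
  note d = assms[unfolded elam_def]
  show "\<And>l. l \<in> E \<Longrightarrow> extended_leaf l" using d[THEN conjunct1] by blast
  show "inj_on tips E" using d[THEN conjunct2, THEN conjunct1] .
  show "\<And>l m. l \<in> E \<Longrightarrow> m \<in> E \<Longrightarrow> l \<noteq> m \<Longrightarrow> \<not> crossing (tips l) (tips m)"
    using d[THEN conjunct2, THEN conjunct2, THEN conjunct1] by blast
  show "\<And>\<epsilon>. \<epsilon> > 0 \<Longrightarrow> finite {l\<in>E. height l \<ge> \<epsilon>}"
    using d[THEN conjunct2, THEN conjunct2, THEN conjunct2, THEN conjunct1] by blast
qed

lemma elam_sat: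
  assumes "elam E" "l \<in> E" "m \<in> E" "l \<noteq> m" "height l \<le> height m" "edge (tips l) p q"
    "\<And>z. z \<in> tips m \<Longrightarrow> carc p q z" "p \<in> tips m \<or> q \<in> tips m"
  shows "sat E l p q"
proof -
  note d = assms(1)[unfolded elam_def, THEN conjunct2, THEN conjunct2, THEN conjunct2, THEN conjunct2]
  show ?thesis using d[rule_format, of l m p q] assms(2-) by blast
qed

lemma elam_edge:
  assumes "elam E" "l \<in> E" "m \<in> E" "l \<noteq> m"
  shows "\<exists>p q. edge (tips l) p q \<and> (\<forall>z\<in>tips m. carc p q z)"
proof -
  have "tips l \<noteq> tips m" using elamD(2)[OF assms(1)] assms unfolding inj_on_def by blast
  moreover have "\<not> crossing (tips l) (tips m)" using elamD(3)[OF assms(1)] assms by blast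
  moreover note l = extended_leafD[OF elamD(1)[OF assms(1,2)]] and m = extended_leafD[OF elamD(1)[OF assms(1,3)]]
  moreover have "tips m \<noteq> {}" using m(4) by auto
  ultimately show ?thesis using edge_of_not_crossing[OF l(3,4,2) _ m(2)] by simp
qed

lemma elam_edges:
  assumes "elam E" "l \<in> E"
  shows "p \<in> tips l \<Longrightarrow> \<exists>q. edge (tips l) p q" "p \<in> tips l \<Longrightarrow> \<exists>q. edge (tips l) q p"
proof -
  note l = extended_leafD[OF elamD(1)[OF assms]]
  show "p \<in> tips l \<Longrightarrow> \<exists>q. edge (tips l) p q" using ex_edge_from[OF l(3,4,2)] .
  show "p \<in> tips l \<Longrightarrow> \<exists>q. edge (tips l) q p" using ex_edge_to[OF l(3,4,2)] .
qed

text \<open>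
  Two polygons with the vertices \<open>p\<close> and \<open>q\<close> on the same side of \<open>pq\<close> would cross. Hence a saturator
  is the closest one unless it is a polygon and the geodesic \<open>pq\<close> is a leaf as well.
\<close>

definition closest_sat :: "leaf set \<Rightarrow> leaf \<Rightarrow> real \<Rightarrow> real \<Rightarrow> leaf \<Rightarrow> bool" where
  "closest_sat E l p q m \<longleftrightarrow> m \<in> E \<and> height m > height l \<and> p \<in> tips m \<and> q \<in> tips m \<and>
     (\<forall>z\<in>tips m. carc p q z) \<and>
     (\<forall>m'\<in>E. m' \<noteq> l \<longrightarrow> height m' \<ge> height l \<longrightarrow> tips m' = {p, q} \<longrightarrow> m' = m)"

text \<open>If the geodesic \<open>pq\<close> is a leaf of at least the height of \<open>l\<close>,
  it has to be the closest one, so it must be strictly taller. At equal height \<open>l\<close>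
  would touch it from its other side and force a taller leaf there. That leaf lies behind one of the
  edges \<open>pq\<close> and \<open>qp\<close> of \<open>l\<close>, and then it or \<open>l\<close>
  would have the tips {p, q} as well.\<close>

lemma closest_sat_ex:
  assumes E: "elam E" and l: "l \<in> E" and e: "edge (tips l) p q" and s: "sat E l p q"
  shows "\<exists>m. closest_sat E l p q m"
proof (cases "\<exists>m'\<in>E. m' \<noteq> l \<and> height m' \<ge> height l \<and> tips m' = {p, q}")
  case False
  then show ?thesis using s unfolding sat_def closest_sat_def by blast
next
  case True
  then obtain m' where m': "m' \<in> E" "m' \<noteq> l" "tips m' = {p, q}" and hm: "height m' \<ge> height l" by blast
  have u: "n = m'" if "n \<in> E" "tips n = {p,q}" for n
    using elamD(2)[OF E] that m' unfolding inj_on_def by simp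
  have "height m' > height l"
  proof (rule ccontr)
    assume a: "\<not> height m' > height l"
    obtain n where n: "n \<in> E" "height n > height l" "p \<in> tips n" "q \<in> tips n" "\<forall>z\<in>tips n. carc p q z"
      using s unfolding sat_def by blast
    have pq: "p \<noteq> q" "p \<in> tips l" "q \<in> tips l" using e unfolding edge_def by auto
    have "edge (tips m') q p" unfolding edge_def m'(3) using pq unfolding btw_def by auto
    moreover have "carc q p z" if "z \<in> tips l" for z
      using e that unfolding edge_def carc_def btw_def by (smt (verit))
    ultimately have "sat E m' q p" using elam_sat[OF E m'(1) l m'(2)] a pq by auto
    then obtain k where k: "k \<in> E" "height k > height m'" "p \<in> tips k" "q \<in> tips k" "\<forall>z\<in>tips k. carc q p z"
      unfolding sat_def by blast
    show False
    proof (cases "k = l")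
      case False
      obtain a b where ab: "edge (tips l) a b" "\<forall>z\<in>tips k. carc a b z" using elam_edge[OF E l k(1)] False by blast
      have "(a = p \<and> b = q) \<or> (a = q \<and> b = p)" using ab k pq unfolding edge_def carc_def by metis
      then show False
      proof
        assume "a = p \<and> b = q"
        then have "tips k = {p,q}" using ab k unfolding carc_def btw_def by (smt (verit) empty_iff insert_iff subsetI subset_antisym)
        then show False using u k by blast
      next
        assume "a = q \<and> b = p"
        then have "z = p \<or> z = q" if "z \<in> tips l" for z using ab e that unfolding edge_def btw_def by (smt (verit))
        then have "tips l = {p,q}" using pq by blast
        then show False using u l m' by blast
      qed
    next
      case True
      then show False using k hm by simp
    qed
  qed
  then show ?thesis using m' u unfolding closest_sat_def carc_def by blast
qed

text \<open>A leaf other than the geodesic \<open>pq\<close> has a tip strictly inside the arc, so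
  the edge of \<open>m\<close> behind which it lies cannot be the edge \<open>qp\<close> that faces
  \<open>l\<close>.\<close>

lemma closest_sat_separates:
  assumes E: "elam E" and l: "l \<in> E" and e: "edge (tips l) p q" and c: "closest_sat E l p q m"
    and m': "m' \<in> E" "m' \<noteq> l" "height m' \<ge> height l" "m' \<noteq> m" "\<forall>z\<in>tips m'. carc p q z"
  shows "separates m p q m'"
proof -
  have m: "m \<in> E" "p \<in> tips m" "q \<in> tips m" "\<forall>z\<in>tips m. carc p q z" using c unfolding closest_sat_def by auto
  note xl = extended_leafD[OF elamD(1)[OF E l]] and xm' = extended_leafD[OF elamD(1)[OF E m'(1)]]
  have pq: "p \<noteq> q" "p \<in> tips l" "q \<in> tips l" using e unfolding edge_def by auto
  then have pq1: "p \<in> {0..<1}" "q \<in> {0..<1}" using xl(2) by auto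
  have "tips m' \<noteq> {p, q}" using c m' unfolding closest_sat_def by blast
  moreover have "tips m' = {p, q}" if "tips m' \<subseteq> {p, q}"
  proof -
    have "card (tips m') = card {p, q}" using xm'(4) pq(1) card_mono[OF _ that] by simp
    then show ?thesis using that by (simp add: card_subset_eq)
  qed
  ultimately obtain z where z: "z \<in> tips m'" "btw p z q" using m'(5) unfolding carc_def by blast
  obtain a b where ab: "edge (tips m) a b" "\<forall>z\<in>tips m'. carc a b z"
    using elam_edge[OF E m(1) m'(1)] m'(4) by blast
  then have ab1: "a \<in> tips m" "b \<in> tips m" "\<not> btw a p b" "\<not> btw a q b" using m unfolding edge_def by auto
  have "\<not> (a = q \<and> b = p)"
  proof
    assume "a = q \<and> b = p"
    then have "carc q p z" using ab z by auto
    then show False using z(2) pq(1) unfolding carc_def btw_def by (smt (verit))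
  qed
  then show ?thesis
    using separatesI[OF elamD(1)[OF E m(1)] elamD(1)[OF E m'(1)] pq1 ab(1)] ab1 m(4) pq(1) ab(2) by simp
qed

text \<open>If the geodesic \<open>pq\<close> is a leaf different from the closest leaf
  \<open>m\<close>, then \<open>m\<close> separates it from \<open>pq\<close>. This makes
  \<open>pq\<close> an edge of \<open>m\<close> facing away from \<open>l\<close>, so
  \<open>m\<close> has no tips besides \<open>p\<close> and \<open>q\<close> and the two leaves
  coincide.\<close>

lemma saturates_iff:
  assumes E: "elam E" and l: "l \<in> E" and e: "edge (tips l) p q"
  shows "saturates E m l p q \<longleftrightarrow> closest_sat E l p q m"
proof -
  have ext: "\<forall>l\<in>E. extended_leaf l" using elamD(1)[OF E] by blast
  note la = leaves_at_iff[OF ext l e]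
  note xl = extended_leafD[OF elamD(1)[OF E l]]
  have pq: "p \<noteq> q" "p \<in> tips l" "q \<in> tips l" using e unfolding edge_def by auto
  then have pq1: "p \<in> {0..<1}" "q \<in> {0..<1}" using xl(2) by auto
  show ?thesis
  proof
    assume s: "saturates E m l p q"
    then have m: "m \<in> E" "height m > height l" "p \<in> tips m" "q \<in> tips m" "\<forall>z\<in>tips m. carc p q z"
      unfolding saturates_def closest_def la by auto
    have "m' = m" if h: "m' \<in> E" "m' \<noteq> l" "height m' \<ge> height l" "tips m' = {p, q}" for m'
    proof (rule ccontr)
      assume "m' \<noteq> m"
      moreover have "m' \<in> leaves_at E l p q p" unfolding la using h by (auto simp: carc_def)
      ultimately have "separates m p q m'" using s unfolding saturates_def closest_def by blast
      then have "edge (tips m) p q"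
        using separatesD[OF elamD(1)[OF E m(1)] elamD(1)[OF E h(1)] pq1 m(3,4) pq(1) h(4)] by blast
      then have "tips m = {p, q}" using m unfolding edge_def carc_def by blast
      then show False using elamD(2)[OF E] h m \<open>m' \<noteq> m\<close> unfolding inj_on_def by simp
    qed
    then show "closest_sat E l p q m" using m unfolding closest_sat_def by blast
  next
    assume c: "closest_sat E l p q m"
    then have m: "m \<in> E" "height m > height l" "p \<in> tips m" "q \<in> tips m" "\<forall>z\<in>tips m. carc p q z"
      unfolding closest_sat_def by auto
    have "separates m p q m'" if "m' \<in> leaves_at E l p q x" "m' \<noteq> m" for x m'
      using closest_sat_separates[OF E l e c] that unfolding la by blast
    moreover have "m \<in> leaves_at E l p q x" if "x = p \<or> x = q" for x using m that unfolding la by auto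
    ultimately show "saturates E m l p q" using m(2) unfolding saturates_def closest_def by blast
  qed
qed

lemma sat_iff_saturates:
  assumes "elam E" "l \<in> E" "edge (tips l) p q"
  shows "sat E l p q \<longleftrightarrow> (\<exists>m. saturates E m l p q)"
  using closest_sat_ex[OF assms] saturates_iff[OF assms] unfolding closest_sat_def sat_def by blast

lemma saturated_edges_iff:
  assumes "elam E" "l \<in> E"
  shows "(p, q) \<in> saturated_edges E l \<longleftrightarrow> edge (tips l) p q \<and> sat E l p q \<or> edge (tips l) q p \<and> sat E l q p"
proof -
  have "vein_edge l a b \<longleftrightarrow> edge (tips l) a b" for a b
    using vein_edge_iff[OF extended_leafD(2)[OF elamD(1)[OF assms]]] .
  then show ?thesis using sat_iff_saturates[OF assms] unfolding saturated_edges_def by blast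
qed

lemma elamination_iff_elam: "elamination E \<longleftrightarrow> elam E"
proof
  assume E: "elam E"
  have x: "extended_leaf l" if "l \<in> E" for l using elamD(1)[OF E that] .
  have nt: "tips l \<noteq> tips m" if "l \<in> E" "m \<in> E" "l \<noteq> m" for l m
    using elamD(2)[OF E] that unfolding inj_on_def by blast
  have "(leaves_at E l p q p \<noteq> {} \<longleftrightarrow> leaves_at E l p q q \<noteq> {}) \<and>
        (leaves_at E l p q p \<noteq> {} \<longrightarrow> (\<exists>m. saturates E m l p q))" if l: "l \<in> E" and "vein_edge l p q" for l p q
  proof -
    have e: "edge (tips l) p q" using that vein_edge_iff extended_leafD(2)[OF x[OF l]] by blast
    have la: "m \<in> leaves_at E l p q x \<longleftrightarrow>
      m \<in> E \<and> m \<noteq> l \<and> height m \<ge> height l \<and> (\<forall>z\<in>tips m. carc p q z) \<and> x \<in> tips m" for m x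
      using leaves_at_iff[OF _ l e] x by blast
    have 1: "\<exists>m. saturates E m l p q" if "leaves_at E l p q y \<noteq> {}" "y = p \<or> y = q" for y
    proof -
      obtain m where "m \<in> E" "m \<noteq> l" "height m \<ge> height l" "\<forall>z\<in>tips m. carc p q z" "y \<in> tips m"
        using \<open>leaves_at E l p q y \<noteq> {}\<close> la by blast
      then have "sat E l p q" using elam_sat[OF E l, of m p q] e that(2) by blast
      then show ?thesis using sat_iff_saturates[OF E l e] by blast
    qed
    have 2: "leaves_at E l p q p \<noteq> {}" "leaves_at E l p q q \<noteq> {}" if "\<exists>m. saturates E m l p q"
      using that unfolding saturates_def closest_def by blast+
    show ?thesis using 1 2 by blast
  qed
  then show "elamination E" unfolding elamination_def
    using x elamD(2,3,4)[OF E] veins_cross_iff[OF x x nt] by blast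
next
  assume E: "elamination E"
  note d = E[unfolded elamination_def]
  note d3 = d[THEN conjunct2, THEN conjunct2]
  have x: "extended_leaf l" if "l \<in> E" for l using d[THEN conjunct1] that by simp
  have inj: "inj_on tips E" using d[THEN conjunct2, THEN conjunct1] .
  have fin: "\<forall>\<epsilon> > 0. finite {l \<in> E. height l \<ge> \<epsilon>}" using d3[THEN conjunct2, THEN conjunct1] .
  have nc: "\<not> veins_cross l m" if "l \<in> E" "m \<in> E" "l \<noteq> m" for l m using d3[THEN conjunct1] that by simp
  have nt: "tips l \<noteq> tips m" if "l \<in> E" "m \<in> E" "l \<noteq> m" for l m
    using inj that unfolding inj_on_def by blast
  have "sat E l p q" if l: "l \<in> E" and m: "m \<in> E" "l \<noteq> m" "height l \<le> height m" and e: "edge (tips l) p q"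
    and a: "\<forall>z\<in>tips m. carc p q z" "p \<in> tips m \<or> q \<in> tips m" for l m p q
  proof -
    have la: "m \<in> leaves_at E l p q x \<longleftrightarrow>
      m \<in> E \<and> m \<noteq> l \<and> height m \<ge> height l \<and> (\<forall>z\<in>tips m. carc p q z) \<and> x \<in> tips m" for m x
      using leaves_at_iff[OF _ l e] x by blast
    have "vein_edge l p q" using e vein_edge_iff extended_leafD(2)[OF x[OF l]] by blast
    then have *: "(leaves_at E l p q p \<noteq> {} \<longleftrightarrow> leaves_at E l p q q \<noteq> {}) \<and>
        (leaves_at E l p q p \<noteq> {} \<longrightarrow> (\<exists>m. saturates E m l p q))"
      using d3[THEN conjunct2, THEN conjunct2] l by (elim ballE allE[of _ p] allE[of _ q] impE) auto
    have "m \<in> leaves_at E l p q p \<or> m \<in> leaves_at E l p q q" using a m unfolding la by blast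
    then obtain k where "saturates E k l p q" using * by blast
    then show ?thesis unfolding saturates_def closest_def la sat_def by blast
  qed
  then show "elam E" unfolding elam_def
    using x inj fin nc veins_cross_iff[OF x x nt] by simp
qed

section \<open>Lifting an elamination to the pieces\<close>

definition trip :: "real \<Rightarrow> real" where "trip x = frac (3 * x)"

text \<open>The open arc from \<open>x\<close> to \<open>y\<close> is a part of the circle that a
  critical leaf cuts off from the piece. The order of the ends records the side: the piece stays in
  the closed arc from \<open>y\<close> to \<open>x\<close>.\<close>

definition hole :: "real set \<Rightarrow> real \<Rightarrow> real \<Rightarrow> bool" where
  "hole X x y \<longleftrightarrow> x \<in> X \<and> y \<in> X \<and> x \<noteq> y \<and> trip x = trip y \<and> (\<forall>z\<in>X. \<not> btw x z y)"

lemma holeD: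
  assumes "hole X x y"
  shows "x \<in> X" "y \<in> X" "x \<noteq> y" "trip x = trip y" "\<And>z. z \<in> X \<Longrightarrow> \<not> btw x z y"
  using assms unfolding hole_def by blast+

lemma edgeD:
  assumes "edge S p q"
  shows "p \<in> S" "q \<in> S" "p \<noteq> q" "\<And>z. z \<in> S \<Longrightarrow> \<not> btw p z q"
  using assms unfolding edge_def by blast+

lemma btw_cases: "x \<noteq> y \<Longrightarrow> y \<noteq> z \<Longrightarrow> x \<noteq> z \<Longrightarrow> btw x y z \<or> btw x z y"
  unfolding btw_def by linarith

lemma btw_rot: "btw x y z \<Longrightarrow> btw y z x"
  unfolding btw_def by linarith

text \<open>
  \<open>X\<close> is one of the pieces into which the critical leaves cut the disk, and tripling is injective on
  \<open>X\<close> except that both ends of a hole have the same image. If the edge of \<open>Q\<close> next to this image is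
  saturated, then the lift of the saturator hides the corresponding end of the hole, which is
  therefore not a tip of the lift of \<open>Q\<close>.
\<close>

definition pull :: "leaf set \<Rightarrow> real set \<Rightarrow> leaf \<Rightarrow> leaf" where
  "pull E X Q = Leaf (height Q / 3) {x\<in>X. trip x \<in> tips Q \<and>
     (\<forall>y p. hole X x y \<longrightarrow> edge (tips Q) p (trip x) \<longrightarrow> \<not> sat E Q p (trip x)) \<and>
     (\<forall>y q. hole X y x \<longrightarrow> edge (tips Q) (trip x) q \<longrightarrow> \<not> sat E Q (trip x) q)}"

text \<open>This is not one of the axioms. It guarantees that a lift keeps at least one end of a
  hole: if both edges at a tip were saturated, \<open>pull\<close> would drop both ends over
  it.\<close>

definition nondeg :: "leaf set \<Rightarrow> bool" where
  "nondeg E \<longleftrightarrow> (\<forall>l\<in>E. \<forall>p q. tips l = {p, q} \<longrightarrow> p \<noteq> q \<longrightarrow> \<not> (sat E l p q \<and> sat E l q p))"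

text \<open>A leaf saturating \<open>m\<close> on the side of \<open>l\<close> would have
  \<open>p\<close> and \<open>q\<close> as tips and lie behind an edge of \<open>l\<close>. Behind
  \<open>pq\<close> it would be a geodesic leaf closer than \<open>m\<close>; behind
  \<open>qp\<close> it would make \<open>l\<close> a geodesic saturated on both sides.\<close>

lemma facing_edge_not_sat:
  assumes E: "elam E" "nondeg E" and l: "l \<in> E" and e: "edge (tips l) p q" and c: "closest_sat E l p q m"
  shows "\<not> sat E m q p"
proof
  assume "sat E m q p"
  then obtain k where k: "k \<in> E" "height k > height m" "p \<in> tips k" "q \<in> tips k" "\<forall>z\<in>tips k. carc q p z"
    unfolding sat_def by blast
  have m: "height m > height l" "sat E l p q" "\<And>m'. m' \<in> E \<Longrightarrow> m' \<noteq> l \<Longrightarrow> height m' \<ge> height l \<Longrightarrow> tips m' = {p, q} \<Longrightarrow> m' = m"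
    using c unfolding closest_sat_def sat_def by auto
  have pq: "p \<noteq> q" "p \<in> tips l" "q \<in> tips l" using e unfolding edge_def by auto
  have "k \<noteq> l" using k m by auto
  then obtain a b where ab: "edge (tips l) a b" "\<forall>z\<in>tips k. carc a b z" using elam_edge[OF E(1) l k(1)] by blast
  have "(a = p \<and> b = q) \<or> (a = q \<and> b = p)" using ab k pq unfolding edge_def carc_def by metis
  then show False
  proof
    assume "a = p \<and> b = q"
    then have "z = p \<or> z = q" if "z \<in> tips k" for z
      using ab(2) k(5) that pq(1) unfolding carc_def btw_def by (smt (verit))
    then have "tips k = {p,q}" using k(3,4) by blast
    then show False using m(3)[OF k(1)] k m \<open>k \<noteq> l\<close> by fastforce
  next
    assume "a = q \<and> b = p"
    then have "z = p \<or> z = q" if "z \<in> tips l" for z using ab(1) e that unfolding edge_def btw_def by (smt (verit))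
    then have "tips l = {p,q}" using pq by blast
    moreover have "sat E l q p" unfolding sat_def using k m(1) by (intro bexI[of _ k]) auto
    ultimately show False using E(2) l m(2) pq(1) unfolding nondeg_def by blast
  qed
qed

text \<open>The closest saturators of the two edges share the tip \<open>c\<close>. Across the edge
  that faces \<open>l\<close>, the lower of them is touched by the other, so this facing edge would
  be saturated, contrary to \<open>facing_edge_not_sat\<close>.\<close>

lemma not_both_sides_sat:
  assumes E: "elam E" "nondeg E" and l: "l \<in> E" and e: "edge (tips l) p c" "edge (tips l) c q"
    and s: "sat E l p c" "sat E l c q"
  shows False
proof (cases "p = q")
  case True
  have pc: "p \<noteq> c" "p \<in> tips l" "c \<in> tips l" using e unfolding edge_def by auto
  have "z = p \<or> z = c" if "z \<in> tips l" for z using e that True unfolding edge_def btw_def by (smt (verit))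
  then have "tips l = {p, c}" using pc by blast
  then show False using s E(2) l pc True unfolding nondeg_def by blast
next
  case False
  obtain m1 where m1: "closest_sat E l c q m1" using closest_sat_ex[OF E(1) l e(2) s(2)] by blast
  obtain m2 where m2: "closest_sat E l p c m2" using closest_sat_ex[OF E(1) l e(1) s(1)] by blast
  have f1: "m1 \<in> E" "c \<in> tips m1" "q \<in> tips m1" "\<forall>z\<in>tips m1. carc c q z" using m1 unfolding closest_sat_def by auto
  have f2: "m2 \<in> E" "p \<in> tips m2" "c \<in> tips m2" "\<forall>z\<in>tips m2. carc p c z" using m2 unfolding closest_sat_def by auto
  have d: "p \<noteq> c" "q \<noteq> c" "\<not> btw c p q" "\<not> btw p q c" using e unfolding edge_def by auto
  have cqp: "btw c q p" using d False unfolding btw_def by (smt (verit))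
  have "m1 \<noteq> m2" using f1(4) f2(2) d False unfolding carc_def by blast
  have e2: "edge (tips m2) c p" unfolding edge_def using f2 d unfolding carc_def btw_def by (smt (verit))
  have e1: "edge (tips m1) q c" unfolding edge_def using f1 d unfolding carc_def btw_def by (smt (verit))
  show False
  proof (cases "height m2 \<le> height m1")
    case True
    have "carc c p z" if "z \<in> tips m1" for z using f1(4) that cqp unfolding carc_def btw_def by (smt (verit))
    then have "sat E m2 c p" using elam_sat[OF E(1) f2(1) f1(1) _ True e2] f1(2) \<open>m1 \<noteq> m2\<close> by blast
    then show False using facing_edge_not_sat[OF E l e(1) m2] by blast
  next
    case False
    have "carc q c z" if "z \<in> tips m2" for z using f2(4) that cqp unfolding carc_def btw_def by (smt (verit))
    then have "sat E m1 q c" using elam_sat[OF E(1) f1(1) f2(1) _ _ e1] f2(3) \<open>m1 \<noteq> m2\<close> False by force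
    then show False using facing_edge_not_sat[OF E l e(2) m1] by blast
  qed
qed

text \<open>The properties of the cut disk used for lifting, freed from coordinates. Tripling is
  monotone of degree one on each piece (\<open>onto\<close>, \<open>ord\<close>), and the ends of a
  hole are its only double points (\<open>hol\<close>, \<open>two\<close>). By \<open>nox\<close>,
  \<open>meet\<close> and \<open>side\<close> the pieces do not interlace and touch only across a
  critical leaf; \<open>K_hole\<close> and \<open>hole_K\<close> match critical leaves with
  holes.\<close>

locale pieces =
  fixes PS :: "real set set" and K :: "leaf set"
  assumes fin_PS: "finite PS" and fin_K: "finite K"
    and sub: "X \<in> PS \<Longrightarrow> X \<subseteq> {0..<1}"
    and onto: "X \<in> PS \<Longrightarrow> y \<in> {0..<1} \<Longrightarrow> \<exists>x\<in>X. trip x = y"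
    and ord: "X \<in> PS \<Longrightarrow> x \<in> X \<Longrightarrow> y \<in> X \<Longrightarrow> z \<in> X \<Longrightarrow> trip x \<noteq> trip y \<Longrightarrow> trip y \<noteq> trip z \<Longrightarrow>
       trip x \<noteq> trip z \<Longrightarrow> btw x y z \<longleftrightarrow> btw (trip x) (trip y) (trip z)"
    and hol: "X \<in> PS \<Longrightarrow> x \<in> X \<Longrightarrow> y \<in> X \<Longrightarrow> x \<noteq> y \<Longrightarrow> trip x = trip y \<Longrightarrow> hole X x y \<or> hole X y x"
    and two: "X \<in> PS \<Longrightarrow> x \<in> X \<Longrightarrow> y \<in> X \<Longrightarrow> z \<in> X \<Longrightarrow> trip x = trip y \<Longrightarrow> trip y = trip z \<Longrightarrow> x = y \<or> y = z \<or> x = z"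
    and nox: "X \<in> PS \<Longrightarrow> Y \<in> PS \<Longrightarrow> X \<noteq> Y \<Longrightarrow> \<not> crossing X Y"
    and meet: "X \<in> PS \<Longrightarrow> Y \<in> PS \<Longrightarrow> X \<noteq> Y \<Longrightarrow> x \<in> X \<Longrightarrow> x \<in> Y \<Longrightarrow> y \<in> X \<Longrightarrow> y \<in> Y \<Longrightarrow> trip x = trip y"
    and side: "X \<in> PS \<Longrightarrow> Y \<in> PS \<Longrightarrow> X \<noteq> Y \<Longrightarrow> x \<in> X \<Longrightarrow> x \<in> Y \<Longrightarrow>
       \<exists>x'. hole X x x' \<and> (\<forall>z\<in>Y. carc x x' z) \<or> hole X x' x \<and> (\<forall>z\<in>Y. carc x' x z)"
    and K_ext: "C \<in> K \<Longrightarrow> extended_leaf C"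
    and K_hole: "C \<in> K \<Longrightarrow> \<exists>X\<in>PS. \<exists>Y\<in>PS. \<exists>x y. X \<noteq> Y \<and> tips C = {x, y} \<and> hole X x y \<and> hole Y y x"
    and hole_K: "X \<in> PS \<Longrightarrow> hole X x y \<Longrightarrow> \<exists>C\<in>K. tips C = {x, y}"
    and K_disj: "C \<in> K \<Longrightarrow> C' \<in> K \<Longrightarrow> C \<noteq> C' \<Longrightarrow> tips C \<inter> tips C' = {}"
    and K_nc: "C \<in> K \<Longrightarrow> C' \<in> K \<Longrightarrow> C \<noteq> C' \<Longrightarrow> \<not> crossing (tips C) (tips C')"
begin

lemma K_piece:
  assumes "C \<in> K" "X \<in> PS"
  shows "\<exists>Y\<in>PS. Y \<noteq> X \<and> tips C \<subseteq> Y"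
  using K_hole[OF assms(1)] unfolding hole_def by (metis empty_subsetI insert_subset)

lemma K_trip: "C \<in> K \<Longrightarrow> x \<in> tips C \<Longrightarrow> y \<in> tips C \<Longrightarrow> trip x = trip y"
  using K_hole[of C] unfolding hole_def by auto

text \<open>Tripling maps the piece onto the circle, so the piece has a third point, and this point
  lies on one of the two arcs between \<open>x\<close> and \<open>y\<close>.\<close>

lemma hole_asym:
  assumes X: "X \<in> PS" and "hole X x y" "hole X y x"
  shows False
proof -
  define u where "u = (if trip x = 0 then 1/2 else 0::real)"
  have "u \<in> {0..<1}" "u \<noteq> trip x" unfolding u_def by auto
  then obtain z where z: "z \<in> X" "trip z \<noteq> trip x" using onto[OF X] by blast
  then have "z \<noteq> x" "z \<noteq> y" using holeD(4)[OF assms(2)] by metis+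
  then have "btw x z y \<or> btw y z x" using holeD(3)[OF assms(2)] btw_cases btw_rot by metis
  then show False using holeD(5)[OF assms(2) z(1)] holeD(5)[OF assms(3) z(1)] by blast
qed

lemma hole_trans:
  assumes X: "X \<in> PS" and "hole X x y" "hole X y z"
  shows False
proof -
  have "x = z" using two[OF X, of x y z] assms unfolding hole_def by auto
  then show False using hole_asym[OF X] assms by blast
qed

lemma pull_tips: "x \<in> tips (pull E X Q) \<Longrightarrow> x \<in> X" "x \<in> tips (pull E X Q) \<Longrightarrow> trip x \<in> tips Q"
  unfolding pull_def by auto

lemma height_pull: "height (pull E X Q) = height Q / 3"
  unfolding pull_def by simp

lemma pull_keep_end: "x \<in> tips (pull E X Q) \<Longrightarrow> hole X x y \<Longrightarrow> edge (tips Q) p (trip x) \<Longrightarrow> \<not> sat E Q p (trip x)"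
  unfolding pull_def by auto

lemma pull_keep_start: "x \<in> tips (pull E X Q) \<Longrightarrow> hole X y x \<Longrightarrow> edge (tips Q) (trip x) q \<Longrightarrow> \<not> sat E Q (trip x) q"
  unfolding pull_def by auto

lemma pull_memI:
  "x \<in> X \<Longrightarrow> trip x \<in> tips Q \<Longrightarrow>
   (\<And>y p. hole X x y \<Longrightarrow> edge (tips Q) p (trip x) \<Longrightarrow> \<not> sat E Q p (trip x)) \<Longrightarrow>
   (\<And>y q. hole X y x \<Longrightarrow> edge (tips Q) (trip x) q \<Longrightarrow> \<not> sat E Q (trip x) q) \<Longrightarrow> x \<in> tips (pull E X Q)"
  unfolding pull_def leaf.sel by blast

lemma finite_pull:
  assumes "X \<in> PS" "finite (tips Q)"
  shows "finite (tips (pull E X Q))"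
proof -
  have "finite {x\<in>X. trip x = c}" for c
  proof (cases "\<exists>x y. x \<in> X \<and> y \<in> X \<and> x \<noteq> y \<and> trip x = c \<and> trip y = c")
    case True
    then obtain x y where xy: "x \<in> X" "y \<in> X" "x \<noteq> y" "trip x = c" "trip y = c" by blast
    have "z = x \<or> z = y" if "z \<in> X" "trip z = c" for z
      using two[OF assms(1) xy(1,2) that(1)] xy that(2) by metis
    then have "{x\<in>X. trip x = c} \<subseteq> {x, y}" by blast
    then show ?thesis by (rule finite_subset) simp
  next
    case False
    show ?thesis
    proof (cases "\<exists>x. x \<in> X \<and> trip x = c")
      case True
      then obtain x where "x \<in> X \<and> trip x = c" by blast
      then have "{x\<in>X. trip x = c} \<subseteq> {x}" using False by blast
      then show ?thesis by (rule finite_subset) simp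
    next
      case False
      then have "{x\<in>X. trip x = c} = {}" by blast
      then show ?thesis by (metis finite.emptyI)
    qed
  qed
  then have "finite (\<Union>c\<in>tips Q. {x\<in>X. trip x = c})" using assms(2) by blast
  moreover have "tips (pull E X Q) \<subseteq> (\<Union>c\<in>tips Q. {x\<in>X. trip x = c})" unfolding pull_def by auto
  ultimately show ?thesis by (rule rev_finite_subset)
qed

definition next_gen :: "leaf set \<Rightarrow> leaf set" where
  "next_gen E = K \<union> {pull E X Q |X Q. X \<in> PS \<and> Q \<in> E}"

lemma next_genE:
  assumes "M \<in> next_gen E"
  obtains "M \<in> K" | X Q where "X \<in> PS" "Q \<in> E" "M = pull E X Q"
  using assms unfolding next_gen_def by blast

lemma pull_in_next_gen: "X \<in> PS \<Longrightarrow> Q \<in> E \<Longrightarrow> pull E X Q \<in> next_gen E"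
  unfolding next_gen_def by blast

end

text \<open>By \<open>low\<close> each critical leaf is taller than all lifts, so it saturates every
  lift that has an edge across its hole.\<close>

locale pieces_elam = pieces +
  fixes E :: "leaf set"
  assumes E: "elam E" "nondeg E" and low: "Q \<in> E \<Longrightarrow> C \<in> K \<Longrightarrow> height Q / 3 < height C"
begin

text \<open>A point over \<open>c\<close> is omitted only at one end of a hole. The other end then
  stays, because losing both would require both edges at \<open>c\<close> to be saturated, contrary
  to \<open>not_both_sides_sat\<close>.\<close>

lemma pull_onto:
  assumes X: "X \<in> PS" and Q: "Q \<in> E" and c: "c \<in> tips Q"
  shows "\<exists>x\<in>tips (pull E X Q). trip x = c"
proof -
  have "c \<in> {0..<1}" using extended_leafD(2)[OF elamD(1)[OF E(1) Q]] c by blast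
  then obtain x where x: "x \<in> X" "trip x = c" using onto[OF X] by blast
  show ?thesis
  proof (cases "x \<in> tips (pull E X Q)")
    case False
    then consider y p where "hole X x y" "edge (tips Q) p c" "sat E Q p c"
      | y q where "hole X y x" "edge (tips Q) c q" "sat E Q c q"
      using pull_memI[of x X Q E] x c by blast
    then show ?thesis
    proof cases
      case 1
      then have y: "y \<in> X" "trip y = c" using x unfolding hole_def by auto
      have "y \<in> tips (pull E X Q)"
      proof (rule pull_memI[OF y(1)])
        show "trip y \<in> tips Q" using y c by simp
        show "\<not> sat E Q p (trip y)" if "hole X y y'" for y' p using hole_trans[OF X 1(1) that] by blast
        show "\<not> sat E Q (trip y) q" if "edge (tips Q) (trip y) q" for q
          using not_both_sides_sat[OF E Q 1(2) _ 1(3)] that y(2) by blast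
      qed
      then show ?thesis using y by blast
    next
      case 2
      then have y: "y \<in> X" "trip y = c" using x unfolding hole_def by auto
      have "y \<in> tips (pull E X Q)"
      proof (rule pull_memI[OF y(1)])
        show "trip y \<in> tips Q" using y c by simp
        show "\<not> sat E Q (trip y) q" if "hole X y' y" for y' q using hole_trans[OF X that 2(1)] by blast
        show "\<not> sat E Q p (trip y)" if "edge (tips Q) p (trip y)" for p
          using not_both_sides_sat[OF E Q _ 2(2) _ 2(3)] that y(2) by blast
      qed
      then show ?thesis using y by blast
    qed
  qed (use x in blast)
qed

lemma trip_pull:
  assumes "X \<in> PS" "Q \<in> E"
  shows "trip ` tips (pull E X Q) = tips Q"
  using pull_onto[OF assms] pull_tips(2)[of _ E X Q] by (metis image_eqI image_subsetI subsetI subset_antisym)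

lemma cube_pull:
  assumes "X \<in> PS" "Q \<in> E"
  shows "cube (pull E X Q) = Q"
proof -
  have "(\<lambda>x. frac (3 * x)) ` tips (pull E X Q) = tips Q"
    using trip_pull[OF assms] unfolding trip_def by simp
  then show ?thesis unfolding cube_def height_pull by simp
qed

lemma two_tips: "Q \<in> E \<Longrightarrow> \<exists>c\<in>tips Q. c \<noteq> d"
proof -
  assume "Q \<in> E"
  then have "card (tips Q) \<ge> 2" using extended_leafD(4) elamD(1)[OF E(1)] by blast
  moreover have "card (tips Q) \<le> 1" if "tips Q \<subseteq> {d}" using card_mono[OF _ that] by simp
  ultimately show ?thesis by fastforce
qed

lemma extended_pull:
  assumes "X \<in> PS" "Q \<in> E"
  shows "extended_leaf (pull E X Q)"
proof -
  note q = extended_leafD[OF elamD(1)[OF E(1) assms(2)]]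
  have f: "finite (tips (pull E X Q))" using finite_pull[OF assms(1) q(3)] .
  then have "card (tips (pull E X Q)) \<ge> 2"
    using card_image_le[of "tips (pull E X Q)" trip] trip_pull[OF assms] q(4) by simp
  then show ?thesis unfolding extended_leaf_def height_pull
    using f q(1) sub[OF assms(1)] pull_tips(1)[of _ E X Q] by (auto simp del: atLeastLessThan_iff)
qed

text \<open>A tip of \<open>Q\<close> between the two images would have a lift between
  \<open>x\<close> and \<open>y\<close>. A hole from \<open>y\<close> to \<open>x\<close> is
  impossible, since a third tip of the lift would fit into neither arc.\<close>

lemma pull_edge:
  assumes X: "X \<in> PS" and Q: "Q \<in> E" and e: "edge (tips (pull E X Q)) x y"
  shows "hole X x y \<or> trip x \<noteq> trip y \<and> edge (tips Q) (trip x) (trip y)"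
proof -
  have xy: "x \<in> X" "y \<in> X" "x \<noteq> y" "trip x \<in> tips Q" "trip y \<in> tips Q"
    using e pull_tips unfolding edge_def by blast+
  show ?thesis
  proof (cases "trip x = trip y")
    case True
    have "\<not> hole X y x"
    proof
      assume h: "hole X y x"
      obtain c where c: "c \<in> tips Q" "c \<noteq> trip x" using two_tips[OF Q] by blast
      then obtain z where z: "z \<in> tips (pull E X Q)" "trip z = c" using pull_onto[OF X Q] by blast
      then have "\<not> btw x z y" "\<not> btw y z x" "z \<noteq> x" "z \<noteq> y"
        using e h pull_tips(1) c True unfolding edge_def hole_def by auto
      then show False using xy unfolding btw_def by linarith
    qed
    then show ?thesis using hol[OF X xy(1-3) True] by blast
  next
    case False
    have "\<not> btw (trip x) c (trip y)" if c: "c \<in> tips Q" for c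
    proof
      assume b: "btw (trip x) c (trip y)"
      obtain z where z: "z \<in> tips (pull E X Q)" "trip z = c" using pull_onto[OF X Q] c by blast
      have "trip x \<noteq> c" "c \<noteq> trip y" using b unfolding btw_def by auto
      then have "btw x z y" using ord[OF X, of x z y] xy z pull_tips(1) False b by metis
      then show False using e z unfolding edge_def by blast
    qed
    then show ?thesis using False xy unfolding edge_def by blast
  qed
qed

text \<open>The saturator is the lift of the closest saturator below. Its edge facing
  \<open>Q\<close> is unsaturated, so \<open>pull\<close> keeps \<open>x\<close> and
  \<open>y\<close> in it. Its further tips over the two images are partners across holes; these lie
  between \<open>x\<close> and \<open>y\<close>, because a hole on the outer side would have removed
  \<open>x\<close> or \<open>y\<close> from the lift of \<open>Q\<close>.\<close>

lemma sat_pull: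
  assumes X: "X \<in> PS" and Q: "Q \<in> E" and e: "edge (tips (pull E X Q)) x y" and ne: "trip x \<noteq> trip y"
    and s: "sat E Q (trip x) (trip y)"
  shows "sat (next_gen E) (pull E X Q) x y"
proof -
  let ?p = "trip x" and ?q = "trip y"
  have eQ: "edge (tips Q) ?p ?q" using pull_edge[OF X Q e] ne holeD(4) by blast
  have xP: "x \<in> tips (pull E X Q)" "y \<in> tips (pull E X Q)" using edgeD[OF e] by auto
  have xX: "x \<in> X" "y \<in> X" using pull_tips(1) xP by blast+
  obtain m where m: "closest_sat E Q ?p ?q m" using closest_sat_ex[OF E(1) Q eQ s] by blast
  have m': "m \<in> E" "height m > height Q" "?p \<in> tips m" "?q \<in> tips m" "\<And>z. z \<in> tips m \<Longrightarrow> carc ?p ?q z"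
    using m unfolding closest_sat_def by auto
  have face: "\<not> sat E m ?q ?p" using facing_edge_not_sat[OF E Q eQ m] .
  have em: "edge (tips m) ?q ?p" unfolding edge_def
  proof (intro conjI ballI)
    show "\<not> btw ?q z ?p" if "z \<in> tips m" for z
      using m'(5)[OF that] ne unfolding carc_def btw_def by linarith
  qed (use m' ne in auto)
  have ns: "\<not> hole X z x" for z using pull_keep_start[OF xP(1) _ eQ] s by blast
  have ne': "\<not> hole X y z" for z using pull_keep_end[OF xP(2) _ eQ] s by blast
  have xM: "x \<in> tips (pull E X m)"
  proof (rule pull_memI[OF xX(1) m'(3)])
    show "\<not> sat E m p' ?p" if "edge (tips m) p' ?p" for p' using edge_unique_to[OF that em] face by blast
  qed (use ns in blast)
  have yM: "y \<in> tips (pull E X m)"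
  proof (rule pull_memI[OF xX(2) m'(4)])
    show "\<not> sat E m ?q q'" if "edge (tips m) ?q q'" for q' using edge_unique_from[OF that em] face by blast
  qed (use ne' in blast)
  have "carc x y z" if z: "z \<in> tips (pull E X m)" for z
  proof -
    have zX: "z \<in> X" "trip z \<in> tips m" using pull_tips z by blast+
    have nxy: "x \<noteq> y" using ne by blast
    consider "trip z = ?p" | "trip z = ?q" | "btw ?p (trip z) ?q" using m'(5)[OF zX(2)] unfolding carc_def by blast
    then show ?thesis
    proof cases
      case 1
      show ?thesis
      proof (cases "z = x")
        case False
        then have h: "hole X x z" using hol[OF X xX(1) zX(1)] 1 ns by metis
        have "z \<noteq> y" using 1 ne by auto
        then have "btw x z y" using holeD(5)[OF h xX(2)] btw_cases False nxy by metis
        then show ?thesis unfolding carc_def by blast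
      qed (simp add: carc_def)
    next
      case 2
      show ?thesis
      proof (cases "z = y")
        case False
        then have h: "hole X z y" using hol[OF X xX(2) zX(1)] 2 ne' by metis
        have "z \<noteq> x" using 2 ne by auto
        then have "btw x z y" using holeD(5)[OF h xX(1)] btw_cases[of z x y] btw_rot False nxy by metis
        then show ?thesis unfolding carc_def by blast
      qed (simp add: carc_def)
    next
      case 3
      then have "?p \<noteq> trip z" "trip z \<noteq> ?q" unfolding btw_def by auto
      then show ?thesis using 3 ord[OF X xX(1) zX(1) xX(2)] ne unfolding carc_def by blast
    qed
  qed
  moreover have "height (pull E X m) > height (pull E X Q)" using m'(2) by (simp add: height_pull)
  ultimately show ?thesis using xM yM pull_in_next_gen[OF X m'(1)] unfolding sat_def by blast
qed

text \<open>A critical leaf has a single image point, so the saturator is itself a lift. It lies in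
  the same piece, because different pieces meet only over one image point.\<close>

lemma sat_pullD:
  assumes X: "X \<in> PS" and Q: "Q \<in> E" and e: "edge (tips (pull E X Q)) x y" and ne: "trip x \<noteq> trip y"
    and s: "sat (next_gen E) (pull E X Q) x y"
  shows "sat E Q (trip x) (trip y)"
proof -
  obtain M where M: "M \<in> next_gen E" "height M > height (pull E X Q)" "x \<in> tips M" "y \<in> tips M"
    "\<forall>z\<in>tips M. carc x y z" using s unfolding sat_def by blast
  have xX: "x \<in> X" "y \<in> X" using edgeD[OF e] pull_tips(1) by blast+
  from M(1) show ?thesis
  proof (cases rule: next_genE)
    case 1
    then show ?thesis using K_trip[OF 1 M(3,4)] ne by blast
  next
    case (2 Y N)
    have "Y = X" using meet[OF 2(1) X _ _ xX(1) _ xX(2)] pull_tips(1) M(3,4) 2(3) ne by blast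
    then have MN: "M = pull E X N" using 2 by simp
    have "trip x \<in> tips N" "trip y \<in> tips N" using M(3,4) MN pull_tips(2) by blast+
    moreover have "height N > height Q" using M(2) MN by (simp add: height_pull)
    moreover have "carc (trip x) (trip y) n" if n: "n \<in> tips N" for n
    proof -
      obtain z where z: "z \<in> tips M" "trip z = n" using pull_onto[OF X 2(2) n] MN by blast
      have zX: "z \<in> X" using z MN pull_tips(1) by blast
      show ?thesis using M(5) z ord[OF X xX(1) zX xX(2)] ne unfolding carc_def by metis
    qed
    ultimately show ?thesis unfolding sat_def using 2(2) by blast
  qed
qed

text \<open>The point \<open>a\<close> is kept only if the edge of \<open>Q\<close> arriving at the
  common image is unsaturated, and \<open>x\<close> only if the edge of \<open>Q'\<close> leaving it
  is. The leaf that is not the taller one would be saturated on such an edge if the other leaf lay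
  behind it, which fixes the side on which the two leaves touch.\<close>

lemma touch_at_hole:
  assumes X: "X \<in> PS" and Q: "Q \<in> E" "Q' \<in> E" "Q \<noteq> Q'"
    and a: "a \<in> tips (pull E X Q)" and x: "x \<in> tips (pull E X Q')" and h: "hole X a x"
  shows "(\<exists>q. edge (tips Q) (trip a) q \<and> (\<forall>z\<in>tips Q'. carc (trip a) q z)) \<or>
         (\<exists>r. edge (tips Q') r (trip a) \<and> (\<forall>z\<in>tips Q. carc r (trip a) z))"
proof -
  let ?c = "trip a"
  have cc: "trip x = ?c" using holeD(4)[OF h] by simp
  have c: "?c \<in> tips Q" "?c \<in> tips Q'" using pull_tips(2) a x cc by metis+
  have k1: "\<not> sat E Q p ?c" if "edge (tips Q) p ?c" for p using pull_keep_end[OF a h that] .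
  have k2: "\<not> sat E Q' ?c q" if "edge (tips Q') ?c q" for q using pull_keep_start[OF x h] that cc by metis
  show ?thesis
  proof (cases "height Q \<le> height Q'")
    case True
    obtain p q where pq: "edge (tips Q) p q" "\<forall>z\<in>tips Q'. carc p q z" using elam_edge[OF E(1) Q] by blast
    have "?c = p \<or> ?c = q" using pq c unfolding carc_def edge_def by blast
    then show ?thesis
    proof
      assume "?c = q"
      then have "sat E Q p ?c" using elam_sat[OF E(1) Q True pq(1)] pq(2) c by blast
      then show ?thesis using k1 pq \<open>?c = q\<close> by blast
    qed (use pq in blast)
  next
    case False
    obtain p q where pq: "edge (tips Q') p q" "\<forall>z\<in>tips Q. carc p q z" using elam_edge[OF E(1) Q(2,1)] Q(3) by blast
    have "?c = p \<or> ?c = q" using pq c unfolding carc_def edge_def by blast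
    then show ?thesis
    proof
      assume "?c = p"
      then have "sat E Q' ?c q" using elam_sat[OF E(1) Q(2,1) _ _ pq(1)] pq(2) c Q(3) False by force
      then show ?thesis using k2 pq \<open>?c = p\<close> by blast
    qed (use pq in blast)
  qed
qed

lemma tips_eqD: "Q \<in> E \<Longrightarrow> Q' \<in> E \<Longrightarrow> tips Q = tips Q' \<Longrightarrow> Q = Q'"
  using elamD(2)[OF E(1)] unfolding inj_on_def by blast

text \<open>Interlaced tips with distinct images would interlace below, so a crossing of lifts needs
  two tips with one image, the ends of a hole. \<open>touch_at_hole\<close> then contradicts the
  order of the remaining tips. If these also have a common image, it forces both leaves to be the
  geodesic between the two images.\<close>

lemma pull_not_crossing_aux:
  assumes X: "X \<in> PS" and Q: "Q \<in> E" "Q' \<in> E" "Q \<noteq> Q'"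
    and P: "a \<in> tips (pull E X Q)" "b \<in> tips (pull E X Q)" "x \<in> tips (pull E X Q')" "y \<in> tips (pull E X Q')"
    and o: "btw a x b" "btw b y a" and c: "trip a = trip x"
  shows False
proof -
  have inX: "a \<in> X" "b \<in> X" "x \<in> X" "y \<in> X" using P pull_tips(1) by blast+
  have tQ: "trip a \<in> tips Q" "trip b \<in> tips Q" "trip x \<in> tips Q'" "trip y \<in> tips Q'" using P pull_tips(2) by blast+
  have d: "a \<noteq> b" "x \<noteq> y" "a \<noteq> x" "b \<noteq> y" "x \<noteq> b" "a \<noteq> y"
    using o unfolding btw_def by linarith+
  have o2: "btw x b y" "btw y a x" "btw a b y" using o unfolding btw_def by linarith+
  have ab: "trip a \<noteq> trip b"
    using hol[OF X inX(1,2) d(1)] holeD(5) inX o by blast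
  have xy: "trip x \<noteq> trip y"
    using hol[OF X inX(3,4) d(2)] holeD(5) inX o2 by blast
  have h: "hole X a x" using hol[OF X inX(1,3) d(3) c] holeD(5)[of X x a b] inX o2 unfolding btw_def by linarith
  note t = touch_at_hole[OF X Q P(1,3) h]
  show False
  proof (cases "trip b = trip y")
    case False
    have "btw (trip a) (trip b) (trip y)"
      using ord[OF X inX(1,2,4)] ab xy c False o2(3) by metis
    moreover have "\<not> btw (trip a) (trip b) (trip y)"
      using t
    proof
      assume "\<exists>q. edge (tips Q) (trip a) q \<and> (\<forall>z\<in>tips Q'. carc (trip a) q z)"
      then obtain q where "edge (tips Q) (trip a) q" "carc (trip a) q (trip y)" using tQ by blast
      then have "\<not> btw (trip a) (trip b) q" "carc (trip a) q (trip y)" using edgeD(4) tQ by blast+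
      then show ?thesis using xy c unfolding carc_def btw_def by linarith
    next
      assume "\<exists>r. edge (tips Q') r (trip a) \<and> (\<forall>z\<in>tips Q. carc r (trip a) z)"
      then obtain r where "edge (tips Q') r (trip a)" "carc r (trip a) (trip b)" using tQ by blast
      then have "\<not> btw r (trip y) (trip a)" "carc r (trip a) (trip b)" using edgeD(4) tQ by blast+
      then show ?thesis using ab unfolding carc_def btw_def by linarith
    qed
    ultimately show False by blast
  next
    case True
    have h': "hole X b y" using hol[OF X inX(2,4) d(4) True] holeD(5)[of X y b a] inX o2 unfolding btw_def by linarith
    note t' = touch_at_hole[OF X Q P(2,4) h']
    have end_l: "\<And>q. edge (tips Q) (trip a) q \<Longrightarrow> \<forall>z\<in>tips Q'. carc (trip a) q z \<Longrightarrow> q = trip b"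
      using tQ True ab unfolding edge_def carc_def by metis
    have end_r: "\<And>r. edge (tips Q') r (trip a) \<Longrightarrow> \<forall>z\<in>tips Q. carc r (trip a) z \<Longrightarrow> r = trip b"
      using tQ True ab unfolding edge_def carc_def by metis
    have end_l': "\<And>q. edge (tips Q) (trip b) q \<Longrightarrow> \<forall>z\<in>tips Q'. carc (trip b) q z \<Longrightarrow> q = trip a"
      using tQ c ab unfolding edge_def carc_def by metis
    have end_r': "\<And>r. edge (tips Q') r (trip b) \<Longrightarrow> \<forall>z\<in>tips Q. carc r (trip b) z \<Longrightarrow> r = trip a"
      using tQ c ab unfolding edge_def carc_def by metis
    have 1: "edge (tips Q) (trip a) (trip b) \<and> (\<forall>z\<in>tips Q'. carc (trip a) (trip b) z) \<or>
          edge (tips Q') (trip b) (trip a) \<and> (\<forall>z\<in>tips Q. carc (trip b) (trip a) z)"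
      using t end_l end_r by blast
    have 2: "edge (tips Q) (trip b) (trip a) \<and> (\<forall>z\<in>tips Q'. carc (trip b) (trip a) z) \<or>
          edge (tips Q') (trip a) (trip b) \<and> (\<forall>z\<in>tips Q. carc (trip a) (trip b) z)"
      using t' end_l' end_r' by blast
    have s1: "z = trip a \<or> z = trip b" if "z \<in> tips Q" for z
      using 1 2 edgeD(4)[OF _ that] that ab unfolding carc_def btw_def by (smt (verit))
    have s2: "z = trip a \<or> z = trip b" if "z \<in> tips Q'" for z
      using 1 2 edgeD(4)[OF _ that] that ab unfolding carc_def btw_def by (smt (verit))
    have "tips Q = {trip a, trip b}" "tips Q' = {trip a, trip b}" using s1 s2 tQ True c by auto
    then show False using tips_eqD Q by metis
  qed
qed

lemma pull_not_crossing:
  assumes X: "X \<in> PS" and Q: "Q \<in> E" "Q' \<in> E" "Q \<noteq> Q'"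
  shows "\<not> crossing (tips (pull E X Q)) (tips (pull E X Q'))"
proof
  assume "crossing (tips (pull E X Q)) (tips (pull E X Q'))"
  then obtain a b x y where P: "a \<in> tips (pull E X Q)" "b \<in> tips (pull E X Q)"
    "x \<in> tips (pull E X Q')" "y \<in> tips (pull E X Q')" and o: "btw a x b" "btw b y a"
    unfolding crossing_def by blast
  have inX: "a \<in> X" "b \<in> X" "x \<in> X" "y \<in> X" using P pull_tips(1) by blast+
  have tQ: "trip a \<in> tips Q" "trip b \<in> tips Q" "trip x \<in> tips Q'" "trip y \<in> tips Q'" using P pull_tips(2) by blast+
  have d: "a \<noteq> b" "x \<noteq> y" using o unfolding btw_def by linarith+
  have o2: "btw x b y" "btw y a x" using o unfolding btw_def by linarith+
  have 1: "trip a \<noteq> trip b" using hol[OF X inX(1,2) d(1)] holeD(5) inX o by blast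
  have 2: "trip x \<noteq> trip y" using hol[OF X inX(3,4) d(2)] holeD(5) inX o2 by blast
  have 3: "trip a \<noteq> trip x" using pull_not_crossing_aux[OF X Q P o] by blast
  have 4: "trip b \<noteq> trip y" using pull_not_crossing_aux[OF X Q P(2,1,4,3) o(2,1)] by blast
  have 5: "trip x \<noteq> trip b" using pull_not_crossing_aux[OF X Q(2,1) Q(3)[symmetric] P(3,4,2,1) o2] by blast
  have 6: "trip y \<noteq> trip a" using pull_not_crossing_aux[OF X Q(2,1) Q(3)[symmetric] P(4,3,1,2) o2(2,1)] by blast
  have "btw (trip a) (trip x) (trip b)" using ord[OF X inX(1,3,2)] 1 3 5 o(1) by metis
  moreover have "btw (trip b) (trip y) (trip a)" using ord[OF X inX(2,4,1)] 1 4 6 o(2) by metis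
  ultimately have "crossing (tips Q) (tips Q')" using tQ unfolding crossing_def by blast
  then show False using elamD(3)[OF E(1) Q] by blast
qed

text \<open>An edge across a hole is saturated by its critical leaf. Any other edge lifts an edge of
  \<open>Q\<close>, and by \<open>sat_pull\<close> it is enough to saturate that one. If
  \<open>M\<close> lies in another piece, it reaches the edge through a hole at \<open>x\<close> or
  \<open>y\<close>. The far end of this hole lies inside the edge without being a tip, and
  \<open>pull\<close> omits it only because the edge of \<open>Q\<close> is saturated.\<close>

lemma next_gen_sat:
  assumes l: "l \<in> next_gen E" and M: "M \<in> next_gen E" "l \<noteq> M" "height l \<le> height M"
    and e: "edge (tips l) x y" and a: "\<And>z. z \<in> tips M \<Longrightarrow> carc x y z" and t: "x \<in> tips M \<or> y \<in> tips M"
    and Mext: "card (tips M) \<ge> 2"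
  shows "sat (next_gen E) l x y"
  using l
proof (cases rule: next_genE)
  case 1
  from M(1) show ?thesis
  proof (cases rule: next_genE)
    case M1: 1
    then show ?thesis using K_disj[OF 1 M1 M(2)] edgeD(1,2)[OF e] t by blast
  next
    case (2 X Q)
    then show ?thesis using low[OF 2(2) 1] M(3) by (simp add: height_pull)
  qed
next
  case (2 X Q)
  note X = 2(1) and Q = 2(2)
  have e': "edge (tips (pull E X Q)) x y" using e 2(3) by simp
  have xX: "x \<in> X" "y \<in> X" "x \<noteq> y" using edgeD[OF e'] pull_tips(1) by blast+
  consider "hole X x y" | "trip x \<noteq> trip y" "edge (tips Q) (trip x) (trip y)" using pull_edge[OF X Q e'] by blast
  then show ?thesis
  proof cases
    case 1
    obtain C where C: "C \<in> K" "tips C = {x, y}" using hole_K[OF X 1] by blast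
    then have "height C > height l" using low[OF Q C(1)] 2(3) by (simp add: height_pull)
    then show ?thesis unfolding sat_def using C unfolding next_gen_def carc_def by (intro bexI[of _ C]) auto
  next
    case eQ: 2
    have ml: "\<exists>z\<in>tips M. z \<noteq> w" for w
    proof -
      have "card (tips M) \<le> 1" if "tips M \<subseteq> {w}" using card_mono[OF _ that] by simp
      then show ?thesis using Mext by fastforce
    qed
    have other: "sat E Q (trip x) (trip y)" if Y: "Y \<in> PS" "Y \<noteq> X" "tips M \<subseteq> Y" for Y
      using t
    proof
      assume xM: "x \<in> tips M"
      then have "x \<in> Y" using Y by blast
      then obtain x' where x': "hole X x x' \<and> (\<forall>z\<in>Y. carc x x' z) \<or> hole X x' x \<and> (\<forall>z\<in>Y. carc x' x z)"
        using side[OF X Y(1) Y(2)[symmetric] xX(1)] by blast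
      have "trip x' = trip x" using x' holeD(4) by metis
      then have nx: "x' \<noteq> y" using eQ(1) by auto
      show ?thesis
      proof (cases "hole X x x'")
        case h: True
        have "btw x x' y" using btw_cases[of x y x'] holeD(3,5)[OF h] xX nx by blast
        then have "x' \<notin> tips (pull E X Q)" using edgeD(4)[OF e'] by blast
        moreover have "x' \<in> X" "trip x' \<in> tips Q" using holeD[OF h] edgeD[OF eQ(2)] by auto
        ultimately obtain q where "edge (tips Q) (trip x') q" "sat E Q (trip x') q"
          using pull_memI[of x' X Q E] hole_trans[OF X h] by blast
        then show ?thesis using edge_unique_from[OF eQ(2)] \<open>trip x' = trip x\<close> by metis
      next
        case False
        then have h: "hole X x' x" "\<forall>z\<in>Y. carc x' x z" using x' by auto
        have "\<not> btw x' y x" using holeD(5)[OF h(1) xX(2)] .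
        then have "z = x" if "z \<in> tips M" for z
          using h(2) Y(3) that a[OF that] nx xX(3) holeD(3)[OF h(1)]
          unfolding carc_def btw_def by (smt (verit) subsetD)
        then show ?thesis using ml by blast
      qed
    next
      assume yM: "y \<in> tips M"
      then have "y \<in> Y" using Y by blast
      then obtain y' where y': "hole X y y' \<and> (\<forall>z\<in>Y. carc y y' z) \<or> hole X y' y \<and> (\<forall>z\<in>Y. carc y' y z)"
        using side[OF X Y(1) Y(2)[symmetric] xX(2)] by blast
      have ty: "trip y' = trip y" using y' holeD(4) by metis
      then have nx: "y' \<noteq> x" using eQ(1) by auto
      show ?thesis
      proof (cases "hole X y' y")
        case h: True
        have "btw x y' y" using btw_cases[of y' x y] btw_rot holeD(3,5)[OF h] xX nx by blast
        then have "y' \<notin> tips (pull E X Q)" using edgeD(4)[OF e'] by blast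
        moreover have "y' \<in> X" "trip y' \<in> tips Q" using holeD[OF h] edgeD[OF eQ(2)] by auto
        ultimately obtain p where "edge (tips Q) p (trip y')" "sat E Q p (trip y')"
          using pull_memI[of y' X Q E] hole_trans[OF X _ h] by blast
        then show ?thesis using edge_unique_to[OF eQ(2)] ty by metis
      next
        case False
        then have h: "hole X y y'" "\<forall>z\<in>Y. carc y y' z" using y' by auto
        have "\<not> btw y x y'" using holeD(5)[OF h(1) xX(1)] .
        then have "z = y" if "z \<in> tips M" for z
          using h(2) Y(3) that a[OF that] nx xX(3) holeD(3)[OF h(1)]
          unfolding carc_def btw_def by (smt (verit) subsetD)
        then show ?thesis using ml by blast
      qed
    qed
    have "sat E Q (trip x) (trip y)"
      using M(1)
    proof (cases rule: next_genE)
      case 1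
      then show ?thesis using K_piece[OF 1 X] other by blast
    next
      case MY: (2 Y N)
      show ?thesis
      proof (cases "Y = X")
        case False
        then show ?thesis using other MY pull_tips(1) by blast
      next
        case True
        then have MN: "M = pull E X N" using MY by simp
        have "Q \<noteq> N" "height Q \<le> height N" using M(2,3) MN 2(3) by (auto simp: height_pull)
        moreover have "carc (trip x) (trip y) n" if n: "n \<in> tips N" for n
        proof -
          obtain z where z: "z \<in> tips M" "trip z = n" using pull_onto[OF X MY(2) n] MN by blast
          have zX: "z \<in> X" using z MN pull_tips(1) by blast
          show ?thesis using a[OF z(1)] z ord[OF X xX(1) zX xX(2)] eQ(1) unfolding carc_def by metis
        qed
        moreover have "trip x \<in> tips N \<or> trip y \<in> tips N" using t MN pull_tips(2) by blast
        ultimately show ?thesis using elam_sat[OF E(1) Q MY(2) _ _ eQ(2)] by blast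
      qed
    qed
    then show ?thesis using sat_pull[OF X Q e' eQ(1)] 2(3) by simp
  qed
qed

lemma not_sat_next_gen_K:
  assumes C: "C \<in> K" "p \<in> tips C"
  shows "\<not> sat (next_gen E) C p q"
proof
  assume "sat (next_gen E) C p q"
  then obtain M where M: "M \<in> next_gen E" "height M > height C" "p \<in> tips M"
    unfolding sat_def by blast
  from M(1) show False
  proof (cases rule: next_genE)
    case 1
    then show ?thesis using K_disj[OF C(1) 1] M C by fastforce
  next
    case (2 X Q)
    then show ?thesis using low[OF 2(2) C(1)] M(2) by (simp add: height_pull)
  qed
qed

text \<open>Saturation of an edge with distinct images passes down by \<open>sat_pullD\<close>, so a
  doubly saturated geodesic among the lifts would give one in \<open>E\<close>. Critical leaves are
  touched by nothing taller.\<close>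

lemma nondeg_next_gen: "nondeg (next_gen E)"
  unfolding nondeg_def
proof (intro ballI allI impI notI)
  fix l p q assume l: "l \<in> next_gen E" and t: "tips l = {p, q}" "p \<noteq> q"
    and s: "sat (next_gen E) l p q \<and> sat (next_gen E) l q p"
  from l show False
  proof (cases rule: next_genE)
    case 1
    then show ?thesis using not_sat_next_gen_K[OF 1, of p q] t s by blast
  next
    case (2 X Q)
    have tr: "tips Q = {trip p, trip q}" using trip_pull[OF 2(1,2)] t 2(3) by auto
    then have ne: "trip p \<noteq> trip q" using two_tips[OF 2(2), of "trip p"] by auto
    have e: "edge (tips (pull E X Q)) p q" "edge (tips (pull E X Q)) q p"
      using t 2(3) unfolding edge_def btw_def by auto
    have "sat E Q (trip p) (trip q)" "sat E Q (trip q) (trip p)"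
      using sat_pullD[OF 2(1,2) e(1) ne] sat_pullD[OF 2(1,2) e(2) ne[symmetric]] s 2(3) by blast+
    then show ?thesis using E(2) 2(2) tr ne unfolding nondeg_def by blast
  qed
qed

lemma pull_inj:
  assumes X: "X \<in> PS" "Y \<in> PS" and Q: "Q \<in> E" "N \<in> E" and e: "tips (pull E X Q) = tips (pull E Y N)"
  shows "X = Y \<and> Q = N"
proof -
  have "X = Y"
  proof (rule ccontr)
    assume n: "X \<noteq> Y"
    obtain c d where cd: "c \<in> tips Q" "d \<in> tips Q" "c \<noteq> d" using two_tips[OF Q(1)] by metis
    obtain x y where "x \<in> tips (pull E X Q)" "trip x = c" "y \<in> tips (pull E X Q)" "trip y = d"
      using pull_onto[OF X(1) Q(1)] cd by metis
    then show False using meet[OF X n, of x y] pull_tips(1) e cd(3) by metis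
  qed
  then show ?thesis using trip_pull[OF X(1) Q(1)] trip_pull[OF X(2) Q(2)] e tips_eqD[OF Q] by metis
qed

lemma pull_tips_not_K:
  assumes X: "X \<in> PS" and Q: "Q \<in> E" and C: "C \<in> K"
  shows "tips (pull E X Q) \<noteq> tips C"
proof
  assume e: "tips (pull E X Q) = tips C"
  obtain c d where cd: "c \<in> tips Q" "d \<in> tips Q" "c \<noteq> d" using two_tips[OF Q] by metis
  obtain x y where "x \<in> tips (pull E X Q)" "trip x = c" "y \<in> tips (pull E X Q)" "trip y = d"
    using pull_onto[OF X Q] cd by metis
  then show False using K_trip[OF C, of x y] e cd(3) by simp
qed

lemma elam_next_gen:
  assumes K_inj: "inj_on tips K"
  shows "elam (next_gen E)"
proof -
  have ext: "extended_leaf l" if "l \<in> next_gen E" for l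
    using that by (cases rule: next_genE) (use K_ext extended_pull in auto)
  have nc1: "\<not> crossing (tips C) (tips (pull E X Q))" if CX: "C \<in> K" "X \<in> PS" for C X Q
  proof -
    obtain Y where "Y \<in> PS" "Y \<noteq> X" "tips C \<subseteq> Y" using K_piece[OF CX] by blast
    then show ?thesis using nox[of Y X] crossing_mono[of "tips C" "tips (pull E X Q)" Y X] CX pull_tips(1) by blast
  qed
  have nc2: "\<not> crossing (tips (pull E X Q)) (tips (pull E Y N))"
    if "X \<in> PS" "Y \<in> PS" "Q \<in> E" "N \<in> E" "pull E X Q \<noteq> pull E Y N" for X Y Q N
  proof (cases "X = Y")
    case True
    then show ?thesis using pull_not_crossing[OF that(1,3,4)] that(5) by blast
  next
    case False
    then show ?thesis
      using nox[OF that(1,2)] crossing_mono[of "tips (pull E X Q)" "tips (pull E Y N)" X Y] pull_tips(1) by blast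
  qed
  have nc: "\<not> crossing (tips l) (tips m)" if "l \<in> next_gen E" "m \<in> next_gen E" "l \<noteq> m" for l m
    using that(1)
  proof (cases rule: next_genE)
    case l: 1
    from that(2) show ?thesis
      by (cases rule: next_genE) (use l that(3) K_nc nc1 in blast)+
  next
    case l: (2 X Q)
    from that(2) show ?thesis
    proof (cases rule: next_genE)
      case 1
      then show ?thesis using nc1 l crossing_sym by blast
    next
      case (2 Y N)
      then show ?thesis using nc2[OF l(1) 2(1) l(2) 2(2)] l(3) that(3) by blast
    qed
  qed
  have inj: "inj_on tips (next_gen E)"
  proof (rule inj_onI)
    fix l m assume l: "l \<in> next_gen E" and m: "m \<in> next_gen E" and e: "tips l = tips m"
    from l show "l = m"
    proof (cases rule: next_genE)
      case l: 1
      from m show ?thesis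
      proof (cases rule: next_genE)
        case 1
        then show ?thesis using K_inj l e unfolding inj_on_def by blast
      next
        case (2 Y N)
        then show ?thesis using pull_tips_not_K l e by metis
      qed
    next
      case l: (2 X Q)
      from m show ?thesis
      proof (cases rule: next_genE)
        case 1
        then show ?thesis using pull_tips_not_K l e by metis
      next
        case (2 Y N)
        then show ?thesis using pull_inj[OF l(1) 2(1) l(2) 2(2)] l e by blast
      qed
    qed
  qed
  have fin: "finite {l\<in>next_gen E. height l \<ge> \<epsilon>}" if "\<epsilon> > 0" for \<epsilon>
  proof -
    have "finite {l\<in>E. height l \<ge> 3 * \<epsilon>}" using elamD(4)[OF E(1), of "3 * \<epsilon>"] that by simp
    then have "finite (K \<union> (\<Union>X\<in>PS. pull E X ` {l\<in>E. height l \<ge> 3 * \<epsilon>}))" using fin_K fin_PS by blast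
    moreover have "{l\<in>next_gen E. height l \<ge> \<epsilon>} \<subseteq> K \<union> (\<Union>X\<in>PS. pull E X ` {l\<in>E. height l \<ge> 3 * \<epsilon>})"
    proof
      fix l assume "l \<in> {l\<in>next_gen E. height l \<ge> \<epsilon>}"
      then have l: "l \<in> next_gen E" "height l \<ge> \<epsilon>" by auto
      from l(1) show "l \<in> K \<union> (\<Union>X\<in>PS. pull E X ` {l\<in>E. height l \<ge> 3 * \<epsilon>})"
      proof (cases rule: next_genE)
        case (2 X Q)
        then have "height Q \<ge> 3 * \<epsilon>" using l(2) by (simp add: height_pull)
        then show ?thesis using 2 by blast
      qed simp
    qed
    ultimately show ?thesis by (rule rev_finite_subset)
  qed
  have sat: "sat (next_gen E) l p q" if "l \<in> next_gen E" "m \<in> next_gen E" "l \<noteq> m" "height l \<le> height m"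
      "edge (tips l) p q" "\<forall>z\<in>tips m. carc p q z" "p \<in> tips m \<or> q \<in> tips m" for l m p q
    using next_gen_sat[OF that(1-5) _ that(7)] extended_leafD(4)[OF ext[OF that(2)]] that(6) by blast
  show ?thesis unfolding elam_def using ext inj nc fin sat by blast
qed

end

section \<open>Locality: dependence on taller leaves only\<close>

lemma sat_cong:
  assumes "\<And>m. height m > height l \<Longrightarrow> m \<in> E \<longleftrightarrow> m \<in> E'"
  shows "sat E l p q \<longleftrightarrow> sat E' l p q"
  using assms unfolding sat_def by blast

text \<open>Forming a lift consults only leaves taller than the one lifted. This is what makes the
  generations stabilise from the top downwards.\<close>

lemma pull_cong:
  assumes "\<And>m. height m > height Q \<Longrightarrow> m \<in> E \<longleftrightarrow> m \<in> E'"
  shows "pull E X Q = pull E' X Q"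
  using sat_cong[of Q E E'] assms unfolding pull_def by simp

text \<open>Each axiom speaks of leaves above some positive height, for instance the smaller of two
  given heights, so it can be checked in an elamination that agrees with \<open>L\<close> above
  it.\<close>

lemma elam_local:
  assumes "\<And>h. h > 0 \<Longrightarrow> \<exists>E. elam E \<and> (\<forall>l. height l \<ge> h \<longrightarrow> (l \<in> L \<longleftrightarrow> l \<in> E))" and pos: "\<And>l. l \<in> L \<Longrightarrow> height l > 0"
  shows "elam L"
proof -
  have ex2: "\<exists>E. elam E \<and> l \<in> E \<and> m \<in> E \<and> (\<forall>k. height k \<ge> height l \<longrightarrow> (k \<in> L \<longleftrightarrow> k \<in> E))" if lm: "l \<in> L" "m \<in> L" for l m
  proof -
    have "min (height l) (height m) > 0" using pos lm by simp
    then obtain E where "elam E" "\<forall>k. height k \<ge> min (height l) (height m) \<longrightarrow> (k \<in> L \<longleftrightarrow> k \<in> E)" using assms(1) by blast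
    then show ?thesis using lm by (intro exI[of _ E]) auto
  qed
  have 1: "extended_leaf l" if "l \<in> L" for l using ex2[OF that that] elamD(1) by blast
  have 2: "inj_on tips L"
  proof (rule inj_onI)
    fix l m assume lm: "l \<in> L" "m \<in> L" and e: "tips l = tips m"
    then show "l = m" using ex2[OF lm] elamD(2) unfolding inj_on_def by metis
  qed
  have 3: "\<not> crossing (tips l) (tips m)" if lm: "l \<in> L" "m \<in> L" "l \<noteq> m" for l m
    using ex2[OF lm(1,2)] elamD(3) lm(3) by blast
  have 4: "finite {l\<in>L. height l \<ge> \<epsilon>}" if "\<epsilon> > 0" for \<epsilon>
  proof -
    obtain E where "elam E" "\<forall>k. height k \<ge> \<epsilon> \<longrightarrow> (k \<in> L \<longleftrightarrow> k \<in> E)" using assms(1) \<open>\<epsilon> > 0\<close> by blast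
    moreover from this have "{l\<in>L. height l \<ge> \<epsilon>} = {l\<in>E. height l \<ge> \<epsilon>}" by blast
    ultimately show ?thesis using elamD(4) that by simp
  qed
  have 5: "sat L l p q" if lm: "l \<in> L" "m \<in> L" and h: "l \<noteq> m" "height l \<le> height m" "edge (tips l) p q"
     "\<forall>z\<in>tips m. carc p q z" "p \<in> tips m \<or> q \<in> tips m" for l m p q
  proof -
    obtain E where E: "elam E" "l \<in> E" "m \<in> E" "\<forall>k. height k \<ge> height l \<longrightarrow> (k \<in> L \<longleftrightarrow> k \<in> E)" using ex2[OF lm] by blast
    have "sat E l p q" using elam_sat[OF E(1-3) h(1-3)] h by blast
    then show ?thesis using sat_cong[of l L E] E(4) by simp
  qed
  show ?thesis unfolding elam_def using 1 2 3 4 5 by blast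
qed

section \<open>Dynamical elaminations\<close>

text \<open>\<open>hmin\<close> and \<open>hmax\<close> bound the heights of the critical leaves,
  and \<open>hmax / 3 < hmin\<close> keeps all later lifts below them. \<open>in_piece\<close>
  serves uniqueness: a leaf compatible with the critical leaves cannot extend over several
  pieces.\<close>

locale dynamics = pieces +
  fixes hmin hmax :: real
  assumes h: "0 < hmin" "hmax / 3 < hmin" and hK: "C \<in> K \<Longrightarrow> hmin \<le> height C \<and> height C \<le> hmax"
    and K_inj: "inj_on tips K"
    and PS3: "card PS = 3"
    and in_piece: "extended_leaf P \<Longrightarrow> (\<And>C. C \<in> K \<Longrightarrow> tips C \<noteq> tips P \<and> \<not> crossing (tips C) (tips P)) \<Longrightarrow> \<exists>X\<in>PS. tips P \<subseteq> X"
begin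

definition gen :: "nat \<Rightarrow> leaf set" where "gen n = (next_gen ^^ n) K"

definition dyn :: "leaf set" where "dyn = (\<Union>n. gen n)"

lemma gen_0: "gen 0 = K" and gen_Suc: "gen (Suc n) = next_gen (gen n)"
  unfolding gen_def by simp_all

lemma elam_K: "elam K" and nondeg_K: "nondeg K"
proof -
  have ns: "\<not> sat K C p q" if "C \<in> K" "p \<in> tips C" for C p q
    using K_disj[OF that(1)] that(2) unfolding sat_def by fastforce
  show "elam K" unfolding elam_def
  proof (intro conjI ballI allI impI)
    show "\<And>l m p q. l \<in> K \<Longrightarrow> m \<in> K \<Longrightarrow> l \<noteq> m \<and> height l \<le> height m \<and> edge (tips l) p q \<and>
       (\<forall>z\<in>tips m. carc p q z) \<and> (p \<in> tips m \<or> q \<in> tips m) \<Longrightarrow> sat K l p q"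
      using K_disj edgeD(1,2) by blast
  qed (use K_ext K_inj K_nc fin_K in auto)
  show "nondeg K" unfolding nondeg_def using ns by blast
qed

lemma gen_props: "elam (gen n) \<and> nondeg (gen n) \<and> (\<forall>l\<in>gen n. hmin / 3 ^ n \<le> height l \<and> height l \<le> hmax)"
proof (induction n)
  case 0
  then show ?case using elam_K nondeg_K hK by (simp add: gen_0)
next
  case (Suc n)
  have pos: "height Q > 0" if "Q \<in> gen n" for Q using Suc h(1) that
    by (meson divide_pos_pos less_le_trans zero_less_numeral zero_less_power)
  interpret P: pieces_elam PS K "gen n"
  proof unfold_locales
    fix Q C assume "Q \<in> gen n" "C \<in> K"
    then show "height Q / 3 < height C" using Suc hK[of C] h by force
  qed (use Suc in auto)
  have "hmin / 3 ^ Suc n \<le> height l \<and> height l \<le> hmax" if l: "l \<in> next_gen (gen n)" for l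
    using l
  proof (cases rule: next_genE)
    case 1
    have "(1::real) \<le> 3 ^ Suc n" by (rule one_le_power) simp
    then have "hmin / 3 ^ Suc n \<le> hmin / 1" by (intro divide_left_mono) (use h in auto)
    then show ?thesis using hK[OF 1] by simp
  next
    case (2 X Q)
    then have "hmin / 3 ^ n \<le> height Q \<and> height Q \<le> hmax" using Suc by blast
    then show ?thesis using 2 pos[of Q] by (simp add: height_pull field_simps)
  qed
  then show ?case using P.elam_next_gen[OF K_inj] P.nondeg_next_gen by (simp add: gen_Suc)
qed

text \<open>By \<open>pull_cong\<close> the old leaves keep their lifts, and lifting divides the
  height bound for new leaves by 3. Hence the part above any positive height becomes
  stationary.\<close>

lemma gen_step: "gen n \<subseteq> gen (Suc n) \<and> (\<forall>l\<in>gen (Suc n). hmin / 3 ^ n \<le> height l \<longrightarrow> l \<in> gen n)"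
proof (induction n)
  case 0
  have "l \<in> K" if "l \<in> next_gen K" "hmin \<le> height l" for l
    using that(1)
  proof (cases rule: next_genE)
    case (2 X Q)
    then have "height l \<le> hmax / 3" using hK[of Q] by (simp add: height_pull)
    then show ?thesis using h that(2) by simp
  qed
  then show ?case by (auto simp: gen_0 gen_Suc next_gen_def)
next
  case (Suc n)
  have pc: "pull (gen n) X Q = pull (gen (Suc n)) X Q" if "Q \<in> gen n" for X Q
  proof (rule pull_cong)
    fix m assume "height m > height Q"
    moreover have "height Q \<ge> hmin / 3 ^ n" using gen_props[of n] that by blast
    ultimately show "m \<in> gen n \<longleftrightarrow> m \<in> gen (Suc n)" using Suc by (meson less_imp_le order_trans subsetD)
  qed
  show ?case
  proof (intro conjI ballI impI subsetI)
    fix l assume "l \<in> gen (Suc n)"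
    then have "l \<in> next_gen (gen n)" by (simp add: gen_Suc)
    then have "l \<in> next_gen (gen (Suc n))"
    proof (cases rule: next_genE)
      case (2 X Q)
      then show ?thesis using pc[OF 2(2)] pull_in_next_gen[OF 2(1)] Suc by (metis subsetD)
    qed (simp add: next_gen_def)
    then show "l \<in> gen (Suc (Suc n))" by (simp add: gen_Suc)
  next
    fix l assume l: "l \<in> gen (Suc (Suc n))" "hmin / 3 ^ Suc n \<le> height l"
    then have "l \<in> next_gen (gen (Suc n))" by (simp add: gen_Suc)
    then have "l \<in> next_gen (gen n)"
    proof (cases rule: next_genE)
      case (2 X Q)
      then have "hmin / 3 ^ n \<le> height Q" using l(2) by (simp add: height_pull field_simps)
      then have "Q \<in> gen n" using Suc 2(2) by blast
      then show ?thesis using pc[of Q X] 2 pull_in_next_gen[of X Q "gen n"] by simp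
    qed (simp add: next_gen_def)
    then show "l \<in> gen (Suc n)" by (simp add: gen_Suc)
  qed
qed

lemma gen_mono: "n \<le> m \<Longrightarrow> gen n \<subseteq> gen m"
  using lift_Suc_mono_le[of gen] gen_step by blast

lemma gen_trunc: "l \<in> gen m \<Longrightarrow> hmin / 3 ^ n \<le> height l \<Longrightarrow> l \<in> gen n"
proof (induction m)
  case 0
  then show ?case using gen_mono[of 0 n] by auto
next
  case (Suc m)
  show ?case
  proof (cases "Suc m \<le> n")
    case True
    then show ?thesis using gen_mono[OF True] Suc by blast
  next
    case False
    have "hmin / 3 ^ m \<le> hmin / 3 ^ n"
      using False h(1) by (intro divide_left_mono) (auto intro!: power_increasing)
    then have "l \<in> gen m" using gen_step[of m] Suc.prems by auto
    then show ?thesis using Suc by blast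
  qed
qed

lemma ex_gen_height:
  assumes "x > 0"
  shows "\<exists>n. hmin / 3 ^ n \<le> x"
proof -
  obtain n where "hmin / x < 3 ^ n" using real_arch_pow[of 3 "hmin / x"] by auto
  then have "hmin / 3 ^ n \<le> x" using assms by (simp add: field_simps)
  then show ?thesis by blast
qed

lemma dyn_trunc: "hmin / 3 ^ n \<le> height l \<Longrightarrow> l \<in> dyn \<longleftrightarrow> l \<in> gen n"
  unfolding dyn_def using gen_trunc by blast

lemma dyn_pos: "l \<in> dyn \<Longrightarrow> 0 < height l \<and> height l \<le> hmax"
proof -
  assume "l \<in> dyn"
  then obtain n where "l \<in> gen n" unfolding dyn_def by blast
  then have "hmin / 3 ^ n \<le> height l" "height l \<le> hmax" using gen_props[of n] by blast+
  then show ?thesis using h(1) by (meson divide_pos_pos less_le_trans zero_less_numeral zero_less_power)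
qed

lemma elam_dyn: "elam dyn"
proof (rule elam_local)
  fix x :: real assume "x > 0"
  then obtain n where "hmin / 3 ^ n \<le> x" using ex_gen_height by blast
  then show "\<exists>E. elam E \<and> (\<forall>l. height l \<ge> x \<longrightarrow> (l \<in> dyn \<longleftrightarrow> l \<in> E))"
    using gen_props[of n] dyn_trunc by (meson order_trans)
qed (use dyn_pos in blast)

lemma nondeg_dyn: "nondeg dyn"
  unfolding nondeg_def
proof (intro ballI allI impI)
  fix l p q assume l: "l \<in> dyn" "tips l = {p, q}" "p \<noteq> q"
  then obtain n where n: "l \<in> gen n" unfolding dyn_def by blast
  then have "hmin / 3 ^ n \<le> height l" using gen_props[of n] by blast
  then have "sat dyn l a b = sat (gen n) l a b" for a b using sat_cong[of l dyn "gen n"] dyn_trunc by simp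
  then show "\<not> (sat dyn l p q \<and> sat dyn l q p)" using gen_props[of n] n l unfolding nondeg_def by simp
qed

lemma pull_gen:
  assumes "Q \<in> gen n"
  shows "pull (gen n) X Q = pull dyn X Q"
proof (rule pull_cong)
  fix m assume "height m > height Q"
  moreover have "hmin / 3 ^ n \<le> height Q" using gen_props[of n] assms by blast
  ultimately show "m \<in> gen n \<longleftrightarrow> m \<in> dyn" using dyn_trunc[of n m] by simp
qed

lemma next_gen_dyn: "next_gen dyn = dyn"
proof (intro subset_antisym subsetI)
  fix l assume "l \<in> next_gen dyn"
  then show "l \<in> dyn"
  proof (cases rule: next_genE)
    case 1
    then show ?thesis unfolding dyn_def using gen_0 by blast
  next
    case (2 X Q)
    then obtain n where n: "Q \<in> gen n" unfolding dyn_def by blast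
    then have "l \<in> gen (Suc n)" using pull_gen[OF n] 2 pull_in_next_gen[OF 2(1) n] by (simp add: gen_Suc)
    then show ?thesis unfolding dyn_def by blast
  qed
next
  fix l assume "l \<in> dyn"
  then obtain n where n: "l \<in> gen n" unfolding dyn_def by blast
  then have "l \<in> gen (Suc n)" using gen_step by blast
  then have "l \<in> next_gen (gen n)" by (simp add: gen_Suc)
  then show "l \<in> next_gen dyn"
  proof (cases rule: next_genE)
    case (2 X Q)
    then show ?thesis using pull_gen[OF 2(2)] pull_in_next_gen[OF 2(1), of Q dyn] unfolding dyn_def by auto
  qed (simp add: next_gen_def)
qed

lemma dynE:
  assumes "l \<in> dyn"
  obtains "l \<in> K" | X Q where "X \<in> PS" "Q \<in> dyn" "l = pull dyn X Q"
  using assms next_genE[of l dyn] unfolding next_gen_dyn by blast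

lemma K_dyn: "C \<in> K \<Longrightarrow> C \<in> dyn" and pull_dyn: "X \<in> PS \<Longrightarrow> Q \<in> dyn \<Longrightarrow> pull dyn X Q \<in> dyn"
  using next_gen_dyn next_gen_def by blast+

sublocale D: pieces_elam PS K dyn
proof unfold_locales
  fix Q C assume "Q \<in> dyn" "C \<in> K"
  then show "height Q / 3 < height C" using dyn_pos hK[of C] h by force
qed (use elam_dyn nondeg_dyn in auto)

section \<open>Preimages in the dynamical elamination and its uniqueness\<close>

lemma pull_not_K: "Q \<in> dyn \<Longrightarrow> pull dyn X Q \<notin> K"
  using D.low[of Q "pull dyn X Q"] by (auto simp: height_pull)

lemma dyn_preimages:
  assumes "Q \<in> dyn"
  shows "{P \<in> dyn - K. cube P = Q} = (\<lambda>X. pull dyn X Q) ` PS"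
proof (intro subset_antisym subsetI)
  fix P assume "P \<in> {P \<in> dyn - K. cube P = Q}"
  then have P: "P \<in> dyn" "P \<notin> K" "cube P = Q" by auto
  from P(1) show "P \<in> (\<lambda>X. pull dyn X Q) ` PS"
  proof (cases rule: dynE)
    case (2 X N)
    then show ?thesis using D.cube_pull[OF 2(1,2)] P(3) by auto
  qed (use P in simp)
next
  fix P assume "P \<in> (\<lambda>X. pull dyn X Q) ` PS"
  then obtain X where X: "X \<in> PS" "P = pull dyn X Q" by blast
  then show "P \<in> {P \<in> dyn - K. cube P = Q}"
    using pull_dyn[OF X(1) assms] pull_not_K[OF assms] D.cube_pull[OF X(1) assms] by simp
qed

lemma card_dyn_preimages:
  assumes "Q \<in> dyn"
  shows "card {P \<in> dyn - K. cube P = Q} = 3"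
proof -
  have "inj_on (\<lambda>X. pull dyn X Q) PS"
    using D.pull_inj[OF _ _ assms assms] by (metis (no_types, lifting) inj_onI)
  then show ?thesis unfolding dyn_preimages[OF assms] using card_image PS3 by metis
qed

text \<open>Here \<open>P\<close> belongs to an unknown elamination that agrees with
  \<open>dyn\<close> above the height of \<open>P\<close>, and its tips at a hole are shown to obey
  the rule in \<open>pull\<close>. If exactly one end is a tip, the critical leaf touches an edge of
  \<open>P\<close> there; the resulting saturator is already known and descends to an edge of
  \<open>Q\<close> at the common image, so \<open>pull\<close> omits the other end too. If both ends
  are tips, a saturator of such an edge of \<open>Q\<close> would have a lift that crosses
  \<open>P\<close>.\<close>

lemma lift_drop:
  assumes L': "elam L'" "K \<subseteq> L'" and P: "P \<in> L'" "P \<notin> K" and X: "X \<in> PS" "tips P \<subseteq> X"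
    and Q: "Q \<in> dyn" "cube P = Q" and ag: "\<And>m. height m > height P \<Longrightarrow> m \<in> dyn \<longleftrightarrow> m \<in> L'"
    and hl: "hole X e b"
  shows "b \<in> tips P \<Longrightarrow> e \<notin> tips P \<Longrightarrow> e \<notin> tips (pull dyn X Q)"
    and "e \<in> tips P \<Longrightarrow> b \<notin> tips P \<Longrightarrow> b \<notin> tips (pull dyn X Q)"
    and "b \<in> tips P \<Longrightarrow> e \<in> tips P \<Longrightarrow> e \<in> tips (pull dyn X Q) \<and> b \<in> tips (pull dyn X Q)"
proof -
  have tP: "trip ` tips P = tips Q" "height Q = 3 * height P" using Q(2) unfolding cube_def trip_def by auto
  have tPE: "\<exists>z'\<in>tips P. trip z' = z" if "z \<in> tips Q" for z using that tP(1) by (metis imageE)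
  have tPI: "trip z \<in> tips Q" if "z \<in> tips P" for z using that tP(1) by (metis imageI)
  note hd = holeD[OF hl]
  note pe = elam_edges[OF L'(1) P(1)]
  obtain C where C: "C \<in> K" "tips C = {e, b}" using hole_K[OF X(1) hl] by blast
  have CL: "C \<in> L'" "P \<noteq> C" "height P \<le> height C" using C L' P D.low[OF Q(1) C(1)] tP(2) by auto
  have edgeQ: "edge (tips Q) (trip x) (trip y)" if "edge (tips P) x y" "trip x \<noteq> trip y" for x y
    unfolding edge_def
  proof (intro conjI ballI)
    fix z assume "z \<in> tips Q"
    then obtain z' where z': "z' \<in> tips P" "trip z' = z" using tPE by blast
    have xyX: "x \<in> X" "y \<in> X" "z' \<in> X" using edgeD(1,2)[OF that(1)] z' X(2) by blast+
    show "\<not> btw (trip x) z (trip y)"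
    proof
      assume bb: "btw (trip x) z (trip y)"
      then have "trip x \<noteq> z" "z \<noteq> trip y" unfolding btw_def by auto
      then have "btw x z' y" using ord[OF X(1) xyX(1,3,2)] z'(2) that(2) bb by metis
      then show False using edgeD(4)[OF that(1) z'(1)] by blast
    qed
  qed (use that(2) edgeD(1,2)[OF that(1)] tPI in auto)
  have satQ: "sat dyn Q (trip x) (trip y)" if xy: "edge (tips P) x y" "trip x \<noteq> trip y" "sat L' P x y" for x y
  proof -
    obtain M where M: "M \<in> L'" "height M > height P" "x \<in> tips M" "y \<in> tips M" "\<forall>z\<in>tips M. carc x y z"
      using xy(3) unfolding sat_def by blast
    have xyX: "x \<in> X" "y \<in> X" using edgeD(1,2)[OF xy(1)] X(2) by blast+
    have "M \<in> dyn" using ag M by blast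
    then show ?thesis
    proof (cases rule: dynE)
      case 1
      then show ?thesis using K_trip[OF 1 M(3,4)] xy(2) by blast
    next
      case (2 Y N)
      have "Y = X" using meet[OF 2(1) X(1) _ _ xyX(1) _ xyX(2)] pull_tips(1) M(3,4) 2(3) xy(2) by blast
      then have MN: "M = pull dyn X N" using 2 by simp
      have "carc (trip x) (trip y) n" if n: "n \<in> tips N" for n
      proof -
        obtain z where z: "z \<in> tips M" "trip z = n" using D.pull_onto[OF X(1) 2(2) n] MN by blast
        have zX: "z \<in> X" using z MN pull_tips(1) by blast
        show ?thesis using M(5) z ord[OF X(1) xyX(1) zX xyX(2)] xy(2) unfolding carc_def by metis
      qed
      moreover have "trip x \<in> tips N" "trip y \<in> tips N" using M(3,4) MN pull_tips(2) by blast+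
      moreover have "height N > height Q" using M(2) MN tP(2) by (simp add: height_pull)
      ultimately show ?thesis unfolding sat_def using 2(2) by blast
    qed
  qed
  show "e \<notin> tips (pull dyn X Q)" if bb: "b \<in> tips P" "e \<notin> tips P"
  proof -
    obtain w where w: "edge (tips P) w b" using pe(2)[OF bb(1)] by blast
    have wX: "w \<in> X" "w \<noteq> b" "w \<noteq> e" using edgeD(1,3)[OF w] edgeD(2,3)[OF w] X(2) bb by auto
    have tw: "trip w \<noteq> trip b" using two[OF X(1) wX(1) hd(2,1)] wX hd by metis
    have "btw w e b" using hd(5)[OF wX(1)] btw_cases[of w e b] btw_rot wX hd(3) by metis
    then have "\<And>z. z \<in> tips C \<Longrightarrow> carc w b z" using C(2) unfolding carc_def by auto
    then have "sat L' P w b" using elam_sat[OF L'(1) P(1) CL w] C(2) by blast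
    then have "sat dyn Q (trip w) (trip e)" using satQ[OF w tw] hd(4) by simp
    moreover have "edge (tips Q) (trip w) (trip e)" using edgeQ[OF w tw] hd(4) by simp
    ultimately show ?thesis using pull_keep_end[OF _ hl] by blast
  qed
  show "b \<notin> tips (pull dyn X Q)" if bb: "e \<in> tips P" "b \<notin> tips P"
  proof -
    obtain w where w: "edge (tips P) e w" using pe(1)[OF bb(1)] by blast
    have wX: "w \<in> X" "w \<noteq> b" "w \<noteq> e" using edgeD(1,3)[OF w] edgeD(2,3)[OF w] X(2) bb by auto
    have tw: "trip e \<noteq> trip w" using two[OF X(1) wX(1) hd(1,2)] wX hd by metis
    have "btw e b w" using hd(5)[OF wX(1)] btw_cases[of e b w] wX hd(3) by metis
    then have "\<And>z. z \<in> tips C \<Longrightarrow> carc e w z" using C(2) unfolding carc_def by auto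
    then have "sat L' P e w" using elam_sat[OF L'(1) P(1) CL w] C(2) by blast
    then have "sat dyn Q (trip b) (trip w)" using satQ[OF w tw] hd(4) by simp
    moreover have "edge (tips Q) (trip b) (trip w)" using edgeQ[OF w tw] hd(4) by simp
    ultimately show ?thesis using pull_keep_start[OF _ hl] by blast
  qed
  have nc: False if "m \<in> dyn" "height m > height Q" "a1 \<in> tips (pull dyn X m)" "a2 \<in> tips (pull dyn X m)"
     "x1 \<in> tips P" "x2 \<in> tips P" "btw a1 x1 a2" "btw a2 x2 a1" for m a1 a2 x1 x2
  proof -
    have "height (pull dyn X m) > height P" using that(2) tP(2) by (simp add: height_pull)
    then have "pull dyn X m \<in> L'" "pull dyn X m \<noteq> P" using ag pull_dyn[OF X(1) that(1)] by auto
    then show False using elamD(3)[OF L'(1) _ P(1)] that(3-8) unfolding crossing_def by blast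
  qed
  show "e \<in> tips (pull dyn X Q) \<and> b \<in> tips (pull dyn X Q)" if bP: "b \<in> tips P" and eP: "e \<in> tips P"
  proof -
    define c where "c = trip b"
    have ce: "trip e = c" "trip b = c" "c \<in> tips Q" using hd(4) c_def tPI bP by auto
    \<comment> \<open>This serves the case of a geodesic saturator \<open>m\<close>: distinct leaves
      have distinct tips, so \<open>Q\<close> has a further tip, and its lift lies opposite to an
      end of the hole with respect to the lift of \<open>m\<close>.\<close>
    have third: "\<exists>z\<in>tips Q. z \<noteq> p \<and> z \<noteq> c" if "m \<in> dyn" "height m > height Q" "tips m = {p, c}" "p \<in> tips Q" for m p
    proof (rule ccontr)
      assume "\<not> ?thesis"
      then have "tips Q = {p, c}" using that(4) ce(3) by blast
      then show False using D.tips_eqD[OF that(1) Q(1)] that by auto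
    qed
    have "e \<in> tips (pull dyn X Q)"
    proof (rule ccontr)
      assume "e \<notin> tips (pull dyn X Q)"
      then obtain p where p: "edge (tips Q) p c" "sat dyn Q p c"
        using pull_memI[of e X Q dyn] hd(1) ce hole_trans[OF X(1) _ hl] by metis
      obtain m where m: "closest_sat dyn Q p c m" using closest_sat_ex[OF elam_dyn Q(1) p] by blast
      have m': "m \<in> dyn" "height m > height Q" "p \<in> tips m" "c \<in> tips m" "\<And>z. z \<in> tips m \<Longrightarrow> carc p c z"
        using m unfolding closest_sat_def by auto
      have pc: "p \<noteq> c" "p \<in> tips Q" using edgeD[OF p(1)] by auto
      have face: "\<not> sat dyn m c p" using facing_edge_not_sat[OF elam_dyn nondeg_dyn Q(1) p(1) m] .
      have em: "edge (tips m) c p" unfolding edge_def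
      proof (intro conjI ballI)
        show "\<not> btw c z p" if "z \<in> tips m" for z using m'(5)[OF that] pc(1) unfolding carc_def btw_def by linarith
      qed (use m' pc in auto)
      have bM: "b \<in> tips (pull dyn X m)"
      proof (rule pull_memI[OF hd(2)])
        show "trip b \<in> tips m" using ce m' by simp
        show "\<not> sat dyn m (trip b) q" if "edge (tips m) (trip b) q" for q
          using edge_unique_from[OF em] that face ce by metis
      qed (use hole_trans[OF X(1) hl] in blast)
      show False
      proof (cases "\<exists>y\<in>tips m. btw p y c")
        case True
        then obtain y where y: "y \<in> tips m" "btw p y c" by blast
        then obtain yM where yM: "yM \<in> tips (pull dyn X m)" "trip yM = y" using D.pull_onto[OF X(1) m'(1)] by blast
        obtain xP where xP: "xP \<in> tips P" "trip xP = p" using tPE pc(2) by blast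
        have yX: "yM \<in> X" "xP \<in> X" using yM xP X(2) pull_tips(1) by blast+
        have ny: "y \<noteq> c" "y \<noteq> p" using y(2) unfolding btw_def by auto
        have "btw c p y" using y(2) unfolding btw_def by linarith
        then have 1: "btw b xP yM" using ord[OF X(1) hd(2) yX(2,1)] ce xP yM ny pc by metis
        have "yM \<noteq> e" "yM \<noteq> b" using ny yM ce by auto
        then have 2: "btw yM e b" using hd(5)[OF yX(1)] btw_cases[of yM e b] btw_rot hd(3) by metis
        show False using nc[OF m'(1,2) yM(1) bM eP xP(1) 2 1] .
      next
        case False
        then have "tips m = {p, c}" using m'(3-5) unfolding carc_def by blast
        then obtain z where z: "z \<in> tips Q" "z \<noteq> p" "z \<noteq> c" using third[OF m'(1,2)] pc by blast
        then have cz: "btw c z p" using edgeD(4)[OF p(1) z(1)] btw_cases[of c z p] btw_rot pc(1) by metis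
        obtain zP where zP: "zP \<in> tips P" "trip zP = z" using tPE z(1) by blast
        obtain x where x: "x \<in> tips (pull dyn X m)" "trip x = p" using D.pull_onto[OF X(1) m'(1,3)] by blast
        have zX: "zP \<in> X" "x \<in> X" using zP x X(2) pull_tips(1) by blast+
        have 1: "btw b zP x" using ord[OF X(1) hd(2) zX] ce zP x z pc cz by metis
        have "x \<noteq> e" "x \<noteq> b" using x ce pc by auto
        then have 2: "btw x e b" using hd(5)[OF zX(2)] btw_cases[of x e b] btw_rot hd(3) by metis
        show False using nc[OF m'(1,2) x(1) bM eP zP(1) 2 1] .
      qed
    qed
    moreover have "b \<in> tips (pull dyn X Q)"
    proof (rule ccontr)
      assume "b \<notin> tips (pull dyn X Q)"
      then obtain q where q: "edge (tips Q) c q" "sat dyn Q c q"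
        using pull_memI[of b X Q dyn] hd(2) ce hole_trans[OF X(1) hl] by metis
      obtain m where m: "closest_sat dyn Q c q m" using closest_sat_ex[OF elam_dyn Q(1) q] by blast
      have m': "m \<in> dyn" "height m > height Q" "c \<in> tips m" "q \<in> tips m" "\<And>z. z \<in> tips m \<Longrightarrow> carc c q z"
        using m unfolding closest_sat_def by auto
      have qc: "q \<noteq> c" "q \<in> tips Q" using edgeD[OF q(1)] by auto
      have face: "\<not> sat dyn m q c" using facing_edge_not_sat[OF elam_dyn nondeg_dyn Q(1) q(1) m] .
      have em: "edge (tips m) q c" unfolding edge_def
      proof (intro conjI ballI)
        show "\<not> btw q z c" if "z \<in> tips m" for z using m'(5)[OF that] qc(1) unfolding carc_def btw_def by linarith
      qed (use m' qc in auto)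
      have eM: "e \<in> tips (pull dyn X m)"
      proof (rule pull_memI[OF hd(1)])
        show "trip e \<in> tips m" using ce m' by simp
        show "\<not> sat dyn m p (trip e)" if "edge (tips m) p (trip e)" for p
          using edge_unique_to[OF em] that face ce by metis
      qed (use hole_trans[OF X(1) _ hl] in blast)
      show False
      proof (cases "\<exists>y\<in>tips m. btw c y q")
        case True
        then obtain y where y: "y \<in> tips m" "btw c y q" by blast
        then obtain yM where yM: "yM \<in> tips (pull dyn X m)" "trip yM = y" using D.pull_onto[OF X(1) m'(1)] by blast
        obtain xP where xP: "xP \<in> tips P" "trip xP = q" using tPE qc(2) by blast
        have yX: "yM \<in> X" "xP \<in> X" using yM xP X(2) pull_tips(1) by blast+
        have ny: "y \<noteq> c" "y \<noteq> q" using y(2) unfolding btw_def by auto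
        have "btw y q c" using y(2) unfolding btw_def by linarith
        then have 1: "btw yM xP e" using ord[OF X(1) yX hd(1)] ce xP yM ny qc by metis
        have "yM \<noteq> e" "yM \<noteq> b" using ny yM ce by auto
        then have 2: "btw e b yM" using hd(5)[OF yX(1)] btw_cases[of e b yM] hd(3) by metis
        show False using nc[OF m'(1,2) eM yM(1) bP xP(1) 2 1] .
      next
        case False
        then have "tips m = {q, c}" using m'(3-5) unfolding carc_def by blast
        then obtain z where z: "z \<in> tips Q" "z \<noteq> q" "z \<noteq> c" using third[OF m'(1,2)] qc by blast
        then have cz: "btw q z c" using edgeD(4)[OF q(1) z(1)] btw_cases[of q z c] btw_rot qc(1) by metis
        obtain zP where zP: "zP \<in> tips P" "trip zP = z" using tPE z(1) by blast
        obtain x where x: "x \<in> tips (pull dyn X m)" "trip x = q" using D.pull_onto[OF X(1) m'(1,4)] by blast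
        have zX: "x \<in> X" "zP \<in> X" using zP x X(2) pull_tips(1) by blast+
        have 1: "btw x zP e" using ord[OF X(1) zX hd(1)] ce zP x z qc cz by metis
        have "x \<noteq> e" "x \<noteq> b" using x ce qc by auto
        then have 2: "btw e b x" using hd(5)[OF zX(1)] btw_cases[of e b x] hd(3) by metis
        show False using nc[OF m'(1,2) eM x(1) bP zP(1) 2 1] .
      qed
    qed
    ultimately show ?thesis by blast
  qed
qed

text \<open>\<open>in_piece\<close> places \<open>P\<close> in one piece. Both \<open>P\<close> and
  the lift have a tip over each tip of \<open>Q\<close>, so they can differ only in the ends of
  holes, which \<open>lift_drop\<close> decides.\<close>

lemma lift_eq_pull:
  assumes L': "elam L'" "K \<subseteq> L'" and P: "P \<in> L'" "P \<notin> K"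
    and Q: "Q \<in> dyn" "cube P = Q" and ag: "\<And>m. height m > height P \<Longrightarrow> m \<in> dyn \<longleftrightarrow> m \<in> L'"
  shows "\<exists>X\<in>PS. P = pull dyn X Q"
proof -
  have "tips C \<noteq> tips P \<and> \<not> crossing (tips C) (tips P)" if "C \<in> K" for C
    using elamD(2,3)[OF L'(1)] that L'(2) P unfolding inj_on_def by blast
  then obtain X where X: "X \<in> PS" "tips P \<subseteq> X" using in_piece[OF elamD(1)[OF L'(1) P(1)]] by blast
  have tP: "trip ` tips P = tips Q" "height Q = 3 * height P" using Q(2) unfolding cube_def trip_def by auto
  note ld = lift_drop[OF L' P X Q ag]
  have "tips P = tips (pull dyn X Q)"
  proof (intro subset_antisym subsetI)
    fix x assume x: "x \<in> tips P"
    then have "trip x \<in> tips Q" using tP by blast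
    then obtain x' where x': "x' \<in> tips (pull dyn X Q)" "trip x' = trip x" using D.pull_onto[OF X(1) Q(1)] by blast
    have xX: "x \<in> X" "x' \<in> X" using x X(2) x'(1) pull_tips(1) by blast+
    show "x \<in> tips (pull dyn X Q)"
    proof (cases "x = x'")
      case False
      then have "hole X x x' \<or> hole X x' x" using hol[OF X(1) xX] x'(2) by simp
      then show ?thesis using ld x x'(1) by blast
    qed (use x' in simp)
  next
    fix x assume x: "x \<in> tips (pull dyn X Q)"
    then have "trip x \<in> tips Q" using pull_tips(2) by blast
    then obtain x' where x': "x' \<in> tips P" "trip x' = trip x" using tP by (metis imageE)
    have xX: "x \<in> X" "x' \<in> X" using x' X(2) x pull_tips(1) by blast+
    show "x \<in> tips P"
    proof (cases "x = x'")
      case False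
      then have "hole X x x' \<or> hole X x' x" using hol[OF X(1) xX] x'(2) by simp
      then show ?thesis using ld(1,2) x x'(1) by blast
    qed (use x' in simp)
  qed
  then have "P = pull dyn X Q" using tP(2) by (intro leaf.expand) (simp add: height_pull)
  then show ?thesis using X by blast
qed

text \<open>The induction is on the number of taller leaves in the two elaminations together, which
  is finite at positive height. At a given height \<open>lift_eq_pull\<close> identifies each
  noncritical leaf of \<open>L'\<close> with one of the three lifts of its image; as the image has
  exactly three preimages in \<open>L'\<close>, all lifts occur.\<close>

lemma dyn_unique:
  assumes L': "elam L'" "K \<subseteq> L'" and cl: "cube ` (L' - K) \<subseteq> L'"
    and c3: "\<And>Q. Q \<in> L' \<Longrightarrow> card {P \<in> L' - K. cube P = Q} = 3"
  shows "L' = dyn"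
proof -
  have pos: "height l > 0" if "l \<in> dyn \<union> L'" for l using that dyn_pos elamD(1)[OF L'(1)] extended_leafD(1) by blast
  have fin: "finite {m \<in> dyn \<union> L'. height m > x}" if "x > 0" for x
  proof -
    have "finite ({m \<in> dyn. height m \<ge> x} \<union> {m \<in> L'. height m \<ge> x})"
      using elamD(4)[OF L'(1) that] elamD(4)[OF elam_dyn that] by blast
    then show ?thesis by (rule rev_finite_subset) auto
  qed
  have "\<forall>x>0. card {m \<in> dyn \<union> L'. height m > x} = n \<longrightarrow> (\<forall>l. height l = x \<longrightarrow> (l \<in> dyn \<longleftrightarrow> l \<in> L'))" for n
  proof (induction n rule: less_induct)
    case (less n)
    show ?case
    proof (intro allI impI)
      fix x l assume x: "0 < x" "card {m \<in> dyn \<union> L'. height m > x} = n" and l: "height l = x"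
      have ag: "m \<in> dyn \<longleftrightarrow> m \<in> L'" if "height m > x" for m
      proof (cases "m \<in> dyn \<union> L'")
        case True
        have "{k \<in> dyn \<union> L'. height k > height m} \<subset> {k \<in> dyn \<union> L'. height k > x}" using that True by auto
        then have "card {k \<in> dyn \<union> L'. height k > height m} < n" using psubset_card_mono[OF fin[OF x(1)]] x(2) by blast
        moreover have "height m > 0" using x(1) that by simp
        ultimately show ?thesis using less.IH[rule_format, OF _ _ refl refl] by blast
      qed simp
      have sub: "\<exists>X\<in>PS. P = pull dyn X (cube P)" if P: "P \<in> L'" "P \<notin> K" "height P = x" for P
      proof (rule lift_eq_pull[OF L' P(1,2)])
        have "cube P \<in> L'" using cl P by blast
        moreover have "height (cube P) > x" using P(3) x(1) unfolding cube_def by simp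
        ultimately show "cube P \<in> dyn" using ag by blast
      qed (use ag P(3) in auto)
      show "l \<in> dyn \<longleftrightarrow> l \<in> L'"
      proof
        assume lL: "l \<in> L'"
        show "l \<in> dyn"
        proof (cases "l \<in> K")
          case False
          have "cube l \<in> L'" using cl lL False by blast
          moreover have "height (cube l) > x" using l x(1) unfolding cube_def by simp
          ultimately have "cube l \<in> dyn" using ag by blast
          then show ?thesis using sub[OF lL False l] pull_dyn by metis
        qed (simp add: K_dyn)
      next
        assume "l \<in> dyn"
        then show "l \<in> L'"
        proof (cases rule: dynE)
          case 1
          then show ?thesis using L'(2) by blast
        next
          case (2 X Q)
          have hQ: "height Q = 3 * x" using 2(3) l by (simp add: height_pull)
          then have QL: "Q \<in> L'" using ag[of Q] 2(2) x(1) by simp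
          have "{P \<in> L' - K. cube P = Q} \<subseteq> (\<lambda>X. pull dyn X Q) ` PS"
          proof
            fix P assume P: "P \<in> {P \<in> L' - K. cube P = Q}"
            then have "height P = x" using hQ unfolding cube_def by auto
            then show "P \<in> (\<lambda>X. pull dyn X Q) ` PS" using sub[of P] P by auto
          qed
          moreover have "card ((\<lambda>X. pull dyn X Q) ` PS) \<le> card {P \<in> L' - K. cube P = Q}"
            using c3[OF QL] card_image_le[OF fin_PS] PS3 by simp
          ultimately have "{P \<in> L' - K. cube P = Q} = (\<lambda>X. pull dyn X Q) ` PS"
            using fin_PS by (meson card_seteq finite_imageI)
          then show ?thesis using 2 by blast
        qed
      qed
    qed
  qed
  then have "l \<in> dyn \<longleftrightarrow> l \<in> L'" if "l \<in> dyn \<union> L'" for l using pos[OF that] by blast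
  then show ?thesis by blast
qed

lemma dyn_The:
  "(THE L. elamination L \<and> K \<subseteq> L \<and> cube ` (L - K) \<subseteq> L \<and> (\<forall>Q \<in> L. card {P \<in> L - K. cube P = Q} = 3)) = dyn"
proof (rule the_equality)
  have "cube ` (dyn - K) \<subseteq> dyn"
  proof
    fix Q assume "Q \<in> cube ` (dyn - K)"
    then obtain P where P: "P \<in> dyn" "P \<notin> K" "Q = cube P" by blast
    from P(1) show "Q \<in> dyn"
      by (cases rule: dynE) (use P D.cube_pull in auto)
  qed
  then show "elamination dyn \<and> K \<subseteq> dyn \<and> cube ` (dyn - K) \<subseteq> dyn \<and> (\<forall>Q \<in> dyn. card {P \<in> dyn - K. cube P = Q} = 3)"
    using elam_dyn K_dyn card_dyn_preimages elamination_iff_elam by blast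
qed (use dyn_unique elamination_iff_elam in blast)

end

section \<open>The pieces of the disk\<close>

text \<open>
  In the coordinate \<open>kap t\<close>, which starts at the first critical leaf, tripling becomes \<open>trp\<close>, and with
  \<open>\<tau> = s - t\<close> the three pieces are unions of arcs that do not depend on \<open>t\<close>.
\<close>

definition kap :: "real \<Rightarrow> real \<Rightarrow> real" where "kap t x = frac (x - t)"

definition trp :: "real \<Rightarrow> real" where
  "trp a = (if a < 1/3 then 3 * a else if a < 2/3 then 3 * a - 1 else 3 * a - 2)"

lemma trp_cases: "0 \<le> a \<Longrightarrow> a < 1 \<Longrightarrow> (3 * a < 1 \<and> trp a = 3 * a) \<or>
    (1 \<le> 3 * a \<and> 3 * a < 2 \<and> trp a = 3 * a - 1) \<or> (2 \<le> 3 * a \<and> trp a = 3 * a - 2)"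
  unfolding trp_def by auto

definition inA :: "real \<Rightarrow> bool" where "inA a \<longleftrightarrow> 0 \<le> a \<and> 3 * a \<le> 1"

definition inB :: "real \<Rightarrow> real \<Rightarrow> bool" where "inB \<tau> a \<longleftrightarrow> \<tau> \<le> a \<and> 3 * a \<le> 3 * \<tau> + 1"

text \<open>The piece between the critical leaves has two boundary arcs. The second one ends at
  coordinate 1, which is represented by \<open>a = 0\<close>, so this end of the first critical leaf
  is listed separately.\<close>

definition inC :: "real \<Rightarrow> real \<Rightarrow> bool" where
  "inC \<tau> a \<longleftrightarrow> a = 0 \<or> 1 \<le> 3 * a \<and> a \<le> \<tau> \<or> 3 * \<tau> + 1 \<le> 3 * a \<and> a < 1"

lemma trp_ordA:
  assumes "1 < 3 * \<tau>" "3 * \<tau> < 2" "inA a" "inA b" "inA c" "trp a \<noteq> trp b" "trp b \<noteq> trp c" "trp a \<noteq> trp c"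
  shows "btw a b c \<longleftrightarrow> btw (trp a) (trp b) (trp c)"
proof -
  have "0 \<le> a" "a < 1" "0 \<le> b" "b < 1" "0 \<le> c" "c < 1" using assms(1-5) unfolding inA_def by auto
  then show ?thesis
    using assms trp_cases[of a] trp_cases[of b] trp_cases[of c] unfolding inA_def btw_def by (smt (z3))
qed

lemma trp_eqA:
  assumes "1 < 3 * \<tau>" "3 * \<tau> < 2" "inA a" "inA b" "trp a = trp b" "a \<noteq> b"
  shows "a = 0 \<and> 3 * b = 1 \<or> b = 0 \<and> 3 * a = 1"
proof -
  have "0 \<le> a" "a < 1" "0 \<le> b" "b < 1" using assms(1-4) unfolding inA_def by auto
  then show ?thesis
    using assms trp_cases[of a] trp_cases[of b] unfolding inA_def by (smt (z3))
qed

lemma trp_ordB: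
  assumes "1 < 3 * \<tau>" "3 * \<tau> < 2" "inB \<tau> a" "inB \<tau> b" "inB \<tau> c" "trp a \<noteq> trp b" "trp b \<noteq> trp c" "trp a \<noteq> trp c"
  shows "btw a b c \<longleftrightarrow> btw (trp a) (trp b) (trp c)"
proof -
  have "0 \<le> a" "a < 1" "0 \<le> b" "b < 1" "0 \<le> c" "c < 1" using assms(1-5) unfolding inB_def by auto
  then show ?thesis
    using assms trp_cases[of a] trp_cases[of b] trp_cases[of c] unfolding inB_def btw_def by (smt (z3))
qed

lemma trp_eqB:
  assumes "1 < 3 * \<tau>" "3 * \<tau> < 2" "inB \<tau> a" "inB \<tau> b" "trp a = trp b" "a \<noteq> b"
  shows "a = \<tau> \<and> 3 * b = 3 * \<tau> + 1 \<or> b = \<tau> \<and> 3 * a = 3 * \<tau> + 1"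
proof -
  have "0 \<le> a" "a < 1" "0 \<le> b" "b < 1" using assms(1-4) unfolding inB_def by auto
  then show ?thesis
    using assms trp_cases[of a] trp_cases[of b] unfolding inB_def by (smt (z3))
qed

lemma trp_ordC:
  assumes "1 < 3 * \<tau>" "3 * \<tau> < 2" "inC \<tau> a" "inC \<tau> b" "inC \<tau> c" "trp a \<noteq> trp b" "trp b \<noteq> trp c" "trp a \<noteq> trp c"
  shows "btw a b c \<longleftrightarrow> btw (trp a) (trp b) (trp c)"
proof -
  have "0 \<le> a" "a < 1" "0 \<le> b" "b < 1" "0 \<le> c" "c < 1" using assms(1-5) unfolding inC_def by auto
  then show ?thesis
    using assms trp_cases[of a] trp_cases[of b] trp_cases[of c] unfolding inC_def btw_def by (smt (z3))
qed

lemma trp_eqC: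
  assumes "1 < 3 * \<tau>" "3 * \<tau> < 2" "inC \<tau> a" "inC \<tau> b" "trp a = trp b" "a \<noteq> b"
  shows "a = 0 \<and> 3 * b = 1 \<or> b = 0 \<and> 3 * a = 1 \<or> a = \<tau> \<and> 3 * b = 3 * \<tau> + 1 \<or> b = \<tau> \<and> 3 * a = 3 * \<tau> + 1"
proof -
  have "0 \<le> a" "a < 1" "0 \<le> b" "b < 1" using assms(1-4) unfolding inC_def by auto
  then show ?thesis
    using assms trp_cases[of a] trp_cases[of b] unfolding inC_def by (smt (z3))
qed

section \<open>The circle coordinate measured from \<open>t\<close>\<close>

lemma frac_frac_diff: "frac (frac x - y) = frac (x - y)"
  using frac_add_of_int_right[of "x - y" "- \<lfloor>x\<rfloor>"] by (simp add: frac_def algebra_simps)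

lemma frac_diff_frac: "frac (x - frac y) = frac (x - y)"
  using frac_add_of_int_right[of "x - y" "\<lfloor>y\<rfloor>"] by (simp add: frac_def algebra_simps)

lemma frac_mult_frac: "frac (real n * frac x) = frac (real n * x)"
  using frac_add_of_int_right[of "real n * x" "- (int n * \<lfloor>x\<rfloor>)"] by (simp add: frac_def algebra_simps)

lemma kap_unit: "kap t x \<in> {0..<1}"
  unfolding kap_def by (simp add: frac_lt_1)

lemma kap_btw:
  assumes "x \<in> {0..<1}" "y \<in> {0..<1}" "z \<in> {0..<1}"
  shows "btw (kap t x) (kap t y) (kap t z) \<longleftrightarrow> btw x y z"
proof -
  have r: "frac t \<in> {0..<1}" by (simp add: frac_lt_1)
  have k: "kap t w = (if frac t \<le> w then w - frac t else w - frac t + 1)" if "w \<in> {0..<1}" for w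
    using frac_diff_unit[OF that r] unfolding kap_def frac_diff_frac .
  show ?thesis using assms unfolding k[OF assms(1)] k[OF assms(2)] k[OF assms(3)] btw_def atLeastLessThan_iff
    by (smt (z3))
qed

lemma kap_inj: "x \<in> {0..<1} \<Longrightarrow> y \<in> {0..<1} \<Longrightarrow> kap t x = kap t y \<longleftrightarrow> x = y"
proof -
  assume a: "x \<in> {0..<1}" "y \<in> {0..<1}"
  have r: "frac t \<in> {0..<1}" by (simp add: frac_lt_1)
  have k: "kap t w = (if frac t \<le> w then w - frac t else w - frac t + 1)" if "w \<in> {0..<1}" for w
    using frac_diff_unit[OF that r] unfolding kap_def frac_diff_frac .
  show ?thesis using a unfolding k[OF a(1)] k[OF a(2)] by (auto split: if_splits)
qed

lemma kap_onto: "a \<in> {0..<1} \<Longrightarrow> \<exists>x\<in>{0..<1}. kap t x = a"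
proof
  assume a: "a \<in> {0..<1}"
  show "kap t (frac (a + t)) = a" unfolding kap_def frac_frac_diff using a by (simp add: frac_eq)
qed (simp add: frac_lt_1)

lemma trp_eq: "a \<in> {0..<1} \<Longrightarrow> trp a = frac (3 * a)"
proof -
  assume a: "a \<in> {0..<1}"
  have "\<lfloor>3 * a\<rfloor> = (if a < 1/3 then 0 else if a < 2/3 then 1 else 2)"
    using a by (auto simp: floor_eq_iff)
  then show ?thesis unfolding trp_def frac_def by auto
qed

lemma kap_trip: "kap (3 * t) (trip x) = trp (kap t x)"
proof -
  have "kap (3 * t) (trip x) = frac (3 * (x - t))" unfolding kap_def trip_def frac_frac_diff by (simp add: algebra_simps)
  also have "\<dots> = frac (3 * kap t x)" unfolding kap_def using frac_mult_frac[of 3 "x - t"] by simp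
  finally show ?thesis using trp_eq[OF kap_unit] by simp
qed

lemma trip_unit: "trip x \<in> {0..<1}"
  unfolding trip_def by (simp add: frac_lt_1)

lemma trip_btw: "btw (trip x) (trip y) (trip z) \<longleftrightarrow> btw (trp (kap t x)) (trp (kap t y)) (trp (kap t z))"
  using kap_btw[OF trip_unit trip_unit trip_unit, of "3 * t"] unfolding kap_trip by blast

lemma trip_eq: "trip x = trip y \<longleftrightarrow> trp (kap t x) = trp (kap t y)"
  using kap_inj[OF trip_unit trip_unit, of "3 * t"] unfolding kap_trip by blast

definition pieceA :: "real \<Rightarrow> real set" where "pieceA t = {x\<in>{0..<1}. inA (kap t x)}"

definition pieceB :: "real \<Rightarrow> real \<Rightarrow> real set" where "pieceB t s = {x\<in>{0..<1}. inB (s - t) (kap t x)}"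

definition pieceC :: "real \<Rightarrow> real \<Rightarrow> real set" where "pieceC t s = {x\<in>{0..<1}. inC (s - t) (kap t x)}"

definition PSet :: "real \<Rightarrow> real \<Rightarrow> real set set" where
  "PSet t s = {pieceA t, pieceB t s, pieceC t s}"

definition KSet :: "real \<Rightarrow> real \<Rightarrow> real \<Rightarrow> leaf set" where
  "KSet \<epsilon> t s = {simple_critical_leaf 1 t, simple_critical_leaf (1 - \<epsilon>) s}"

definition admissible :: "real \<Rightarrow> real \<Rightarrow> bool" where
  "admissible t s \<longleftrightarrow> t + 1/3 < s \<and> s < t + 2/3"

lemma kap_eqI:
  assumes "x = frac (t + a)" "a \<in> {0..<1}"
  shows "kap t x = a"
  using assms unfolding kap_def assms(1) frac_frac_diff by (simp add: frac_eq)

lemma hole_kap: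
  assumes "X \<subseteq> {0..<1}" "x \<in> X" "y \<in> X"
  shows "hole X x y \<longleftrightarrow> kap t x \<noteq> kap t y \<and> trp (kap t x) = trp (kap t y) \<and> (\<forall>z\<in>X. \<not> btw (kap t x) (kap t z) (kap t y))"
  using assms kap_inj[of x y t] kap_btw[of x _ y t] unfolding hole_def trip_eq[of x y t] by (meson subsetD)

lemma crossing_kap:
  assumes "X \<subseteq> {0..<1}" "Y \<subseteq> {0..<1}" "crossing X Y"
  shows "\<exists>a\<in>X. \<exists>b\<in>X. \<exists>x\<in>Y. \<exists>y\<in>Y. btw (kap t a) (kap t x) (kap t b) \<and> btw (kap t b) (kap t y) (kap t a)"
  using assms(3) kap_btw[of _ _ _ t] assms(1,2) unfolding crossing_def by (meson subsetD)

lemma carc_kap: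
  assumes "x \<in> {0..<1}" "y \<in> {0..<1}" "z \<in> {0..<1}"
  shows "carc x y z \<longleftrightarrow> kap t z = kap t x \<or> kap t z = kap t y \<or> btw (kap t x) (kap t z) (kap t y)"
  using assms kap_inj kap_btw unfolding carc_def by blast

context
  fixes t s :: real
  assumes ad: "admissible t s"
begin

lemma tau: "1 < 3 * (s - t)" "3 * (s - t) < 2"
  using ad unfolding admissible_def by auto

lemma PSet_sub: "X \<in> PSet t s \<Longrightarrow> X \<subseteq> {0..<1}"
  unfolding PSet_def pieceA_def pieceB_def pieceC_def by auto

lemma PSet_ord:
  assumes X: "X \<in> PSet t s" "x \<in> X" "y \<in> X" "z \<in> X"
    and ne: "trip x \<noteq> trip y" "trip y \<noteq> trip z" "trip x \<noteq> trip z"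
  shows "btw x y z \<longleftrightarrow> btw (trip x) (trip y) (trip z)"
proof -
  have u: "x \<in> {0..<1}" "y \<in> {0..<1}" "z \<in> {0..<1}" using PSet_sub[OF X(1)] X(2-) by blast+
  have ne': "trp (kap t x) \<noteq> trp (kap t y)" "trp (kap t y) \<noteq> trp (kap t z)" "trp (kap t x) \<noteq> trp (kap t z)"
    using ne unfolding trip_eq[of _ _ t] .
  have "btw (kap t x) (kap t y) (kap t z) \<longleftrightarrow> btw (trp (kap t x)) (trp (kap t y)) (trp (kap t z))"
    using X trp_ordA[OF tau _ _ _ ne'] trp_ordB[OF tau _ _ _ ne'] trp_ordC[OF tau _ _ _ ne']
    unfolding PSet_def pieceA_def pieceB_def pieceC_def by blast
  then show ?thesis unfolding trip_btw[of x y z t] kap_btw[OF u] .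
qed

lemma hole_pieces:
  assumes u: "x \<in> {0..<1}" "y \<in> {0..<1}"
  shows "3 * kap t x = 1 \<Longrightarrow> kap t y = 0 \<Longrightarrow> hole (pieceA t) x y"
    "3 * kap t x = 3 * (s - t) + 1 \<Longrightarrow> kap t y = s - t \<Longrightarrow> hole (pieceB t s) x y"
    "kap t x = 0 \<Longrightarrow> 3 * kap t y = 1 \<Longrightarrow> hole (pieceC t s) x y"
    "kap t x = s - t \<Longrightarrow> 3 * kap t y = 3 * (s - t) + 1 \<Longrightarrow> hole (pieceC t s) x y"
proof -
  have sub: "pieceA t \<subseteq> {0..<1}" "pieceB t s \<subseteq> {0..<1}" "pieceC t s \<subseteq> {0..<1}"
    unfolding pieceA_def pieceB_def pieceC_def by auto
  have uu: "0 \<le> kap t x" "kap t x < 1" "0 \<le> kap t y" "kap t y < 1" using kap_unit by simp_all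
  note tc = trp_cases[OF uu(1,2)] trp_cases[OF uu(3,4)]
  show "hole (pieceA t) x y" if "3 * kap t x = 1" "kap t y = 0"
  proof (rule hole_kap[OF sub(1), THEN iffD2])
    show "x \<in> pieceA t" "y \<in> pieceA t" using that u unfolding pieceA_def inA_def by auto
    have "\<not> btw (kap t x) (kap t z) (kap t y)" if "z \<in> pieceA t" for z
      using that \<open>3 * kap t x = 1\<close> \<open>kap t y = 0\<close> unfolding pieceA_def inA_def btw_def by auto
    moreover have "kap t x \<noteq> kap t y" "trp (kap t x) = trp (kap t y)" using that tc by auto
    ultimately show "kap t x \<noteq> kap t y \<and> trp (kap t x) = trp (kap t y) \<and> (\<forall>z\<in>pieceA t. \<not> btw (kap t x) (kap t z) (kap t y))" by blast
  qed
  show "hole (pieceB t s) x y" if "3 * kap t x = 3 * (s - t) + 1" "kap t y = s - t"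
  proof (rule hole_kap[OF sub(2), THEN iffD2])
    show "x \<in> pieceB t s" "y \<in> pieceB t s" using that u unfolding pieceB_def inB_def by auto
    have "\<not> btw (kap t x) (kap t z) (kap t y)" if "z \<in> pieceB t s" for z
      using that \<open>3 * kap t x = 3 * (s - t) + 1\<close> \<open>kap t y = s - t\<close> unfolding pieceB_def inB_def btw_def by auto
    moreover have "kap t x \<noteq> kap t y" "trp (kap t x) = trp (kap t y)" using that tc tau by auto
    ultimately show "kap t x \<noteq> kap t y \<and> trp (kap t x) = trp (kap t y) \<and> (\<forall>z\<in>pieceB t s. \<not> btw (kap t x) (kap t z) (kap t y))" by blast
  qed
  show "hole (pieceC t s) x y" if "kap t x = 0" "3 * kap t y = 1"
  proof (rule hole_kap[OF sub(3), THEN iffD2])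
    show "x \<in> pieceC t s" "y \<in> pieceC t s" using that u tau unfolding pieceC_def inC_def by auto
    have "\<not> btw (kap t x) (kap t z) (kap t y)" if "z \<in> pieceC t s" for z
      using that \<open>kap t x = 0\<close> \<open>3 * kap t y = 1\<close> tau unfolding pieceC_def inC_def btw_def by auto
    moreover have "kap t x \<noteq> kap t y" "trp (kap t x) = trp (kap t y)" using that tc by auto
    ultimately show "kap t x \<noteq> kap t y \<and> trp (kap t x) = trp (kap t y) \<and> (\<forall>z\<in>pieceC t s. \<not> btw (kap t x) (kap t z) (kap t y))" by blast
  qed
  show "hole (pieceC t s) x y" if "kap t x = s - t" "3 * kap t y = 3 * (s - t) + 1"
  proof (rule hole_kap[OF sub(3), THEN iffD2])
    show "x \<in> pieceC t s" "y \<in> pieceC t s" using that u tau uu unfolding pieceC_def inC_def by auto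
    have "\<not> btw (kap t x) (kap t z) (kap t y)" if "z \<in> pieceC t s" for z
      using that \<open>kap t x = s - t\<close> \<open>3 * kap t y = 3 * (s - t) + 1\<close> tau unfolding pieceC_def inC_def btw_def by auto
    moreover have "kap t x \<noteq> kap t y" "trp (kap t x) = trp (kap t y)" using that tc tau by auto
    ultimately show "kap t x \<noteq> kap t y \<and> trp (kap t x) = trp (kap t y) \<and> (\<forall>z\<in>pieceC t s. \<not> btw (kap t x) (kap t z) (kap t y))" by blast
  qed
qed

lemma double_cases:
  assumes X: "X \<in> PSet t s" "x \<in> X" "y \<in> X" and ne: "x \<noteq> y" "trip x = trip y"
  obtains "X = pieceA t" "kap t x = 0" "3 * kap t y = 1" | "X = pieceA t" "kap t y = 0" "3 * kap t x = 1"
    | "X = pieceB t s" "kap t x = s - t" "3 * kap t y = 3 * (s - t) + 1"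
    | "X = pieceB t s" "kap t y = s - t" "3 * kap t x = 3 * (s - t) + 1"
    | "X = pieceC t s" "kap t x = 0" "3 * kap t y = 1" | "X = pieceC t s" "kap t y = 0" "3 * kap t x = 1"
    | "X = pieceC t s" "kap t x = s - t" "3 * kap t y = 3 * (s - t) + 1"
    | "X = pieceC t s" "kap t y = s - t" "3 * kap t x = 3 * (s - t) + 1"
proof -
  have u: "x \<in> {0..<1}" "y \<in> {0..<1}" using PSet_sub[OF X(1)] X(2-) by blast+
  have ne': "trp (kap t x) = trp (kap t y)" "kap t x \<noteq> kap t y"
    using ne kap_inj[OF u] unfolding trip_eq[of _ _ t] by auto
  consider (A) "X = pieceA t" | (B) "X = pieceB t s" | (C) "X = pieceC t s" using X(1) unfolding PSet_def by blast
  then show ?thesis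
  proof cases
    case A
    then have "inA (kap t x)" "inA (kap t y)" using X unfolding pieceA_def by auto
    then show ?thesis using trp_eqA[OF tau _ _ ne'] that(1,2) A by blast
  next
    case B
    then have "inB (s - t) (kap t x)" "inB (s - t) (kap t y)" using X unfolding pieceB_def by auto
    then show ?thesis using trp_eqB[OF tau _ _ ne'] that(3,4) B by blast
  next
    case C
    then have "inC (s - t) (kap t x)" "inC (s - t) (kap t y)" using X unfolding pieceC_def by auto
    then show ?thesis using trp_eqC[OF tau _ _ ne'] that(5-8) C by blast
  qed
qed

lemma PSet_hol:
  assumes X: "X \<in> PSet t s" "x \<in> X" "y \<in> X" and ne: "x \<noteq> y" "trip x = trip y"
  shows "hole X x y \<or> hole X y x"
proof -
  have u: "x \<in> {0..<1}" "y \<in> {0..<1}" using PSet_sub[OF X(1)] X(2-) by blast+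
  show ?thesis
    by (rule double_cases[OF assms]) (use hole_pieces[OF u] hole_pieces[OF u(2,1)] in blast)+
qed

lemma PSet_two:
  assumes X: "X \<in> PSet t s" "x \<in> X" "y \<in> X" "z \<in> X" and e: "trip x = trip y" "trip y = trip z"
  shows "x = y \<or> y = z \<or> x = z"
proof (rule ccontr)
  assume n: "\<not> ?thesis"
  have u: "x \<in> {0..<1}" "y \<in> {0..<1}" "z \<in> {0..<1}" using PSet_sub[OF X(1)] X(2-) by blast+
  have k: "0 \<le> kap t w" "kap t w < 1" for w using kap_unit by simp_all
  have ne: "kap t x \<noteq> kap t y" "kap t y \<noteq> kap t z" "kap t x \<noteq> kap t z" using n kap_inj u by auto
  have te: "trp (kap t x) = trp (kap t y)" "trp (kap t y) = trp (kap t z)" using e unfolding trip_eq[of _ _ t] .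
  have te': "trp (kap t x) = trp (kap t z)" using te by simp
  consider (A) "X = pieceA t" | (B) "X = pieceB t s" | (C) "X = pieceC t s" using X(1) unfolding PSet_def by blast
  then show False
  proof cases
    case A
    then have i: "inA (kap t x)" "inA (kap t y)" "inA (kap t z)" using X unfolding pieceA_def by auto
    show ?thesis
      using trp_eqA[OF tau i(1,2) te(1) ne(1)] trp_eqA[OF tau i(2,3) te(2) ne(2)] trp_eqA[OF tau i(1,3) te' ne(3)] ne
      by (smt (z3))
  next
    case B
    then have i: "inB (s - t) (kap t x)" "inB (s - t) (kap t y)" "inB (s - t) (kap t z)" using X unfolding pieceB_def by auto
    show ?thesis
      using trp_eqB[OF tau i(1,2) te(1) ne(1)] trp_eqB[OF tau i(2,3) te(2) ne(2)] trp_eqB[OF tau i(1,3) te' ne(3)] ne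
      by (smt (z3))
  next
    case C
    then have i: "inC (s - t) (kap t x)" "inC (s - t) (kap t y)" "inC (s - t) (kap t z)" using X unfolding pieceC_def by auto
    show ?thesis
      using trp_eqC[OF tau i(1,2) te(1) ne(1)] trp_eqC[OF tau i(2,3) te(2) ne(2)] trp_eqC[OF tau i(1,3) te' ne(3)] ne tau
      by (smt (z3))
  qed
qed

lemma pieces_disj: "pieceA t \<noteq> pieceB t s" "pieceB t s \<noteq> pieceC t s" "pieceA t \<noteq> pieceC t s"
proof -
  obtain x where x: "x \<in> {0..<1}" "kap t x = 1/6" using kap_onto[of "1/6" t] by auto
  have 1: "x \<in> pieceA t" "x \<notin> pieceB t s" "x \<notin> pieceC t s"
    using x tau unfolding pieceA_def pieceB_def pieceC_def inA_def inB_def inC_def by auto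
  obtain y where y: "y \<in> {0..<1}" "kap t y = s - t + 1/6" using kap_onto[of "s - t + 1/6" t] tau by auto
  have 2: "y \<in> pieceB t s" "y \<notin> pieceC t s"
    using y tau unfolding pieceB_def pieceC_def inB_def inC_def by auto
  show "pieceA t \<noteq> pieceB t s" "pieceB t s \<noteq> pieceC t s" "pieceA t \<noteq> pieceC t s" using 1 2 by blast+
qed

end

context
  fixes t s :: real
  assumes ad: "admissible t s"
begin

lemma PSet_onto:
  assumes X: "X \<in> PSet t s" and y: "y \<in> {0..<1}"
  shows "\<exists>x\<in>X. trip x = y"
proof -
  note tau = tau[OF ad]
  define b where "b = kap (3 * t) y"
  have b: "0 \<le> b" "b < 1" using kap_unit b_def by simp_all
  have *: "\<exists>x\<in>{0..<1}. kap t x = a \<and> trip x = y" if aa: "0 \<le> a" "a < 1" "trp a = b" for a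
  proof -
    obtain x where x: "x \<in> {0..<1}" "kap t x = a" using kap_onto[of a t] aa by auto
    then have "trip x = y" using kap_inj[of "trip x" y "3 * t", OF trip_unit y] kap_trip aa(3) b_def by simp
    then show ?thesis using x by blast
  qed
  have **: "\<exists>x\<in>X. trip x = y" if a: "0 \<le> a" "a < 1" "trp a = b" "X = {x\<in>{0..<1}. J (kap t x)}" "J a" for a J
  proof -
    obtain x where "x \<in> {0..<1}" "kap t x = a" "trip x = y" using *[OF a(1-3)] by blast
    then show ?thesis using a(4,5) by blast
  qed
  have t0: "trp (b / 3) = b" and t1: "trp ((b + 1) / 3) = b" and t2: "trp ((b + 2) / 3) = b"
    unfolding trp_def using b by (auto simp: field_simps)
  \<comment> \<open>\<open>b / 3\<close>, \<open>b1\<close> and \<open>b2\<close> are the solutions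
    of \<open>trp a = b\<close>. The first serves \<open>pieceA\<close>; each of the other pieces
    contains \<open>b1\<close> or \<open>b2\<close>, depending on the position of
    \<open>s - t\<close>.\<close>
  define b1 where "b1 = (b + 1) / 3"
  define b2 where "b2 = (b + 2) / 3"
  have bb: "3 * b1 = b + 1" "3 * b2 = b + 2" unfolding b1_def b2_def by auto
  consider "X = pieceA t" | "X = pieceB t s" | "X = pieceC t s" using X unfolding PSet_def by blast
  then show ?thesis
  proof cases
    case 1
    then show ?thesis using b t0 by (intro **[of "b / 3" inA]) (auto simp: pieceA_def inA_def)
  next
    case 2
    then have X: "X = {x\<in>{0..<1}. inB (s - t) (kap t x)}" unfolding pieceB_def .
    show ?thesis
    proof (cases "b1 \<ge> s - t")
      case True
      then have "inB (s - t) b1" unfolding inB_def using b bb tau by (smt (z3))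
      then show ?thesis using **[OF _ _ t1[folded b1_def] X] b bb by simp
    next
      case False
      then have "inB (s - t) b2" unfolding inB_def using b bb tau by (smt (z3))
      then show ?thesis using **[OF _ _ t2[folded b2_def] X] b bb by simp
    qed
  next
    case 3
    then have X: "X = {x\<in>{0..<1}. inC (s - t) (kap t x)}" unfolding pieceC_def .
    show ?thesis
    proof (cases "b1 \<le> s - t")
      case True
      then have "inC (s - t) b1" unfolding inC_def using b bb tau by (smt (z3))
      then show ?thesis using **[OF _ _ t1[folded b1_def] X] b bb by simp
    next
      case False
      then have "inC (s - t) b2" unfolding inC_def using b bb tau by (smt (z3))
      then show ?thesis using **[OF _ _ t2[folded b2_def] X] b bb by simp
    qed
  qed
qed

lemma no_cross_AB: "\<not> crossing (pieceA t) (pieceB t s)"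
proof
  assume "crossing (pieceA t) (pieceB t s)"
  then obtain a b x y where h: "a \<in> pieceA t" "b \<in> pieceA t" "x \<in> pieceB t s" "y \<in> pieceB t s"
    "btw (kap t a) (kap t x) (kap t b)" "btw (kap t b) (kap t y) (kap t a)"
    using crossing_kap[of "pieceA t" "pieceB t s" t] unfolding pieceA_def pieceB_def by blast
  have "0 \<le> kap t a" "3 * kap t a \<le> 1" "0 \<le> kap t b" "3 * kap t b \<le> 1" "s - t \<le> kap t x" "s - t \<le> kap t y"
    using h unfolding pieceA_def pieceB_def inA_def inB_def by auto
  then show False using h(5,6) tau[OF ad] unfolding btw_def by (smt (z3))
qed

lemma no_cross_AC: "\<not> crossing (pieceA t) (pieceC t s)"
proof
  assume "crossing (pieceA t) (pieceC t s)"
  then obtain a b x y where h: "a \<in> pieceA t" "b \<in> pieceA t" "x \<in> pieceC t s" "y \<in> pieceC t s"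
    "btw (kap t a) (kap t x) (kap t b)" "btw (kap t b) (kap t y) (kap t a)"
    using crossing_kap[of "pieceA t" "pieceC t s" t] unfolding pieceA_def pieceC_def by blast
  have "0 \<le> kap t a" "3 * kap t a \<le> 1" "0 \<le> kap t b" "3 * kap t b \<le> 1"
    "kap t x = 0 \<or> 1 \<le> 3 * kap t x" "kap t y = 0 \<or> 1 \<le> 3 * kap t y"
    using h tau[OF ad] unfolding pieceA_def pieceC_def inA_def inC_def by auto
  then show False using h(5,6) tau[OF ad] unfolding btw_def by (smt (z3))
qed

lemma no_cross_BC: "\<not> crossing (pieceB t s) (pieceC t s)"
proof
  assume "crossing (pieceB t s) (pieceC t s)"
  then obtain a b x y where h: "a \<in> pieceB t s" "b \<in> pieceB t s" "x \<in> pieceC t s" "y \<in> pieceC t s"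
    "btw (kap t a) (kap t x) (kap t b)" "btw (kap t b) (kap t y) (kap t a)"
    using crossing_kap[of "pieceB t s" "pieceC t s" t] unfolding pieceB_def pieceC_def by blast
  have "s - t \<le> kap t a" "3 * kap t a \<le> 3 * (s - t) + 1" "s - t \<le> kap t b" "3 * kap t b \<le> 3 * (s - t) + 1"
    "kap t x \<le> s - t \<or> 3 * (s - t) + 1 \<le> 3 * kap t x" "kap t y \<le> s - t \<or> 3 * (s - t) + 1 \<le> 3 * kap t y"
    using h tau[OF ad] unfolding pieceB_def pieceC_def inB_def inC_def by auto
  then show False using h(5,6) tau[OF ad] unfolding btw_def by (smt (z3))
qed

lemma PSet_nox:
  assumes "X \<in> PSet t s" "Y \<in> PSet t s" "X \<noteq> Y"
  shows "\<not> crossing X Y"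
  using assms no_cross_AB no_cross_AC no_cross_BC crossing_sym unfolding PSet_def by blast

lemma meet_AB: "\<not> (x \<in> pieceA t \<and> x \<in> pieceB t s)"
  using tau[OF ad] unfolding pieceA_def pieceB_def inA_def inB_def by auto

lemma meet_AC: "x \<in> pieceA t \<Longrightarrow> x \<in> pieceC t s \<Longrightarrow> kap t x = 0 \<or> 3 * kap t x = 1"
  using tau[OF ad] unfolding pieceA_def pieceC_def inA_def inC_def by auto

lemma meet_BC: "x \<in> pieceB t s \<Longrightarrow> x \<in> pieceC t s \<Longrightarrow> kap t x = s - t \<or> 3 * kap t x = 3 * (s - t) + 1"
  using tau[OF ad] unfolding pieceB_def pieceC_def inB_def inC_def by auto

lemma trp_crit: "a = 0 \<or> 3 * a = 1 \<Longrightarrow> trp a = 0" "a = s - t \<or> 3 * a = 3 * (s - t) + 1 \<Longrightarrow> trp a = 3 * (s - t) - 1"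
  using tau[OF ad] unfolding trp_def by auto

lemma PSet_meet:
  assumes "X \<in> PSet t s" "Y \<in> PSet t s" "X \<noteq> Y" "x \<in> X" "x \<in> Y" "y \<in> X" "y \<in> Y"
  shows "trip x = trip y"
proof -
  have "(kap t x = 0 \<or> 3 * kap t x = 1) \<and> (kap t y = 0 \<or> 3 * kap t y = 1) \<or>
    (kap t x = s - t \<or> 3 * kap t x = 3 * (s - t) + 1) \<and> (kap t y = s - t \<or> 3 * kap t y = 3 * (s - t) + 1)"
    using assms meet_AB meet_AC meet_BC unfolding PSet_def by blast
  then have "trp (kap t x) = trp (kap t y)" using trp_crit by metis
  then show ?thesis unfolding trip_eq[of _ _ t] .
qed

lemma kap_point: "0 \<le> a \<Longrightarrow> a < 1 \<Longrightarrow> \<exists>x\<in>{0..<1}. kap t x = a"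
  using kap_onto[of a t] by simp

lemma PSet_side:
  assumes X: "X \<in> PSet t s" "Y \<in> PSet t s" "X \<noteq> Y" and x: "x \<in> X" "x \<in> Y"
  shows "\<exists>x'. hole X x x' \<and> (\<forall>z\<in>Y. carc x x' z) \<or> hole X x' x \<and> (\<forall>z\<in>Y. carc x' x z)"
proof -
  note tau = tau[OF ad] and hp = hole_pieces[OF ad]
  have xu: "x \<in> {0..<1}" using PSet_sub[OF ad X(1)] x by blast
  obtain c0 where c0: "c0 \<in> {0..<1}" "kap t c0 = 0" using kap_point[of 0] by auto
  obtain c1 where c1: "c1 \<in> {0..<1}" "3 * kap t c1 = 1" using kap_point[of "1/3"] by auto
  obtain d0 where d0: "d0 \<in> {0..<1}" "kap t d0 = s - t" using kap_point[of "s - t"] tau by auto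
  obtain d1 where d1: "d1 \<in> {0..<1}" "3 * kap t d1 = 3 * (s - t) + 1" using kap_point[of "s - t + 1/3"] tau by auto
  have eq: "x = y" if "kap t x = kap t y" "y \<in> {0..<1}" for y using that kap_inj[OF xu that(2), of t] by simp
  have A: "carc c1 c0 z" if "z \<in> pieceC t s" for z
  proof -
    have "z \<in> {0..<1}" "kap t z = 0 \<or> 1 \<le> 3 * kap t z" using that tau unfolding pieceC_def inC_def by auto
    then show ?thesis using carc_kap[OF c1(1) c0(1), of z t] c0(2) c1(2) unfolding btw_def by (smt (z3))
  qed
  have A': "carc c0 c1 z" if "z \<in> pieceA t" for z
  proof -
    have "z \<in> {0..<1}" "0 \<le> kap t z" "3 * kap t z \<le> 1" using that tau unfolding pieceA_def inA_def by auto
    then show ?thesis using carc_kap[OF c0(1) c1(1), of z t] c0(2) c1(2) unfolding btw_def by (smt (z3))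
  qed
  have B: "carc d1 d0 z" if "z \<in> pieceC t s" for z
  proof -
    have "z \<in> {0..<1}" "kap t z \<le> s - t \<or> 3 * (s - t) + 1 \<le> 3 * kap t z" using that tau unfolding pieceC_def inC_def by auto
    then show ?thesis using carc_kap[OF d1(1) d0(1), of z t] d0(2) d1(2) unfolding btw_def by (smt (z3))
  qed
  have B': "carc d0 d1 z" if "z \<in> pieceB t s" for z
  proof -
    have "z \<in> {0..<1}" "s - t \<le> kap t z" "3 * kap t z \<le> 3 * (s - t) + 1" using that tau unfolding pieceB_def inB_def by auto
    then show ?thesis using carc_kap[OF d0(1) d1(1), of z t] d0(2) d1(2) unfolding btw_def by (smt (z3))
  qed
  have hA: "hole (pieceA t) c1 c0" using hp(1)[OF c1(1) c0(1)] c0 c1 by blast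
  have hB: "hole (pieceB t s) d1 d0" using hp(2)[OF d1(1) d0(1)] d0 d1 by blast
  have hC: "hole (pieceC t s) c0 c1" using hp(3)[OF c0(1) c1(1)] c0 c1 by blast
  have hD: "hole (pieceC t s) d0 d1" using hp(4)[OF d0(1) d1(1)] d0 d1 by blast
  have "X = pieceA t \<and> Y = pieceC t s \<or> X = pieceC t s \<and> Y = pieceA t \<or>
      X = pieceB t s \<and> Y = pieceC t s \<or> X = pieceC t s \<and> Y = pieceB t s"
    using X x meet_AB[of x] unfolding PSet_def by auto
  then show ?thesis
  proof (elim disjE conjE)
    assume 1: "X = pieceA t" "Y = pieceC t s"
    have "kap t x = kap t c0 \<or> kap t x = kap t c1" using meet_AC[of x] x[unfolded 1] c0(2) c1(2) by (smt (z3))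
    then have "x = c0 \<or> x = c1" using eq c0(1) c1(1) by blast
    then show ?thesis using hA A 1 by blast
  next
    assume 2: "X = pieceC t s" "Y = pieceA t"
    have "kap t x = kap t c0 \<or> kap t x = kap t c1" using meet_AC[of x] x[unfolded 2] c0(2) c1(2) by (smt (z3))
    then have "x = c0 \<or> x = c1" using eq c0(1) c1(1) by blast
    then show ?thesis using hC A' 2 by blast
  next
    assume 3: "X = pieceB t s" "Y = pieceC t s"
    have "kap t x = kap t d0 \<or> kap t x = kap t d1" using meet_BC[of x] x[unfolded 3] d0(2) d1(2) by (smt (z3))
    then have "x = d0 \<or> x = d1" using eq d0(1) d1(1) by blast
    then show ?thesis using hB B 3 by blast
  next
    assume 4: "X = pieceC t s" "Y = pieceB t s"
    have "kap t x = kap t d0 \<or> kap t x = kap t d1" using meet_BC[of x] x[unfolded 4] d0(2) d1(2) by (smt (z3))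
    then have "x = d0 \<or> x = d1" using eq d0(1) d1(1) by blast
    then show ?thesis using hD B' 4 by blast
  qed
qed

lemma crit_tips:
  "tips (simple_critical_leaf h t) = {x\<in>{0..<1}. kap t x = 0 \<or> 3 * kap t x = 1}"
  "tips (simple_critical_leaf h s) = {x\<in>{0..<1}. kap t x = s - t \<or> 3 * kap t x = 3 * (s - t) + 1}"
proof -
  note tau = tau[OF ad]
  have e: "{frac (t + a), frac (t + b)} = {x\<in>{0..<1}. kap t x = a \<or> kap t x = b}" if "0 \<le> a" "a < 1" "0 \<le> b" "b < 1" for a b
  proof -
    have 1: "kap t (frac (t + a)) = a" "kap t (frac (t + b)) = b" using kap_eqI[OF refl] that by auto
    have 2: "frac (t + a) \<in> {0..<1}" "frac (t + b) \<in> {0..<1}" by (simp_all add: frac_lt_1)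
    show ?thesis
    proof (intro subset_antisym subsetI)
      fix x assume "x \<in> {x\<in>{0..<1}. kap t x = a \<or> kap t x = b}"
      then show "x \<in> {frac (t + a), frac (t + b)}" using 1 kap_inj[OF _ 2(1), of x t] kap_inj[OF _ 2(2), of x t] by auto
    qed (use 1 2 in auto)
  qed
  have eq: "3 * x = 1 \<longleftrightarrow> x = 1/3" "3 * x = 3 * (s - t) + 1 \<longleftrightarrow> x = s - t + 1/3" for x by auto
  have st: "t + (s - t) = s" "t + (s - t + 1/3) = s + 1/3" by auto
  show "tips (simple_critical_leaf h t) = {x\<in>{0..<1}. kap t x = 0 \<or> 3 * kap t x = 1}"
    "tips (simple_critical_leaf h s) = {x\<in>{0..<1}. kap t x = s - t \<or> 3 * kap t x = 3 * (s - t) + 1}"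
    using e[of 0 "1/3"] e[of "s - t" "s - t + 1/3"] tau unfolding simple_critical_leaf_def eq st leaf.sel by simp_all
qed

lemma crit_tips_obtain:
  obtains c0 c1 d0 d1 where "c0 \<in> {0..<1}" "c1 \<in> {0..<1}" "d0 \<in> {0..<1}" "d1 \<in> {0..<1}"
    "kap t c0 = 0" "3 * kap t c1 = 1" "kap t d0 = s - t" "3 * kap t d1 = 3 * (s - t) + 1"
    "\<And>h. tips (simple_critical_leaf h t) = {c0, c1}" "\<And>h. tips (simple_critical_leaf h s) = {d0, d1}"
proof -
  note tau = tau[OF ad]
  obtain c0 where c0: "c0 \<in> {0..<1}" "kap t c0 = 0" using kap_point[of 0] by auto
  obtain c1 where c1: "c1 \<in> {0..<1}" "3 * kap t c1 = 1" using kap_point[of "1/3"] by auto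
  obtain d0 where d0: "d0 \<in> {0..<1}" "kap t d0 = s - t" using kap_point[of "s - t"] tau by auto
  obtain d1 where d1: "d1 \<in> {0..<1}" "3 * kap t d1 = 3 * (s - t) + 1" using kap_point[of "s - t + 1/3"] tau by auto
  have "x = y" if "x \<in> {0..<1}" "y \<in> {0..<1}" "kap t x = kap t y" for x y using kap_inj[OF that(1,2), of t] that(3) by simp
  then have u: "x \<in> {0..<1} \<and> (kap t x = kap t a \<or> kap t x = kap t b) \<longleftrightarrow> x = a \<or> x = b"
    if "a \<in> {0..<1}" "b \<in> {0..<1}" for x a b using that by blast
  have e1: "kap t x = 0 \<longleftrightarrow> kap t x = kap t c0" "3 * kap t x = 1 \<longleftrightarrow> kap t x = kap t c1"
    "kap t x = s - t \<longleftrightarrow> kap t x = kap t d0" "3 * kap t x = 3 * (s - t) + 1 \<longleftrightarrow> kap t x = kap t d1" for x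
    using c0(2) c1(2) d0(2) d1(2) by auto
  have "tips (simple_critical_leaf h t) = {c0, c1}" for h
    unfolding crit_tips(1) set_eq_iff mem_Collect_eq e1(1,2) using u[OF c0(1) c1(1)] by simp
  moreover have "tips (simple_critical_leaf h s) = {d0, d1}" for h
    unfolding crit_tips(2) set_eq_iff mem_Collect_eq e1(3,4) using u[OF d0(1) d1(1)] by simp
  ultimately show thesis using that[OF c0(1) c1(1) d0(1) d1(1) c0(2) c1(2) d0(2) d1(2)] by blast
qed

text \<open>A leaf that does not cross a critical leaf lies on one side of it. The inner side of the
  first or second critical leaf gives \<open>pieceA\<close> or \<open>pieceB\<close>, and the outer
  side of both gives \<open>pieceC\<close>.\<close>

lemma PSet_in_piece:
  assumes P: "extended_leaf P"
    and nc: "\<And>C. C \<in> KSet \<epsilon> t s \<Longrightarrow> tips C \<noteq> tips P \<and> \<not> crossing (tips C) (tips P)"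
  shows "\<exists>X\<in>PSet t s. tips P \<subseteq> X"
proof -
  note tau = tau[OF ad]
  obtain c0 c1 d0 d1 where c: "c0 \<in> {0..<1}" "c1 \<in> {0..<1}" "d0 \<in> {0..<1}" "d1 \<in> {0..<1}"
    and k: "kap t c0 = 0" "3 * kap t c1 = 1" "kap t d0 = s - t" "3 * kap t d1 = 3 * (s - t) + 1"
    and T: "\<And>h. tips (simple_critical_leaf h t) = {c0, c1}" "\<And>h. tips (simple_critical_leaf h s) = {d0, d1}"
    using crit_tips_obtain by blast
  have ne: "c0 \<noteq> c1" "d0 \<noteq> d1" using k by auto
  note pe = extended_leafD[OF P]
  have pn: "tips P \<noteq> {}" using pe by auto
  have "\<exists>p q. edge {c0, c1} p q \<and> (\<forall>z\<in>tips P. carc p q z)"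
    by (rule edge_of_not_crossing) (use nc[of "simple_critical_leaf 1 t"] T c ne pe pn in \<open>auto simp: KSet_def\<close>)
  then have 1: "(\<forall>z\<in>tips P. carc c0 c1 z) \<or> (\<forall>z\<in>tips P. carc c1 c0 z)" unfolding edge_def by blast
  have "\<exists>p q. edge {d0, d1} p q \<and> (\<forall>z\<in>tips P. carc p q z)"
    by (rule edge_of_not_crossing) (use nc[of "simple_critical_leaf (1 - \<epsilon>) s"] T c ne pe pn in \<open>auto simp: KSet_def\<close>)
  then have 2: "(\<forall>z\<in>tips P. carc d0 d1 z) \<or> (\<forall>z\<in>tips P. carc d1 d0 z)" unfolding edge_def by blast
  have u: "z \<in> {0..<1}" "0 \<le> kap t z" "kap t z < 1" if "z \<in> tips P" for z using pe(2) that kap_unit[of t z] by auto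
  have a: "z \<in> pieceA t" if z: "carc c0 c1 z" "z \<in> tips P" for z
  proof -
    have "inA (kap t z)"
      using z(1) u[OF z(2)] k unfolding carc_kap[OF c(1,2) u(1)[OF z(2)], of t] btw_def inA_def by (smt (z3))
    then show ?thesis using u[OF z(2)] unfolding pieceA_def by blast
  qed
  have b: "z \<in> pieceB t s" if z: "carc d0 d1 z" "z \<in> tips P" for z
  proof -
    have "inB (s - t) (kap t z)"
      using z(1) u[OF z(2)] k tau unfolding carc_kap[OF c(3,4) u(1)[OF z(2)], of t] btw_def inB_def by (smt (z3))
    then show ?thesis using u[OF z(2)] unfolding pieceB_def by blast
  qed
  have cc: "z \<in> pieceC t s" if z: "carc c1 c0 z" "carc d1 d0 z" "z \<in> tips P" for z
  proof -
    have "inC (s - t) (kap t z)"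
      using z(1,2) u[OF z(3)] k tau unfolding carc_kap[OF c(2,1) u(1)[OF z(3)], of t] carc_kap[OF c(4,3) u(1)[OF z(3)], of t]
        btw_def inC_def by (smt (z3))
    then show ?thesis using u[OF z(3)] unfolding pieceC_def by blast
  qed
  have "(\<forall>z\<in>tips P. z \<in> pieceA t) \<or> (\<forall>z\<in>tips P. z \<in> pieceB t s) \<or> (\<forall>z\<in>tips P. z \<in> pieceC t s)"
    using 1 2 a b cc by blast
  then show ?thesis unfolding PSet_def by blast
qed

text \<open>The upper bound on \<epsilon> enters as \<open>1 / 3 < 1 - \<epsilon>\<close>, the
  instance of \<open>hmax / 3 < hmin\<close> for critical leaves of heights \<open>1\<close> and
  \<open>1 - \<epsilon>\<close>.\<close>

lemma dynamics_holds:
  assumes eps: "0 < \<epsilon>" "\<epsilon> < 2/3"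
  shows "dynamics (PSet t s) (KSet \<epsilon> t s) (1 - \<epsilon>) 1"
proof -
  note tau = tau[OF ad]
  obtain c0 c1 d0 d1 where c: "c0 \<in> {0..<1}" "c1 \<in> {0..<1}" "d0 \<in> {0..<1}" "d1 \<in> {0..<1}"
    and k: "kap t c0 = 0" "3 * kap t c1 = 1" "kap t d0 = s - t" "3 * kap t d1 = 3 * (s - t) + 1"
    and T: "\<And>h. tips (simple_critical_leaf h t) = {c0, c1}" "\<And>h. tips (simple_critical_leaf h s) = {d0, d1}"
    using crit_tips_obtain by blast
  have ne: "c0 \<noteq> c1" "d0 \<noteq> d1" "c0 \<noteq> d0" "c0 \<noteq> d1" "c1 \<noteq> d0" "c1 \<noteq> d1" using k tau by auto
  have Hh: "height (simple_critical_leaf h x) = h" for h x unfolding simple_critical_leaf_def by simp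
  note hp = hole_pieces[OF ad]
  have hA: "hole (pieceA t) c1 c0" using hp(1)[OF c(2,1)] k by blast
  have hB: "hole (pieceB t s) d1 d0" using hp(2)[OF c(4,3)] k by blast
  have hC: "hole (pieceC t s) c0 c1" using hp(3)[OF c(1,2)] k by blast
  have hD: "hole (pieceC t s) d0 d1" using hp(4)[OF c(3,4)] k by blast
  have H1: "\<exists>C\<in>KSet \<epsilon> t s. tips C = {x, y}" if X: "X \<in> PSet t s" and h: "hole X x y" for X x y
  proof -
    have xy: "x \<in> X" "y \<in> X" "x \<noteq> y" "trip x = trip y" using holeD[OF h] by auto
    have u: "x \<in> {0..<1}" "y \<in> {0..<1}" using xy PSet_sub[OF ad X] by blast+
    have i: "z = c0 \<longleftrightarrow> kap t z = 0" "z = c1 \<longleftrightarrow> 3 * kap t z = 1" "z = d0 \<longleftrightarrow> kap t z = s - t"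
      "z = d1 \<longleftrightarrow> 3 * kap t z = 3 * (s - t) + 1" if "z \<in> {0..<1}" for z
      using kap_inj[OF that c(1), of t] kap_inj[OF that c(2), of t] kap_inj[OF that c(3), of t] kap_inj[OF that c(4), of t] k by auto
    have "{x, y} = {c0, c1} \<or> {x, y} = {d0, d1}"
      by (rule double_cases[OF ad X xy]) (use i[OF u(1)] i[OF u(2)] in blast)+
    then show ?thesis unfolding KSet_def using T by auto
  qed
  have H2: "\<exists>X\<in>PSet t s. \<exists>Y\<in>PSet t s. \<exists>x y. X \<noteq> Y \<and> tips C = {x, y} \<and> hole X x y \<and> hole Y y x"
    if C: "C \<in> KSet \<epsilon> t s" for C
  proof (cases "C = simple_critical_leaf 1 t")
    case True
    then show ?thesis using T hA hC pieces_disj[OF ad] unfolding PSet_def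
      by (intro bexI[of _ "pieceC t s"] bexI[of _ "pieceA t"] exI[of _ c0] exI[of _ c1]) auto
  next
    case False
    then have "C = simple_critical_leaf (1 - \<epsilon>) s" using C unfolding KSet_def by auto
    then show ?thesis using T hB hD pieces_disj[OF ad] unfolding PSet_def
      by (intro bexI[of _ "pieceC t s"] bexI[of _ "pieceB t s"] exI[of _ d0] exI[of _ d1]) auto
  qed
  have nc: "\<not> crossing {c0, c1} {d0, d1}"
    using crossing_mono[of "{c0, c1}" "{d0, d1}" "pieceA t" "pieceB t s"] no_cross_AB holeD(1,2)[OF hA] holeD(1,2)[OF hB] by blast
  have H3: "C = simple_critical_leaf 1 t \<and> C' = simple_critical_leaf (1 - \<epsilon>) s \<or>
      C' = simple_critical_leaf 1 t \<and> C = simple_critical_leaf (1 - \<epsilon>) s"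
    if "C \<in> KSet \<epsilon> t s" "C' \<in> KSet \<epsilon> t s" "C \<noteq> C'" for C C' using that unfolding KSet_def by auto
  have H4: "tips C \<inter> tips C' = {}" if "C \<in> KSet \<epsilon> t s" "C' \<in> KSet \<epsilon> t s" "C \<noteq> C'" for C C'
    using H3[OF that] T ne by auto
  have H5: "\<not> crossing (tips C) (tips C')" if "C \<in> KSet \<epsilon> t s" "C' \<in> KSet \<epsilon> t s" "C \<noteq> C'" for C C'
    using H3[OF that] T nc crossing_sym by auto
  have H6: "extended_leaf C" if "C \<in> KSet \<epsilon> t s" for C
    using that c ne T eps unfolding KSet_def extended_leaf_def by (auto simp: Hh)
  have H7: "1 - \<epsilon> \<le> height C \<and> height C \<le> 1" if "C \<in> KSet \<epsilon> t s" for C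
    using that eps unfolding KSet_def by (auto simp: Hh)
  have H8: "inj_on tips (KSet \<epsilon> t s)" unfolding KSet_def inj_on_def using T ne by auto
  have c3: "card (PSet t s) = 3" unfolding PSet_def using pieces_disj[OF ad] by auto
  have fin: "finite (PSet t s)" "finite (KSet \<epsilon> t s)" unfolding PSet_def KSet_def by simp_all
  have e: "0 < 1 - \<epsilon>" "1 / 3 < 1 - \<epsilon>" using eps by auto
  have P: "pieces (PSet t s) (KSet \<epsilon> t s)"
    by (rule pieces.intro) (fact fin PSet_sub[OF ad] PSet_onto PSet_hol[OF ad] PSet_ord[OF ad] PSet_two[OF ad]
      PSet_nox PSet_meet PSet_side H1 H2 H4 H5 H6)+
  show ?thesis
    by (rule dynamics.intro[OF P dynamics_axioms.intro]) (fact e H7 H8 c3 PSet_in_piece)+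
qed

end

context dynamics
begin

lemma dyn_induct [consumes 1, case_names K pull]:
  assumes "l \<in> dyn" "\<And>C. C \<in> K \<Longrightarrow> P C" "\<And>X Q. X \<in> PS \<Longrightarrow> Q \<in> dyn \<Longrightarrow> P Q \<Longrightarrow> P (pull dyn X Q)"
  shows "P l"
proof -
  obtain n where "l \<in> gen n" using assms(1) unfolding dyn_def by blast
  then show ?thesis
  proof (induction n arbitrary: l)
    case 0
    then show ?case using assms(2) gen_0 by blast
  next
    case (Suc n)
    then have "l \<in> next_gen (gen n)" by (simp add: gen_Suc)
    then show ?case
    proof (cases rule: next_genE)
      case (2 X Q)
      have "Q \<in> dyn" using 2(2) unfolding dyn_def by blast
      then show ?thesis using assms(3)[OF 2(1)] Suc.IH[OF 2(2)] pull_gen[OF 2(2)] 2(3) by simp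
    qed (use assms(2) in blast)
  qed
qed

end

section \<open>Levels and critical values\<close>

definition crit :: "real \<Rightarrow> real set" where "crit t = {frac t, frac (t + 1/3)}"

lemma crit_unit: "crit t \<subseteq> {0..<1}"
  unfolding crit_def by (auto simp: frac_lt_1)

lemma trip_frac: "trip (frac x) = frac (3 * x)"
  unfolding trip_def using frac_mult_frac[of 3 x] by simp

lemma trip_crit: "x \<in> crit t \<Longrightarrow> trip x = frac (3 * t)"
  using frac_add_of_int_right[of "3 * t" 1] unfolding crit_def by (auto simp: trip_frac algebra_simps)

lemma trip_pow_frac: "(trip ^^ n) (frac x) = frac (3 ^ n * x)"
  by (induction n) (simp_all add: trip_frac mult.assoc)

lemma one_third_pow_less: "(1::real) / 3 ^ k < 1 / 3 ^ i \<longleftrightarrow> i < k"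
  by (simp add: field_simps)

lemma frac_crit_ne: "frac t \<noteq> frac (t + 1/3)" for t :: real
proof
  assume "frac t = frac (t + 1/3)"
  then have "1/3 = real_of_int (\<lfloor>t + 1/3\<rfloor> - \<lfloor>t\<rfloor>)" unfolding frac_def by simp
  then obtain n :: int where "1/3 = real_of_int n" by blast
  then have "real_of_int (3 * n) = 1" by simp
  then have "3 * n = 1" by linarith
  then show False by presburger
qed

text \<open>\<open>m\<close> is the level of \<open>x\<close>. Only the first visit of a critical
  value to \<open>C1\<close> yields a collision; at later visits the leaf concerned is shielded by a
  taller leaf with the same tip.\<close>

definition exact :: "real \<Rightarrow> nat \<Rightarrow> real \<Rightarrow> bool" where
  "exact t m x \<longleftrightarrow> x \<in> {0..<1} \<and> (trip ^^ m) x \<in> crit t \<and> (\<forall>i<m. (trip ^^ i) x \<notin> crit t)"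

text \<open>The inverse of \<open>s \<mapsto> 3s\<close>: the position of \<open>C\<^sub>2\<close> for the critical value \<open>v\<close>.\<close>

definition crit_pos :: "real \<Rightarrow> real \<Rightarrow> real" where
  "crit_pos t v = t + (1 + kap (3 * t) v) / 3"

lemma crit_pos_adm:
  assumes "v \<in> {0..<1}" "v \<noteq> frac (3 * t)"
  shows "admissible t (crit_pos t v)"
proof -
  have "kap (3 * t) v \<noteq> kap (3 * t) (frac (3 * t))"
    using kap_inj[of v "frac (3 * t)" "3 * t"] assms by (simp add: frac_lt_1)
  moreover have "kap (3 * t) (frac (3 * t)) = 0" unfolding kap_def frac_frac_diff by simp
  ultimately have "0 < kap (3 * t) v" "kap (3 * t) v < 1" using kap_unit[of "3 * t" v] by auto
  then show ?thesis unfolding admissible_def crit_pos_def by (simp add: field_simps)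
qed

lemma frac_crit_pos: "v \<in> {0..<1} \<Longrightarrow> frac (3 * crit_pos t v) = v"
proof -
  assume v: "v \<in> {0..<1}"
  have "3 * crit_pos t v = (3 * t + 1) + kap (3 * t) v" unfolding crit_pos_def by simp
  also have "\<dots> = v + of_int (1 - \<lfloor>v - 3 * t\<rfloor>)" unfolding kap_def frac_def by simp
  finally have "frac (3 * crit_pos t v) = frac v" using frac_add_of_int_right by metis
  then show ?thesis using v by (simp add: frac_eq)
qed

lemma crit_pos_unique:
  assumes "admissible t s"
  shows "crit_pos t (frac (3 * s)) = s" "frac (3 * s) \<noteq> frac (3 * t)"
proof -
  have "frac (3 * s - 3 * t) = frac (3 * s - 3 * t - 1)" using frac_add_of_int_right[of "3 * s - 3 * t" "-1"] by simp
  also have "\<dots> = 3 * s - 3 * t - 1" using assms unfolding admissible_def by (simp add: frac_eq)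
  finally have k: "kap (3 * t) (frac (3 * s)) = 3 * s - 3 * t - 1" unfolding kap_def frac_frac_diff .
  then show "crit_pos t (frac (3 * s)) = s" unfolding crit_pos_def by (simp add: field_simps)
  show "frac (3 * s) \<noteq> frac (3 * t)"
  proof
    assume "frac (3 * s) = frac (3 * t)"
    moreover have "kap (3 * t) (frac (3 * t)) = 0" unfolding kap_def frac_frac_diff by simp
    ultimately have "kap (3 * t) (frac (3 * s)) = 0" by simp
    then show False using k assms unfolding admissible_def by linarith
  qed
qed

text \<open>From time 1 on both ends have the same orbit. If both were hit, \<open>frac t\<close>
  would return to itself after \<open>i\<close> steps and reach the other end after \<open>j\<close>
  steps. As iterates commute, the other end would also return after \<open>i\<close> steps, although
  its orbit is then at \<open>frac t\<close>.\<close>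

lemma star_exists: "\<exists>a\<in>crit t. \<forall>x\<in>crit t. \<forall>j\<ge>1. (trip ^^ j) x \<noteq> a"
proof (rule ccontr)
  assume n: "\<not> ?thesis"
  let ?a = "frac t" and ?b = "frac (t + 1/3)"
  have ab: "?a \<in> crit t" "?b \<in> crit t" unfolding crit_def by auto
  have eq: "(trip ^^ j) x = (trip ^^ j) ?a" if jx: "j \<ge> 1" "x \<in> crit t" for j x
  proof -
    obtain i where "j = Suc i" using jx(1) by (cases j) auto
    then show ?thesis using trip_crit[OF jx(2)] trip_crit[OF ab(1)] by (simp add: funpow_Suc_right del: funpow.simps)
  qed
  obtain i where i: "i \<ge> 1" "(trip ^^ i) ?a = ?a" using n ab eq by metis
  obtain j where j: "j \<ge> 1" "(trip ^^ j) ?a = ?b" using n ab eq by metis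
  have "(trip ^^ i) ?b = (trip ^^ j) ((trip ^^ i) ?a)" unfolding j(2)[symmetric]
    by (metis add.commute comp_apply funpow_add)
  then have "(trip ^^ i) ?b = ?b" using i j by simp
  then show False using eq[OF i(1) ab(2)] i(2) frac_crit_ne by metis
qed

text \<open>
  Every leaf of \<open>\<Lambda>\<^sub>T(t)\<close> has exactly one tip above this end of \<open>C\<^sub>1\<close>, and all edges that do not end
  at this tip are saturated: the other tips are the alternative positions of one and the same tip.
\<close>

definition star :: "real \<Rightarrow> real" where
  "star t = (SOME a. a \<in> crit t \<and> (\<forall>x\<in>crit t. \<forall>j\<ge>1. (trip ^^ j) x \<noteq> a))"

lemma star: "star t \<in> crit t" "x \<in> crit t \<Longrightarrow> j \<ge> 1 \<Longrightarrow> (trip ^^ j) x \<noteq> star t"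
  using someI_ex[of "\<lambda>a. a \<in> crit t \<and> (\<forall>x\<in>crit t. \<forall>j\<ge>1. (trip ^^ j) x \<noteq> a)"] star_exists[of t]
  unfolding star_def by blast+

text \<open>From an earlier visit to an end of \<open>C1\<close> the orbit would go on to
  \<open>star t\<close>, which the choice of \<open>star t\<close> excludes.\<close>

lemma exact_star:
  assumes "x \<in> {0..<1}" "(trip ^^ k) x = star t"
  shows "exact t k x"
proof -
  have "(trip ^^ i) x \<notin> crit t" if "i < k" for i
  proof
    assume "(trip ^^ i) x \<in> crit t"
    moreover have "(trip ^^ (k - i)) ((trip ^^ i) x) = star t"
      using assms(2) that by (metis comp_apply funpow_add le_add_diff_inverse2 less_imp_le)
    ultimately show False using star(2) that by (metis Suc_leI One_nat_def zero_less_diff)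
  qed
  then show ?thesis unfolding exact_def using assms star(1) by auto
qed

lemma exact_ex:
  assumes "x \<in> {0..<1}" "(trip ^^ k) x \<in> crit t"
  shows "\<exists>m\<le>k. exact t m x"
proof -
  let ?m = "LEAST m. (trip ^^ m) x \<in> crit t"
  have "(trip ^^ ?m) x \<in> crit t" using assms(2) by (rule LeastI)
  moreover have "(trip ^^ i) x \<notin> crit t" if "i < ?m" for i using not_less_Least[OF that] .
  moreover have "?m \<le> k" using assms(2) by (rule Least_le)
  ultimately show ?thesis unfolding exact_def using assms(1) by blast
qed

lemma exact_trip: "exact t (Suc m) x \<Longrightarrow> exact t m (trip x)"
  unfolding exact_def using trip_unit by (auto simp: funpow_Suc_right simp del: funpow.simps)

locale eps_small =
  fixes \<epsilon> :: real
  assumes eps: "0 < \<epsilon>" "\<epsilon> < 2/3"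
begin

definition LL :: "real \<Rightarrow> real \<Rightarrow> leaf set" where
  "LL t v = dynamics.dyn (PSet t (crit_pos t v)) (KSet \<epsilon> t (crit_pos t v))"

end

text \<open>\<open>vc\<close> keeps \<open>C2\<close> away from the limits \<open>t + 1/3\<close>
  and \<open>t + 2/3\<close> of its range, where the critical leaves share an end. The level
  \<open>m\<close> of \<open>v\<close> is a depth down to which no taller lift of \<open>C2\<close>
  touches a lift of \<open>C1\<close>.\<close>

locale param = eps_small +
  fixes t v :: real and m :: nat
  assumes v: "exact t m v" and vc: "v \<noteq> frac (3 * t)"
begin

abbreviation "s \<equiv> crit_pos t v"
abbreviation "PS \<equiv> PSet t s"
abbreviation "K \<equiv> KSet \<epsilon> t s"

lemma v_unit: "v \<in> {0..<1}" using v unfolding exact_def by blast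

lemma ad: "admissible t s" using crit_pos_adm[OF v_unit vc] .

sublocale dynamics PS K "1 - \<epsilon>" 1
  using dynamics_holds[OF ad eps] .

lemma LL_eq: "LL t v = dyn" unfolding LL_def ..

abbreviation "C1 \<equiv> simple_critical_leaf 1 t"
abbreviation "C2 \<equiv> simple_critical_leaf (1 - \<epsilon>) s"

lemma K_eq: "K = {C1, C2}" unfolding KSet_def ..

lemma tips_C: "tips C1 = crit t" "tips C2 = crit s" "height C1 = 1" "height C2 = 1 - \<epsilon>"
  unfolding simple_critical_leaf_def crit_def by auto

lemma trip_crit_s: "x \<in> crit s \<Longrightarrow> trip x = v"
  using trip_crit frac_crit_pos[OF v_unit] by metis

text \<open>\<open>1 - \<epsilon>\<close> lies strictly between 1/3 and 1, hence is not a power of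
  3. The height of a leaf therefore tells lifts of \<open>C1\<close> from lifts of
  \<open>C2\<close>.\<close>

lemma height_incomm: "1 / 3 ^ k \<noteq> (1 - \<epsilon>) / 3 ^ j"
proof
  assume e: "1 / 3 ^ k = (1 - \<epsilon>) / 3 ^ j"
  show False
  proof (cases "k \<le> j")
    case True
    then have "(3::real) ^ j = 3 ^ k * 3 ^ (j - k)" by (simp flip: power_add)
    then have "3 ^ (j - k) = 1 - \<epsilon>" using e by (simp add: field_simps)
    moreover have "(1::real) \<le> 3 ^ (j - k)" by (rule one_le_power) simp
    ultimately show False using eps by linarith
  next
    case False
    then have "(3::real) ^ k = 3 ^ j * 3 ^ (k - j)" by (simp flip: power_add)
    then have a: "(1 - \<epsilon>) * 3 ^ (k - j) = 1" using e by (simp add: field_simps)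
    have "(3::real) ^ 1 \<le> 3 ^ (k - j)" using False by (intro power_increasing) auto
    then have "(1 - \<epsilon>) * 3 \<le> (1 - \<epsilon>) * 3 ^ (k - j)" using eps by (intro mult_left_mono) auto
    then have "(1 - \<epsilon>) * 3 \<le> 1" unfolding a .
    then show False using eps by simp
  qed
qed

lemma height_compare: "(1 - \<epsilon>) / 3 ^ j > 1 / 3 ^ k \<Longrightarrow> j < k"
proof (rule ccontr)
  assume a: "(1 - \<epsilon>) / 3 ^ j > 1 / 3 ^ k" "\<not> j < k"
  have "(1 - \<epsilon>) / 3 ^ j \<le> 1 / 3 ^ j" using eps by (intro divide_right_mono) auto
  also have "\<dots> \<le> 1 / 3 ^ k" using a(2) by (intro divide_left_mono power_increasing) auto
  finally show False using a(1) by simp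
qed

lemma kinds:
  assumes "l \<in> dyn"
  obtains k where "height l = 1 / 3 ^ k" "(trip ^^ k) ` tips l = crit t"
    | k where "height l = (1 - \<epsilon>) / 3 ^ k" "(trip ^^ k) ` tips l = crit s"
proof -
  have "(\<exists>k. height l = 1 / 3 ^ k \<and> (trip ^^ k) ` tips l = crit t) \<or>
        (\<exists>k. height l = (1 - \<epsilon>) / 3 ^ k \<and> (trip ^^ k) ` tips l = crit s)"
    using assms
  proof (induction rule: dyn_induct)
    case (K C)
    then show ?case unfolding K_eq using tips_C by (metis div_by_1 funpow_0 image_ident image_cong insertE power_0 singletonD)
  next
    case (pull X Q)
    have "(trip ^^ Suc k) ` tips (pull dyn X Q) = (trip ^^ k) ` tips Q" for k
      using D.trip_pull[OF pull(1,2)] by (metis funpow_Suc_right image_comp)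
    moreover have "h / 3 ^ Suc k = h / 3 ^ k / 3" for h :: real and k by simp
    ultimately show ?case using pull(3) unfolding height_pull by metis
  qed
  then show thesis using that by blast
qed

lemma level_tips:
  assumes "l \<in> dyn" "height l = 1 / 3 ^ k"
  shows "(trip ^^ k) ` tips l = crit t"
  using assms(1)
proof (cases rule: kinds)
  case (1 j)
  then have "(3::real) ^ k = 3 ^ j" using assms(2) by simp
  then have "k = j" using power_inject_exp[of "3::real" k j] by simp
  then show ?thesis using 1 by simp
qed (use height_incomm assms(2) in metis)

text \<open>After an end of \<open>C2\<close> the orbit continues from \<open>v\<close>, which needs
  \<open>m\<close> further steps to reach \<open>C1\<close>; this postpones the visit beyond time
  \<open>m\<close>.\<close>

lemma not_hit_s:
  assumes "(trip ^^ k) x \<in> crit t" "(trip ^^ j) x \<in> crit s" "j < k" "k \<le> m"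
  shows False
proof -
  have 1: "(trip ^^ Suc j) x = v" using trip_crit_s[OF assms(2)] by simp
  have "k = (k - Suc j) + Suc j" using assms(3) by simp
  then have "(trip ^^ (k - Suc j)) ((trip ^^ Suc j) x) = (trip ^^ k) x" by (metis comp_apply funpow_add)
  then have "(trip ^^ (k - Suc j)) v \<in> crit t" using 1 assms(1) by simp
  moreover have "k - Suc j < m" using assms(3,4) by simp
  ultimately show False using v unfolding exact_def by blast
qed

text \<open>A tip shared with a taller lift of \<open>C2\<close> would visit \<open>C2\<close> and
  later \<open>C1\<close>, contrary to \<open>not_hit_s\<close>. So saturation down to level
  \<open>m\<close> is decided among lifts of \<open>C1\<close>, which makes it comparable for
  different positions of \<open>C2\<close>.\<close>

lemma touch_level:
  assumes "l \<in> dyn" "height l = 1 / 3 ^ k" "k \<le> m" "n \<in> dyn" "height n > height l" "p \<in> tips l" "p \<in> tips n"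
  shows "\<exists>i<k. height n = 1 / 3 ^ i"
  using assms(4)
proof (cases rule: kinds)
  case (1 i)
  then show ?thesis using assms(2,5) one_third_pow_less by metis
next
  case (2 j)
  have "j < k" using height_compare assms(2,5) 2(1) by metis
  moreover have "(trip ^^ k) p \<in> crit t" using level_tips[OF assms(1,2)] assms(6) by blast
  moreover have "(trip ^^ j) p \<in> crit s" using 2(2) assms(7) by blast
  ultimately show ?thesis using not_hit_s assms(3) by blast
qed

lemma exact_no_taller:
  assumes "exact t i z" "i \<le> m" "n \<in> dyn" "height n > 1 / 3 ^ i" "z \<in> tips n"
  shows False
  using assms(3)
proof (cases rule: kinds)
  case (1 j)
  then have "j < i" using assms(4) one_third_pow_less by metis
  moreover have "(trip ^^ j) z \<in> crit t" using 1 assms(5) by blast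
  ultimately show False using assms(1) unfolding exact_def by blast
next
  case (2 j)
  have "j < i" using height_compare assms(4) 2(1) by metis
  moreover have "(trip ^^ j) z \<in> crit s" using 2(2) assms(5) by blast
  moreover have "(trip ^^ i) z \<in> crit t" using assms(1) unfolding exact_def by blast
  ultimately show False using not_hit_s assms(2) by blast
qed

lemma exact_not_sat:
  assumes "exact t k x" "k \<le> m" "height l = 1 / 3 ^ k" "x = p \<or> x = q"
  shows "\<not> sat dyn l p q"
  using exact_no_taller[OF assms(1,2)] assms(3,4) unfolding sat_def by auto

lemma piece_cover: "z \<in> {0..<1} \<Longrightarrow> \<exists>X\<in>PS. z \<in> X"
proof -
  assume z: "z \<in> {0..<1}"
  have "inA (kap t z) \<or> inB (s - t) (kap t z) \<or> inC (s - t) (kap t z)"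
    using kap_unit[of t z] unfolding inA_def inB_def inC_def by auto
  then have "z \<in> pieceA t \<or> z \<in> pieceB t s \<or> z \<in> pieceC t s"
    unfolding pieceA_def pieceB_def pieceC_def using z by simp
  then show ?thesis unfolding PSet_def by blast
qed

lemma hole_crit: "X \<in> PS \<Longrightarrow> hole X x y \<Longrightarrow> {x, y} = crit t \<or> {x, y} = crit s"
  using hole_K[of X x y] unfolding K_eq using tips_C by auto

text \<open>\<open>pull\<close> omits points only at ends of holes, that is, on critical leaves.
  Before time \<open>i\<close> the orbit of \<open>z\<close> avoids \<open>C1\<close> by exactness
  and \<open>C2\<close> by \<open>not_hit_s\<close>, so its points survive every lift.\<close>

lemma exact_leaf_exists:
  assumes "exact t i z" "i \<le> m"
  shows "\<exists>l\<in>dyn. height l = 1 / 3 ^ i \<and> z \<in> tips l"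
  using assms
proof (induction i arbitrary: z)
  case 0
  then show ?case using K_dyn[of C1] tips_C unfolding K_eq exact_def by (intro bexI[of _ C1]) auto
next
  case (Suc i)
  obtain Q where Q: "Q \<in> dyn" "height Q = 1 / 3 ^ i" "trip z \<in> tips Q"
    using Suc.IH[OF exact_trip[OF Suc.prems(1)]] Suc.prems(2) by auto
  have z: "z \<in> {0..<1}" "(trip ^^ Suc i) z \<in> crit t" "z \<notin> crit t"
    using Suc.prems(1) unfolding exact_def by (auto dest: spec[of _ 0])
  have zs: "z \<notin> crit s" using not_hit_s[OF z(2), of 0] Suc.prems(2) by auto
  obtain X where X: "X \<in> PS" "z \<in> X" using piece_cover z(1) by blast
  have "z \<in> tips (pull dyn X Q)"
    using pull_memI[OF X(2) Q(3)] hole_crit[OF X(1)] z(3) zs by blast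
  then show ?case using pull_dyn[OF X(1) Q(1)] Q(2) by (intro bexI[of _ "pull dyn X Q"]) (auto simp: height_pull)
qed

lemma level_pull:
  assumes "l \<in> dyn" "height l = 1 / 3 ^ Suc k"
  obtains X Q where "X \<in> PS" "Q \<in> dyn" "l = pull dyn X Q" "height Q = 1 / 3 ^ k"
  using assms(1)
proof (cases rule: dynE)
  case 1
  then have "l = C1 \<or> l = C2" unfolding K_eq by blast
  moreover have "(1::real) / 3 ^ Suc k < 1 / 3 ^ 0" using one_third_pow_less by blast
  ultimately show ?thesis using assms(2) tips_C height_incomm[of "Suc k" 0] by auto
next
  case (2 X Q)
  then show ?thesis using that assms(2) by (simp add: height_pull)
qed

lemma level_0: "l \<in> dyn \<Longrightarrow> height l = 1 \<Longrightarrow> l = C1"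
proof -
  assume l: "l \<in> dyn" "height l = 1"
  from l(1) show "l = C1"
  proof (cases rule: dynE)
    case 1
    then show ?thesis using l(2) tips_C eps unfolding K_eq by auto
  next
    case (2 X Q)
    then show ?thesis using l(2) dyn_pos[OF 2(2)] by (simp add: height_pull)
  qed
qed

text \<open>The tip over \<open>star t\<close> lifts uniquely: a second lift would be its partner
  across a hole, but no end of \<open>C1\<close> leads to \<open>star t\<close>, and an end of
  \<open>C2\<close> maps to \<open>v\<close>, which has not yet reached \<open>C1\<close> at that
  time. An edge away from this tip either spans a hole and is saturated by a critical leaf, or lifts
  an edge saturated by induction.\<close>

lemma tips_structure:
  assumes "l \<in> dyn" "height l = 1 / 3 ^ k" "k \<le> m"
  shows "\<exists>x\<in>tips l. (trip ^^ k) x = star t \<and> (\<forall>w\<in>tips l. (trip ^^ k) w = star t \<longrightarrow> w = x) \<and>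
     (\<forall>p q. edge (tips l) p q \<longrightarrow> p \<noteq> x \<longrightarrow> q \<noteq> x \<longrightarrow> sat dyn l p q)"
  using assms
proof (induction k arbitrary: l)
  case 0
  then have l: "tips l = crit t" using level_0 tips_C by simp
  have "p = star t \<or> q = star t" if "edge (tips l) p q" for p q
    using edgeD(1-3)[OF that] star(1)[of t] unfolding l crit_def by auto
  then show ?case using star(1)[of t] l by (intro bexI[of _ "star t"]) auto
next
  case (Suc k)
  obtain X Q where X: "X \<in> PS" and Q: "Q \<in> dyn" "height Q = 1 / 3 ^ k" and l: "l = pull dyn X Q"
    using level_pull Suc.prems(1,2) by metis
  have "k \<le> m" using Suc.prems(3) by simp
  from Suc.IH[OF Q this] obtain y where y: "y \<in> tips Q" "(trip ^^ k) y = star t"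
    "\<forall>w\<in>tips Q. (trip ^^ k) w = star t \<longrightarrow> w = y"
    "\<forall>p q. edge (tips Q) p q \<longrightarrow> p \<noteq> y \<longrightarrow> q \<noteq> y \<longrightarrow> sat dyn Q p q"
    by (elim bexE conjE)
  have y_unit: "y \<in> {0..<1}" using y(1) extended_leafD(2)[OF elamD(1)[OF elam_dyn Q(1)]] by blast
  obtain x where x: "x \<in> tips l" "trip x = y" using D.pull_onto[OF X Q(1) y(1)] l by blast
  have xX: "x \<in> X" using x(1) l pull_tips(1) by blast
  have uniq: "w = x" if w: "w \<in> X" "trip w = y" for w
  proof (rule ccontr)
    assume "w \<noteq> x"
    then have "hole X w x \<or> hole X x w" using hol[OF X w(1) xX] w(2) x(2) by simp
    then have "x \<in> crit t \<or> x \<in> crit s" using hole_crit[OF X] by blast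
    then show False
    proof
      assume "x \<in> crit t"
      then have "(trip ^^ Suc k) x \<noteq> star t" using star(2)[of x t "Suc k"] by simp
      then show False using x(2) y(2) by (simp add: funpow_Suc_right del: funpow.simps)
    next
      assume "x \<in> crit s"
      then have "y = v" using trip_crit_s x(2) by metis
      then have "(trip ^^ k) v \<in> crit t" using y(2) star(1) by metis
      then show False using v Suc.prems(3) unfolding exact_def by auto
    qed
  qed
  have sx: "(trip ^^ Suc k) w = (trip ^^ k) (trip w)" for w by (simp add: funpow_Suc_right del: funpow.simps)
  show ?case
  proof (intro bexI[OF _ x(1)] conjI ballI allI impI)
    show "(trip ^^ Suc k) x = star t" using sx x(2) y(2) by simp
    show "w = x" if "w \<in> tips l" "(trip ^^ Suc k) w = star t" for w
      using uniq[of w] y(3) pull_tips[of w dyn X Q] that sx l by metis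
    fix p q assume e: "edge (tips l) p q" "p \<noteq> x" "q \<noteq> x"
    have e': "edge (tips (pull dyn X Q)) p q" using e(1) l by simp
    have pq: "p \<in> X" "q \<in> X" using edgeD(1,2)[OF e'] pull_tips(1) by blast+
    from D.pull_edge[OF X Q(1) e'] show "sat dyn l p q"
    proof
      assume "hole X p q"
      then obtain C where C: "C \<in> K" "tips C = {p, q}" using hole_K[OF X] by blast
      then have "height C > height l" using D.low[OF Q(1) C(1)] l by (simp add: height_pull)
      then show ?thesis unfolding sat_def using C K_dyn unfolding carc_def by (intro bexI[of _ C]) auto
    next
      assume h: "trip p \<noteq> trip q \<and> edge (tips Q) (trip p) (trip q)"
      have "trip p \<noteq> y" "trip q \<noteq> y" using uniq pq e(2,3) by blast+
      then have "sat dyn Q (trip p) (trip q)" using y(4) h by blast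
      then show ?thesis using D.sat_pull[OF X Q(1) e'] h l next_gen_dyn by simp
    qed
  qed
qed

end

section \<open>Dependence of the lifts on the critical value\<close>

lemma pull_eqI:
  assumes 1: "\<And>x. trip x \<in> tips Q \<Longrightarrow> x \<in> X \<longleftrightarrow> x \<in> Y"
    and 2: "\<And>x y. trip x \<in> tips Q \<Longrightarrow> hole X x y \<longleftrightarrow> hole Y x y"
    and 3: "\<And>p q. edge (tips Q) p q \<Longrightarrow> sat E Q p q \<longleftrightarrow> sat E' Q p q"
  shows "pull E X Q = pull E' Y Q"
proof -
  have h: "hole X y x \<longleftrightarrow> hole Y y x" if "trip x \<in> tips Q" for x y
    using 2[of y x] that holeD(4) by metis
  have "x \<in> tips (pull E X Q) \<longleftrightarrow> x \<in> tips (pull E' Y Q)" for x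
  proof (cases "trip x \<in> tips Q")
    case True
    have 3: "(edge (tips Q) p q \<longrightarrow> \<not> sat E Q p q) \<longleftrightarrow> (edge (tips Q) p q \<longrightarrow> \<not> sat E' Q p q)" for p q
      using 3 by blast
    show ?thesis unfolding pull_def leaf.sel mem_Collect_eq by (simp only: 1[OF True] 2[OF True] h[OF True] 3)
  qed (simp add: pull_def)
  then show ?thesis by (intro leaf.expand) (auto simp: pull_def)
qed

lemma hole_B:
  assumes "admissible t s" "hole (pieceB t s) x y"
  shows "trip x = frac (3 * s)"
proof -
  note h = holeD[OF assms(2)]
  have u: "x \<in> {0..<1}" "y \<in> {0..<1}" using h unfolding pieceB_def by auto
  have "pieceB t s \<in> PSet t s" unfolding PSet_def by blast
  then have "kap t x = s - t \<or> 3 * kap t x = 3 * (s - t) + 1"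
    by (rule double_cases[OF assms(1) _ h(1-4)]) (use pieces_disj[OF assms(1)] in auto)
  then have "x \<in> tips (simple_critical_leaf 1 s)" using crit_tips(2)[OF assms(1)] u by auto
  then have "x \<in> crit s" unfolding simple_critical_leaf_def crit_def by simp
  then show ?thesis using trip_crit by blast
qed

lemma hole_C:
  assumes "admissible t s" "x \<in> {0..<1}" "y \<in> {0..<1}" "trip x \<noteq> frac (3 * s)"
  shows "hole (pieceC t s) x y \<longleftrightarrow> kap t x = 0 \<and> 3 * kap t y = 1"
proof
  assume hh: "hole (pieceC t s) x y"
  note h = holeD[OF hh]
  have C: "pieceC t s \<in> PSet t s" unfolding PSet_def by blast
  have n: "\<not> (kap t x = s - t \<or> 3 * kap t x = 3 * (s - t) + 1)"
  proof
    assume "kap t x = s - t \<or> 3 * kap t x = 3 * (s - t) + 1"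
    then have "x \<in> tips (simple_critical_leaf 1 s)" using crit_tips(2)[OF assms(1)] assms(2) by auto
    then have "x \<in> crit s" unfolding simple_critical_leaf_def crit_def by simp
    then show False using trip_crit assms(4) by blast
  qed
  have "kap t x = 0 \<and> 3 * kap t y = 1 \<or> kap t y = 0 \<and> 3 * kap t x = 1"
    by (rule double_cases[OF assms(1) C h(1-4)]) (use n pieces_disj[OF assms(1)] in auto)
  moreover have "\<not> (kap t y = 0 \<and> 3 * kap t x = 1)"
  proof
    assume "kap t y = 0 \<and> 3 * kap t x = 1"
    then have r: "hole (pieceC t s) y x" using hole_pieces(3)[OF assms(1) assms(3,2)] by blast
    \<comment> \<open>The pieces do not involve \<epsilon>, so any admissible value such as 1/3
      gives access to \<open>hole_asym\<close>.\<close>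
    interpret dynamics "PSet t s" "KSet (1/3) t s" "1 - 1/3" 1 using dynamics_holds[OF assms(1), of "1/3"] by simp
    show False using hole_asym[OF C hh r] .
  qed
  ultimately show "kap t x = 0 \<and> 3 * kap t y = 1" by blast
qed (use hole_pieces(3)[OF assms(1-3)] in blast)

text \<open>\<open>K\<close> is the coordinate of the critical value. A point of the middle or last
  third changes between the second and the third piece exactly when its image passes
  \<open>K\<close>, so only the position of the image relative to the critical value
  matters.\<close>

lemma piece_mem:
  assumes K: "s - t = (1 + K) / 3" "0 < K" "K < 1" and x: "x \<in> {0..<1}" and ne: "kap (3 * t) (trip x) \<noteq> K"
  shows "x \<in> pieceB t s \<longleftrightarrow> (1 \<le> 3 * kap t x \<and> 3 * kap t x < 2 \<and> K < kap (3 * t) (trip x)) \<or> (2 \<le> 3 * kap t x \<and> kap (3 * t) (trip x) < K)"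
    "x \<in> pieceC t s \<longleftrightarrow> kap t x = 0 \<or> (1 \<le> 3 * kap t x \<and> 3 * kap t x < 2 \<and> kap (3 * t) (trip x) < K) \<or> (2 \<le> 3 * kap t x \<and> K < kap (3 * t) (trip x))"
proof -
  have k: "0 \<le> kap t x" "kap t x < 1" using kap_unit by simp_all
  define a where "a = kap t x"
  have tr: "kap (3 * t) (trip x) = trp a" unfolding a_def kap_trip ..
  have st: "3 * (s - t) = 1 + K" using K(1) by simp
  show "x \<in> pieceB t s \<longleftrightarrow> (1 \<le> 3 * kap t x \<and> 3 * kap t x < 2 \<and> K < kap (3 * t) (trip x)) \<or> (2 \<le> 3 * kap t x \<and> kap (3 * t) (trip x) < K)"
    unfolding pieceB_def mem_Collect_eq inB_def tr a_def[symmetric]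
    using x k[folded a_def] ne[unfolded tr] st K(2,3) trp_cases[of a] by (smt (z3))
  show "x \<in> pieceC t s \<longleftrightarrow> kap t x = 0 \<or> (1 \<le> 3 * kap t x \<and> 3 * kap t x < 2 \<and> kap (3 * t) (trip x) < K) \<or> (2 \<le> 3 * kap t x \<and> K < kap (3 * t) (trip x))"
    unfolding pieceC_def mem_Collect_eq inC_def tr a_def[symmetric]
    using x k[folded a_def] ne[unfolded tr] st K(2,3) trp_cases[of a] by (smt (z3))
qed

context eps_small
begin

text \<open>
  Moving the critical value from \<open>v\<close> to \<open>w\<close> exchanges the lifts of a leaf in the second and the
  third piece if the leaf lies between them, and does not affect these lifts otherwise.
\<close>

lemma LL_step:
  assumes P: "param \<epsilon> t v m" "param \<epsilon> t w m'" and k: "Suc k \<le> m" "Suc k \<le> m'"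
    and ag: "\<And>i l. i \<le> k \<Longrightarrow> height l = 1 / 3 ^ i \<Longrightarrow> l \<in> LL t v \<longleftrightarrow> l \<in> LL t w"
    and ns: "\<And>l. l \<in> LL t v \<Longrightarrow> height l = 1 / 3 ^ k \<Longrightarrow> \<not> crossing (tips l) {v, w}"
    and l: "l \<in> LL t v" "height l = 1 / 3 ^ Suc k"
  shows "l \<in> LL t w"
proof -
  interpret V: param \<epsilon> t v m by fact
  interpret W: param \<epsilon> t w m' by fact
  obtain X Q where X: "X \<in> V.PS" and Q: "Q \<in> V.dyn" "height Q = 1 / 3 ^ k" and lQ: "l = pull V.dyn X Q"
    using V.level_pull l unfolding V.LL_eq by metis
  have QW: "Q \<in> W.dyn" using ag[of k Q] Q unfolding V.LL_eq W.LL_eq by simp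
  have tQ: "(trip ^^ k) ` tips Q = crit t" using V.level_tips[OF Q] .
  have vQ: "v \<notin> tips Q" "w \<notin> tips Q" using tQ V.v W.v k unfolding exact_def by (metis Suc_le_lessD imageI)+
  have Qu: "tips Q \<subseteq> {0..<1}" using extended_leafD(2)[OF elamD(1)[OF V.elam_dyn Q(1)]] .
  have satag: "sat V.dyn Q p q \<longleftrightarrow> sat W.dyn Q p q" if "edge (tips Q) p q" for p q
  proof -
    have p: "p \<in> tips Q" using edgeD(1)[OF that] .
    have "n \<in> W.dyn" if n: "n \<in> V.dyn" "height n > height Q" "p \<in> tips n" for n
    proof -
      obtain i where i: "i < k" "height n = 1 / 3 ^ i" using V.touch_level[OF Q _ n(1,2) p n(3)] k by auto
      then show ?thesis using ag[of i n] n(1) unfolding V.LL_eq W.LL_eq by simp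
    qed
    moreover have "n \<in> V.dyn" if n: "n \<in> W.dyn" "height n > height Q" "p \<in> tips n" for n
    proof -
      obtain i where i: "i < k" "height n = 1 / 3 ^ i" using W.touch_level[OF QW Q(2) _ n(1,2) p n(3)] k by auto
      then show ?thesis using ag[of i n] n(1) unfolding V.LL_eq W.LL_eq by simp
    qed
    ultimately show ?thesis unfolding sat_def by blast
  qed
  define kp where "kp = kap (3 * t)"
  have kp_inj: "kp x = kp y \<longleftrightarrow> x = y" if "x \<in> {0..<1}" "y \<in> {0..<1}" for x y using kap_inj[OF that] unfolding kp_def .
  have kp0: "kp (frac (3 * t)) = 0" unfolding kp_def kap_def frac_frac_diff by simp
  have kpu: "0 \<le> kp x" "kp x < 1" for x using kap_unit[of "3 * t" x] unfolding kp_def by auto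
  have cu: "frac (3 * t) \<in> {0..<1}" by (simp add: frac_lt_1)
  have kv: "0 < kp v" "0 < kp w" using kpu[of v] kpu[of w] kp_inj[OF V.v_unit cu] kp_inj[OF W.v_unit cu] kp0 V.vc W.vc by auto
  have st: "V.s - t = (1 + kp v) / 3" "W.s - t = (1 + kp w) / 3" unfolding crit_pos_def kp_def by simp_all
  have neq: "kp y \<noteq> kp v" "kp y \<noteq> kp w" if "y \<in> tips Q" for y
    using kp_inj[of y v] kp_inj[of y w] that Qu vQ V.v_unit W.v_unit by (metis subsetD)+
  have ns': "\<not> crossing (tips Q) {v, w}" using ns[of Q] Q unfolding V.LL_eq by simp
  \<comment> \<open>As \<open>Q\<close> does not separate \<open>v\<close> from \<open>w\<close>,
    either all tips of \<open>Q\<close> or none of them have a coordinate between those of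
    \<open>v\<close> and \<open>w\<close>.\<close>
  have dich: "(kp y < kp v \<longleftrightarrow> kp y < kp w) \<longleftrightarrow> (kp z < kp v \<longleftrightarrow> kp z < kp w)" if yz: "y \<in> tips Q" "z \<in> tips Q" for y z
  proof (rule ccontr)
    assume "\<not> ?thesis"
    then have "btw (kp y) (kp v) (kp z) \<and> btw (kp z) (kp w) (kp y) \<or> btw (kp y) (kp w) (kp z) \<and> btw (kp z) (kp v) (kp y)"
      using neq[OF yz(1)] neq[OF yz(2)] unfolding btw_def by (smt (z3))
    then have "btw y v z \<and> btw z w y \<or> btw y w z \<and> btw z v y"
      using kap_btw yz Qu V.v_unit W.v_unit unfolding kp_def by (meson subsetD)
    then show False using ns' yz unfolding crossing_def by blast
  qed
  have memV: "x \<in> pieceB t V.s \<longleftrightarrow> (1 \<le> 3 * kap t x \<and> 3 * kap t x < 2 \<and> kp v < kp (trip x)) \<or> (2 \<le> 3 * kap t x \<and> kp (trip x) < kp v)"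
    "x \<in> pieceC t V.s \<longleftrightarrow> kap t x = 0 \<or> (1 \<le> 3 * kap t x \<and> 3 * kap t x < 2 \<and> kp (trip x) < kp v) \<or> (2 \<le> 3 * kap t x \<and> kp v < kp (trip x))"
    if "x \<in> {0..<1}" "trip x \<in> tips Q" for x
    using piece_mem[OF st(1) kv(1) kpu(2) that(1)] neq[OF that(2)] unfolding kp_def by blast+
  have memW: "x \<in> pieceB t W.s \<longleftrightarrow> (1 \<le> 3 * kap t x \<and> 3 * kap t x < 2 \<and> kp w < kp (trip x)) \<or> (2 \<le> 3 * kap t x \<and> kp (trip x) < kp w)"
    "x \<in> pieceC t W.s \<longleftrightarrow> kap t x = 0 \<or> (1 \<le> 3 * kap t x \<and> 3 * kap t x < 2 \<and> kp (trip x) < kp w) \<or> (2 \<le> 3 * kap t x \<and> kp w < kp (trip x))"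
    if "x \<in> {0..<1}" "trip x \<in> tips Q" for x
    using piece_mem[OF st(2) kv(2) kpu(2) that(1)] neq[OF that(2)] unfolding kp_def by blast+
  have unit: "x \<in> {0..<1}" if "x \<in> pieceB t u \<or> x \<in> pieceC t u" for x u using that unfolding pieceB_def pieceC_def by auto
  have nhB: "\<not> hole (pieceB t V.s) x y" "\<not> hole (pieceB t W.s) x y" if "trip x \<in> tips Q" for x y
    using hole_B[OF V.ad] hole_B[OF W.ad] frac_crit_pos[OF V.v_unit] frac_crit_pos[OF W.v_unit] that vQ by metis+
  have hC: "hole (pieceC t V.s) x y \<longleftrightarrow> x \<in> {0..<1} \<and> y \<in> {0..<1} \<and> kap t x = 0 \<and> 3 * kap t y = 1"
     "hole (pieceC t W.s) x y \<longleftrightarrow> x \<in> {0..<1} \<and> y \<in> {0..<1} \<and> kap t x = 0 \<and> 3 * kap t y = 1" if tx: "trip x \<in> tips Q" for x y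
  proof -
    have "trip x \<noteq> frac (3 * V.s)" "trip x \<noteq> frac (3 * W.s)"
      using frac_crit_pos[OF V.v_unit] frac_crit_pos[OF W.v_unit] tx vQ by metis+
    then show "hole (pieceC t V.s) x y \<longleftrightarrow> x \<in> {0..<1} \<and> y \<in> {0..<1} \<and> kap t x = 0 \<and> 3 * kap t y = 1"
     "hole (pieceC t W.s) x y \<longleftrightarrow> x \<in> {0..<1} \<and> y \<in> {0..<1} \<and> kap t x = 0 \<and> 3 * kap t y = 1"
      using hole_C[OF V.ad, of x y] hole_C[OF W.ad, of x y] holeD(1,2)[of "pieceC t V.s" x y] holeD(1,2)[of "pieceC t W.s" x y] unit by blast+
  qed
  have "\<exists>Y\<in>W.PS. pull V.dyn X Q = pull W.dyn Y Q"
  proof (cases "\<exists>y\<in>tips Q. (kp y < kp v \<longleftrightarrow> kp y < kp w)")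
    case True
    then have same: "kp y < kp v \<longleftrightarrow> kp y < kp w" if "y \<in> tips Q" for y using dich that by blast
    have same': "kp v < kp y \<longleftrightarrow> kp w < kp y" if "y \<in> tips Q" for y using same[OF that] neq[OF that] by linarith
    have eB: "x \<in> pieceB t V.s \<longleftrightarrow> x \<in> pieceB t W.s" and eC: "x \<in> pieceC t V.s \<longleftrightarrow> x \<in> pieceC t W.s" if "trip x \<in> tips Q" for x
      using memV[OF _ that] memW[OF _ that] same[OF that] same'[OF that] unit by blast+
    consider "X = pieceA t" | "X = pieceB t V.s" | "X = pieceC t V.s" using X unfolding PSet_def by blast
    then show ?thesis
    proof cases
      case 1
      have "pull V.dyn (pieceA t) Q = pull W.dyn (pieceA t) Q" by (rule pull_eqI) (use satag in auto)
      then show ?thesis using 1 unfolding PSet_def by blast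
    next
      case 2
      have "pull V.dyn (pieceB t V.s) Q = pull W.dyn (pieceB t W.s) Q" by (rule pull_eqI) (use satag eB nhB in auto)
      then show ?thesis using 2 unfolding PSet_def by blast
    next
      case 3
      have "pull V.dyn (pieceC t V.s) Q = pull W.dyn (pieceC t W.s) Q" by (rule pull_eqI) (use satag eC hC in auto)
      then show ?thesis using 3 unfolding PSet_def by blast
    qed
  next
    case False
    then have opp: "kp y < kp v \<longleftrightarrow> kp w < kp y" "kp v < kp y \<longleftrightarrow> kp y < kp w" if "y \<in> tips Q" for y
      using that neq[OF that] by (meson linorder_neqE_linordered_idom order_less_asym)+
    \<comment> \<open>The end of \<open>C1\<close> at coordinate 0 has an image at coordinate 0,
      which is below both critical values and so not between them.\<close>
    have nz: "kap t x \<noteq> 0" if tx: "trip x \<in> tips Q" for x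
    proof
      assume "kap t x = 0"
      then have "kp (trip x) = 0" unfolding kp_def kap_trip trp_def by simp
      then show False using opp[OF tx] kv by simp
    qed
    have eB: "x \<in> pieceB t V.s \<longleftrightarrow> x \<in> pieceC t W.s" and eC: "x \<in> pieceC t V.s \<longleftrightarrow> x \<in> pieceB t W.s" if "trip x \<in> tips Q" for x
      using memV[OF _ that] memW[OF _ that] opp[OF that] nz[OF that] unit by blast+
    have nhC: "\<not> hole (pieceC t V.s) x y" "\<not> hole (pieceC t W.s) x y" if "trip x \<in> tips Q" for x y
      using hC[OF that] nz[OF that] by blast+
    consider "X = pieceA t" | "X = pieceB t V.s" | "X = pieceC t V.s" using X unfolding PSet_def by blast
    then show ?thesis
    proof cases
      case 1
      have "pull V.dyn (pieceA t) Q = pull W.dyn (pieceA t) Q" by (rule pull_eqI) (use satag in auto)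
      then show ?thesis using 1 unfolding PSet_def by blast
    next
      case 2
      have "pull V.dyn (pieceB t V.s) Q = pull W.dyn (pieceC t W.s) Q" by (rule pull_eqI) (use satag eB nhB nhC in auto)
      then show ?thesis using 2 unfolding PSet_def by blast
    next
      case 3
      have "pull V.dyn (pieceC t V.s) Q = pull W.dyn (pieceB t W.s) Q" by (rule pull_eqI) (use satag eC nhB nhC in auto)
      then show ?thesis using 3 unfolding PSet_def by blast
    qed
  qed
  then show ?thesis using lQ W.pull_dyn QW unfolding W.LL_eq by metis
qed

lemma LL_agree:
  assumes P: "param \<epsilon> t v m" "param \<epsilon> t w m'"
    and ns: "\<And>i l. i < k \<Longrightarrow> l \<in> LL t v \<Longrightarrow> height l = 1 / 3 ^ i \<Longrightarrow> \<not> crossing (tips l) {v, w}"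
    and k: "k \<le> m" "k \<le> m'" and i: "i \<le> k" "height l = 1 / 3 ^ i"
  shows "l \<in> LL t v \<longleftrightarrow> l \<in> LL t w"
  using ns k i
proof (induction k arbitrary: i l)
  case 0
  interpret V: param \<epsilon> t v m by fact
  interpret W: param \<epsilon> t w m' by fact
  have "V.C1 \<in> V.dyn" "W.C1 \<in> W.dyn" using V.K_dyn W.K_dyn V.K_eq W.K_eq by blast+
  then show ?case using V.level_0[of l] W.level_0[of l] 0 unfolding V.LL_eq W.LL_eq by auto
next
  case (Suc k)
  have ag: "l \<in> LL t v \<longleftrightarrow> l \<in> LL t w" if "i \<le> k" "height l = 1 / 3 ^ i" for i l
  proof -
    have "\<And>i l. i < k \<Longrightarrow> l \<in> LL t v \<Longrightarrow> height l = 1 / 3 ^ i \<Longrightarrow> \<not> crossing (tips l) {v, w}"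
      using Suc.prems(1) by (meson less_SucI)
    then show ?thesis using Suc.IH[of i l] Suc.prems(2,3) that by simp
  qed
  show ?case
  proof (cases "i = Suc k")
    case False
    then show ?thesis using ag[of i l] Suc.prems(4,5) by simp
  next
    case True
    have "\<not> crossing (tips l) {w, v}" if "l \<in> LL t w" "height l = 1 / 3 ^ k" for l
      using Suc.prems(1)[of k l] ag[of k l] that by (simp add: insert_commute)
    then show ?thesis
      using LL_step[OF P Suc.prems(2,3), of l] LL_step[OF P(2,1) Suc.prems(3,2), of l] ag Suc.prems(1)[of k] Suc.prems(5) True
      by (metis lessI)
  qed
qed

end

section \<open>The tautological elamination\<close>

lemma edges_arc:
  assumes "edge S a b" "edge S c d" "\<not> (a = c \<and> b = d)" "carc c d z"
  shows "carc b a z"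
proof -
  have "\<not> btw a c b" "\<not> btw a d b" "\<not> btw c a d" "\<not> btw c b d" "a \<noteq> b" "c \<noteq> d"
    using edgeD[OF assms(1)] edgeD[OF assms(2)] by blast+
  then show ?thesis using assms(3,4) unfolding carc_def btw_def by (smt (z3))
qed

lemma arcs_not_crossing:
  assumes "a \<noteq> b" "\<forall>x\<in>S. carc a b x" "\<forall>y\<in>T. carc b a y"
  shows "\<not> crossing S T"
proof
  assume "crossing S T"
  then obtain x x' y y' where h: "x \<in> S" "x' \<in> S" "y \<in> T" "y' \<in> T" "btw x y x'" "btw x' y' x"
    unfolding crossing_def by blast
  then have "carc a b x" "carc a b x'" "carc b a y" "carc b a y'" using assms by blast+
  then show False using h(5,6) assms(1) unfolding carc_def btw_def by (smt (z3))
qed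

lemma finite_trip_fibre: "finite {x\<in>{0..<1}. (trip ^^ n) x = y}"
proof (induction n arbitrary: y)
  case 0
  have "{x\<in>{0..<1}. (trip ^^ 0) x = y} \<subseteq> {y}" by auto
  then show ?case using finite_subset by blast
next
  case (Suc n)
  have f: "finite {x\<in>{0..<1}. trip x = z}" for z
  proof (rule finite_subset)
    show "{x\<in>{0..<1}. trip x = z} \<subseteq> {z/3, (z+1)/3, (z+2)/3}"
    proof
      fix x assume "x \<in> {x\<in>{0..<1}. trip x = z}"
      then have "0 \<le> x" "x < 1" "trp x = z" using trp_eq[of x] unfolding trip_def by auto
      then show "x \<in> {z/3, (z+1)/3, (z+2)/3}" using trp_cases[of x] by auto
    qed
  qed simp
  have "{x\<in>{0..<1}. (trip ^^ Suc n) x = y} \<subseteq> (\<Union>z\<in>{x\<in>{0..<1}. (trip ^^ n) x = y}. {x\<in>{0..<1}. trip x = z})"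
    using trip_unit by (auto simp: funpow_Suc_right simp del: funpow.simps)
  then show ?case using Suc f by (meson finite_UN_I finite_subset)
qed

text \<open>Makes a tip over \<open>star t\<close> admissible as a critical value: the value of
  \<open>C1\<close> cannot lead to \<open>star t\<close>, since then an end of \<open>C1\<close>
  would.\<close>

lemma star_not_value: "(trip ^^ k) x = star t \<Longrightarrow> x \<noteq> frac (3 * t)"
proof
  assume a: "(trip ^^ k) x = star t" "x = frac (3 * t)"
  then have "(trip ^^ Suc k) (star t) = star t" using trip_crit[OF star(1)] by (simp add: funpow_Suc_right del: funpow.simps)
  then show False using star(2)[OF star(1), of "Suc k"] by simp
qed

lemma exact_le: "exact t j w \<Longrightarrow> (trip ^^ m) w \<in> crit t \<Longrightarrow> j \<le> m"
  unfolding exact_def by (meson not_le)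

context param
begin

lemma cube_pow_level:
  assumes "l \<in> dyn" "height l = 1 / 3 ^ k"
  shows "(cube ^^ k) l = C1"
  using assms
proof (induction k arbitrary: l)
  case 0
  then show ?case using level_0 by simp
next
  case (Suc k)
  obtain X Q where "X \<in> PS" "Q \<in> dyn" "l = pull dyn X Q" "height Q = 1 / 3 ^ k" using level_pull[OF Suc.prems] .
  then show ?case using Suc.IH[of Q] D.cube_pull[of X Q] by (simp add: funpow_Suc_right del: funpow.simps)
qed

lemma dynamical_eq: "dynamical_elamination C1 C2 = dyn"
  using dyn_The unfolding dynamical_elamination_def K_eq by simp

lemma side_of_edge:
  assumes l: "l \<in> dyn" "x \<in> tips l" "exact t k x" "k \<le> m" and l': "l' \<in> dyn" "height l' = 1 / 3 ^ i" "i < k" and ne: "l \<noteq> l'"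
  shows "\<exists>a b. edge (tips l') a b \<and> btw a x b \<and> (\<forall>z\<in>tips l. carc a b z)"
proof -
  obtain a b where ab: "edge (tips l') a b" "\<forall>z\<in>tips l. carc a b z" using elam_edge[OF elam_dyn l'(1) l(1)] ne by blast
  have "x \<notin> tips l'" using exact_no_taller[OF l(3,4) l'(1)] l'(2,3) one_third_pow_less by auto
  moreover have "carc a b x" using ab l(2) by blast
  ultimately have "btw a x b" using edgeD(1,2)[OF ab(1)] unfolding carc_def by metis
  then show ?thesis using ab by blast
qed

end

context eps_small
begin

text \<open>
  If \<open>C\<^sub>2\<close> collides with \<open>P\<close>, then the critical value \<open>v = 3s\<close> is a tip of \<open>Q = P\<^sup>3\<close>, and \<open>Q\<close> is the
  leaf of its level with this tip.
\<close>

definition Lam :: "real \<Rightarrow> leaf set" where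
  "Lam t = {Q. \<exists>v m. exact t m v \<and> v \<noteq> frac (3 * t) \<and> Q \<in> LL t v \<and> height Q = 1 / 3 ^ m \<and> v \<in> tips Q}"

lemma paramI: "exact t m v \<Longrightarrow> v \<noteq> frac (3 * t) \<Longrightarrow> param \<epsilon> t v m"
  by unfold_locales

text \<open>The leaf \<open>P\<close> is the lift of \<open>Q\<close> to the piece between the
  critical leaves. As \<open>v\<close> has exact level \<open>m\<close>, no edge of \<open>Q\<close>
  at \<open>v\<close> is saturated; hence \<open>pull\<close> keeps both ends of \<open>C2\<close>,
  and \<open>P\<close> has an edge along \<open>C2\<close>. The depth of \<open>P\<close> is
  \<open>Suc m\<close>, one more than that of its cube.\<close>

lemma Lam_sub_taut:
  assumes "Q \<in> Lam t"
  shows "Q \<in> tautological_elamination \<epsilon> t"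
proof -
  obtain v m where vm: "exact t m v" "v \<noteq> frac (3 * t)" "Q \<in> LL t v" "height Q = 1 / 3 ^ m" "v \<in> tips Q"
    using assms unfolding Lam_def by blast
  interpret param \<epsilon> t v m by (rule paramI[OF vm(1,2)])
  have Q: "Q \<in> dyn" using vm(3) LL_eq by simp
  obtain c0 c1 d0 d1 where "c0 \<in> {0..<1}" "c1 \<in> {0..<1}" and d1: "d0 \<in> {0..<1}" "d1 \<in> {0..<1}"
    and "kap t c0 = 0" "3 * kap t c1 = 1" and d2: "kap t d0 = s - t" "3 * kap t d1 = 3 * (s - t) + 1"
    and "\<And>h. tips (simple_critical_leaf h t) = {c0, c1}" and d3: "\<And>h. tips (simple_critical_leaf h s) = {d0, d1}"
    by (rule crit_tips_obtain[OF ad]) blast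
  note d = d1 d2 d3
  have dcrit: "crit s = {d0, d1}" using d(5)[of 1] unfolding simple_critical_leaf_def crit_def by simp
  have X: "pieceC t s \<in> PS" unfolding PSet_def by blast
  have h: "hole (pieceC t s) d0 d1" using hole_pieces(4)[OF ad d(1,2)] d by blast
  have td: "trip d0 = v" "trip d1 = v" using trip_crit_s dcrit by auto
  define P where "P = pull dyn (pieceC t s) Q"
  have P: "P \<in> dyn" using pull_dyn[OF X Q] P_def by simp
  have "d0 \<in> tips P" unfolding P_def
    using pull_memI[of d0 _ Q dyn] holeD(1)[OF h] td vm(5) exact_not_sat[OF v _ vm(4)] by auto
  moreover have "d1 \<in> tips P" unfolding P_def
    using pull_memI[of d1 _ Q dyn] holeD(2)[OF h] td vm(5) exact_not_sat[OF v _ vm(4)] by auto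
  ultimately have e: "edge (tips P) d0 d1" unfolding edge_def P_def using holeD[OF h] pull_tips(1) by blast
  have C2: "C2 \<in> K" unfolding K_eq by simp
  have uq: "m' = C2" if "m' \<in> dyn" "tips m' = {d0, d1}" for m'
    using D.tips_eqD[OF that(1) K_dyn[OF C2]] that(2) d(5) by simp
  have "closest_sat dyn P d0 d1 C2"
    unfolding closest_sat_def
  proof (intro conjI ballI impI)
    show "C2 \<in> dyn" using K_dyn[OF C2] .
    show "height C2 > height P" using D.low[OF Q C2] P_def by (simp add: height_pull)
    show "d0 \<in> tips C2" "d1 \<in> tips C2" unfolding d(5) by simp_all
    show "carc d0 d1 z" if "z \<in> tips C2" for z using that unfolding d(5) carc_def by blast
  qed (use uq in blast)
  then have "saturates dyn C2 P d0 d1" using saturates_iff[OF elam_dyn P e] by simp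
  moreover have "vein_edge P d0 d1" using vein_edge_iff[of P] extended_leafD(2)[OF elamD(1)[OF elam_dyn P]] e by blast
  moreover have "cube P = Q" using D.cube_pull[OF X Q] P_def by simp
  moreover have "(cube ^^ Suc m) P = C1" using cube_pow_level[OF P, of "Suc m"] vm(4) P_def by (simp add: height_pull)
  moreover have "frac (3 ^ Suc m * s) \<in> {frac t, frac (t + 1/3)}"
  proof -
    have "(trip ^^ Suc m) (frac s) = (trip ^^ m) v"
      using trip_frac[of s] frac_crit_pos[OF v_unit, of t] by (simp add: funpow_Suc_right del: funpow.simps)
    then show ?thesis using v trip_pow_frac[of "Suc m" s] unfolding exact_def crit_def by simp
  qed
  moreover have "t + 1/3 < s" "s < t + 2/3" using ad unfolding admissible_def by auto
  ultimately show ?thesis unfolding tautological_elamination_def mem_Collect_eq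
    using P dynamical_eq[symmetric] by metis
qed

lemma height_cube_pow: "height ((cube ^^ n) P) = 3 ^ n * height P"
  by (induction n) (simp_all add: cube_def)

text \<open>A collision makes both ends of \<open>C2\<close> tips of \<open>P\<close>. If
  \<open>v\<close> reached \<open>C1\<close> before time \<open>n'\<close>, the taller leaf through
  \<open>v\<close> would saturate an edge of \<open>Q\<close> at \<open>v\<close>, and the lift of
  \<open>Q\<close> would have lost one of these ends.\<close>

lemma taut_sub_Lam:
  assumes "Q \<in> tautological_elamination \<epsilon> t"
  shows "Q \<in> Lam t"
proof -
  obtain P s n C1 C2 L p q where h: "t + 1/3 < s" "s < t + 2/3"
      "C1 = simple_critical_leaf 1 t" "C2 = simple_critical_leaf (1 - \<epsilon>) s"
      "L = dynamical_elamination C1 C2" "frac (3 ^ n * s) \<in> {frac t, frac (t + 1/3)}"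
      "P \<in> L" "(cube ^^ n) P = C1" "vein_edge P p q" "saturates L C2 P p q" "Q = cube P"
    using assms unfolding tautological_elamination_def by blast
  have ads: "admissible t s" using h unfolding admissible_def by simp
  define v where "v = frac (3 * s)"
  have cv: "crit_pos t v = s" "v \<noteq> frac (3 * t)" using crit_pos_unique[OF ads] v_def by auto
  have hC: "height C1 = 1" "height C2 = 1 - \<epsilon>" using h unfolding simple_critical_leaf_def by auto
  have hP: "height P < 1 - \<epsilon>" using h(10) hC unfolding saturates_def by simp
  \<comment> \<open>For \<open>n = 0\<close> the leaf \<open>P\<close> would be \<open>C1\<close>,
    which is taller than \<open>C2\<close>.\<close>
  obtain n' where n: "n = Suc n'" using h(8) hC hP eps by (cases n) auto
  have "(trip ^^ n) (frac s) = (trip ^^ n') v"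
    unfolding n v_def using trip_frac[of s] by (simp add: funpow_Suc_right del: funpow.simps)
  then have "(trip ^^ n') v \<in> crit t" using h(6) trip_pow_frac[of n s] unfolding crit_def by simp
  moreover have "v \<in> {0..<1}" unfolding v_def by (simp add: frac_lt_1)
  ultimately obtain m where m: "m \<le> n'" "exact t m v" using exact_ex by blast
  interpret V: param \<epsilon> t v m by (rule paramI[OF m(2) cv(2)])
  have C: "V.C1 = C1" "V.C2 = C2" using cv h by simp_all
  have L: "L = V.dyn" using V.dynamical_eq h(5) C by simp
  have P: "P \<in> V.dyn" using h(7) L by simp
  have heP: "height P = 1 / 3 ^ n" using height_cube_pow[of n P] h(8) hC by (simp add: field_simps)
  have e: "edge (tips P) p q" using vein_edge_iff[of P] extended_leafD(2)[OF elamD(1)[OF V.elam_dyn P]] h(9) by blast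
  have "closest_sat V.dyn P p q C2" using saturates_iff[OF V.elam_dyn P e] h(10) L by simp
  then have pq: "p \<in> crit s" "q \<in> crit s" unfolding closest_sat_def using V.tips_C(2) C(2) cv(1) by auto
  obtain X Q' where X: "X \<in> V.PS" "Q' \<in> V.dyn" "P = pull V.dyn X Q'" "height Q' = 1 / 3 ^ n'"
    using V.level_pull[OF P] heP n by metis
  have QQ: "Q' = Q" using V.D.cube_pull[OF X(1,2)] X(3) h(11) by simp
  have tv: "trip p = v" "trip q = v" using V.trip_crit_s pq cv(1) by auto
  have vQ: "v \<in> tips Q" using edgeD(1)[OF e] X(3) tv V.pull_tips(2) QQ by metis
  have "m = n'"
  proof (rule ccontr)
    assume "m \<noteq> n'"
    then have mn: "m < n'" using m by simp
    obtain l where l: "l \<in> V.dyn" "height l = 1 / 3 ^ m" "v \<in> tips l" using V.exact_leaf_exists[OF m(2)] by auto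
    have "height Q < height l" using X(4) QQ l(2) mn one_third_pow_less by simp
    then obtain a b where ab: "edge (tips Q) a b" "\<forall>z\<in>tips l. carc a b z"
      using elam_edge[OF V.elam_dyn _ l(1), of Q] X(2) QQ by blast
    then have vab: "v = a \<or> v = b" using l(3) vQ unfolding carc_def edge_def by blast
    have st: "sat V.dyn Q a b"
      using elam_sat[OF V.elam_dyn _ l(1) _ _ ab(1)] X(2) QQ \<open>height Q < height l\<close> ab(2) vab l(3) by force
    have pX: "p \<in> X" "q \<in> X" "p \<noteq> q" using edgeD(1-3)[OF e] X(3) V.pull_tips(1) by blast+
    have "hole X p q \<or> hole X q p" using V.hol[OF X(1) pX] tv by simp
    then obtain e b' where hl: "hole X e b'" "e \<in> tips P" "b' \<in> tips P" "trip e = v" "trip b' = v"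
      using edgeD(1,2)[OF e] tv by blast
    show False using vab
    proof
      assume "v = a"
      then show False using V.pull_keep_start[of b' V.dyn X Q e b] hl X(3) QQ ab(1) st by simp
    next
      assume "v = b"
      then show False using V.pull_keep_end[of e V.dyn X Q b' a] hl X(3) QQ ab(1) st by simp
    qed
  qed
  then show ?thesis unfolding Lam_def using m(2) cv(2) X(2,4) QQ vQ V.LL_eq by blast
qed

lemma taut_eq: "tautological_elamination \<epsilon> t = Lam t"
  using Lam_sub_taut taut_sub_Lam by blast

text \<open>At the first level that contains a separating leaf the two elaminations still agree by
  \<open>LL_agree\<close>, so this leaf belongs to both.\<close>

lemma agree_or_separated:
  assumes P: "param \<epsilon> t v m" "param \<epsilon> t w j" and jm: "k \<le> m" "k \<le> j"
  shows "(\<forall>i\<le>k. \<forall>l. height l = 1 / 3 ^ i \<longrightarrow> (l \<in> LL t v \<longleftrightarrow> l \<in> LL t w)) \<or>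
    (\<exists>i<k. \<exists>l. l \<in> LL t v \<and> l \<in> LL t w \<and> height l = 1 / 3 ^ i \<and> crossing (tips l) {v, w})"
proof -
  let ?S = "\<lambda>i. i < k \<and> (\<exists>l. l \<in> LL t v \<and> height l = 1 / 3 ^ i \<and> crossing (tips l) {v, w})"
  show ?thesis
  proof (cases "\<exists>i. ?S i")
    case False
    then show ?thesis using LL_agree[OF P _ jm] by blast
  next
    case True
    define i where "i = (LEAST i. ?S i)"
    have i: "?S i" unfolding i_def using True by (rule LeastI_ex)
    then obtain l where l: "l \<in> LL t v" "height l = 1 / 3 ^ i" "crossing (tips l) {v, w}" by blast
    have "\<not> crossing (tips l) {v, w}" if "i' < i" "l \<in> LL t v" "height l = 1 / 3 ^ i'" for i' l
      using not_less_Least[of i' ?S] that i unfolding i_def by (meson less_trans)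
    then have "l \<in> LL t w" using LL_agree[OF P, of i i l] l i jm by auto
    then show ?thesis using l i by blast
  qed
qed

text \<open>A certificate of membership in \<open>Lam t\<close>. One leaf may be certified by
  several of its tips, and the arguments choose a convenient one.\<close>

definition seen :: "real \<Rightarrow> real \<Rightarrow> nat \<Rightarrow> leaf \<Rightarrow> bool" where
  "seen t v m Q \<longleftrightarrow> param \<epsilon> t v m \<and> Q \<in> LL t v \<and> height Q = 1 / 3 ^ m \<and> v \<in> tips Q"

lemma Lam_seen: "Q \<in> Lam t \<longleftrightarrow> (\<exists>v m. seen t v m Q)"
  unfolding Lam_def seen_def using paramI param.v param.vc by blast

lemma seenD:
  assumes "seen t v m Q"
  shows "param \<epsilon> t v m" "Q \<in> LL t v" "height Q = 1 / 3 ^ m" "v \<in> tips Q" "exact t m v" "elam (LL t v)" "nondeg (LL t v)"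
proof -
  show p: "param \<epsilon> t v m" and "Q \<in> LL t v" "height Q = 1 / 3 ^ m" "v \<in> tips Q" using assms unfolding seen_def by auto
  interpret param \<epsilon> t v m by (rule p)
  show "exact t m v" "elam (LL t v)" "nondeg (LL t v)" using v elam_dyn nondeg_dyn LL_eq by simp_all
qed

lemma seen_side:
  assumes "seen t v m Q" "param \<epsilon> t w j" "l' \<in> LL t w" "height l' = 1 / 3 ^ i" "i < m" "m \<le> j" "Q \<in> LL t w"
  shows "\<exists>a b. edge (tips l') a b \<and> btw a v b \<and> (\<forall>z\<in>tips Q. carc a b z)"
proof -
  interpret param \<epsilon> t w j by fact
  have "Q \<noteq> l'" using seenD(3)[OF assms(1)] assms(4,5) one_third_pow_less[of m i] by auto
  then show ?thesis using side_of_edge[of Q v m l' i] assms seenD[OF assms(1)] LL_eq by simp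
qed

lemma separated_sides:
  assumes Q: "seen t v m Q" and R: "seen t w j R" and l': "l' \<in> LL t v" "l' \<in> LL t w" "height l' = 1 / 3 ^ i"
    and i: "i < m" "i < j" and c: "crossing (tips l') {v, w}"
  obtains a b c d where "edge (tips l') a b" "btw a v b" "\<forall>z\<in>tips Q. carc a b z"
    "edge (tips l') c d" "btw c w d" "\<forall>z\<in>tips R. carc c d z" "\<forall>z\<in>tips R. carc b a z" "\<not> (a = c \<and> b = d)"
proof -
  obtain a b where ab: "edge (tips l') a b" "btw a v b" "\<forall>z\<in>tips Q. carc a b z"
    using seen_side[OF Q seenD(1)[OF Q] l'(1,3) i(1) _ seenD(2)[OF Q]] by auto
  obtain c d where cd: "edge (tips l') c d" "btw c w d" "\<forall>z\<in>tips R. carc c d z"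
    using seen_side[OF R seenD(1)[OF R] l'(2,3) i(2) _ seenD(2)[OF R]] by auto
  have ne: "\<not> (a = c \<and> b = d)"
  proof
    assume "a = c \<and> b = d"
    then have "\<forall>z\<in>{v, w}. carc a b z" using ab(2) cd(2) unfolding carc_def by auto
    then show False using arc_no_crossing[OF ab(1)] c by blast
  qed
  then have "\<forall>z\<in>tips R. carc b a z" using edges_arc[OF ab(1) cd(1)] cd(3) by blast
  then show thesis using that[OF ab cd _ ne] by blast
qed

lemma seen_cases:
  assumes Q: "seen t v m Q" and R: "seen t w j R" and jm: "j \<le> m"
  shows "R \<in> LL t v \<or> (\<exists>i l'. i < j \<and> l' \<in> LL t v \<and> l' \<in> LL t w \<and> height l' = 1 / 3 ^ i \<and> crossing (tips l') {v, w})"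
  using agree_or_separated[OF seenD(1)[OF Q] seenD(1)[OF R] jm order_refl] seenD(2,3)[OF R] by blast

lemma seen_level_le:
  assumes "seen t v m Q" "seen t w j R" "w \<in> tips Q"
  shows "j \<le> m"
proof -
  interpret V: param \<epsilon> t v m by (rule seenD(1)[OF assms(1)])
  have "(trip ^^ m) w \<in> crit t" using V.level_tips[of Q m] seenD(2,3)[OF assms(1)] V.LL_eq assms(3) by blast
  then show ?thesis using exact_le seenD(5)[OF assms(2)] by blast
qed

text \<open>Each leaf has a tip whose exact level is its own, so equal tip sets bound the two levels
  by each other, and the level determines the height.\<close>

lemma Lam_inj: "inj_on tips (Lam t)"
proof (rule inj_onI)
  fix Q R assume "Q \<in> Lam t" "R \<in> Lam t" and e: "tips Q = tips R"
  then obtain v m w j where Q: "seen t v m Q" and R: "seen t w j R" unfolding Lam_seen by blast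
  have "m = j" using seen_level_le[OF Q R] seen_level_le[OF R Q] seenD(4)[OF Q] seenD(4)[OF R] e by simp
  then show "Q = R" using seenD(3)[OF Q] seenD(3)[OF R] e by (intro leaf.expand) simp
qed

lemma seen_not_crossing:
  assumes Q: "seen t v m Q" and R: "seen t w j R" and jm: "j \<le> m" and ne: "Q \<noteq> R"
  shows "\<not> crossing (tips Q) (tips R)"
  using seen_cases[OF Q R jm]
proof
  assume "R \<in> LL t v"
  then show ?thesis using elamD(3)[OF seenD(6)[OF Q] seenD(2)[OF Q]] ne by blast
next
  assume "\<exists>i l'. i < j \<and> l' \<in> LL t v \<and> l' \<in> LL t w \<and> height l' = 1 / 3 ^ i \<and> crossing (tips l') {v, w}"
  then obtain i l' where l': "i < j" "l' \<in> LL t v" "l' \<in> LL t w" "height l' = 1 / 3 ^ i" "crossing (tips l') {v, w}" by blast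
  have "i < m" using l'(1) jm by simp
  then obtain a b c d where "edge (tips l') a b" "\<forall>z\<in>tips Q. carc a b z" "\<forall>z\<in>tips R. carc b a z"
    using separated_sides[OF Q R l'(2-4) _ l'(1,5)] by metis
  then show ?thesis using arcs_not_crossing[of a b "tips Q" "tips R"] edgeD(3) by blast
qed

text \<open>
  When the critical value moves to a tip of the saturator \<open>n\<close>, no taller leaf is crossed, because a
  leaf separating \<open>n\<close> from \<open>Q\<close> would be closer to \<open>Q\<close> than \<open>n\<close>.
\<close>

lemma closest_sat_in_Lam:
  assumes Q: "seen t v m Q" and e: "edge (tips Q) p q" and c: "closest_sat (LL t v) Q p q n"
  shows "n \<in> Lam t"
proof -
  interpret V: param \<epsilon> t v m by (rule seenD(1)[OF Q])
  note LL = V.LL_eq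
  have QL: "Q \<in> V.dyn" using seenD(2)[OF Q] LL by simp
  have n: "n \<in> V.dyn" "height n > height Q" "p \<in> tips n" "q \<in> tips n" "\<And>z. z \<in> tips n \<Longrightarrow> carc p q z"
    "\<And>m'. m' \<in> V.dyn \<Longrightarrow> m' \<noteq> Q \<Longrightarrow> height m' \<ge> height Q \<Longrightarrow> tips m' = {p, q} \<Longrightarrow> m' = n"
    using c LL unfolding closest_sat_def by auto
  have pq: "p \<in> tips Q" "q \<in> tips Q" "p \<noteq> q" using edgeD(1-3)[OF e] by auto
  obtain k where k: "k < m" "height n = 1 / 3 ^ k"
    using V.touch_level[OF QL seenD(3)[OF Q] order_refl n(1,2) pq(1) n(3)] by blast
  obtain z where z: "z \<in> tips n" "(trip ^^ k) z = star t" using V.tips_structure[OF n(1) k(2)] k(1) by auto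
  have zu: "z \<in> {0..<1}" using extended_leafD(2)[OF elamD(1)[OF V.elam_dyn n(1)]] z(1) by blast
  have ez: "exact t k z" using exact_star[OF zu z(2)] .
  have P: "param \<epsilon> t z k" using paramI[OF ez star_not_value[OF z(2)]] .
  interpret Z: param \<epsilon> t z k by (rule P)
  have "n \<in> LL t z"
  proof (rule ccontr)
    assume no: "n \<notin> LL t z"
    then obtain i l' where l': "i < k" "l' \<in> LL t v" "l' \<in> LL t z" "height l' = 1 / 3 ^ i" "crossing (tips l') {v, z}"
      using agree_or_separated[OF seenD(1)[OF Q] P less_imp_le[OF k(1)] order_refl] n(1) k(2) LL by blast
    have l'd: "l' \<in> V.dyn" using l'(2) LL by simp
    have ne: "l' \<noteq> Q" "l' \<noteq> n" using l'(1,4) k seenD(3)[OF Q] one_third_pow_less[of m i] one_third_pow_less[of k i] by auto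
    obtain a b where ab: "edge (tips l') a b" "btw a v b" "\<forall>x\<in>tips Q. carc a b x"
      using V.side_of_edge[OF QL seenD(4,5)[OF Q] order_refl l'd l'(4) _ ne(1)[symmetric]] l'(1) k(1) by auto
    obtain d d' where d: "edge (tips l') d d'" "btw d z d'" "\<forall>x\<in>tips n. carc d d' x"
      using V.side_of_edge[OF n(1) z(1) ez less_imp_le[OF k(1)] l'd l'(4,1) ne(2)[symmetric]] by auto
    have dd: "\<not> (a = d \<and> b = d')"
    proof
      assume "a = d \<and> b = d'"
      then have "\<forall>x\<in>{v, z}. carc a b x" using ab(2) d(2) unfolding carc_def by auto
      then show False using arc_no_crossing[OF ab(1)] l'(5) by blast
    qed
    have p1: "carc a b p" "carc a b q" "carc b a p" "carc b a q"
      using ab(3) pq edges_arc[OF ab(1) d(1) dd] d(3) n(3,4) by blast+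
    have ab': "a \<noteq> b" "a \<in> tips l'" "b \<in> tips l'" using edgeD[OF ab(1)] by auto
    have "p = a \<or> p = b" "q = a \<or> q = b" using p1 ab' unfolding carc_def btw_def by (smt (z3))+
    moreover have "\<not> (p = a \<and> q = b)" using ab(2) edgeD(4)[OF e seenD(4)[OF Q]] by blast
    ultimately have pqab: "p = b" "q = a" using pq(3) by auto
    have "carc d d' p" "carc d d' q" using d(3) n(3,4) by auto
    then have "(d = p \<or> d' = p) \<and> (d = q \<or> d' = q)" using edgeD(4)[OF d(1)] ab' pqab unfolding carc_def by metis
    then have "d = p \<and> d' = q" using pq(3) dd pqab by auto
    then have "edge (tips l') p q" using d(1) by simp
    then have "x = p \<or> x = q" if "x \<in> tips l'" for x
      using edgeD(4)[OF ab(1) that] edgeD(4)[OF _ that] pqab ab'(1) unfolding btw_def by (smt (z3))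
    then have "tips l' = {p, q}" using ab' pqab by auto
    moreover have "height l' \<ge> height Q" using l'(1,4) k seenD(3)[OF Q] one_third_pow_less[of m i] by simp
    ultimately show False using n(6)[OF l'd ne(1)] ne(2) by blast
  qed
  then have "seen t z k n" unfolding seen_def using P k(2) z(1) by blast
  then show ?thesis unfolding Lam_seen by blast
qed

lemma sat_in_Lam:
  assumes Q: "seen t v m Q" and e: "edge (tips Q) p q" and s: "sat (LL t v) Q p q"
  shows "sat (Lam t) Q p q"
proof -
  obtain n where n: "closest_sat (LL t v) Q p q n" using closest_sat_ex[OF seenD(6)[OF Q] seenD(2)[OF Q] e s] by blast
  then show ?thesis using closest_sat_in_Lam[OF Q e n] unfolding sat_def closest_sat_def by blast
qed

text \<open>If \<open>R\<close> does not occur in the dynamical elamination of \<open>v\<close>, a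
  taller leaf \<open>l'\<close> of that elamination separates \<open>R\<close> from
  \<open>Q\<close>. The tip common to \<open>Q\<close> and \<open>R\<close> is then also a tip of
  \<open>l'\<close>, and \<open>l'\<close> lies behind the same edge \<open>pq\<close>. So
  \<open>l'\<close> takes the place of \<open>R\<close>, and \<open>sat_in_Lam\<close> carries the
  saturation over to \<open>Lam t\<close>.\<close>

lemma Lam_sat:
  assumes Q: "seen t v m Q" and R: "seen t w j R" and ne: "Q \<noteq> R" and h: "height Q \<le> height R"
    and e: "edge (tips Q) p q" and a: "\<And>z. z \<in> tips R \<Longrightarrow> carc p q z" and tch: "p \<in> tips R \<or> q \<in> tips R"
  shows "sat (Lam t) Q p q"
proof (rule sat_in_Lam[OF Q e])
  interpret V: param \<epsilon> t v m by (rule seenD(1)[OF Q])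
  note LL = V.LL_eq
  have jm: "j \<le> m"
  proof (rule ccontr)
    assume "\<not> j \<le> m"
    then have "(1::real) / 3 ^ j < 1 / 3 ^ m" using one_third_pow_less[of j m] by simp
    then show False using h seenD(3)[OF Q] seenD(3)[OF R] by simp
  qed
  from seen_cases[OF Q R jm] show "sat (LL t v) Q p q"
  proof
    assume "R \<in> LL t v"
    then show ?thesis using elam_sat[OF seenD(6)[OF Q] seenD(2)[OF Q] _ ne h e a tch] by blast
  next
    assume "\<exists>i l'. i < j \<and> l' \<in> LL t v \<and> l' \<in> LL t w \<and> height l' = 1 / 3 ^ i \<and> crossing (tips l') {v, w}"
    then obtain i l' where l': "i < j" "l' \<in> LL t v" "l' \<in> LL t w" "height l' = 1 / 3 ^ i" "crossing (tips l') {v, w}" by blast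
    have im: "i < m" using l'(1) jm by simp
    obtain a' b c d where ab: "edge (tips l') a' b" "btw a' v b" "\<forall>z\<in>tips Q. carc a' b z"
      "edge (tips l') c d" "btw c w d" "\<forall>z\<in>tips R. carc c d z" "\<forall>z\<in>tips R. carc b a' z" "\<not> (a' = c \<and> b = d)"
      by (rule separated_sides[OF Q R l'(2-4) im l'(1,5)])
    have l'h: "height Q < height l'" using l'(4) im seenD(3)[OF Q] one_third_pow_less by simp
    then have l'Q: "Q \<noteq> l'" by auto
    have ab': "a' \<in> tips l'" "b \<in> tips l'" "a' \<noteq> b" using edgeD[OF ab(1)] by auto
    have pq: "p \<in> tips Q" "q \<in> tips Q" "p \<noteq> q" using edgeD(1-3)[OF e] by auto
    have "z = a' \<or> z = b" if "z \<in> tips Q" "z \<in> tips R" for z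
      using ab(3,7) that ab'(3) unfolding carc_def btw_def by (smt (z3))
    then have t': "p \<in> tips l' \<or> q \<in> tips l'" using tch pq ab' by blast
    obtain p' q' where pq': "edge (tips Q) p' q'" "\<forall>z\<in>tips l'. carc p' q' z"
      using elam_edge[OF seenD(6)[OF Q] seenD(2)[OF Q] l'(2) l'Q] by blast
    have "carc p q y" if y: "y \<in> tips l'" for y
    proof (cases "p = p' \<and> q = q'")
      case True
      then show ?thesis using pq' y by blast
    next
      case False
      have 1: "carc q p a'" "carc q p b" "carc q p y" using edges_arc[OF e pq'(1) False] pq'(2) ab' y by blast+
      have 2: "carc a' b p" "carc a' b q" using ab(3) pq by blast+
      have "carc b a' w" "w \<notin> tips l'"
        using ab(7) seenD(4)[OF R] edgeD(4)[OF ab(4)] ab(5) by blast+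
      then have 3: "btw b w a'" using ab' unfolding carc_def by auto
      have 4: "carc p q w" using a seenD(4)[OF R] by blast
      have 5: "\<not> btw a' y b" using edgeD(4)[OF ab(1) y] .
      show ?thesis using 1 2 3 4 5 pq(3) ab'(3) unfolding carc_def btw_def by (smt (z3))
    qed
    then show ?thesis using elam_sat[OF seenD(6)[OF Q] seenD(2)[OF Q] l'(2) l'Q less_imp_le[OF l'h] e _ t'] by blast
  qed
qed

lemma elam_Lam: "elam (Lam t)"
  unfolding elam_def
proof (intro conjI ballI allI impI)
  show "extended_leaf Q" if QL: "Q \<in> Lam t" for Q
  proof -
    obtain v m where "seen t v m Q" using QL unfolding Lam_seen by blast
    then show ?thesis using elamD(1) seenD(2,6) by blast
  qed
  show "inj_on tips (Lam t)" by (rule Lam_inj)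
  show "\<not> crossing (tips Q) (tips R)" if QR: "Q \<in> Lam t" "R \<in> Lam t" "Q \<noteq> R" for Q R
  proof -
    obtain v m w j where Q: "seen t v m Q" and R: "seen t w j R" using QR unfolding Lam_seen by blast
    show ?thesis
    proof (cases "j \<le> m")
      case True
      then show ?thesis using seen_not_crossing[OF Q R _ QR(3)] by blast
    next
      case False
      then show ?thesis using seen_not_crossing[OF R Q _ QR(3)[symmetric]] crossing_sym by auto
    qed
  qed
  show "finite {Q\<in>Lam t. height Q \<ge> x}" if x0: "x > 0" for x
  proof -
    obtain N where N: "1 / x < 3 ^ N" using real_arch_pow[of 3 "1 / x"] by auto
    \<comment> \<open>The critical values of level \<open>m\<close> are among the finitely many
      preimages of the ends of \<open>C1\<close> under \<open>m\<close> triplings, and a lower bound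
      on the height bounds \<open>m\<close>.\<close>
    let ?V = "\<lambda>m. {y\<in>{0..<1}. (trip ^^ m) y = frac t} \<union> {y\<in>{0..<1}. (trip ^^ m) y = frac (t + 1/3)}"
    let ?W = "\<lambda>m v. {Q\<in>LL t v. height Q \<ge> 1 / 3 ^ m \<and> elam (LL t v)}"
    have "finite (?W m v)" for m v
    proof (cases "elam (LL t v)")
      case True
      then show ?thesis using elamD(4)[OF True, of "1 / 3 ^ m"] by simp
    qed simp
    then have "finite (\<Union>m\<in>{..N}. \<Union>v\<in>?V m. ?W m v)" using finite_trip_fibre by blast
    moreover have "{Q\<in>Lam t. height Q \<ge> x} \<subseteq> (\<Union>m\<in>{..N}. \<Union>v\<in>?V m. ?W m v)"
    proof
      fix Q assume "Q \<in> {Q\<in>Lam t. height Q \<ge> x}"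
      then obtain v m where Q: "seen t v m Q" "height Q \<ge> x" unfolding Lam_seen by blast
      have "m \<le> N"
      proof (rule ccontr)
        assume "\<not> m \<le> N"
        then have "(3::real) ^ N \<le> 3 ^ m" by (intro power_increasing) auto
        moreover have "x * 3 ^ m \<le> 1" using Q(2) seenD(3)[OF Q(1)] by (simp add: field_simps)
        moreover have "1 < x * 3 ^ N" using N x0 by (simp add: field_simps)
        moreover have "x * 3 ^ N \<le> x * 3 ^ m" using calculation(1) x0 by (intro mult_left_mono) auto
        ultimately show False by linarith
      qed
      moreover have "v \<in> ?V m" using seenD(5)[OF Q(1)] unfolding exact_def crit_def by auto
      moreover have "Q \<in> ?W m v" using seenD(2,3,6)[OF Q(1)] by auto
      ultimately show "Q \<in> (\<Union>m\<in>{..N}. \<Union>v\<in>?V m. ?W m v)" by blast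
    qed
    ultimately show ?thesis by (rule rev_finite_subset)
  qed
  show "sat (Lam t) Q p q" if QR: "Q \<in> Lam t" "R \<in> Lam t" "Q \<noteq> R \<and> height Q \<le> height R \<and> edge (tips Q) p q \<and>
     (\<forall>z\<in>tips R. carc p q z) \<and> (p \<in> tips R \<or> q \<in> tips R)" for Q R p q
  proof -
    obtain v m w j where Q: "seen t v m Q" and R: "seen t w j R" using QR(1,2) Lam_seen by metis
    show ?thesis using Lam_sat[OF Q R, of p q] QR(3) by blast
  qed
qed

section \<open>Levels and the tip over the distinguished end\<close>

definition lev :: "real \<Rightarrow> nat \<Rightarrow> leaf set" where "lev t m = {Q\<in>Lam t. height Q = 1 / 3 ^ m}"

text \<open>The original critical value \<open>v\<close> can be exchanged for the tip over
  \<open>star t\<close>: both are tips of \<open>Q\<close>, so a leaf separating them would cross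
  \<open>Q\<close>. A taller leaf with this tip would contradict its exact level.\<close>

lemma lev_star:
  assumes "Q \<in> lev t m"
  shows "\<exists>x. seen t x m Q \<and> (trip ^^ m) x = star t \<and> (\<forall>w\<in>tips Q. (trip ^^ m) w = star t \<longrightarrow> w = x) \<and>
    (\<forall>p q. edge (tips Q) p q \<longrightarrow> p \<noteq> x \<longrightarrow> q \<noteq> x \<longrightarrow> sat (Lam t) Q p q) \<and>
    (\<forall>w\<in>tips Q. (trip ^^ m) w \<in> crit t) \<and>
    (\<forall>n\<in>Lam t. height n > height Q \<longrightarrow> x \<notin> tips n)"
proof -
  obtain v k where Q: "seen t v k Q" "height Q = 1 / 3 ^ m" using assms unfolding lev_def Lam_seen by blast
  interpret V: param \<epsilon> t v k by (rule seenD(1)[OF Q(1)])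
  have "(3::real) ^ k = 3 ^ m" using seenD(3)[OF Q(1)] Q(2) by simp
  then have km: "k = m" using power_inject_exp[of "3::real" k m] by simp
  have QL: "Q \<in> V.dyn" using seenD(2)[OF Q(1)] V.LL_eq by simp
  obtain x where x: "x \<in> tips Q" "(trip ^^ m) x = star t" "\<forall>w\<in>tips Q. (trip ^^ m) w = star t \<longrightarrow> w = x"
     "\<forall>p q. edge (tips Q) p q \<longrightarrow> p \<noteq> x \<longrightarrow> q \<noteq> x \<longrightarrow> sat V.dyn Q p q"
    using V.tips_structure[OF QL Q(2)] km by blast
  have xu: "x \<in> {0..<1}" using extended_leafD(2)[OF elamD(1)[OF V.elam_dyn QL]] x(1) by blast
  have ex: "exact t m x" using exact_star[OF xu x(2)] .
  have P: "param \<epsilon> t x m" using paramI[OF ex star_not_value[OF x(2)]] .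
  have "Q \<in> LL t x"
  proof (rule ccontr)
    assume "Q \<notin> LL t x"
    then obtain i l' where l': "i < m" "l' \<in> LL t v" "l' \<in> LL t x" "height l' = 1 / 3 ^ i" "crossing (tips l') {v, x}"
      using agree_or_separated[OF seenD(1)[OF Q(1)] P _ order_refl] QL Q(2) V.LL_eq km by blast
    have "l' \<noteq> Q" using l'(1,4) Q(2) one_third_pow_less[of m i] by auto
    then have "\<not> crossing (tips l') (tips Q)" using elamD(3)[OF V.elam_dyn _ QL] l'(2) V.LL_eq by auto
    then show False using crossing_mono[OF l'(5), of "tips l'" "tips Q"] x(1) seenD(4)[OF Q(1)] by blast
  qed
  then have s: "seen t x m Q" unfolding seen_def using P Q(2) x(1) by blast
  have "(trip ^^ m) w \<in> crit t" if "w \<in> tips Q" for w using V.level_tips[OF QL Q(2)] that by blast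
  moreover have "sat (Lam t) Q p q" if "edge (tips Q) p q" "p \<noteq> x" "q \<noteq> x" for p q
    using x(4) that sat_in_Lam[OF Q(1) that(1)] V.LL_eq by simp
  moreover have "x \<notin> tips n" if n: "n \<in> Lam t" "height n > height Q" for n
  proof
    assume xn: "x \<in> tips n"
    obtain w j where w: "seen t w j n" using n(1) unfolding Lam_seen by blast
    have "m \<le> j" using seen_level_le[OF w s xn] .
    then show False using n(2) Q(2) seenD(3)[OF w] one_third_pow_less[of m j] by auto
  qed
  ultimately show ?thesis using s x(2,3) by blast
qed

lemma lev_exists:
  assumes "x \<in> {0..<1}" "(trip ^^ m) x = star t"
  shows "\<exists>Q\<in>lev t m. x \<in> tips Q"
proof -
  have ex: "exact t m x" using exact_star[OF assms] .
  interpret V: param \<epsilon> t x m using paramI[OF ex star_not_value[OF assms(2)]] .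
  obtain l where "l \<in> V.dyn" "height l = 1 / 3 ^ m" "x \<in> tips l" using V.exact_leaf_exists[OF ex] by auto
  then have "seen t x m l" unfolding seen_def using V.param_axioms V.LL_eq by simp
  then show ?thesis unfolding lev_def Lam_seen using seenD(3,4) by blast
qed

text \<open>Two leaves of one level with a common tip force a taller leaf at this tip, but no leaf
  of \<open>Lam t\<close> through \<open>x\<close> is above the level of \<open>x\<close>.\<close>

lemma seen_unique:
  assumes "seen t x m Q" "R \<in> lev t m" "x \<in> tips R"
  shows "Q = R"
proof (rule ccontr)
  assume ne: "Q \<noteq> R"
  obtain w j where R: "seen t w j R" using assms(2) unfolding lev_def Lam_seen by blast
  have QL: "Q \<in> Lam t" "R \<in> Lam t" using assms R Lam_seen by (auto simp: lev_def)
  have hh: "height Q = height R" using seenD(3)[OF assms(1)] assms(2) unfolding lev_def by simp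
  obtain p q where pq: "edge (tips Q) p q" "\<forall>z\<in>tips R. carc p q z" using elam_edge[OF elam_Lam QL ne] by blast
  have xpq: "x = p \<or> x = q" using pq(2) assms(3) edgeD(4)[OF pq(1) seenD(4)[OF assms(1)]] unfolding carc_def by blast
  then have "sat (Lam t) Q p q" using elam_sat[OF elam_Lam QL ne _ pq(1)] pq(2) hh assms(3) by auto
  then obtain n where n: "n \<in> Lam t" "height n > height Q" "x \<in> tips n" unfolding sat_def using xpq by blast
  obtain w j where w: "seen t w j n" using n(1) unfolding Lam_seen by blast
  interpret V: param \<epsilon> t w j by (rule seenD(1)[OF w])
  have "m \<le> j" using seen_level_le[OF w assms(1) n(3)] .
  then show False using n(2) seenD(3)[OF w] seenD(3)[OF assms(1)] one_third_pow_less[of m j] by auto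
qed

end

section \<open>Moving \<open>t\<close>\<close>

text \<open>\<open>a\<close> is a speed and \<open>u\<close> a time. Tripling multiplies the speed
  by 3, so a tip of level \<open>m\<close> gets speed \<open>1 / 3 ^ m\<close> in order that its
  image follows an end of \<open>C1\<close>, which has speed 1.\<close>

definition sh :: "real \<Rightarrow> real \<Rightarrow> real \<Rightarrow> real" where "sh a u x = frac (x + a * u)"

text \<open>The two sides of time 0 are kept apart because the second moving tip of a leaf depends
  on the direction of the motion.\<close>

definition dirF :: "bool \<Rightarrow> real filter" where "dirF \<sigma> = (if \<sigma> then at_right 0 else at_left 0)"

definition dedge :: "bool \<Rightarrow> real set \<Rightarrow> real \<Rightarrow> real \<Rightarrow> bool" where
  "dedge \<sigma> S x q \<longleftrightarrow> (if \<sigma> then edge S x q else edge S q x)"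

lemma sh_unit: "sh a u x \<in> {0..<1}"
  unfolding sh_def by (simp add: frac_lt_1)

lemma frac_frac_add: "frac (frac x + y) = frac (x + y)"
  using frac_frac_diff[of x "- y"] by simp

lemma trip_sh: "trip (sh a u x) = sh (3 * a) u (trip x)"
  unfolding sh_def trip_def frac_frac_add
  using frac_mult_frac[of 3 "x + a * u"] by (simp add: algebra_simps)

lemma trip_pow_sh: "(trip ^^ n) (sh a u x) = sh (3 ^ n * a) u ((trip ^^ n) x)"
  by (induction n) (simp_all add: trip_sh mult.assoc)

lemma sh_frac: "sh 1 u (frac t) = frac (t + u)"
  unfolding sh_def frac_frac_add by simp

lemma crit_shift: "crit (t + u) = sh 1 u ` crit t"
proof -
  have "sh 1 u (frac (t + 1/3)) = frac (t + u + 1/3)" unfolding sh_frac by (simp add: algebra_simps)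
  then show ?thesis unfolding crit_def by (simp add: sh_frac)
qed

lemma kap_sh: "kap (t + b * u) (sh a u x) = frac (kap t x + (a - b) * u)"
proof -
  have "kap (t + b * u) (sh a u x) = frac (x + a * u - (t + b * u))" unfolding kap_def sh_def frac_frac_diff ..
  also have "\<dots> = frac ((x - t) + (a - b) * u)" by (simp add: algebra_simps)
  finally show ?thesis unfolding kap_def frac_frac_add .
qed

lemma dirF_nhds: "eventually P (nhds 0) \<Longrightarrow> eventually P (dirF \<sigma>)"
  unfolding dirF_def by (simp add: eventually_at_filter eventually_mono)

lemma dirF_sign: "\<forall>\<^sub>F u in dirF \<sigma>. (if \<sigma> then u > 0 else u < 0)"
  unfolding dirF_def by (auto simp: eventually_at_filter)

lemma ev_less: "\<alpha> < c \<Longrightarrow> \<forall>\<^sub>F u in dirF \<sigma>. \<alpha> + \<beta> * u < (c::real)"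
proof -
  assume a: "\<alpha> < c"
  have "((\<lambda>u. \<alpha> + \<beta> * u) \<longlongrightarrow> \<alpha> + \<beta> * 0) (nhds 0)" by (intro tendsto_intros) (simp add: filterlim_ident)
  then have "\<forall>\<^sub>F u in nhds 0. \<alpha> + \<beta> * u < c" using order_tendstoD(2)[of _ \<alpha>] a by simp
  then show ?thesis by (rule dirF_nhds)
qed

lemma ev_greater: "c < \<alpha> \<Longrightarrow> \<forall>\<^sub>F u in dirF \<sigma>. (c::real) < \<alpha> + \<beta> * u"
proof -
  assume a: "c < \<alpha>"
  have "((\<lambda>u. \<alpha> + \<beta> * u) \<longlongrightarrow> \<alpha> + \<beta> * 0) (nhds 0)" by (intro tendsto_intros) (simp add: filterlim_ident)
  then have "\<forall>\<^sub>F u in nhds 0. c < \<alpha> + \<beta> * u" using order_tendstoD(1)[of _ \<alpha>] a by simp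
  then show ?thesis by (rule dirF_nhds)
qed

lemma frac_eq_int: "frac x = frac y \<Longrightarrow> \<exists>n::int. x - y = of_int n"
  unfolding frac_def by (intro exI[of _ "\<lfloor>x\<rfloor> - \<lfloor>y\<rfloor>"]) simp

lemma ev_sh_ne:
  assumes "x \<in> {0..<1}" "y \<in> {0..<1}" "x \<noteq> y \<or> a \<noteq> b"
  shows "\<forall>\<^sub>F u in dirF \<sigma>. sh a u x \<noteq> sh b u y"
proof -
  have i: "\<exists>n::int. (x - y) + (a - b) * u = of_int n" if "sh a u x = sh b u y" for u
    using frac_eq_int[OF that[unfolded sh_def]] by (simp add: algebra_simps)
  have lt: "-1 < x - y" "x - y < 1" using assms(1,2) by auto
  have no: False if "(x - y) + (a - b) * u = of_int n" "-1 < (x - y) + (a - b) * u" "(x - y) + (a - b) * u < 1"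
     "(x - y) + (a - b) * u \<noteq> 0" for u and n :: int
  proof -
    have "-1 < n" "n < 1" "n \<noteq> 0" using that by linarith+
    then show False by linarith
  qed
  have nz: "\<forall>\<^sub>F u in dirF \<sigma>. (x - y) + (a - b) * u \<noteq> 0"
  proof (cases "x = y")
    case True
    then have "a - b \<noteq> 0" using assms(3) by simp
    have "\<forall>\<^sub>F u in dirF \<sigma>. u \<noteq> 0" using dirF_sign[of \<sigma>] by eventually_elim (auto split: if_splits)
    then show ?thesis by eventually_elim (use True \<open>a - b \<noteq> 0\<close> in simp)
  next
    case False
    show ?thesis
    proof (cases "x < y")
      case True
      show ?thesis using ev_less[of "x - y" 0 "a - b" \<sigma>] True by (simp add: eventually_mono)
    next
      case F: False
      have "\<forall>\<^sub>F u in dirF \<sigma>. 0 < x - y + (a - b) * u" by (rule ev_greater) (use F False in simp)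
      then show ?thesis by eventually_elim simp
    qed
  qed
  show ?thesis using nz ev_greater[OF lt(1), of "a - b" \<sigma>] ev_less[OF lt(2), of "a - b" \<sigma>]
    by eventually_elim (use i no in blast)
qed

lemma ev_frac_id:
  assumes "0 < a" "a < 1"
  shows "\<forall>\<^sub>F u in dirF \<sigma>. frac (a + b * u) = a + b * u"
  using ev_greater[OF assms(1), of b \<sigma>] ev_less[OF assms(2), of b \<sigma>]
  by eventually_elim (simp add: frac_eq)

definition pc :: "nat \<Rightarrow> real \<Rightarrow> real \<Rightarrow> real set" where
  "pc i t s = (if i = 0 then pieceA t else if i = 1 then pieceB t s else pieceC t s)"

lemma pc_PSet: "pc i t s \<in> PSet t s"
  unfolding pc_def PSet_def by simp

lemma PSet_pc: "X \<in> PSet t s \<Longrightarrow> \<exists>i. X = pc i t s"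
  unfolding pc_def PSet_def by (auto intro: exI[of _ 0] exI[of _ 1] exI[of _ 2])

context param
begin

lemma kv: "0 < kap (3 * t) v" "kap (3 * t) v < 1" "s - t = (1 + kap (3 * t) v) / 3"
proof -
  show "s - t = (1 + kap (3 * t) v) / 3" unfolding crit_pos_def by simp
  then show "0 < kap (3 * t) v" "kap (3 * t) v < 1" using ad unfolding admissible_def by (auto simp: field_simps)
qed

text \<open>With this speed the image of \<open>v\<close> after \<open>m\<close> triplings stays on
  its end of \<open>C1\<close>. At earlier times only finitely many pairs of distinct points have to
  remain distinct, which they do for small \<open>u\<close>.\<close>

lemma ev_param: "\<forall>\<^sub>F u in dirF \<sigma>. param \<epsilon> (t + u) (sh (1 / 3 ^ m) u v) m"
proof -
  have pu: "(trip ^^ i) v \<in> {0..<1}" for i using v_unit trip_unit by (cases i) auto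
  have cu: "y \<in> {0..<1}" if "y \<in> crit t" for y using crit_unit that by blast
  have "\<forall>\<^sub>F u in dirF \<sigma>. \<forall>i\<in>{..<m}. \<forall>y\<in>crit t. sh (3 ^ i * (1 / 3 ^ m)) u ((trip ^^ i) v) \<noteq> sh 1 u y"
  proof (intro eventually_ball_finite ballI)
    fix i y assume i: "i \<in> {..<m}" "y \<in> crit t"
    then have "(trip ^^ i) v \<noteq> y" using v unfolding exact_def by auto
    then show "\<forall>\<^sub>F u in dirF \<sigma>. sh (3 ^ i * (1 / 3 ^ m)) u ((trip ^^ i) v) \<noteq> sh 1 u y"
      by (intro ev_sh_ne[OF pu cu[OF i(2)]]) blast
  qed (auto simp: crit_def)
  moreover have "\<forall>\<^sub>F u in dirF \<sigma>. sh (1 / 3 ^ m) u v \<noteq> sh 3 u (frac (3 * t))"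
    by (intro ev_sh_ne[OF v_unit]) (use vc in \<open>auto simp: frac_lt_1\<close>)
  ultimately show ?thesis
  proof eventually_elim
    case (elim u)
    have "exact (t + u) m (sh (1 / 3 ^ m) u v)"
      unfolding exact_def
    proof (intro conjI allI impI)
      show "sh (1 / 3 ^ m) u v \<in> {0..<1}" by (rule sh_unit)
      have "(trip ^^ m) v \<in> crit t" using v unfolding exact_def by blast
      then show "(trip ^^ m) (sh (1 / 3 ^ m) u v) \<in> crit (t + u)" unfolding trip_pow_sh crit_shift by simp
      show "(trip ^^ i) (sh (1 / 3 ^ m) u v) \<notin> crit (t + u)" if "i < m" for i
        using elim(1) that unfolding trip_pow_sh crit_shift by blast
    qed
    moreover have "frac (3 * (t + u)) = sh 3 u (frac (3 * t))" unfolding sh_def frac_frac_add by (simp add: algebra_simps)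
    ultimately show ?case using elim(2) by (simp add: paramI)
  qed
qed

text \<open>The coordinate of the critical value is measured from \<open>3 * t\<close>, which has
  speed 3; hence the relative speed \<open>1 / 3 ^ m - 3\<close>.\<close>

lemma ev_s_shift: "\<forall>\<^sub>F u in dirF \<sigma>. 3 * (crit_pos (t + u) (sh (1 / 3 ^ m) u v) - (t + u)) = 3 * (s - t) + (1 / 3 ^ m - 3) * u"
proof -
  have "\<forall>\<^sub>F u in dirF \<sigma>. frac (kap (3 * t) v + (1 / 3 ^ m - 3) * u) = kap (3 * t) v + (1 / 3 ^ m - 3) * u"
    by (rule ev_frac_id[OF kv(1,2)])
  then show ?thesis
  proof eventually_elim
    case (elim u)
    have "kap (3 * (t + u)) (sh (1 / 3 ^ m) u v) = frac (kap (3 * t) v + (1 / 3 ^ m - 3) * u)"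
      using kap_sh[of "3 * t" 3 u "1 / 3 ^ m" v] by (simp add: algebra_simps)
    then show ?case using elim kv(3) unfolding crit_pos_def by simp
  qed
qed

text \<open>
  The critical leaf \<open>C\<^sub>1\<close> moves faster than the other tips, so that a tip which it meets stays in
  its piece for one direction of the motion only.
\<close>

lemma ev_in_piece:
  assumes p: "p \<in> pc i t s" "p \<notin> crit s" and a: "a < 1"
    and c: "p \<in> crit t \<Longrightarrow> if \<sigma> then i = 0 \<and> 3 * kap t p = 1 \<or> i \<noteq> 0 \<and> i \<noteq> 1 \<and> kap t p = 0
                else i = 0 \<and> kap t p = 0 \<or> i \<noteq> 0 \<and> i \<noteq> 1 \<and> 3 * kap t p = 1"
  shows "\<forall>\<^sub>F u in dirF \<sigma>. sh a u p \<in> pc i (t + u) (crit_pos (t + u) (sh (1 / 3 ^ m) u v))"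
proof -
  define k where "k = kap t p"
  define T where "T = 3 * (s - t)"
  define B where "B = 1 / 3 ^ m - (3::real)"
  have ku: "0 \<le> k" "k < 1" using kap_unit unfolding k_def by simp_all
  have T: "1 < T" "T < 2" using tau[OF ad] unfolding T_def by auto
  have pu: "p \<in> {0..<1}" using p(1) PSet_sub[OF ad pc_PSet] by blast
  have nc: "3 * k \<noteq> T" "3 * k \<noteq> T + 1"
  proof -
    have "p \<notin> tips C2" using p(2) tips_C(2) by simp
    then have "\<not> (kap t p = s - t \<or> 3 * kap t p = 3 * (s - t) + 1)" using crit_tips(2)[OF ad] pu by blast
    then show "3 * k \<noteq> T" "3 * k \<noteq> T + 1" unfolding k_def T_def by auto
  qed
  have ct: "p \<in> crit t" if "k = 0 \<or> 3 * k = 1"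
  proof -
    have "p \<in> tips C1" using crit_tips(1)[OF ad] pu that unfolding k_def by blast
    then show ?thesis using tips_C(1) by simp
  qed
  have ks: "kap (t + u) (sh a u p) = frac (k + (a - 1) * u)" for u using kap_sh[of t 1 u a p] unfolding k_def by simp
  have mem: "p \<in> pc i t s \<longleftrightarrow> (if i = 0 then 3 * k \<le> 1 else if i = 1 then T \<le> 3 * k \<and> 3 * k \<le> T + 1
      else k = 0 \<or> 1 \<le> 3 * k \<and> 3 * k \<le> T \<or> T + 1 \<le> 3 * k)"
    using pu ku unfolding pc_def pieceA_def pieceB_def pieceC_def mem_Collect_eq inA_def inB_def inC_def k_def[symmetric] T_def
    by (auto simp: k_def[symmetric])
  have mem': "sh a u p \<in> pc i (t + u) (crit_pos (t + u) (sh (1 / 3 ^ m) u v))"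
    if "3 * (crit_pos (t + u) (sh (1 / 3 ^ m) u v) - (t + u)) = T + B * u" "frac (k + (a - 1) * u) = k'"
      "if i = 0 then 3 * k' \<le> 1 else if i = 1 then T + B * u \<le> 3 * k' \<and> 3 * k' \<le> T + B * u + 1
        else k' = 0 \<or> 1 \<le> 3 * k' \<and> 3 * k' \<le> T + B * u \<or> T + B * u + 1 \<le> 3 * k'" for u k'
  proof -
    have "0 \<le> k'" "k' < 1" using that(2) frac_ge_0 frac_lt_1 by blast+
    moreover have "kap (t + u) (sh a u p) = k'" using ks that(2) by simp
    ultimately show ?thesis using that(1,3) sh_unit[of a u p]
      unfolding pc_def pieceA_def pieceB_def pieceC_def inA_def inB_def inC_def by (auto simp del: atLeastLessThan_iff)
  qed
  have es: "\<forall>\<^sub>F u in dirF \<sigma>. 3 * (crit_pos (t + u) (sh (1 / 3 ^ m) u v) - (t + u)) = T + B * u"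
    using ev_s_shift unfolding T_def B_def .
  have l3: "\<forall>\<^sub>F u in dirF \<sigma>. 3 * (k + (a - 1) * u) < T + B * u" if "3 * k < T"
    using ev_less[of "3 * k - T" 0 "3 * (a - 1) - B" \<sigma>] that by (simp add: algebra_simps)
  have g3: "\<forall>\<^sub>F u in dirF \<sigma>. T + B * u < 3 * (k + (a - 1) * u)" if "T < 3 * k"
    using ev_less[of "T - 3 * k" 0 "B - 3 * (a - 1)" \<sigma>] that by (simp add: algebra_simps)
  have l4: "\<forall>\<^sub>F u in dirF \<sigma>. 3 * (k + (a - 1) * u) < T + B * u + 1" if "3 * k < T + 1"
    using ev_less[of "3 * k - T - 1" 0 "3 * (a - 1) - B" \<sigma>] that by (simp add: algebra_simps)
  have g4: "\<forall>\<^sub>F u in dirF \<sigma>. T + B * u + 1 < 3 * (k + (a - 1) * u)" if "T + 1 < 3 * k"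
    using ev_less[of "T + 1 - 3 * k" 0 "B - 3 * (a - 1)" \<sigma>] that by (simp add: algebra_simps)
  have l1: "\<forall>\<^sub>F u in dirF \<sigma>. 3 * (k + (a - 1) * u) < 1" if "3 * k < 1"
    using ev_less[of "3 * k" 1 "3 * (a - 1)" \<sigma>] that by (simp add: algebra_simps)
  have g1: "\<forall>\<^sub>F u in dirF \<sigma>. 1 < 3 * (k + (a - 1) * u)" if "1 < 3 * k"
    using ev_less[of "- (3 * k)" "-1" "3 * (1 - a)" \<sigma>] that by (simp add: algebra_simps)
  \<comment> \<open>Relative to the ends of \<open>C1\<close> the point is slower and falls behind
    the motion.\<close>
  have sg: "\<forall>\<^sub>F u in dirF \<sigma>. if \<sigma> then (a - 1) * u < 0 else (a - 1) * u > 0"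
    using dirF_sign[of \<sigma>] by eventually_elim (use a in \<open>auto simp: mult_less_0_iff zero_less_mult_iff\<close>)
  show ?thesis
  proof (cases "k = 0")
    case k0: True
    then have cc: "if \<sigma> then i \<noteq> 0 \<and> i \<noteq> 1 else i = 0" using c[OF ct] unfolding k_def[symmetric] by (auto split: if_splits)
    show ?thesis
    proof (cases \<sigma>)
      case True
      have "\<forall>\<^sub>F u in dirF \<sigma>. -1 < (a - 1) * u" using ev_greater[of "-1" 0 "a - 1" \<sigma>] by simp
      moreover have "\<forall>\<^sub>F u in dirF \<sigma>. T + B * u + 1 < 3 * (1 + (a - 1) * u)"
        using ev_less[of "T + 1 - 3" 0 "B - 3 * (a - 1)" \<sigma>] T by (simp add: algebra_simps)
      ultimately show ?thesis using es sg
      proof eventually_elim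
        case (elim u)
        \<comment> \<open>A clockwise drift from coordinate 0 leads to coordinates just below 1, in
          the second arc of the third piece.\<close>
        have "frac ((a - 1) * u) = 1 + (a - 1) * u"
          using frac_add_of_int_right[of "(a - 1) * u" 1] elim(1,4) True by (simp add: frac_eq)
        then show ?case using mem'[OF elim(3), of "1 + (a - 1) * u"] k0 cc True elim(2) by simp
      qed
    next
      case False
      have "\<forall>\<^sub>F u in dirF \<sigma>. 3 * ((a - 1) * u) < 1" using l1 k0 by simp
      then show ?thesis using es sg
      proof eventually_elim
        case (elim u)
        have "frac ((a - 1) * u) = (a - 1) * u" using elim(1,3) False by (simp add: frac_eq)
        then show ?case using mem'[OF elim(2), of "(a - 1) * u"] k0 cc False elim(1) by simp
      qed
    qed
  next
    case k0: False
    then have fi: "\<forall>\<^sub>F u in dirF \<sigma>. frac (k + (a - 1) * u) = k + (a - 1) * u" using ev_frac_id ku by simp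
    show ?thesis
    proof (cases "3 * k = 1")
      case k1: True
      then have cc: "if \<sigma> then i = 0 else i \<noteq> 0 \<and> i \<noteq> 1" using c[OF ct] k0 unfolding k_def[symmetric] by (auto split: if_splits)
      have "\<forall>\<^sub>F u in dirF \<sigma>. 3 * (k + (a - 1) * u) < T + B * u" using l3 k1 T by simp
      then show ?thesis using es sg fi
      proof eventually_elim
        case (elim u)
        then show ?case using mem'[OF elim(2,4)] k1 cc by (auto split: if_splits simp: algebra_simps)
      qed
    next
      case k1: False
      have i0: "3 * k < 1" if "i = 0" using p(1)[unfolded mem] k1 that by simp
      have i1: "T < 3 * k \<and> 3 * k < T + 1" if "i = 1" using p(1)[unfolded mem] nc that by simp
      have i2: "1 < 3 * k \<and> 3 * k < T \<or> T + 1 < 3 * k" if "i \<noteq> 0" "i \<noteq> 1"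
      proof -
        have "k = 0 \<or> 1 \<le> 3 * k \<and> 3 * k \<le> T \<or> T + 1 \<le> 3 * k" using p(1)[unfolded mem] that by simp
        then show ?thesis using nc k0 k1 by (smt (z3))
      qed
      consider (1) "i = 0" "3 * k < 1" | (2) "i = 1" "T < 3 * k" "3 * k < T + 1" | (3) "i \<noteq> 0" "i \<noteq> 1" "1 < 3 * k" "3 * k < T"
        | (4) "i \<noteq> 0" "i \<noteq> 1" "T + 1 < 3 * k"
        using i0 i1 i2 by blast
      then show ?thesis
      proof cases
        case 1
        show ?thesis using l1[OF 1(2)] es fi
        proof eventually_elim
          case (elim u)
          show ?case by (rule mem'[OF elim(2,3)]) (use 1 elim(1) in simp)
        qed
      next
        case 2
        show ?thesis using g3[OF 2(2)] l4[OF 2(3)] es fi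
        proof eventually_elim
          case (elim u)
          show ?case by (rule mem'[OF elim(3,4)]) (use 2 elim(1,2) in simp)
        qed
      next
        case 3
        show ?thesis using g1[OF 3(3)] l3[OF 3(4)] es fi
        proof eventually_elim
          case (elim u)
          show ?case by (rule mem'[OF elim(3,4)]) (use 3 elim(1,2) in simp)
        qed
      next
        case 4
        show ?thesis using g4[OF 4(3)] es fi
        proof eventually_elim
          case (elim u)
          show ?case by (rule mem'[OF elim(2,3)]) (use 4 elim(1) in simp)
        qed
      qed
    qed
  qed
qed

end

section \<open>Lifting the motion to a leaf of given level\<close>

lemma dedgeD:
  assumes "dedge \<sigma> S x q"
  shows "x \<in> S" "q \<in> S" "x \<noteq> q"
  using assms edgeD(1-3)[of S x q] edgeD(1-3)[of S q x] unfolding dedge_def by (auto split: if_splits)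

lemma dedge_unique: "dedge \<sigma> S x q \<Longrightarrow> dedge \<sigma> S x q' \<Longrightarrow> q = q'"
  using edge_unique_from edge_unique_to unfolding dedge_def by (auto split: if_splits)

text \<open>Just before or after a collision only the tip over \<open>star t\<close> and one
  neighbour are present, so the moved leaf is a geodesic even where the leaf at the collision is a
  polygon.\<close>

definition slid :: "nat \<Rightarrow> real \<Rightarrow> real \<Rightarrow> real \<Rightarrow> leaf" where
  "slid k u x q = Leaf (1 / 3 ^ k) {sh (1 / 3 ^ k) u x, sh (1 / 3 ^ k) u q}"

lemma star_not_crit: "(trip ^^ Suc k) x = star t \<Longrightarrow> x \<notin> crit t"
  using star(2)[of x t "Suc k"] by auto

context param
begin

lemma crit_not_level: "y \<in> crit s \<Longrightarrow> (trip ^^ Suc k) y \<in> crit t \<Longrightarrow> Suc k \<le> m \<Longrightarrow> False"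
  using not_hit_s[of "Suc k" y 0] by simp

lemma crit_both: "X \<in> PS \<Longrightarrow> y \<in> crit t \<Longrightarrow> y \<in> X \<Longrightarrow> \<exists>y'. hole X y y' \<or> hole X y' y"
proof -
  assume X: "X \<in> PS" and y: "y \<in> crit t" "y \<in> X"
  have "C1 \<in> K" unfolding K_eq by simp
  then obtain Y where "Y \<in> PS" "Y \<noteq> X" "tips C1 \<subseteq> Y" using K_piece X by blast
  then show ?thesis using side[of X Y y] X y tips_C(1) by blast
qed

text \<open>The first piece lies inside \<open>C1\<close> and the third outside, so the ends bound
  their holes in opposite orders; the second piece does not reach \<open>C1\<close>.\<close>

lemma hole_C1:
  assumes "hole (pc i t s) e b" "e \<in> crit t \<or> b \<in> crit t"
  shows "i = 0 \<and> 3 * kap t e = 1 \<and> kap t b = 0 \<or> i \<noteq> 0 \<and> i \<noteq> 1 \<and> kap t e = 0 \<and> 3 * kap t b = 1"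
proof -
  note h = holeD[OF assms(1)]
  have eb: "{e, b} = crit t \<or> {e, b} = crit s" using hole_crit[OF pc_PSet assms(1)] .
  have C: "C1 \<in> K" "C2 \<in> K" unfolding K_eq by auto
  have "C1 \<noteq> C2" using tips_C(3,4) eps by auto
  then have dj: "crit t \<inter> crit s = {}" using K_disj[OF C] tips_C by simp
  then have "{e, b} = crit t" using eb assms(2) by blast
  then have eb1: "e \<in> tips C1" "b \<in> tips C1" using tips_C(1) by auto
  have ebu: "e \<in> {0..<1}" "b \<in> {0..<1}" using eb1 crit_tips(1)[OF ad] by blast+
  have k: "(kap t e = 0 \<or> 3 * kap t e = 1)" "(kap t b = 0 \<or> 3 * kap t b = 1)" using eb1 crit_tips(1)[OF ad] by blast+
  have "kap t e \<noteq> kap t b" using h(3) kap_inj[OF ebu] by simp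
  then have k2: "kap t e = 0 \<and> 3 * kap t b = 1 \<or> 3 * kap t e = 1 \<and> kap t b = 0" using k by auto
  have i1: "i \<noteq> 1"
  proof
    assume "i = 1"
    then have "e \<in> pieceB t s" using h(1) unfolding pc_def by simp
    then show False using k(1) tau[OF ad] unfolding pieceB_def inB_def by auto
  qed
  show ?thesis
  proof (cases "i = 0")
    case True
    have "\<not> (kap t e = 0 \<and> 3 * kap t b = 1)"
    proof
      assume a: "kap t e = 0 \<and> 3 * kap t b = 1"
      then have "hole (pc i t s) b e" using hole_pieces(1)[OF ad ebu(2,1)] True unfolding pc_def by simp
      then show False using hole_asym[OF pc_PSet assms(1)] by blast
    qed
    then show ?thesis using k2 True by blast
  next
    case False
    have "\<not> (3 * kap t e = 1 \<and> kap t b = 0)"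
    proof
      assume a: "3 * kap t e = 1 \<and> kap t b = 0"
      then have "hole (pc i t s) b e" using hole_pieces(3)[OF ad ebu(2,1)] False i1 unfolding pc_def by simp
      then show False using hole_asym[OF pc_PSet assms(1)] by blast
    qed
    then show ?thesis using k2 False i1 by blast
  qed
qed

text \<open>The moved leaf is rebuilt as the lift of the moved image. After a small motion no tip of
  this image is a critical value, so the lift in the moved piece has exactly one point over each. It
  remains to see that \<open>x\<close> and \<open>q\<close> stay in their piece, which is delicate
  only if \<open>q\<close> is an end of \<open>C1\<close>.\<close>

lemma ev_slid:
  assumes "l \<in> dyn" "height l = 1 / 3 ^ k" "k \<le> m" "x \<in> tips l" "(trip ^^ k) x = star t" "dedge \<sigma> (tips l) x q"
  shows "\<forall>\<^sub>F u in dirF \<sigma>. slid k u x q \<in> LL (t + u) (sh (1 / 3 ^ m) u v)"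
  using assms
proof (induction k arbitrary: l x q)
  case 0
  have "l = C1" using level_0 0 by simp
  then have "crit t = {x, q}" using tips_C(1) dedgeD[OF 0(6)] unfolding crit_def by auto
  then have e: "slid 0 u x q = simple_critical_leaf 1 (t + u)" for u
    using crit_shift[of t u] unfolding slid_def simple_critical_leaf_def crit_def by auto
  show ?case using ev_param
  proof eventually_elim
    case (elim u)
    interpret U: param \<epsilon> "t + u" "sh (1 / 3 ^ m) u v" m by (rule elim)
    show ?case using U.K_dyn[of U.C1] U.K_eq U.LL_eq e by simp
  qed
next
  case (Suc k)
  obtain X Q where X: "X \<in> PS" and Q: "Q \<in> dyn" "height Q = 1 / 3 ^ k" and l: "l = pull dyn X Q"
    using level_pull[OF Suc.prems(1,2)] .
  obtain i where i: "X = pc i t s" using PSet_pc[OF X] by blast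
  have km: "k \<le> m" using Suc.prems(3) by simp
  define y r where "y = trip x" and "r = trip q"
  have tx: "(trip ^^ Suc k) z = (trip ^^ k) (trip z)" for z by (simp add: funpow_Suc_right del: funpow.simps)
  note de = dedgeD[OF Suc.prems(6)]
  have xX: "x \<in> X" "q \<in> X" using de l pull_tips(1) by blast+
  have yQ: "y \<in> tips Q" "r \<in> tips Q" using de l pull_tips(2) y_def r_def by blast+
  have ys: "(trip ^^ k) y = star t" using Suc.prems(5) tx y_def by simp
  have yr: "y \<noteq> r"
  proof
    assume "y = r"
    then have "(trip ^^ Suc k) q = star t" using ys tx r_def by simp
    then show False using tips_structure[OF Suc.prems(1-3)] de Suc.prems(5) by metis
  qed
  have e': "dedge \<sigma> (tips (pull dyn X Q)) x q" using Suc.prems(6) l by simp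
  have dQ: "dedge \<sigma> (tips Q) y r"
  proof (cases \<sigma>)
    case True
    then have "edge (tips (pull dyn X Q)) x q" using e' unfolding dedge_def by simp
    then show ?thesis using D.pull_edge[OF X Q(1)] yr holeD(4) True unfolding dedge_def y_def r_def by metis
  next
    case False
    then have "edge (tips (pull dyn X Q)) q x" using e' unfolding dedge_def by simp
    then show ?thesis using D.pull_edge[OF X Q(1)] yr holeD(4) False unfolding dedge_def y_def r_def by metis
  qed
  have lev: "(trip ^^ Suc k) z \<in> crit t" if "z \<in> tips l" for z using level_tips[OF Suc.prems(1,2)] that by blast
  have ncs: "z \<notin> crit s" if "z \<in> tips l" for z using crit_not_level[OF _ lev[OF that] Suc.prems(3)] by blast
  have xct: "x \<notin> crit t" using star_not_crit Suc.prems(5) by blast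
  have yu: "y \<in> {0..<1}" "r \<in> {0..<1}" using trip_unit y_def r_def by auto
  have ey: "exact t k y" using exact_star[OF yu(1) ys] .
  have ns: "\<not> sat dyn Q a b" if "a = y \<or> b = y" for a b using exact_not_sat[OF ey km Q(2)] that by blast
  \<comment> \<open>The piece must lie on the side to which \<open>q\<close> drifts relative to
    \<open>C1\<close>. Otherwise the other end of the hole lies between \<open>x\<close> and
    \<open>q\<close> without being a tip, so \<open>pull\<close> omitted it on account of a
    saturated edge of \<open>Q\<close> at \<open>y\<close>; but \<open>y\<close> lies over
    \<open>star t\<close> and has no saturated edge.\<close>
  have qdir: "if \<sigma> then i = 0 \<and> 3 * kap t q = 1 \<or> i \<noteq> 0 \<and> i \<noteq> 1 \<and> kap t q = 0
                else i = 0 \<and> kap t q = 0 \<or> i \<noteq> 0 \<and> i \<noteq> 1 \<and> 3 * kap t q = 1" if qc: "q \<in> crit t"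
  proof -
    obtain q' where q': "hole X q q' \<or> hole X q' q" using crit_both[OF X qc xX(2)] by blast
    have "trip q' = r" using q' holeD(4) r_def by metis
    have xq': "x \<noteq> q'" using \<open>trip q' = r\<close> yr y_def by auto
    show ?thesis
    proof (cases \<sigma>)
      case s: True
      have "\<not> hole X q' q"
      proof
        assume h: "hole X q' q"
        have "btw x q' q" using holeD(3,5)[OF h] xX btw_cases[of q' x q] btw_rot xq' de(3) by metis
        then have "q' \<notin> tips (pull dyn X Q)" using e' s unfolding dedge_def edge_def by auto
        then obtain p where "edge (tips Q) p r" "sat dyn Q p r"
          using pull_memI[of q' X Q dyn] holeD(1)[OF h] yQ(2) \<open>trip q' = r\<close> hole_trans[OF X _ h] by metis
        moreover have "edge (tips Q) y r" using dQ s unfolding dedge_def by simp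
        ultimately show False using edge_unique_to ns by blast
      qed
      then have "hole (pc i t s) q q'" using q' i by blast
      then show ?thesis using hole_C1[of i q q'] qc s by auto
    next
      case s: False
      have "\<not> hole X q q'"
      proof
        assume h: "hole X q q'"
        have "btw q q' x" using holeD(3,5)[OF h] xX btw_cases[of q q' x] xq' de(3) by metis
        then have "q' \<notin> tips (pull dyn X Q)" using e' s unfolding dedge_def edge_def by auto
        then obtain p where "edge (tips Q) r p" "sat dyn Q r p"
          using pull_memI[of q' X Q dyn] holeD(2)[OF h] yQ(2) \<open>trip q' = r\<close> hole_trans[OF X h] by metis
        moreover have "edge (tips Q) r y" using dQ s unfolding dedge_def by simp
        ultimately show False using edge_unique_from ns by blast
      qed
      then have "hole (pc i t s) q' q" using q' i by blast
      then show ?thesis using hole_C1[of i q' q] qc s by auto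
    qed
  qed
  let ?a = "1 / 3 ^ Suc k :: real"
  have a1: "?a < 1" using one_third_pow_less[of "Suc k" 0] by simp
  have "\<forall>\<^sub>F u in dirF \<sigma>. sh ?a u x \<in> pc i (t + u) (crit_pos (t + u) (sh (1 / 3 ^ m) u v))"
    by (rule ev_in_piece[OF _ ncs[OF de(1)] a1]) (use xX i xct in auto)
  moreover have "\<forall>\<^sub>F u in dirF \<sigma>. sh ?a u q \<in> pc i (t + u) (crit_pos (t + u) (sh (1 / 3 ^ m) u v))"
    by (rule ev_in_piece[OF _ ncs[OF de(2)] a1 qdir]) (use xX i in auto)
  moreover have "\<forall>\<^sub>F u in dirF \<sigma>. slid k u y r \<in> LL (t + u) (sh (1 / 3 ^ m) u v)"
    using Suc.IH[OF Q km yQ(1) ys dQ] .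
  moreover have cne: "\<forall>\<^sub>F u in dirF \<sigma>. sh (1 / 3 ^ k) u z \<noteq> sh 3 u (frac (3 * t))" if "z \<in> {0..<1}" for z
  proof (rule ev_sh_ne[OF that])
    have "(1::real) / 3 ^ k \<le> 1" by simp
    then have "(1::real) / 3 ^ k \<noteq> 3" by linarith
    then show "z \<noteq> frac (3 * t) \<or> 1 / 3 ^ k \<noteq> (3::real)" by blast
  qed (simp add: frac_lt_1)
  have vQ: "v \<notin> tips Q"
  proof
    assume "v \<in> tips Q"
    then have "(trip ^^ k) v \<in> crit t" using level_tips[OF Q] by blast
    then show False using v Suc.prems(3) unfolding exact_def by auto
  qed
  have vne: "\<forall>\<^sub>F u in dirF \<sigma>. sh (1 / 3 ^ k) u z \<noteq> sh (1 / 3 ^ m) u v" if "z \<in> tips Q" "z \<in> {0..<1}" for z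
    by (rule ev_sh_ne[OF that(2) v_unit]) (use vQ that(1) in auto)
  note cne[OF yu(1)] cne[OF yu(2)] vne[OF yQ(1) yu(1)] vne[OF yQ(2) yu(2)]
  moreover note ev_param[of \<sigma>]
  ultimately show ?case
    using cne[OF yu(1)] cne[OF yu(2)] vne[OF yQ(1) yu(1)] vne[OF yQ(2) yu(2)]
  proof eventually_elim
    case (elim u)
    interpret U: param \<epsilon> "t + u" "sh (1 / 3 ^ m) u v" m by fact
    let ?X = "pc i (t + u) U.s"
    have XU: "?X \<in> U.PS" by (rule pc_PSet)
    let ?Q = "slid k u y r"
    have QU: "?Q \<in> U.dyn" using elim(3) U.LL_eq by simp
    have sx: "sh ?a u x \<in> ?X" "sh ?a u q \<in> ?X" using elim(1,2) by auto
    have tr: "trip (sh ?a u x) = sh (1 / 3 ^ k) u y" "trip (sh ?a u q) = sh (1 / 3 ^ k) u r"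
      unfolding trip_sh y_def r_def by simp_all
    have cu: "frac (3 * (t + u)) = sh 3 u (frac (3 * t))" unfolding sh_def frac_frac_add by (simp add: algebra_simps)
    have nh: "\<not> hole ?X z w \<and> \<not> hole ?X w z" if z: "trip z = sh (1 / 3 ^ k) u y \<or> trip z = sh (1 / 3 ^ k) u r" for z w
    proof -
      have "trip z \<noteq> frac (3 * (t + u))" "trip z \<noteq> sh (1 / 3 ^ m) u v"
        using z cu elim by metis+
      then have "z \<notin> crit (t + u)" "z \<notin> crit U.s" using trip_crit U.trip_crit_s by blast+
      then show ?thesis using U.hole_crit[OF XU] by blast
    qed
    have tQ: "tips ?Q = {sh (1 / 3 ^ k) u y, sh (1 / 3 ^ k) u r}" unfolding slid_def by simp
    have "tips (pull U.dyn ?X ?Q) = {sh ?a u x, sh ?a u q}"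
    proof (intro subset_antisym subsetI)
      fix z assume z: "z \<in> tips (pull U.dyn ?X ?Q)"
      then have zX: "z \<in> ?X" and tz: "trip z = trip (sh ?a u x) \<or> trip z = trip (sh ?a u q)"
        using U.pull_tips[OF z] tQ tr by auto
      have "z = sh ?a u x \<or> z = sh ?a u q"
        using tz U.hol[OF XU zX sx(1)] U.hol[OF XU zX sx(2)] nh[of z] tr by metis
      then show "z \<in> {sh ?a u x, sh ?a u q}" by blast
    next
      fix z assume "z \<in> {sh ?a u x, sh ?a u q}"
      then have z: "z \<in> ?X" "trip z = sh (1 / 3 ^ k) u y \<or> trip z = sh (1 / 3 ^ k) u r" using sx tr by auto
      have "trip z \<in> tips ?Q" using z(2) tQ by auto
      then show "z \<in> tips (pull U.dyn ?X ?Q)" using U.pull_memI[OF z(1)] nh[OF z(2)] by blast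
    qed
    then have "slid (Suc k) u x q = pull U.dyn ?X ?Q"
      by (intro leaf.expand) (simp add: U.height_pull slid_def)
    then show ?case using U.pull_dyn[OF XU QU] U.LL_eq by simp
  qed
qed

end

context eps_small
begin

lemma ev_slid_lev:
  assumes Q: "Q \<in> lev t m" and x: "x \<in> tips Q" "(trip ^^ m) x = star t" and d: "dedge \<sigma> (tips Q) x q"
  shows "\<forall>\<^sub>F u in dirF \<sigma>. seen (t + u) (sh (1 / 3 ^ m) u x) m (slid m u x q)"
proof -
  obtain x' where x': "seen t x' m Q" "\<forall>w\<in>tips Q. (trip ^^ m) w = star t \<longrightarrow> w = x'" using lev_star[OF Q] by blast
  then have s: "seen t x m Q" using x by blast
  interpret param \<epsilon> t x m by (rule seenD(1)[OF s])
  have "\<forall>\<^sub>F u in dirF \<sigma>. slid m u x q \<in> LL (t + u) (sh (1 / 3 ^ m) u x)"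
    using ev_slid[of Q m x \<sigma> q] seenD(2,3)[OF s] LL_eq x d by simp
  then show ?thesis using ev_param[of \<sigma>]
  proof eventually_elim
    case (elim u)
    then show ?case unfolding seen_def by (simp add: slid_def)
  qed
qed

section \<open>Classes of tips and local transport of a level\<close>

lemma lev_Lam: "Q \<in> lev t m \<Longrightarrow> Q \<in> Lam t" and lev_height: "Q \<in> lev t m \<Longrightarrow> height Q = 1 / 3 ^ m"
  unfolding lev_def by auto

lemma lev_unit: "Q \<in> lev t m \<Longrightarrow> tips Q \<subseteq> {0..<1}"
  using extended_leafD(2)[OF elamD(1)[OF elam_Lam lev_Lam]] .

lemma finite_lev: "finite (lev t m)"
proof (rule finite_subset)
  show "lev t m \<subseteq> {Q\<in>Lam t. height Q \<ge> 1 / 3 ^ m}" unfolding lev_def by auto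
  show "finite {Q\<in>Lam t. height Q \<ge> 1 / 3 ^ m}" using elamD(4)[OF elam_Lam, of "1 / 3 ^ m"] by simp
qed

lemma Lam_lev: "Lam t = (\<Union>m. lev t m)"
proof -
  have "\<exists>m. Q \<in> lev t m" if "Q \<in> Lam t" for Q
    using that seenD(3) unfolding lev_def by (metis (mono_tags, lifting) Lam_seen mem_Collect_eq)
  then show ?thesis unfolding lev_def by blast
qed

definition star_tip :: "real \<Rightarrow> nat \<Rightarrow> leaf \<Rightarrow> real" where
  "star_tip t m Q = (THE x. x \<in> tips Q \<and> (trip ^^ m) x = star t)"

lemma star_tip:
  assumes "Q \<in> lev t m"
  shows "star_tip t m Q \<in> tips Q" "(trip ^^ m) (star_tip t m Q) = star t" "seen t (star_tip t m Q) m Q"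
    "\<And>w. w \<in> tips Q \<Longrightarrow> (trip ^^ m) w = star t \<Longrightarrow> w = star_tip t m Q"
    "\<And>p q. edge (tips Q) p q \<Longrightarrow> p \<noteq> star_tip t m Q \<Longrightarrow> q \<noteq> star_tip t m Q \<Longrightarrow> sat (Lam t) Q p q"
    "\<And>w. w \<in> tips Q \<Longrightarrow> (trip ^^ m) w \<in> crit t"
    "\<And>n. n \<in> Lam t \<Longrightarrow> height n > height Q \<Longrightarrow> star_tip t m Q \<notin> tips n"
proof -
  obtain x where x: "seen t x m Q \<and> (trip ^^ m) x = star t \<and> (\<forall>w\<in>tips Q. (trip ^^ m) w = star t \<longrightarrow> w = x) \<and>
    (\<forall>p q. edge (tips Q) p q \<longrightarrow> p \<noteq> x \<longrightarrow> q \<noteq> x \<longrightarrow> sat (Lam t) Q p q) \<and>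
    (\<forall>w\<in>tips Q. (trip ^^ m) w \<in> crit t) \<and> (\<forall>n\<in>Lam t. height n > height Q \<longrightarrow> x \<notin> tips n)"
    using lev_star[OF assms] by blast
  have xt: "x \<in> tips Q" using x seenD(4) by blast
  have e: "star_tip t m Q = x" unfolding star_tip_def by (rule the_equality) (use x xt in blast)+
  show "star_tip t m Q \<in> tips Q" "(trip ^^ m) (star_tip t m Q) = star t" "seen t (star_tip t m Q) m Q"
    "\<And>w. w \<in> tips Q \<Longrightarrow> (trip ^^ m) w = star t \<Longrightarrow> w = star_tip t m Q"
    "\<And>p q. edge (tips Q) p q \<Longrightarrow> p \<noteq> star_tip t m Q \<Longrightarrow> q \<noteq> star_tip t m Q \<Longrightarrow> sat (Lam t) Q p q"
    "\<And>w. w \<in> tips Q \<Longrightarrow> (trip ^^ m) w \<in> crit t"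
    "\<And>n. n \<in> Lam t \<Longrightarrow> height n > height Q \<Longrightarrow> star_tip t m Q \<notin> tips n"
    unfolding e using x xt by blast+
qed

lemma star_tip_isolated:
  assumes Q: "Q \<in> lev t m"
  shows "(star_tip t m Q, y) \<notin> saturated_edges (Lam t) Q" "(y, star_tip t m Q) \<notin> saturated_edges (Lam t) Q"
  unfolding saturated_edges_iff[OF elam_Lam lev_Lam[OF Q]] using star_tip(7)[OF Q] unfolding sat_def by blast+

lemma star_tip_class:
  assumes Q: "Q \<in> lev t m" and r: "(z, y) \<in> (saturated_edges (Lam t) Q)\<^sup>*"
  shows "z = star_tip t m Q \<longleftrightarrow> y = star_tip t m Q"
  using r by (induction rule: rtrancl_induct) (use star_tip_isolated[OF Q] in blast)+

text \<open>Edges that do not end at the star tip are saturated. Following them from any other tip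
  against the direction of the motion ends at \<open>q\<close>; formally, a counterexample at
  minimal distance \<open>f\<close> from the star tip has a closer neighbour in the same
  class.\<close>

lemma other_class:
  assumes Q: "Q \<in> lev t m" and d: "dedge \<sigma> (tips Q) (star_tip t m Q) q" and w: "w \<in> tips Q" "w \<noteq> star_tip t m Q"
  shows "(w, q) \<in> (saturated_edges (Lam t) Q)\<^sup>*"
proof (rule ccontr)
  define x where "x = star_tip t m Q"
  let ?R = "saturated_edges (Lam t) Q"
  assume n: "(w, q) \<notin> ?R\<^sup>*"
  define A where "A = {w\<in>tips Q. w \<noteq> x \<and> (w, q) \<notin> ?R\<^sup>*}"
  define f where "f = (\<lambda>w. if \<sigma> then frac (w - x) else frac (x - w))"
  have fin: "finite A" "A \<noteq> {}" using extended_leafD(3)[OF elamD(1)[OF elam_Lam lev_Lam[OF Q]]] w n unfolding A_def x_def by auto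
  obtain a where a: "a \<in> A" "\<And>b. b \<in> A \<Longrightarrow> \<not> f b < f a"
    using arg_min_if_finite[OF fin, of f] by metis
  have aQ: "a \<in> tips Q" "a \<noteq> x" "(a, q) \<notin> ?R\<^sup>*" using a(1) unfolding A_def by auto
  have xQ: "x \<in> tips Q" using star_tip(1)[OF Q] x_def by simp
  have u: "y \<in> {0..<1}" if "y \<in> tips Q" for y using lev_unit[OF Q] that by blast
  have step: False if b: "b \<in> tips Q" "b \<noteq> x" "(a, b) \<in> ?R" "f b < f a" for b
  proof -
    have "(b, q) \<notin> ?R\<^sup>*" using aQ(3) b(3) by (meson converse_rtrancl_into_rtrancl)
    then have "b \<in> A" using b unfolding A_def by simp
    then show False using a(2) b(4) by blast
  qed
  have aq: "a \<noteq> q" using aQ(3) by auto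
  show False
  proof (cases \<sigma>)
    case True
    obtain b where b: "edge (tips Q) b a" using elam_edges(2)[OF elam_Lam lev_Lam[OF Q] aQ(1)] by blast
    have bx: "b \<noteq> x"
    proof
      assume "b = x"
      then have "a = q" using edge_unique_from[OF b] d True unfolding dedge_def x_def by simp
      then show False using aq by blast
    qed
    have "sat (Lam t) Q b a" using star_tip(5)[OF Q b] bx aQ(2) x_def by blast
    then have r: "(a, b) \<in> ?R" unfolding saturated_edges_iff[OF elam_Lam lev_Lam[OF Q]] using b by blast
    have bQ: "b \<in> tips Q" using edgeD(1)[OF b] .
    have "btw x b a" using edgeD(3,4)[OF b] xQ btw_cases[of b x a] btw_rot bx aQ(2) by metis
    then have "frac (b - x) < frac (a - x)" using btw_frac_less u[OF xQ] u[OF bQ] u[OF aQ(1)] by blast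
    then show False using step[OF bQ bx r] True unfolding f_def by simp
  next
    case False
    obtain b where b: "edge (tips Q) a b" using elam_edges(1)[OF elam_Lam lev_Lam[OF Q] aQ(1)] by blast
    have bx: "b \<noteq> x"
    proof
      assume "b = x"
      then have "a = q" using edge_unique_to[OF b] d False unfolding dedge_def x_def by simp
      then show False using aq by blast
    qed
    have "sat (Lam t) Q a b" using star_tip(5)[OF Q b] bx aQ(2) x_def by blast
    then have r: "(a, b) \<in> ?R" unfolding saturated_edges_iff[OF elam_Lam lev_Lam[OF Q]] using b by blast
    have bQ: "b \<in> tips Q" using edgeD(2)[OF b] .
    have "btw a b x" using edgeD(3,4)[OF b] xQ btw_cases[of a b x] bx aQ(2) by metis
    then have "frac (x - b) < frac (x - a)" using btw_frac_less' u[OF xQ] u[OF bQ] u[OF aQ(1)] by blast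
    then show False using step[OF bQ bx r] False unfolding f_def by simp
  qed
qed

lemma sh_inj: "x \<in> {0..<1} \<Longrightarrow> y \<in> {0..<1} \<Longrightarrow> sh a u x = sh a u y \<longleftrightarrow> x = y"
proof -
  assume u: "x \<in> {0..<1}" "y \<in> {0..<1}"
  have "sh a u w = kap (- a * u) w" for w unfolding sh_def kap_def by simp
  then show ?thesis using kap_inj[OF u] by simp
qed

lemma sh_sh: "sh a u (sh a w x) = sh a (w + u) x"
  unfolding sh_def frac_frac_add by (simp add: algebra_simps)

lemma sh_0: "x \<in> {0..<1} \<Longrightarrow> sh a 0 x = x"
  unfolding sh_def by (simp add: frac_eq)

text \<open>The star tip is a class of its own and all other tips form one class.
  \<open>slides_to\<close> keeps exactly one tip of each, here the star tip and
  \<open>q\<close>.\<close>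

lemma slides_to_slid:
  assumes Q: "Q \<in> lev t m" and d: "dedge \<sigma> (tips Q) (star_tip t m Q) q"
  shows "slides_to (Lam t) Q (1 / 3 ^ m * u) (slid m u (star_tip t m Q) q)"
proof -
  define x where "x = star_tip t m Q"
  have xq: "x \<in> tips Q" "q \<in> tips Q" "x \<noteq> q" using dedgeD[OF d] x_def by auto
  have tl: "tips (slid m u x q) = {sh (1 / 3 ^ m) u x, sh (1 / 3 ^ m) u q}" unfolding slid_def by simp
  have mem: "frac (y + 1 / 3 ^ m * u) \<in> tips (slid m u x q) \<longleftrightarrow> y = x \<or> y = q" if "y \<in> tips Q" for y
  proof -
    have "y \<in> {0..<1}" "x \<in> {0..<1}" "q \<in> {0..<1}" using lev_unit[OF Q] that xq by blast+
    then have "sh (1 / 3 ^ m) u y = sh (1 / 3 ^ m) u x \<longleftrightarrow> y = x" "sh (1 / 3 ^ m) u y = sh (1 / 3 ^ m) u q \<longleftrightarrow> y = q"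
      using sh_inj by blast+
    then show ?thesis unfolding tl sh_def[symmetric] by blast
  qed
  let ?R = "saturated_edges (Lam t) Q"
  have "\<exists>!y. y \<in> tips Q \<and> (z, y) \<in> ?R\<^sup>* \<and> frac (y + 1 / 3 ^ m * u) \<in> tips (slid m u x q)" if z: "z \<in> tips Q" for z
  proof (cases "z = x")
    case True
    have "y = x" if "(z, y) \<in> ?R\<^sup>*" for y using star_tip_class[OF Q that] True x_def by blast
    then show ?thesis using True mem xq by (intro ex1I[of _ x]) blast+
  next
    case False
    have "(z, q) \<in> ?R\<^sup>*" using other_class[OF Q d z] False unfolding x_def by blast
    moreover have "y = q" if "y \<in> tips Q" "(z, y) \<in> ?R\<^sup>*" "frac (y + 1 / 3 ^ m * u) \<in> tips (slid m u x q)" for y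
      using star_tip_class[OF Q that(2)] mem[OF that(1)] that(3) False unfolding x_def by blast
    ultimately show ?thesis using mem xq by (intro ex1I[of _ q]) blast+
  qed
  moreover have "tips (slid m u x q) \<subseteq> (\<lambda>x. frac (x + 1 / 3 ^ m * u)) ` tips Q" unfolding tl sh_def using xq by blast
  ultimately show ?thesis unfolding slides_to_def x_def[symmetric] by blast
qed

lemma dedge_ex: "Q \<in> lev t m \<Longrightarrow> x \<in> tips Q \<Longrightarrow> \<exists>q. dedge \<sigma> (tips Q) x q"
  using elam_edges[OF elam_Lam lev_Lam] unfolding dedge_def by (cases \<sigma>) auto

text \<open>With two tips the neighbour is the same in both directions, so the leaf moves rigidly
  for either sign of \<open>u\<close>.\<close>

lemma slides_to_pair:
  assumes Q: "Q \<in> lev t m" and ab: "tips Q = {a, b}" "a \<noteq> b"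
  shows "slides_to (Lam t) Q (1 / 3 ^ m * u) (slid m u a b)"
proof -
  define x where "x = star_tip t m Q"
  have xab: "x = a \<or> x = b" using star_tip(1)[OF Q] ab x_def by simp
  obtain q where q: "dedge True (tips Q) x q" using dedge_ex[OF Q] star_tip(1)[OF Q] x_def by blast
  have "{x, q} = {a, b}" using dedgeD[OF q] ab xab by auto
  then have "slid m u a b = slid m u x q" unfolding slid_def by (metis image_empty image_insert)
  then show ?thesis using slides_to_slid[OF Q, of True q u] q x_def by simp
qed

definition transport :: "real \<Rightarrow> nat \<Rightarrow> real \<Rightarrow> leaf \<Rightarrow> leaf" where
  "transport t m t' Q = (if t' = t then Q
     else slid m (t' - t) (star_tip t m Q) (SOME q. dedge (t < t') (tips Q) (star_tip t m Q) q))"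

lemma transport_ev:
  assumes Q: "Q \<in> lev t m"
  shows "\<exists>\<delta>>0. \<forall>t'. 0 < \<bar>t' - t\<bar> \<and> \<bar>t' - t\<bar> < \<delta> \<longrightarrow>
     seen t' (sh (1 / 3 ^ m) (t' - t) (star_tip t m Q)) m (transport t m t' Q)"
proof -
  define x where "x = star_tip t m Q"
  have x: "x \<in> tips Q" "(trip ^^ m) x = star t" using star_tip(1,2)[OF Q] x_def by auto
  have s: "dedge \<sigma> (tips Q) x (SOME q. dedge \<sigma> (tips Q) x q)" for \<sigma> using dedge_ex[OF Q x(1)] by (rule someI_ex)
  have "\<forall>\<^sub>F u in at_right 0. seen (t + u) (sh (1 / 3 ^ m) u x) m (slid m u x (SOME q. dedge True (tips Q) x q))"
    using ev_slid_lev[OF Q x s[of True]] unfolding dirF_def by simp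
  then obtain d1 where d1: "d1 > 0" "\<And>u. 0 < u \<Longrightarrow> u < d1 \<Longrightarrow> seen (t + u) (sh (1 / 3 ^ m) u x) m (slid m u x (SOME q. dedge True (tips Q) x q))"
    unfolding eventually_at_right_field by auto
  have "\<forall>\<^sub>F u in at_left 0. seen (t + u) (sh (1 / 3 ^ m) u x) m (slid m u x (SOME q. dedge False (tips Q) x q))"
    using ev_slid_lev[OF Q x s[of False]] unfolding dirF_def by simp
  then obtain d2 where d2: "d2 < 0" "\<And>u. d2 < u \<Longrightarrow> u < 0 \<Longrightarrow> seen (t + u) (sh (1 / 3 ^ m) u x) m (slid m u x (SOME q. dedge False (tips Q) x q))"
    unfolding eventually_at_left_field by auto
  have "seen t' (sh (1 / 3 ^ m) (t' - t) x) m (transport t m t' Q)" if "0 < \<bar>t' - t\<bar>" "\<bar>t' - t\<bar> < min d1 (- d2)" for t'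
  proof (cases "t < t'")
    case True
    then show ?thesis using d1(2)[of "t' - t"] that unfolding transport_def x_def[symmetric] by auto
  next
    case False
    then show ?thesis using d2(2)[of "t' - t"] that unfolding transport_def x_def[symmetric] by auto
  qed
  then show ?thesis unfolding x_def[symmetric] using d1(1) d2(1) by (intro exI[of _ "min d1 (- d2)"]) auto
qed

text \<open>A leaf of the level is determined by its star tip, and star tips move rigidly with speed
  \<open>1 / 3 ^ m\<close>, so they can be traced both forwards and backwards.\<close>

lemma transport_bij:
  assumes near: "\<And>Q. Q \<in> lev t m \<Longrightarrow> seen t' (sh (1 / 3 ^ m) (t' - t) (star_tip t m Q)) m (transport t m t' Q)"
    and ne: "t' \<noteq> t"
  shows "bij_betw (transport t m t') (lev t m) (lev t' m)"
proof -
  let ?a = "1 / 3 ^ m :: real"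
  have tr: "\<exists>q. dedge (t < t') (tips Q) (star_tip t m Q) q \<and> transport t m t' Q = slid m (t' - t) (star_tip t m Q) q"
    if "Q \<in> lev t m" for Q
    using someI_ex[OF dedge_ex[OF that star_tip(1)[OF that], of "t < t'"]] ne unfolding transport_def by auto
  have "inj_on (transport t m t') (lev t m)"
  proof (rule inj_onI)
    fix Q R assume Q: "Q \<in> lev t m" and R: "R \<in> lev t m" and e: "transport t m t' Q = transport t m t' R"
    obtain q where q: "dedge (t < t') (tips R) (star_tip t m R) q" "transport t m t' R = slid m (t' - t) (star_tip t m R) q" using tr[OF R] by blast
    have "sh ?a (t' - t) (star_tip t m Q) \<in> tips (transport t m t' R)" using seenD(4)[OF near[OF Q]] e by simp
    then have "sh ?a (t' - t) (star_tip t m Q) = sh ?a (t' - t) (star_tip t m R) \<or> sh ?a (t' - t) (star_tip t m Q) = sh ?a (t' - t) q"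
      unfolding q(2) slid_def by simp
    then have "star_tip t m Q = star_tip t m R \<or> star_tip t m Q = q"
      using sh_inj lev_unit[OF Q] lev_unit[OF R] star_tip(1)[OF Q] star_tip(1)[OF R] dedgeD(2)[OF q(1)] by blast
    moreover have "star_tip t m Q \<noteq> q"
      using star_tip(4)[OF R dedgeD(2)[OF q(1)]] star_tip(2)[OF Q] dedgeD(3)[OF q(1)] by auto
    ultimately have "star_tip t m Q \<in> tips R" using star_tip(1)[OF R] by simp
    then show "Q = R" using seen_unique[OF star_tip(3)[OF Q] R] by blast
  qed
  moreover have "transport t m t' Q \<in> lev t' m" if "Q \<in> lev t m" for Q
    using near[OF that] seenD(3)[OF near[OF that]] Lam_seen unfolding lev_def by blast
  moreover have "\<exists>Q\<in>lev t m. transport t m t' Q = L" if L: "L \<in> lev t' m" for L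
  proof -
    obtain z0 where "(trip ^^ m) z0 = star t'" "z0 \<in> tips L" using star_tip(1,2)[OF L] by blast
    obtain w j where w: "seen t' w j L" using lev_Lam[OF L] unfolding Lam_seen by blast
    interpret W: param \<epsilon> t' w j by (rule seenD(1)[OF w])
    have "L \<in> W.dyn" using seenD(2)[OF w] W.LL_eq by simp
    then have im: "(trip ^^ m) ` tips L = crit t'" using W.level_tips lev_height[OF L] by blast
    \<comment> \<open>\<open>star t'\<close> is chosen independently and may be the other end of
      \<open>C1\<close>. The leaf is therefore traced back through a tip over the moved point
      \<open>star t\<close>; it has tips over both ends.\<close>
    have "sh 1 (t' - t) (star t) \<in> crit t'" using crit_shift[of t "t' - t"] star(1)[of t] by simp
    then obtain z where z: "z \<in> tips L" "(trip ^^ m) z = sh 1 (t' - t) (star t)" using im by (metis imageE)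
    have zu: "z \<in> {0..<1}" using lev_unit[OF L] z(1) by blast
    define x where "x = sh ?a (t - t') z"
    have xz: "sh ?a (t' - t) x = z" unfolding x_def sh_sh using sh_0[OF zu] by simp
    have "star t \<in> {0..<1}" using star(1) crit_unit by blast
    then have "(trip ^^ m) x = star t" unfolding x_def trip_pow_sh z(2) using sh_sh[of 1 "t - t'" "t' - t" "star t"] sh_0 by simp
    then obtain Q where Q: "Q \<in> lev t m" "x \<in> tips Q" using lev_exists[of x m t] sh_unit[of ?a "t - t'" z] x_def by blast
    have "x = star_tip t m Q" using star_tip(4)[OF Q] \<open>(trip ^^ m) x = star t\<close> by blast
    then have "seen t' z m (transport t m t' Q)" using near[OF Q(1)] xz by simp
    then show ?thesis using seen_unique[OF _ L z(1)] Q(1) by blast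
  qed
  ultimately show ?thesis unfolding bij_betw_def by blast
qed

text \<open>The condition on \<open>t'\<close> and \<open>t''\<close> admits a start at
  \<open>t\<close>, where the neighbour is selected, or a motion strictly on one side of
  \<open>t\<close>, where the leaf is a geodesic and moves rigidly. A minimum over the finitely many
  leaves of the level gives a common \<open>\<delta>\<close>.\<close>

lemma transport_local:
  "\<exists>\<delta>>0. (\<forall>t'. \<bar>t' - t\<bar> < \<delta> \<longrightarrow> bij_betw (transport t m t') (lev t m) (lev t' m)) \<and>
     (\<forall>Q\<in>lev t m. \<forall>t' t''. \<bar>t' - t\<bar> < \<delta> \<longrightarrow> \<bar>t'' - t\<bar> < \<delta> \<longrightarrow> t' \<noteq> t'' \<longrightarrow> (t' = t \<or> (t' < t \<longleftrightarrow> t'' < t) \<and> t'' \<noteq> t) \<longrightarrow>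
       slides_to (Lam t') (transport t m t' Q) (1 / 3 ^ m * (t'' - t')) (transport t m t'' Q))"
proof -
  define ok where "ok = (\<lambda>Q \<delta>. \<forall>t'. 0 < \<bar>t' - t\<bar> \<and> \<bar>t' - t\<bar> < \<delta> \<longrightarrow>
     seen t' (sh (1 / 3 ^ m) (t' - t) (star_tip t m Q)) m (transport t m t' Q))"
  have "\<forall>Q\<in>lev t m. \<exists>\<delta>>0. ok Q \<delta>" using transport_ev unfolding ok_def by blast
  then obtain d where d: "\<And>Q. Q \<in> lev t m \<Longrightarrow> d Q > 0 \<and> ok Q (d Q)" by metis
  define \<delta> where "\<delta> = Min (insert 1 (d ` lev t m))"
  have fin: "finite (insert 1 (d ` lev t m))" using finite_lev by simp
  have \<delta>: "\<delta> > 0" unfolding \<delta>_def using d fin by (subst Min_gr_iff) auto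
  have le: "\<delta> \<le> d Q" if "Q \<in> lev t m" for Q unfolding \<delta>_def using fin that by (intro Min_le) auto
  have near: "seen t' (sh (1 / 3 ^ m) (t' - t) (star_tip t m Q)) m (transport t m t' Q)"
    if "Q \<in> lev t m" "t' \<noteq> t" "\<bar>t' - t\<bar> < \<delta>" for Q t'
    using d[OF that(1)] le[OF that(1)] that(2,3) unfolding ok_def by auto
  have 1: "bij_betw (transport t m t') (lev t m) (lev t' m)" if "\<bar>t' - t\<bar> < \<delta>" for t'
  proof (cases "t' = t")
    case True
    then have "transport t m t' Q = id Q" for Q unfolding transport_def by simp
    then show ?thesis using True by (auto simp: bij_betw_def inj_on_def)
  qed (use transport_bij near that in blast)
  have 2: "slides_to (Lam t') (transport t m t' Q) (1 / 3 ^ m * (t'' - t')) (transport t m t'' Q)"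
    if Q: "Q \<in> lev t m" and h: "\<bar>t' - t\<bar> < \<delta>" "\<bar>t'' - t\<bar> < \<delta>" "t' \<noteq> t''" "t' = t \<or> (t' < t \<longleftrightarrow> t'' < t) \<and> t'' \<noteq> t" for Q t' t''
  proof -
    define x where "x = star_tip t m Q"
    have s: "dedge \<sigma> (tips Q) x (SOME q. dedge \<sigma> (tips Q) x q)" for \<sigma>
      using dedge_ex[OF Q star_tip(1)[OF Q]] unfolding x_def by (rule someI_ex)
    show ?thesis
    proof (cases "t' = t")
      case True
      then have "transport t m t' Q = Q" unfolding transport_def by simp
      then show ?thesis using slides_to_slid[OF Q s[unfolded x_def]] True h(3) unfolding transport_def by simp
    next
      case False
      then have tt: "t < t' \<longleftrightarrow> t < t''" "t'' \<noteq> t" using h(4) by auto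
      define q where "q = (SOME q. dedge (t < t') (tips Q) x q)"
      have xq: "x \<in> tips Q" "q \<in> tips Q" "x \<noteq> q" using dedgeD[OF s[of "t < t'"]] unfolding q_def by auto
      have e: "transport t m t' Q = slid m (t' - t) x q" "transport t m t'' Q = slid m (t'' - t) x q"
        using False tt unfolding transport_def q_def x_def by auto
      define a b where "a = sh (1 / 3 ^ m) (t' - t) x" and "b = sh (1 / 3 ^ m) (t' - t) q"
      have L: "transport t m t' Q \<in> lev t' m"
        using near[OF Q False h(1)] seenD(3)[OF near[OF Q False h(1)]] Lam_seen unfolding lev_def by blast
      have ab: "tips (transport t m t' Q) = {a, b}" unfolding e slid_def a_def b_def by simp
      have "a \<noteq> b" unfolding a_def b_def using sh_inj xq lev_unit[OF Q] by blast
      then have "slides_to (Lam t') (transport t m t' Q) (1 / 3 ^ m * (t'' - t')) (slid m (t'' - t') a b)"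
        using slides_to_pair[OF L ab] by blast
      moreover have "slid m (t'' - t') a b = slid m (t'' - t) x q" unfolding slid_def a_def b_def sh_sh by simp
      ultimately show ?thesis using e by simp
    qed
  qed
  show ?thesis using \<delta> 1 2 by blast
qed

end

section \<open>Existence of the rotation\<close>

lemma eventually_within: "eventually P (at u) \<Longrightarrow> eventually P (at u within S)"
  by (rule filter_leD[OF at_le]) auto

lemma eventually_below: "u < b \<Longrightarrow> \<forall>\<^sub>F v in at u within S. v < (b::real)"
  and eventually_above: "b < u \<Longrightarrow> \<forall>\<^sub>F v in at u within S. (b::real) < v"
  using order_tendstoD[OF tendsto_ident_at] by blast+

context eps_small
begin

text \<open>Leaves are indexed by an arbitrary set \<open>I\<close> and not by an initial position,
  so that motions over adjacent intervals can be joined after matching their indices.\<close>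

definition moving :: "nat \<Rightarrow> real \<Rightarrow> real \<Rightarrow> leaf set \<Rightarrow> (real \<Rightarrow> leaf \<Rightarrow> leaf) \<Rightarrow> bool" where
  "moving m a b I \<psi> \<longleftrightarrow> (\<forall>u\<in>{a..b}. bij_betw (\<psi> u) I (lev u m)) \<and>
     (\<forall>l\<in>I. \<forall>u\<in>{a..b}. \<forall>\<^sub>F v in at u within {a..b}. slides_to (Lam u) (\<psi> u l) (1 / 3 ^ m * (v - u)) (\<psi> v l))"

lemma moving_reindex:
  assumes "moving m a b I \<psi>" "bij_betw g J I"
  shows "moving m a b J (\<lambda>u. \<psi> u \<circ> g)"
  using assms unfolding moving_def by (auto intro: bij_betw_trans dest: bij_betwE)

lemma moving_join:
  assumes 1: "moving m a b I \<psi>" and 2: "moving m b c I \<rho>" and ab: "a \<le> b" "b \<le> c" and eq: "\<And>l. l \<in> I \<Longrightarrow> \<psi> b l = \<rho> b l"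
  shows "moving m a c I (\<lambda>u. if u \<le> b then \<psi> u else \<rho> u)"
proof -
  let ?f = "\<lambda>u. if u \<le> b then \<psi> u else \<rho> u"
  have l: "?f u l = \<psi> u l" if "u \<le> b" for u l using that by simp
  have r: "?f u l = \<rho> u l" if "b \<le> u" "l \<in> I" for u l using that eq[OF that(2)] by (cases "u = b") auto
  have "bij_betw (?f u) I (lev u m)" if "u \<in> {a..c}" for u
    using 1 2 that unfolding moving_def by auto
  moreover have "\<forall>\<^sub>F v in at u within {a..c}. slides_to (Lam u) (?f u l) (1 / 3 ^ m * (v - u)) (?f v l)"
    if I: "l \<in> I" and u: "u \<in> {a..c}" for l u
  proof -
    have L: "\<forall>\<^sub>F v in at u within {a..b}. slides_to (Lam u) (?f u l) (1 / 3 ^ m * (v - u)) (?f v l)"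
    proof (cases "u \<le> b")
      case True
      then have "u \<in> {a..b}" using u by simp
      then have "\<forall>\<^sub>F v in at u within {a..b}. slides_to (Lam u) (\<psi> u l) (1 / 3 ^ m * (v - u)) (\<psi> v l)"
        using 1 I unfolding moving_def by blast
      moreover have "\<forall>\<^sub>F v in at u within {a..b}. v \<le> b" by (simp add: eventually_at_filter)
      ultimately show ?thesis by eventually_elim (use True in simp)
    next
      case False
      then have "\<forall>\<^sub>F v in at u within {a..b}. b < v" by (intro eventually_above) simp
      moreover have "\<forall>\<^sub>F v in at u within {a..b}. v \<le> b" by (simp add: eventually_at_filter)
      ultimately show ?thesis by eventually_elim simp
    qed
    have R: "\<forall>\<^sub>F v in at u within {b..c}. slides_to (Lam u) (?f u l) (1 / 3 ^ m * (v - u)) (?f v l)"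
    proof (cases "b \<le> u")
      case True
      then have "u \<in> {b..c}" using u by simp
      then have "\<forall>\<^sub>F v in at u within {b..c}. slides_to (Lam u) (\<rho> u l) (1 / 3 ^ m * (v - u)) (\<rho> v l)"
        using 2 I unfolding moving_def by blast
      moreover have "\<forall>\<^sub>F v in at u within {b..c}. b \<le> v" by (simp add: eventually_at_filter)
      ultimately show ?thesis by eventually_elim (simp only: r[OF True I] r[OF _ I])
    next
      case False
      then have "\<forall>\<^sub>F v in at u within {b..c}. v < b" by (intro eventually_below) simp
      moreover have "\<forall>\<^sub>F v in at u within {b..c}. b \<le> v" by (simp add: eventually_at_filter)
      ultimately show ?thesis by eventually_elim simp
    qed
    have "{a..c} = {a..b} \<union> {b..c}" using ab by auto
    then show ?thesis using L R by (simp add: at_within_union eventually_sup)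
  qed
  ultimately show ?thesis unfolding moving_def by blast
qed

text \<open>By bisection: motions on adjacent intervals can be joined, and on short intervals around
  each point \<open>transport_local\<close> provides one.\<close>

lemma moving_ex:
  assumes "a \<le> b"
  shows "\<exists>I \<psi>. moving m a b I \<psi>"
  using assms
proof (induction rule: Bolzano)
  case (trans a b c)
  obtain I \<psi> where 1: "moving m a b I \<psi>" using trans(1) by blast
  obtain J \<rho> where 2: "moving m b c J \<rho>" using trans(2) by blast
  have b: "bij_betw (\<psi> b) I (lev b m)" "bij_betw (\<rho> b) J (lev b m)" using 1 2 trans(3,4) unfolding moving_def by auto
  define g where "g = inv_into J (\<rho> b) \<circ> \<psi> b"
  have g: "bij_betw g I J" unfolding g_def using b(1) bij_betw_inv_into[OF b(2)] by (rule bij_betw_trans)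
  have "\<psi> b l = (\<rho> b \<circ> g) l" if "l \<in> I" for l
    using bij_betw_inv_into_right[OF b(2)] bij_betwE[OF b(1)] that unfolding g_def by simp
  then show ?case using moving_join[OF 1 moving_reindex[OF 2 g] trans(3,4)] by blast
next
  case (local x)
  obtain \<delta> where d: "\<delta> > 0" "\<And>t'. \<bar>t' - x\<bar> < \<delta> \<Longrightarrow> bij_betw (transport x m t') (lev x m) (lev t' m)"
    "\<And>Q t' t''. Q \<in> lev x m \<Longrightarrow> \<bar>t' - x\<bar> < \<delta> \<Longrightarrow> \<bar>t'' - x\<bar> < \<delta> \<Longrightarrow> t' \<noteq> t'' \<Longrightarrow> t' = x \<or> (t' < x \<longleftrightarrow> t'' < x) \<and> t'' \<noteq> x \<Longrightarrow>
       slides_to (Lam t') (transport x m t' Q) (1 / 3 ^ m * (t'' - t')) (transport x m t'' Q)"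
    using transport_local[of x m] by blast
  have "moving m a b (lev x m) (transport x m)" if h: "a \<le> x" "x \<le> b" "b - a < \<delta>" for a b
  proof -
    have near: "\<bar>v - x\<bar> < \<delta>" if "v \<in> {a..b}" for v using that h by auto
    have "\<forall>\<^sub>F v in at u within {a..b}. slides_to (Lam u) (transport x m u l) (1 / 3 ^ m * (v - u)) (transport x m v l)"
      if l: "l \<in> lev x m" and u: "u \<in> {a..b}" for l u
    proof -
      have "\<forall>\<^sub>F v in at u within {a..b}. u = x \<or> (u < x \<longleftrightarrow> v < x) \<and> v \<noteq> x"
      proof -
        consider "u = x" | "u < x" | "x < u" by linarith
        then show ?thesis
        proof cases
          case 2
          then have "\<forall>\<^sub>F v in at u within {a..b}. v < x" by (rule eventually_below)
          then show ?thesis by eventually_elim (use 2 in auto)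
        next
          case 3
          then have "\<forall>\<^sub>F v in at u within {a..b}. x < v" by (rule eventually_above)
          then show ?thesis by eventually_elim (use 3 in auto)
        qed simp
      qed
      moreover have "\<forall>\<^sub>F v in at u within {a..b}. v \<in> {a..b} \<and> v \<noteq> u" unfolding eventually_at_filter by simp
      ultimately show ?thesis by eventually_elim (use d(3)[OF l near[OF u] near] in blast)
    qed
    then show ?thesis unfolding moving_def using d(2) near by blast
  qed
  then show ?case using d(1) by blast
qed

lemma lev_unique: "l \<in> lev t m \<Longrightarrow> l \<in> lev t k \<Longrightarrow> k = m"
  unfolding lev_def by simp

text \<open>Each level is moved on its own. Together the levels fill \<open>Lam (t + u)\<close> at
  time \<open>u\<close>, so \<open>elam_Lam\<close> for the shifted parameter shows that the moving
  leaves form an elamination throughout.\<close>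

lemma flow_ex:
  "\<exists>\<phi>. rotation_flow (Lam t) s \<phi> \<and> (\<forall>u\<in>closed_segment 0 s. \<phi> u ` Lam t = Lam (t + u))"
proof -
  define a b where "a = min t (t + s)" and "b = max t (t + s)"
  have seg: "u \<in> closed_segment 0 s \<longleftrightarrow> t + u \<in> {a..b}" for u
    unfolding a_def b_def closed_segment_eq_real_ivl by auto
  have ta: "t \<in> {a..b}" unfolding a_def b_def by auto
  have "\<exists>I \<psi>. moving m a b I \<psi>" for m using moving_ex[of a b m] unfolding a_def b_def by simp
  then obtain I \<psi> where mv: "\<And>m. moving m a b (I m) (\<psi> m)" by metis
  have bij: "bij_betw (\<psi> m u) (I m) (lev u m)" if "u \<in> {a..b}" for m u using mv that unfolding moving_def by blast
  define g where "g = (\<lambda>m. inv_into (I m) (\<psi> m t))"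
  have g: "bij_betw (g m) (lev t m) (I m)" for m unfolding g_def by (rule bij_betw_inv_into[OF bij[OF ta]])
  define f where "f = (\<lambda>m u. \<psi> m (t + u) \<circ> g m)"
  have f: "bij_betw (f m u) (lev t m) (lev (t + u) m)" if "u \<in> closed_segment 0 s" for m u
    unfolding f_def using g bij that seg by (blast intro: bij_betw_trans)
  have f0: "f m 0 l = l" if "l \<in> lev t m" for m l
    unfolding f_def g_def using bij_betw_inv_into_right[OF bij[OF ta] that] by simp
  have fs: "\<forall>\<^sub>F v in at u within closed_segment 0 s. slides_to (Lam (t + u)) (f m u l) (1 / 3 ^ m * (v - u)) (f m v l)"
    if u: "u \<in> closed_segment 0 s" and l: "l \<in> lev t m" for u m l
  proof -
    have "g m l \<in> I m" using bij_betwE[OF g] l by blast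
    then have "\<forall>\<^sub>F w in at (t + u) within {a..b}. slides_to (Lam (t + u)) (\<psi> m (t + u) (g m l)) (1 / 3 ^ m * (w - (t + u))) (\<psi> m w (g m l))"
      using mv[of m] u seg unfolding moving_def by blast
    then obtain d where d: "d > 0" "\<And>w. w \<in> {a..b} \<Longrightarrow> w \<noteq> t + u \<Longrightarrow> dist w (t + u) < d \<Longrightarrow>
        slides_to (Lam (t + u)) (\<psi> m (t + u) (g m l)) (1 / 3 ^ m * (w - (t + u))) (\<psi> m w (g m l))"
      unfolding eventually_at by blast
    have "slides_to (Lam (t + u)) (f m u l) (1 / 3 ^ m * (v - u)) (f m v l)"
      if "v \<in> closed_segment 0 s" "v \<noteq> u" "dist v u < d" for v
    proof -
      have "t + v \<in> {a..b}" using seg that(1) by blast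
      then show ?thesis using d(2)[of "t + v"] that(2,3) unfolding f_def by (simp add: dist_real_def)
    qed
    then show ?thesis unfolding eventually_at using d(1) by blast
  qed
  define L where "L = (\<lambda>l. SOME m. l \<in> lev t m)"
  have L: "L l = m" if "l \<in> lev t m" for l m
    unfolding L_def using that by (rule some_equality) (rule lev_unique[OF that])
  define \<phi> where "\<phi> = (\<lambda>u l. f (L l) u l)"
  have p: "\<phi> u l = f m u l" if "l \<in> lev t m" for u l m unfolding \<phi>_def using L[OF that] by simp
  have im: "\<phi> u ` Lam t = Lam (t + u)" if u: "u \<in> closed_segment 0 s" for u
  proof -
    have "\<phi> u ` lev t m = lev (t + u) m" for m
      using f[OF u, of m] p[of _ m u] unfolding bij_betw_def by (metis (no_types, lifting) image_cong)
    then show ?thesis unfolding Lam_lev image_UN by simp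
  qed
  have lv: "\<exists>m. l \<in> lev t m" if "l \<in> Lam t" for l using that unfolding Lam_lev by blast
  have mem: "\<phi> u l \<in> lev (t + u) m" if "u \<in> closed_segment 0 s" "l \<in> lev t m" for u l m
    using bij_betwE[OF f[OF that(1), of m]] that(2) p[OF that(2)] by simp
  have inj: "inj_on (\<phi> u) (Lam t)" if u: "u \<in> closed_segment 0 s" for u
  proof (rule inj_onI)
    fix l l' assume h: "l \<in> Lam t" "l' \<in> Lam t" "\<phi> u l = \<phi> u l'"
    obtain m k where m: "l \<in> lev t m" "l' \<in> lev t k" using lv h by blast
    have "k = m" using lev_unique mem[OF u m(1)] mem[OF u m(2)] h(3) by simp
    then have "f m u l = f m u l'" "l' \<in> lev t m" using p m h(3) by auto
    then show "l = l'" using f[OF u, of m] m(1) unfolding bij_betw_def inj_on_def by blast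
  qed
  have "rotation_flow (Lam t) s \<phi>" unfolding rotation_flow_def
  proof (intro conjI ballI)
    fix l assume "l \<in> Lam t"
    then obtain m where "l \<in> lev t m" using lv by blast
    then show "\<phi> 0 l = l" using p f0 by simp
  next
    fix u assume u: "u \<in> closed_segment 0 s"
    show "elamination (\<phi> u ` Lam t)" unfolding im[OF u] elamination_iff_elam by (rule elam_Lam)
    show "inj_on (\<phi> u) (Lam t)" using inj[OF u] .
    fix l assume "l \<in> Lam t"
    then obtain m where m: "l \<in> lev t m" using lv by blast
    show "height (\<phi> u l) = height l" using lev_height[OF m] lev_height[OF mem[OF u m]] by simp
    show "\<forall>\<^sub>F v in at u within closed_segment 0 s. slides_to (\<phi> u ` Lam t) (\<phi> u l) (height l * (v - u)) (\<phi> v l)"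
      unfolding im[OF u] lev_height[OF m] p[OF m] by (rule fs[OF u m])
  qed
  then show ?thesis using im by blast
qed

end

section \<open>Uniqueness of the rotation\<close>

lemma saturated_edges_sym: "(p, q) \<in> saturated_edges E l \<Longrightarrow> (q, p) \<in> saturated_edges E l"
  unfolding saturated_edges_def by blast

lemma saturated_class_sym: "(p, q) \<in> (saturated_edges E l)\<^sup>* \<Longrightarrow> (q, p) \<in> (saturated_edges E l)\<^sup>*"
  by (induction rule: rtrancl_induct) (auto intro: converse_rtrancl_into_rtrancl saturated_edges_sym)

text \<open>The situation in the induction on levels: two flows already agree on the taller leaves,
  and the positions \<open>l1\<close> and \<open>l2\<close> of one leaf under both are
  compared.\<close>

locale same_taller =
  fixes E1 E2 :: "leaf set" and l1 l2 :: leaf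
  assumes E: "elam E1" "elam E2" and l: "l1 \<in> E1" "l2 \<in> E2" and ht: "height l1 = height l2"
    and taller: "\<And>n. height n > height l2 \<Longrightarrow> n \<in> E1 \<longleftrightarrow> n \<in> E2"
begin

lemma sat_same: "sat E1 l1 p q \<longleftrightarrow> sat E2 l2 p q"
  unfolding sat_def ht using taller by blast

text \<open>The saturator of \<open>pq\<close> lies behind an edge of \<open>l2\<close> ending at
  \<open>p\<close>, and the saturator of that edge lies behind an edge of \<open>l1\<close> ending
  at \<open>p\<close>. Comparing both gives the same edge; in every other configuration the common
  tip \<open>z\<close> would be joined to \<open>p\<close> by a saturated edge.\<close>

lemma edge_step_fwd:
  assumes p: "p \<in> tips l2" and z: "z \<in> tips l1" "z \<in> tips l2" "(p, z) \<notin> (saturated_edges E1 l1)\<^sup>*"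
    and e: "edge (tips l1) p q" "sat E1 l1 p q"
  shows "edge (tips l2) p q"
proof -
  obtain n where n: "n \<in> E1" "height n > height l1" "p \<in> tips n" "q \<in> tips n" "\<And>y. y \<in> tips n \<Longrightarrow> carc p q y"
    using e(2) unfolding sat_def by blast
  have n2: "n \<in> E2" "l2 \<noteq> n" using taller n ht by auto
  obtain a b where ab: "edge (tips l2) a b" "\<And>y. y \<in> tips n \<Longrightarrow> carc a b y" using elam_edge[OF E(2) l(2) n2] by blast
  have zp: "z \<noteq> p" using z(3) by auto
  have pq: "p \<noteq> q" "\<not> btw p z q" using edgeD(3,4)[OF e(1)] z(1) by blast+
  have nz: "\<not> btw a z b" "a \<noteq> b" "\<not> btw a p b" using edgeD(3,4)[OF ab(1)] z(2) p by blast+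
  have R1: "(p, z) \<in> saturated_edges E1 l1" if "edge (tips l1) p z \<and> sat E1 l1 p z \<or> edge (tips l1) z p \<and> sat E1 l1 z p"
    using that unfolding saturated_edges_iff[OF E(1) l(1)] .
  have "p = a \<or> p = b" using ab(2)[OF n(3)] nz unfolding carc_def by blast
  then show ?thesis
  proof
    assume pa: "p = a"
    have c1: "carc p b q" using ab(2)[OF n(4)] pa by simp
    have "sat E2 l2 p b" using elam_sat[OF E(2) l(2) n2(1,2) _ ab(1)] n ht ab(2) pa by auto
    then obtain n' where n': "n' \<in> E2" "height n' > height l2" "p \<in> tips n'" "b \<in> tips n'" unfolding sat_def by blast
    have n1: "n' \<in> E1" "l1 \<noteq> n'" using taller n' ht by auto
    obtain c d where cd: "edge (tips l1) c d" "\<And>y. y \<in> tips n' \<Longrightarrow> carc c d y" using elam_edge[OF E(1) l(1) n1] by blast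
    have p1: "p \<in> tips l1" "q \<in> tips l1" using edgeD(1,2)[OF e(1)] .
    have ncd: "\<not> btw c p d" "\<not> btw c q d" "\<not> btw c z d" "c \<noteq> d" using edgeD(3,4)[OF cd(1)] p1 z(1) by blast+
    have "p = c \<or> p = d" using cd(2)[OF n'(3)] ncd(1) unfolding carc_def by blast
    then have "b = q"
    proof
      assume pc: "p = c"
      then have "d = q" using edge_unique_from cd(1) e(1) by blast
      then have "carc p q b" using cd(2)[OF n'(4)] pc by simp
      then show ?thesis using c1 pq pa nz(2) unfolding carc_def btw_def by linarith
    next
      assume pd: "p = d"
      show ?thesis
      proof (rule ccontr)
        assume bq: "b \<noteq> q"
        have "carc c p b" using cd(2)[OF n'(4)] pd by simp
        then have "z = c" using c1 bq pq nz ncd zp unfolding pd[symmetric] pa[symmetric] carc_def btw_def by (smt (verit))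
        moreover have "sat E1 l1 c d" using elam_sat[OF E(1) l(1) n1(1,2) _ cd(1)] n' ht cd(2) pd by auto
        ultimately show False using R1 z(3) cd(1) pd by blast
      qed
    qed
    then show ?thesis using ab(1) pa by simp
  next
    assume pb: "p = b"
    have "carc a p q" using ab(2)[OF n(4)] pb by simp
    then have "z = q" using nz pq zp unfolding pb[symmetric] carc_def btw_def by (smt (verit))
    then show ?thesis using R1 z(3) e by blast
  qed
qed

lemma edge_step_bwd:
  assumes p: "p \<in> tips l2" and z: "z \<in> tips l1" "z \<in> tips l2" "(p, z) \<notin> (saturated_edges E1 l1)\<^sup>*"
    and e: "edge (tips l1) q p" "sat E1 l1 q p"
  shows "edge (tips l2) q p"
proof -
  obtain n where n: "n \<in> E1" "height n > height l1" "p \<in> tips n" "q \<in> tips n" "\<And>y. y \<in> tips n \<Longrightarrow> carc q p y"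
    using e(2) unfolding sat_def by blast
  have n2: "n \<in> E2" "l2 \<noteq> n" using taller n ht by auto
  obtain b a where ab: "edge (tips l2) b a" "\<And>y. y \<in> tips n \<Longrightarrow> carc b a y" using elam_edge[OF E(2) l(2) n2] by blast
  have zp: "z \<noteq> p" using z(3) by auto
  have pq: "p \<noteq> q" "\<not> btw q z p" using edgeD(3,4)[OF e(1)] z(1) by blast+
  have nz: "\<not> btw b z a" "a \<noteq> b" "\<not> btw b p a" using edgeD(3,4)[OF ab(1)] z(2) p by blast+
  have R1: "(p, z) \<in> saturated_edges E1 l1" if "edge (tips l1) p z \<and> sat E1 l1 p z \<or> edge (tips l1) z p \<and> sat E1 l1 z p"
    using that unfolding saturated_edges_iff[OF E(1) l(1)] .
  have "p = a \<or> p = b" using ab(2)[OF n(3)] nz unfolding carc_def by blast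
  then show ?thesis
  proof
    assume pa: "p = a"
    have c1: "carc b p q" using ab(2)[OF n(4)] pa by simp
    have "sat E2 l2 b p" using elam_sat[OF E(2) l(2) n2(1,2) _ ab(1)] n ht ab(2) pa by auto
    then obtain n' where n': "n' \<in> E2" "height n' > height l2" "p \<in> tips n'" "b \<in> tips n'" unfolding sat_def by blast
    have n1: "n' \<in> E1" "l1 \<noteq> n'" using taller n' ht by auto
    obtain d c where cd: "edge (tips l1) d c" "\<And>y. y \<in> tips n' \<Longrightarrow> carc d c y" using elam_edge[OF E(1) l(1) n1] by blast
    have p1: "p \<in> tips l1" "q \<in> tips l1" using edgeD(2,1)[OF e(1)] .
    have ncd: "\<not> btw d p c" "\<not> btw d q c" "\<not> btw d z c" "c \<noteq> d" using edgeD(3,4)[OF cd(1)] p1 z(1) by blast+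
    have "p = c \<or> p = d" using cd(2)[OF n'(3)] ncd(1) unfolding carc_def by blast
    then have "b = q"
    proof
      assume pc: "p = c"
      then have "d = q" using edge_unique_to cd(1) e(1) by blast
      then have "carc q p b" using cd(2)[OF n'(4)] pc by simp
      then show ?thesis using c1 pq pa nz(2) unfolding carc_def btw_def by linarith
    next
      assume pd: "p = d"
      show ?thesis
      proof (rule ccontr)
        assume bq: "b \<noteq> q"
        have "carc p c b" using cd(2)[OF n'(4)] pd by simp
        then have "z = c" using c1 bq pq nz ncd zp unfolding pd[symmetric] pa[symmetric] carc_def btw_def by (smt (verit))
        moreover have "sat E1 l1 d c" using elam_sat[OF E(1) l(1) n1(1,2) _ cd(1)] n' ht cd(2) pd by auto
        ultimately show False using R1 z(3) cd(1) pd by blast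
      qed
    qed
    then show ?thesis using ab(1) pa by simp
  next
    assume pb: "p = b"
    have "carc p a q" using ab(2)[OF n(4)] pb by simp
    then have "z = q" using nz pq zp unfolding pb[symmetric] carc_def btw_def by (smt (verit))
    then show ?thesis using R1 z(3) e by blast
  qed
qed

lemma class_step:
  assumes "p \<in> tips l2" "z \<in> tips l1" "z \<in> tips l2" "(p, z) \<notin> (saturated_edges E1 l1)\<^sup>*" "(p, q) \<in> saturated_edges E1 l1"
  shows "q \<in> tips l2"
  using assms(5) edge_step_fwd[OF assms(1-4), of q] edge_step_bwd[OF assms(1-4), of q] edgeD(1,2)
  unfolding saturated_edges_iff[OF E(1) l(1)] by blast

text \<open>Each class of \<open>l1\<close> is traversed along saturated edges from its point in
  \<open>Z\<close>. \<open>class_step\<close> keeps the traversal inside \<open>l2\<close>, with a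
  point of \<open>Z\<close> from another class as \<open>z\<close>.\<close>

lemma class_closed:
  assumes Z: "Z \<subseteq> tips l1" "Z \<subseteq> tips l2" "\<And>y. \<exists>z\<in>Z. z \<noteq> y"
    and pick: "\<And>x. x \<in> tips l1 \<Longrightarrow> \<exists>!y. y \<in> Z \<and> (x, y) \<in> (saturated_edges E1 l1)\<^sup>*"
  shows "tips l1 \<subseteq> tips l2"
proof
  fix x assume x: "x \<in> tips l1"
  let ?R = "saturated_edges E1 l1"
  obtain y where y: "y \<in> Z" "(x, y) \<in> ?R\<^sup>*" using pick[OF x] by blast
  obtain z where z: "z \<in> Z" "z \<noteq> y" using Z(3) by blast
  have yl: "y \<in> tips l1" using y(1) Z(1) by blast
  have yz: "(y, z) \<notin> ?R\<^sup>*" using pick[OF yl] y(1) z by blast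
  have "(y, x) \<in> ?R\<^sup>*" using saturated_class_sym[OF y(2)] .
  then show "x \<in> tips l2"
  proof (induction rule: rtrancl_induct)
    case base
    show ?case using y(1) Z(2) by blast
  next
    case (step w w')
    have "(w, z) \<notin> ?R\<^sup>*" using step(1) yz by (meson rtrancl_trans)
    then show ?case using class_step[OF step(3) _ _ _ step(2)] z(1) Z(1,2) by blast
  qed
qed

end

lemma frac_add_inj:
  fixes x y d :: real
  assumes "x \<in> {0..<1}" "y \<in> {0..<1}" "frac (x + d) = frac (y + d)"
  shows "x = y"
  using kap_inj[OF assms(1,2), of "- d"] assms(3) unfolding kap_def by simp

text \<open>The tips of \<open>M\<close>, rotated back, are common tips of \<open>l1\<close> and
  \<open>l2\<close> and represent every class once. \<open>class_closed\<close> recovers all other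
  tips from them, and the situation is symmetric in \<open>l1\<close> and \<open>l2\<close>.\<close>

lemma (in same_taller) slides_meet:
  assumes M: "extended_leaf M" and s: "slides_to E1 l1 d M" "slides_to E2 l2 d M"
  shows "tips l1 = tips l2"
proof
  define Z where "Z = {y\<in>tips l1. frac (y + d) \<in> tips M}"
  have u: "tips l1 \<subseteq> {0..<1}" "tips l2 \<subseteq> {0..<1}" using extended_leafD(2)[OF elamD(1)] E l by blast+
  have im: "tips M \<subseteq> (\<lambda>x. frac (x + d)) ` tips l1" "tips M \<subseteq> (\<lambda>x. frac (x + d)) ` tips l2"
    using s unfolding slides_to_def by blast+
  have Z2: "Z = {y\<in>tips l2. frac (y + d) \<in> tips M}"
  proof (intro equalityI subsetI)
    fix y assume "y \<in> Z"
    then have y: "y \<in> tips l1" "frac (y + d) \<in> tips M" unfolding Z_def by auto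
    then obtain x where "x \<in> tips l2" "frac (y + d) = frac (x + d)" using im(2) by blast
    then have "y \<in> tips l2" using frac_add_inj[of y x d] u y by blast
    then show "y \<in> {y\<in>tips l2. frac (y + d) \<in> tips M}" using y by blast
  next
    fix y assume "y \<in> {y\<in>tips l2. frac (y + d) \<in> tips M}"
    then have y: "y \<in> tips l2" "frac (y + d) \<in> tips M" by auto
    then obtain x where "x \<in> tips l1" "frac (y + d) = frac (x + d)" using im(1) by blast
    then have "y \<in> tips l1" using frac_add_inj[of y x d] u y by blast
    then show "y \<in> Z" using y unfolding Z_def by blast
  qed
  have sub: "Z \<subseteq> tips l1" "Z \<subseteq> tips l2" using Z_def Z2 by auto
  have two: "\<exists>z\<in>Z. z \<noteq> y" for y
  proof (rule ccontr)
    assume "\<not> ?thesis"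
    then have "Z \<subseteq> {y}" by blast
    then have "tips M \<subseteq> {frac (y + d)}" using im(1) unfolding Z_def by blast
    then have "card (tips M) \<le> 1" using card_mono[of "{frac (y + d)}" "tips M"] by simp
    then show False using extended_leafD(4)[OF M] by simp
  qed
  have pick: "\<exists>!y. y \<in> Z \<and> (x, y) \<in> (saturated_edges E1 l1)\<^sup>*" if "x \<in> tips l1" for x
    using s(1) that unfolding slides_to_def Z_def by (metis (mono_tags, lifting) mem_Collect_eq)
  have pick2: "\<exists>!y. y \<in> Z \<and> (x, y) \<in> (saturated_edges E2 l2)\<^sup>*" if "x \<in> tips l2" for x
    using s(2) that unfolding slides_to_def Z2 by (metis (mono_tags, lifting) mem_Collect_eq)
  show "tips l1 \<subseteq> tips l2" by (rule class_closed[OF sub two pick])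
  interpret O: same_taller E2 E1 l2 l1 by unfold_locales (use E l ht taller in simp_all)
  show "tips l2 \<subseteq> tips l1" by (rule O.class_closed[OF sub(2,1) two pick2])
qed

lemma (in same_taller) saturated_edges_same:
  assumes "l1 = l2"
  shows "saturated_edges E1 l1 = saturated_edges E2 l2"
proof -
  have "(p, q) \<in> saturated_edges E1 l1 \<longleftrightarrow> (p, q) \<in> saturated_edges E2 l2" for p q
    unfolding saturated_edges_iff[OF E(1) l(1)] saturated_edges_iff[OF E(2) l(2)] sat_same using assms by simp
  then show ?thesis by auto
qed

section \<open>The second moving tip is forced\<close>

lemma frac_sh_diff: "frac (sh b u y - sh a u x) = frac (frac (y - x) + (b - a) * u)"
  unfolding sh_def frac_frac_diff frac_diff_frac frac_frac_add by (simp add: algebra_simps)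

lemma ev_btw:
  assumes u: "x \<in> {0..<1}" "z \<in> {0..<1}" "w \<in> {0..<1}" and b: "btw x z w"
  shows "\<forall>\<^sub>F u in dirF \<sigma>. btw (sh a u x) (sh b u z) (sh c u w)"
proof -
  have "z \<in> open_arc x w" using open_arc_iff u b by blast
  then have f: "0 < frac (z - x)" "frac (z - x) < frac (w - x)" unfolding open_arc_def by auto
  have "\<forall>\<^sub>F u in dirF \<sigma>. frac (frac (z - x) + (b - a) * u) = frac (z - x) + (b - a) * u"
    by (intro ev_frac_id f(1) frac_lt_1)
  moreover have "\<forall>\<^sub>F u in dirF \<sigma>. frac (frac (w - x) + (c - a) * u) = frac (w - x) + (c - a) * u"
    by (intro ev_frac_id order.strict_trans[OF f(1) f(2)] frac_lt_1)
  moreover have "\<forall>\<^sub>F u in dirF \<sigma>. 0 < frac (z - x) + (b - a) * u" by (rule ev_greater[OF f(1)])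
  moreover have "\<forall>\<^sub>F u in dirF \<sigma>. (frac (z - x) - frac (w - x)) + ((b - a) - (c - a)) * u < 0"
    by (rule ev_less) (use f in simp)
  ultimately show ?thesis
  proof eventually_elim
    case (elim u)
    have "0 < frac (sh b u z - sh a u x) \<and> frac (sh b u z - sh a u x) < frac (sh c u w - sh a u x)"
      unfolding frac_sh_diff elim(1,2) using elim(3,4) by (simp add: algebra_simps)
    then show ?case using open_arc_iff[of "sh a u x" "sh c u w" "sh b u z"] sh_unit unfolding open_arc_def by blast
  qed
qed

text \<open>Of two tips starting at \<open>w\<close> the faster one pulls ahead in the direction of
  the motion, before it can reach the distant tip from \<open>x\<close>.\<close>

lemma ev_ahead:
  assumes u: "x \<in> {0..<1}" "w \<in> {0..<1}" "x \<noteq> w" and "a < b"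
  shows "\<forall>\<^sub>F u in dirF True. btw (sh a u w) (sh b u w) (sh a u x)"
    and "\<forall>\<^sub>F u in dirF False. btw (sh a u x) (sh b u w) (sh a u w)"
proof -
  have p: "0 < frac (x - w)" "0 < frac (w - x)"
    using u frac_diff_unit[of x w] frac_diff_unit[of w x] by (auto simp del: frac_gt_0_iff split: if_splits)
  have "\<forall>\<^sub>F u in dirF True. 0 + (b - a) * u < frac (x - w)" by (rule ev_less[OF p(1)])
  moreover have "\<forall>\<^sub>F u in dirF True. 0 < u" using dirF_sign[of True] by simp
  ultimately show "\<forall>\<^sub>F u in dirF True. btw (sh a u w) (sh b u w) (sh a u x)"
  proof eventually_elim
    case (elim u)
    have "0 < (b - a) * u" "(b - a) * u < 1" using elim assms(4) frac_lt_1[of "x - w"] by auto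
    then have "0 < frac (sh b u w - sh a u w)" "frac (sh b u w - sh a u w) < frac (sh a u x - sh a u w)"
      unfolding frac_sh_diff using elim by (simp_all add: frac_eq frac_frac del: frac_gt_0_iff)
    then show ?case using open_arc_iff[of "sh a u w" "sh a u x" "sh b u w"] sh_unit unfolding open_arc_def by blast
  qed
  have "\<forall>\<^sub>F u in dirF False. 0 < frac (w - x) + (b - a) * u" by (rule ev_greater[OF p(2)])
  moreover have "\<forall>\<^sub>F u in dirF False. u < 0" using dirF_sign[of False] by simp
  ultimately show "\<forall>\<^sub>F u in dirF False. btw (sh a u x) (sh b u w) (sh a u w)"
  proof eventually_elim
    case (elim u)
    have "(b - a) * u < 0" using elim assms(4) by (simp add: mult_pos_neg)
    moreover have "frac (frac (w - x) + (b - a) * u) = frac (w - x) + (b - a) * u"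
      unfolding frac_eq using elim(1) calculation frac_lt_1[of "w - x"] by linarith
    ultimately have "0 < frac (sh b u w - sh a u x)" "frac (sh b u w - sh a u x) < frac (sh a u w - sh a u x)"
      using elim(1) by (simp_all only: frac_sh_diff) simp_all
    then show ?case using open_arc_iff[of "sh a u x" "sh a u w" "sh b u w"] sh_unit unfolding open_arc_def by blast
  qed
qed

context eps_small
begin

definition towards :: "bool \<Rightarrow> real \<Rightarrow> real \<Rightarrow> real \<Rightarrow> bool" where
  "towards \<sigma> p w z \<longleftrightarrow> z \<noteq> w \<and> (if \<sigma> then carc p w z else carc w p z)"

text \<open>
  If \<open>w\<close> is one of the two moving tips of the saturator, then the saturator itself sweeps over \<open>w\<close>;
  otherwise \<open>w\<close> is an end of a saturated edge of the saturator, and the argument is repeated there.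
\<close>

lemma sweeping_leaf:
  assumes "Q \<in> lev t m" "dedge \<sigma> (tips Q) p w" "if \<sigma> then sat (Lam t) Q p w else sat (Lam t) Q w p"
  shows "\<exists>k N y q z. k < m \<and> N \<in> lev t k \<and> y = star_tip t k N \<and> dedge \<sigma> (tips N) y q \<and> {y, q} = {w, z} \<and> towards \<sigma> p w z"
  using assms
proof (induction m arbitrary: Q p w rule: less_induct)
  case (less m)
  obtain N where N: "N \<in> Lam t" "height N > height Q" "p \<in> tips N" "w \<in> tips N"
    "\<And>z. z \<in> tips N \<Longrightarrow> if \<sigma> then carc p w z else carc w p z"
    using less.prems(3) unfolding sat_def by (cases \<sigma>) auto
  obtain k where k: "N \<in> lev t k" using N(1) Lam_lev by blast
  have km: "k < m" using N(2) lev_height[OF k] lev_height[OF less.prems(1)] one_third_pow_less[of m k] by simp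
  define y where "y = star_tip t k N"
  have yN: "y \<in> tips N" using star_tip(1)[OF k] y_def by simp
  obtain q where q: "dedge \<sigma> (tips N) y q" using dedge_ex[OF k yN] by blast
  have to: "towards \<sigma> p w z" if "z \<in> tips N" "z \<noteq> w" for z using N(5) that unfolding towards_def by blast
  consider "w = y" | "w = q" | "w \<noteq> y" "w \<noteq> q" by blast
  then show ?case
  proof cases
    case 1
    then show ?thesis using km k q y_def to[OF dedgeD(2)[OF q]] dedgeD(3)[OF q] by blast
  next
    case 2
    then show ?thesis using km k q y_def to[OF yN] dedgeD(3)[OF q] by blast
  next
    case 3
    obtain w1 where w1: "dedge \<sigma> (tips N) w1 w"
      using elam_edges[OF elam_Lam N(1,4)] unfolding dedge_def by (cases \<sigma>) auto
    have "w1 \<noteq> y" using 3 dedge_unique[OF q] w1 by blast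
    then have "if \<sigma> then sat (Lam t) N w1 w else sat (Lam t) N w w1"
      using star_tip(5)[OF k] w1 3(1) unfolding dedge_def y_def by (auto split: if_splits)
    from less.IH[OF km k w1 this] obtain k' N' y' q' z where h: "k' < k" "N' \<in> lev t k'" "y' = star_tip t k' N'"
      "dedge \<sigma> (tips N') y' q'" "{y', q'} = {w, z}" "towards \<sigma> w1 w z" by blast
    have c: "towards \<sigma> p w w1" using to[OF dedgeD(1)[OF w1]] dedgeD(3)[OF w1] by blast
    have "towards \<sigma> p w z"
    proof (cases \<sigma>)
      case True
      then have "carc p w w1" "carc w1 w z" "z \<noteq> w" "w1 \<noteq> w" "p \<noteq> w" using c h(6) dedgeD(3)[OF less.prems(2)] unfolding towards_def by auto
      then have "carc p w z" unfolding carc_def btw_def by (smt (z3))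
      then show ?thesis using True h(6) unfolding towards_def by simp
    next
      case False
      then have "carc w p w1" "carc w w1 z" "z \<noteq> w" "w1 \<noteq> w" "p \<noteq> w" using c h(6) dedgeD(3)[OF less.prems(2)] unfolding towards_def by auto
      then have "carc w p z" unfolding carc_def btw_def by (smt (z3))
      then show ?thesis using False h(6) unfolding towards_def by simp
    qed
    moreover have "k' < m" using h(1) km by simp
    ultimately show ?thesis using h(2-5) by blast
  qed
qed

text \<open>\<open>sweeping_leaf\<close> provides a taller leaf with moving tips at \<open>w\<close>
  and at a point \<open>z\<close> behind it. The faster tip at \<open>w\<close> pulls ahead of the
  slower one while the tip from \<open>z\<close> stays behind, so a leaf that kept \<open>w\<close>
  would be crossed.\<close>

lemma ev_crossed:
  assumes Q: "Q \<in> lev t m" and d: "dedge \<sigma> (tips Q) (star_tip t m Q) q"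
    and w: "w \<in> tips Q" "w \<noteq> star_tip t m Q" "w \<noteq> q"
  shows "\<forall>\<^sub>F u in dirF \<sigma>. \<exists>N\<in>Lam (t + u). height N > 1 / 3 ^ m \<and>
    crossing {sh (1 / 3 ^ m) u (star_tip t m Q), sh (1 / 3 ^ m) u w} (tips N)"
proof -
  define x where "x = star_tip t m Q"
  let ?a = "1 / 3 ^ m :: real"
  have xQ: "x \<in> tips Q" using star_tip(1)[OF Q] x_def by simp
  obtain p where p: "dedge \<sigma> (tips Q) p w"
    using elam_edges[OF elam_Lam lev_Lam[OF Q] w(1)] unfolding dedge_def by (cases \<sigma>) auto
  have px: "p \<noteq> x" using w(3) dedge_unique[OF d] p x_def by blast
  have wx: "w \<noteq> x" using w(2) x_def by simp
  have "if \<sigma> then sat (Lam t) Q p w else sat (Lam t) Q w p"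
    using star_tip(5)[OF Q] p px wx unfolding dedge_def x_def by (auto split: if_splits)
  then obtain k N y q' z where h: "k < m" "N \<in> lev t k" "y = star_tip t k N"
      "dedge \<sigma> (tips N) y q'" "{y, q'} = {w, z}" "towards \<sigma> p w z" using sweeping_leaf[OF Q p] by blast
  let ?b = "1 / 3 ^ k :: real"
  have ab: "?a < ?b" using one_third_pow_less[of m k] h(1) by simp
  have zN: "z \<in> tips N" using h(5) dedgeD(1,2)[OF h(4)] by auto
  have u: "x \<in> {0..<1}" "w \<in> {0..<1}" "z \<in> {0..<1}" "x \<noteq> w"
    using lev_unit[OF Q] lev_unit[OF h(2)] xQ w(1) zN wx by blast+
  have zw: "z \<noteq> w" using h(6) unfolding towards_def by simp
  have "\<forall>\<^sub>F u in dirF \<sigma>. seen (t + u) (sh ?b u y) k (slid k u y q')"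
    using ev_slid_lev[OF h(2) _ _ h(4)] star_tip(1,2)[OF h(2)] h(3) by blast
  moreover have "\<forall>\<^sub>F u in dirF \<sigma>. crossing {sh ?a u x, sh ?a u w} {sh ?b u w, sh ?b u z}"
  proof (cases \<sigma>)
    case True
    have e: "edge (tips Q) p w" using p True unfolding dedge_def by simp
    have "carc p w z" "\<not> btw p x w" "p \<noteq> w" using h(6) True edgeD(3,4)[OF e] xQ unfolding towards_def by auto
    then have "btw x z w" using zw px wx unfolding carc_def btw_def by (smt (z3))
    then have "\<forall>\<^sub>F u in dirF True. btw (sh ?a u x) (sh ?b u z) (sh ?a u w)" by (rule ev_btw[OF u(1,3,2)])
    moreover have "\<forall>\<^sub>F u in dirF True. btw (sh ?a u w) (sh ?b u w) (sh ?a u x)" by (rule ev_ahead(1)[OF u(1,2,4) ab])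
    ultimately have "\<forall>\<^sub>F u in dirF True. crossing {sh ?a u x, sh ?a u w} {sh ?b u w, sh ?b u z}"
      by eventually_elim (unfold crossing_def, blast)
    then show ?thesis using True by simp
  next
    case False
    have e: "edge (tips Q) w p" using p False unfolding dedge_def by simp
    have "carc w p z" "\<not> btw w x p" "p \<noteq> w" using h(6) False edgeD(3,4)[OF e] xQ unfolding towards_def by auto
    then have "btw w z x" using zw px wx unfolding carc_def btw_def by (smt (z3))
    then have "\<forall>\<^sub>F u in dirF False. btw (sh ?a u w) (sh ?b u z) (sh ?a u x)" by (rule ev_btw[OF u(2,3,1)])
    moreover have "\<forall>\<^sub>F u in dirF False. btw (sh ?a u x) (sh ?b u w) (sh ?a u w)" by (rule ev_ahead(2)[OF u(1,2,4) ab])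
    ultimately have "\<forall>\<^sub>F u in dirF False. crossing {sh ?a u x, sh ?a u w} {sh ?b u w, sh ?b u z}"
      by eventually_elim (unfold crossing_def, blast)
    then show ?thesis using False by simp
  qed
  ultimately show ?thesis unfolding x_def[symmetric]
  proof eventually_elim
    case (elim u)
    have "slid k u y q' \<in> Lam (t + u)" using elim(1) Lam_seen by blast
    moreover have "height (slid k u y q') > ?a" using ab unfolding slid_def by simp
    moreover have "tips (slid k u y q') = sh ?b u ` {y, q'}" unfolding slid_def by simp
    then have "tips (slid k u y q') = {sh ?b u w, sh ?b u z}" unfolding h(5) by simp
    ultimately show ?case using elim(2) by metis
  qed
qed

text \<open>The classes leave only the second tip \<open>w\<close> free, and
  \<open>ev_crossed\<close> excludes every choice but \<open>q\<close>. \<open>M\<close> and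
  \<open>E\<close> are quantified inside the filter because a competing position and its elamination
  vary with \<open>u\<close>.\<close>

lemma ev_slides_unique:
  assumes Q: "Q \<in> lev t m" and d: "dedge \<sigma> (tips Q) (star_tip t m Q) q"
  shows "\<forall>\<^sub>F u in dirF \<sigma>. \<forall>M E. elam E \<longrightarrow> M \<in> E \<longrightarrow> height M = 1 / 3 ^ m \<longrightarrow>
     (\<forall>n. height n > 1 / 3 ^ m \<longrightarrow> n \<in> E \<longleftrightarrow> n \<in> Lam (t + u)) \<longrightarrow>
     slides_to (Lam t) Q (1 / 3 ^ m * u) M \<longrightarrow> M = slid m u (star_tip t m Q) q"
proof -
  define x where "x = star_tip t m Q"
  let ?a = "1 / 3 ^ m :: real"
  have xQ: "x \<in> tips Q" using star_tip(1)[OF Q] x_def by simp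
  have fin: "finite (tips Q - {x, q})" using extended_leafD(3)[OF elamD(1)[OF elam_Lam lev_Lam[OF Q]]] by simp
  have "\<forall>\<^sub>F u in dirF \<sigma>. \<forall>w\<in>tips Q - {x, q}. \<exists>N\<in>Lam (t + u). height N > ?a \<and> crossing {sh ?a u x, sh ?a u w} (tips N)"
    using fin ev_crossed[OF Q d] unfolding x_def[symmetric] by (auto intro!: eventually_ball_finite)
  then show ?thesis unfolding x_def[symmetric]
  proof eventually_elim
    case (elim u)
    show ?case
    proof (intro allI impI)
      fix M E assume E: "elam E" "M \<in> E" "height M = ?a" "\<forall>n. height n > ?a \<longrightarrow> n \<in> E \<longleftrightarrow> n \<in> Lam (t + u)"
        and s: "slides_to (Lam t) Q (?a * u) M"
      let ?R = "saturated_edges (Lam t) Q"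
      have sub: "tips M \<subseteq> sh ?a u ` tips Q" using s unfolding slides_to_def sh_def by blast
      have pick: "\<exists>!y. y \<in> tips Q \<and> (z, y) \<in> ?R\<^sup>* \<and> sh ?a u y \<in> tips M" if "z \<in> tips Q" for z
        using s that unfolding slides_to_def sh_def by blast
      obtain y where y: "y \<in> tips Q" "(x, y) \<in> ?R\<^sup>*" "sh ?a u y \<in> tips M" using pick[OF xQ] by blast
      have "y = x" using star_tip_class[OF Q y(2)] x_def by blast
      then have xM: "sh ?a u x \<in> tips M" using y(3) by simp
      have qQ: "q \<in> tips Q" "q \<noteq> x" using dedgeD(2,3)[OF d] x_def by auto
      obtain w where w: "w \<in> tips Q" "(q, w) \<in> ?R\<^sup>*" "sh ?a u w \<in> tips M"
        "\<And>w'. w' \<in> tips Q \<Longrightarrow> (q, w') \<in> ?R\<^sup>* \<Longrightarrow> sh ?a u w' \<in> tips M \<Longrightarrow> w' = w" using pick[OF qQ(1)] by blast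
      have wx: "w \<noteq> x" using star_tip_class[OF Q w(2)] qQ(2) x_def by blast
      have oth: "(q, w') \<in> ?R\<^sup>*" if "w' \<in> tips Q" "w' \<noteq> x" for w'
        using saturated_class_sym[OF other_class[OF Q d that(1)]] that(2) x_def by blast
      have M: "tips M = {sh ?a u x, sh ?a u w}"
      proof
        show "tips M \<subseteq> {sh ?a u x, sh ?a u w}"
        proof
          fix b assume b: "b \<in> tips M"
          then obtain w' where w': "w' \<in> tips Q" "b = sh ?a u w'" using sub by blast
          then show "b \<in> {sh ?a u x, sh ?a u w}" using w(4)[OF w'(1) oth[OF w'(1)]] b by blast
        qed
      qed (use xM w(3) in blast)
      have "w = q"
      proof (rule ccontr)
        assume "w \<noteq> q"
        then obtain N where N: "N \<in> Lam (t + u)" "height N > ?a" "crossing {sh ?a u x, sh ?a u w} (tips N)"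
          using elim w(1) wx by blast
        have "N \<in> E" "M \<noteq> N" using E(3,4) N(1,2) by auto
        then show False using elamD(3)[OF E(1,2)] N(3) M by simp
      qed
      then show "M = slid m u x q" using M E(3) unfolding slid_def by (cases M) simp
    qed
  qed
qed

end

section \<open>Comparison of two flows\<close>

lemma ev_shift:
  assumes "\<And>\<sigma>. \<forall>\<^sub>F d in dirF \<sigma>. P d"
  shows "\<forall>\<^sub>F v in at u within S. P (v - u)"
proof -
  have "\<forall>\<^sub>F d in at 0. P d" using assms[of True] assms[of False] unfolding dirF_def by (simp add: eventually_at_split)
  then have "\<forall>\<^sub>F v in at u. P (v - u)" by (subst at_to_0) (simp add: eventually_filtermap)
  then show ?thesis by (rule eventually_within)
qed

lemma rotation_flowD:
  assumes "rotation_flow \<Lambda> s \<psi>" "u \<in> closed_segment 0 s"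
  shows "elam (\<psi> u ` \<Lambda>)" "inj_on (\<psi> u) \<Lambda>" "l \<in> \<Lambda> \<Longrightarrow> height (\<psi> u l) = height l"
    "l \<in> \<Lambda> \<Longrightarrow> \<forall>\<^sub>F v in at u within closed_segment 0 s. slides_to (\<psi> u ` \<Lambda>) (\<psi> u l) (height l * (v - u)) (\<psi> v l)"
  using assms unfolding rotation_flow_def elamination_iff_elam by blast+

context eps_small
begin

text \<open>By induction the flows agree on taller leaves. For the given leaf, agreement spreads to
  nearby times by \<open>ev_slides_unique\<close> and disagreement by \<open>slides_meet\<close>. So
  agreement is locally constant on a connected segment, and it holds at time 0.\<close>

lemma flow_unique:
  assumes \<psi>: "rotation_flow (Lam t) s \<psi>"
    and \<phi>: "rotation_flow (Lam t) s \<phi>" and im: "\<And>u. u \<in> closed_segment 0 s \<Longrightarrow> \<phi> u ` Lam t = Lam (t + u)"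
  shows "l \<in> lev t m \<Longrightarrow> u \<in> closed_segment 0 s \<Longrightarrow> \<psi> u l = \<phi> u l"
proof (induction m arbitrary: l u rule: less_induct)
  case (less m)
  let ?S = "closed_segment 0 s"
  let ?a = "1 / 3 ^ m :: real"
  note l = lev_Lam[OF less.prems(1)]
  have hl: "height l = ?a" using lev_height[OF less.prems(1)] .
  have taller: "n \<in> \<psi> u ` Lam t \<longleftrightarrow> n \<in> Lam (t + u)" if u: "u \<in> ?S" and n: "height n > ?a" for n u
  proof -
    have e: "\<psi> u l' = \<phi> u l'" if l': "l' \<in> Lam t" and h: "height l' > ?a" for l'
    proof -
      obtain k where k: "l' \<in> lev t k" using l' Lam_lev by blast
      then have "k < m" using h lev_height[OF k] one_third_pow_less by simp
      then show ?thesis using less.IH k u by blast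
    qed
    have "n \<in> \<psi> u ` Lam t \<longleftrightarrow> n \<in> \<phi> u ` Lam t"
    proof
      assume "n \<in> \<psi> u ` Lam t"
      then obtain l' where l': "l' \<in> Lam t" "n = \<psi> u l'" by blast
      then show "n \<in> \<phi> u ` Lam t" using e[OF l'(1)] n rotation_flowD(3)[OF \<psi> u l'(1)] by auto
    next
      assume "n \<in> \<phi> u ` Lam t"
      then obtain l' where l': "l' \<in> Lam t" "n = \<phi> u l'" by blast
      then have "n = \<psi> u l'" using e[OF l'(1)] n rotation_flowD(3)[OF \<phi> u l'(1)] by simp
      then show "n \<in> \<psi> u ` Lam t" using l'(1) by blast
    qed
    then show ?thesis unfolding im[OF u] .
  qed
  have const: "\<forall>\<^sub>F v in at u within ?S. (\<psi> u l = \<phi> u l) = (\<psi> v l = \<phi> v l)" if u: "u \<in> ?S" for u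
  proof -
    have st: "same_taller (\<psi> u ` Lam t) (Lam (t + u)) (\<psi> u l) (\<phi> u l)"
    proof
      show "elam (\<psi> u ` Lam t)" "elam (Lam (t + u))" using rotation_flowD(1)[OF \<psi> u] elam_Lam .
      show "\<psi> u l \<in> \<psi> u ` Lam t" "\<phi> u l \<in> Lam (t + u)" using l im[OF u] by blast+
      show "height (\<psi> u l) = height (\<phi> u l)" using rotation_flowD(3)[OF \<psi> u l] rotation_flowD(3)[OF \<phi> u l] by simp
      show "n \<in> \<psi> u ` Lam t \<longleftrightarrow> n \<in> Lam (t + u)" if "height n > height (\<phi> u l)" for n
        using taller[OF u] that rotation_flowD(3)[OF \<phi> u l] hl by simp
    qed
    interpret ST: same_taller "\<psi> u ` Lam t" "Lam (t + u)" "\<psi> u l" "\<phi> u l" by (rule st)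
    have s1: "\<forall>\<^sub>F v in at u within ?S. slides_to (\<psi> u ` Lam t) (\<psi> u l) (?a * (v - u)) (\<psi> v l)"
      using rotation_flowD(4)[OF \<psi> u l] unfolding hl .
    have s2: "\<forall>\<^sub>F v in at u within ?S. slides_to (Lam (t + u)) (\<phi> u l) (?a * (v - u)) (\<phi> v l)"
      using rotation_flowD(4)[OF \<phi> u l] unfolding hl im[OF u] .
    have inS: "\<forall>\<^sub>F v in at u within ?S. v \<in> ?S" by (simp add: eventually_at_filter)
    show ?thesis
    proof (cases "\<psi> u l = \<phi> u l")
      case False
      show ?thesis using s1 s2 inS
      proof eventually_elim
        case (elim v)
        have "\<psi> v l \<noteq> \<phi> v l"
        proof
          assume e: "\<psi> v l = \<phi> v l"
          have "extended_leaf (\<psi> v l)" using elamD(1)[OF rotation_flowD(1)[OF \<psi> elim(3)]] l by blast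
          then have "tips (\<psi> u l) = tips (\<phi> u l)" using ST.slides_meet elim(1,2) e by simp
          then show False using False ST.ht leaf.expand by blast
        qed
        then show ?case using False by blast
      qed
    next
      case True
      let ?Q = "\<phi> u l"
      have Q: "?Q \<in> lev (t + u) m" using ST.l(2) rotation_flowD(3)[OF \<phi> u l] hl unfolding lev_def by simp
      \<comment> \<open>\<open>M0\<close> depends on \<open>d\<close>, and its second tip on the
        direction; quantifying it under the filter allows both directions to be combined by
        \<open>ev_shift\<close>.\<close>
      have "\<forall>\<^sub>F d in dirF \<sigma>. \<exists>M0. \<forall>M E. elam E \<longrightarrow> M \<in> E \<longrightarrow> height M = ?a \<longrightarrow>
         (\<forall>n. height n > ?a \<longrightarrow> n \<in> E \<longleftrightarrow> n \<in> Lam (t + u + d)) \<longrightarrow>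
         slides_to (Lam (t + u)) ?Q (?a * d) M \<longrightarrow> M = M0" for \<sigma>
      proof -
        obtain q where "dedge \<sigma> (tips ?Q) (star_tip (t + u) m ?Q) q" using dedge_ex[OF Q star_tip(1)[OF Q]] by blast
        from ev_slides_unique[OF Q this] show ?thesis by eventually_elim blast
      qed
      then have "\<forall>\<^sub>F v in at u within ?S. \<exists>M0. \<forall>M E. elam E \<longrightarrow> M \<in> E \<longrightarrow> height M = ?a \<longrightarrow>
         (\<forall>n. height n > ?a \<longrightarrow> n \<in> E \<longleftrightarrow> n \<in> Lam (t + u + (v - u))) \<longrightarrow>
         slides_to (Lam (t + u)) ?Q (?a * (v - u)) M \<longrightarrow> M = M0" by (rule ev_shift)
      then show ?thesis using s1 s2 inS
      proof eventually_elim
        case (elim v)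
        obtain M0 where M0: "\<And>M E. elam E \<Longrightarrow> M \<in> E \<Longrightarrow> height M = ?a \<Longrightarrow>
            (\<And>n. height n > ?a \<Longrightarrow> n \<in> E \<longleftrightarrow> n \<in> Lam (t + v)) \<Longrightarrow>
            slides_to (Lam (t + u)) ?Q (?a * (v - u)) M \<Longrightarrow> M = M0" using elim(1) by auto
        have "slides_to (Lam (t + u)) ?Q (?a * (v - u)) (\<psi> v l)"
          using elim(2) True ST.saturated_edges_same[OF True] unfolding slides_to_def by simp
        then have "\<psi> v l = M0"
          using M0[OF rotation_flowD(1)[OF \<psi> elim(4)] _ _ taller[OF elim(4)]] l rotation_flowD(3)[OF \<psi> elim(4) l] hl by simp
        moreover have "\<phi> v l \<in> Lam (t + v)" using l im[OF elim(4)] by blast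
        then have "\<phi> v l = M0"
          by (rule M0[OF elam_Lam]) (use rotation_flowD(3)[OF \<phi> elim(4) l] hl elim(3) in simp_all)
        ultimately show ?case using True by simp
      qed
    qed
  qed
  have "(\<psi> 0 l = \<phi> 0 l) = (\<psi> u l = \<phi> u l)"
    by (rule connected_local_const[of ?S 0 u "\<lambda>u. \<psi> u l = \<phi> u l"]) (use less.prems(2) const in auto)
  then show ?case using \<psi> \<phi> l unfolding rotation_flow_def by simp
qed

lemma rotate_Lam: "rotate_elamination s (Lam t) = Lam (t + s)"
proof -
  obtain \<phi> where \<phi>: "rotation_flow (Lam t) s \<phi>" "\<And>u. u \<in> closed_segment 0 s \<Longrightarrow> \<phi> u ` Lam t = Lam (t + u)"
    using flow_ex[of t s] by blast
  have "\<psi> s ` Lam t = Lam (t + s)" if \<psi>: "rotation_flow (Lam t) s \<psi>" for \<psi>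
  proof -
    have "\<psi> s l = \<phi> s l" if l: "l \<in> Lam t" for l
    proof -
      obtain m where "l \<in> lev t m" using l Lam_lev by blast
      then show ?thesis using flow_unique[OF \<psi> \<phi>] by simp
    qed
    then show ?thesis using \<phi>(2)[of s] by (simp cong: image_cong)
  qed
  then show ?thesis unfolding rotate_elamination_def using \<phi> by (intro the_equality) auto
qed

end

theorem proposition7p3:
  shows "\<exists>\<epsilon>\<^sub>0 > 0. \<forall>\<epsilon>. 0 < \<epsilon> \<and> \<epsilon> < \<epsilon>\<^sub>0 \<longrightarrow>
    (\<forall>t :: real. elamination (tautological_elamination \<epsilon> t)) \<and>
    (\<forall>t s :: real. tautological_elamination \<epsilon> (t + s) =
       rotate_elamination s (tautological_elamination \<epsilon> t))"
proof (intro exI[of _ "2/3 :: real"] conjI allI impI)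
  fix \<epsilon> t s :: real
  assume e: "0 < \<epsilon> \<and> \<epsilon> < 2/3"
  \<comment> \<open>Below 2/3 the height \<open>1 - \<epsilon>\<close> of \<open>C2\<close> exceeds
    1/3, the greatest height of a lift.\<close>
  interpret eps_small \<epsilon> by unfold_locales (use e in auto)
  show "elamination (tautological_elamination \<epsilon> t)" unfolding taut_eq elamination_iff_elam by (rule elam_Lam)
  show "tautological_elamination \<epsilon> (t + s) = rotate_elamination s (tautological_elamination \<epsilon> t)"
    unfolding taut_eq rotate_Lam ..
qed simp

end
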